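(* Let $V$ be a euclidean vector space of dimension $n$, let $0\le k,l\le n$ with $k+l\ge n$, and let $A_1,\dots,A_{n-k},B_1,\dots,B_{n-l}\in\mathcal{K}^{sm}(V)$. Then $$V_{A_1,\dots,A_{n-k}}*V_{B_1,\dots,B_{n-l}}=\binom{k+l}{k}^{-1}\binom{k+l}{n}\,V_{A_1,\dots,A_{n-k},B_1,\dots,B_{n-l}}.$$
   Context: $\mathcal{K}(V)$ is the space of nonempty compact convex subsets of $V$ (Hausdorff metric); $\mathcal{K}^{sm}(V)$ consists of those with smooth and strictly convex boundary. $\mathrm{Val}(V)$ is the space of continuous translation-invariant maps $\phi:\mathcal{K}(V)\to\mathbb{C}$ with $\phi(K\cup L)+\phi(K\cap L)=\phi(K)+\phi(L)$ whenever $K,L,K\cup L\in\mathcal{K}(V)$, a Banach space with norm $\sup_{K\subset B}|\phi(K)|$ ($B$ a fixed bounded set with nonempty interior). $\mathrm{Val}^{sm}(V)$ is the space of those $\phi$ for which $g\mapsto g\phi$, $(g\phi)(K)=\phi(g^{-1}K)$, is a smooth map $GL(V)\to\mathrm{Val}(V)$, with the induced $C^\infty$ topology; $\mathrm{Val}^{sm}_k(V)$ is the subspace of those $\phi$ with $\phi(tK)=t^k\phi(K)$ for $t\ge0$. For $A\in\mathcal{K}(V)$, $\mu_A(K):=\mathrm{vol}(A+K)$ (Minkowski sum, $\mathrm{vol}$ Lebesgue measure); $\mu_A\in\mathrm{Val}^{sm}(V)$ if $A\in\mathcal{K}^{sm}(V)$. $*$ is the convolution product: the unique continuous bilinear product on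 $\mathrm{Val}^{sm}(V)$ with $\mu_A*\mu_B=\mu_{A+B}$ for all $A,B\in\mathcal{K}^{sm}(V)$; it is commutative and associative with unit $\mathrm{vol}$. For $A_1,\dots,A_{n-k}\in\mathcal{K}^{sm}(V)$, $V_{A_1,\dots,A_{n-k}}\in\mathrm{Val}^{sm}_k(V)$ is the mixed volume valuation $K\mapsto V(K,\dots,K,A_1,\dots,A_{n-k})$ ($K$ repeated $k$ times), where $V(\cdot,\dots,\cdot)$ is the mixed volume normalized by $V(K,\dots,K)=\mathrm{vol}(K)$; equivalently $V_{A_1,\dots,A_{n-k}}=\frac{k!}{n!}\left.\frac{\partial^{n-k}}{\partial t_1\cdots\partial t_{n-k}}\right|_{t=0}\mu_{\sum_i t_iA_i}$. *)

theory Defs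
  imports "HOL-Complex_Analysis.Great_Picard" "HOL-Library.Multiset" "HOL-Library.Set_Algebras"
begin

section \<open>Convex bodies\<close>

typedef (overloaded) 'a body = "{K :: 'a::euclidean_space set. K \<noteq> {} \<and> compact K \<and> convex K}"
  morphisms body_set Body
  by (rule exI[of _ "{0}"]) simp

setup_lifting type_definition_body

lemma body_set_props [simp, intro]:
  "body_set K \<noteq> {}" "compact (body_set K)" "convex (body_set K)"
  "closed (body_set K)" "bounded (body_set K)"
  using body_set[of K] by (auto intro: compact_imp_closed compact_imp_bounded)

lemma body_set_Body: "K \<noteq> {} \<Longrightarrow> compact K \<Longrightarrow> convex K \<Longrightarrow> body_set (Body K) = K"
  by (simp add: Body_inverse)

instantiation body :: (euclidean_space) comm_monoid_add
begin

lift_definition plus_body :: "'a body \<Rightarrow> 'a body \<Rightarrow> 'a body" is "\<lambda>K L. K + L"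
proof -
  fix K L :: "'a set"
  assume K: "K \<noteq> {} \<and> compact K \<and> convex K" and L: "L \<noteq> {} \<and> compact L \<and> convex L"
  have "K + L = {x + y |x y. x \<in> K \<and> y \<in> L}" by (auto simp: set_plus_def)
  moreover have "K + L = (\<Union>x\<in>K. \<Union>y\<in>L. {x + y})" by (auto simp: set_plus_def)
  ultimately show "K + L \<noteq> {} \<and> compact (K + L) \<and> convex (K + L)"
    using compact_sums[of K L] convex_sums[of K L] K L by (auto simp: set_plus_def)
qed

lift_definition zero_body :: "'a body" is "{0}" by simp

instance
  by standard (transfer; simp add: set_plus_def; fastforce simp: ac_simps)+

end

lift_definition scale_body :: "real \<Rightarrow> 'a::euclidean_space body \<Rightarrow> 'a body"
  is "\<lambda>t K. (*\<^sub>R) t ` K"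
  by (auto intro: compact_scaling convex_scaling)

lift_definition translate_body :: "'a::euclidean_space \<Rightarrow> 'a body \<Rightarrow> 'a body"
  is "\<lambda>x K. (+) x ` K"
  by (auto intro: compact_translation convex_translation)

lift_definition image_body :: "('a::euclidean_space \<Rightarrow>\<^sub>L 'a) \<Rightarrow> 'a body \<Rightarrow> 'a body"
  is "\<lambda>g K. blinfun_apply g ` K"
  by (auto intro!: compact_continuous_image linear_continuous_on convex_linear_image
        blinfun.bounded_linear_right bounded_linear.linear)

definition vol :: "'a::euclidean_space body \<Rightarrow> real" where
  "vol K = measure lborel (body_set K)"

text \<open>The Hausdorff metric.\<close>

instantiation body :: (euclidean_space) metric_space
begin

definition dist_body :: "'a body \<Rightarrow> 'a body \<Rightarrow> real" where
  "dist_body K L = max (SUP x\<in>body_set K. infdist x (body_set L))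
                       (SUP y\<in>body_set L. infdist y (body_set K))"

definition uniformity_body :: "('a body \<times> 'a body) filter" where
  "uniformity_body = (INF e\<in>{0<..}. principal {(K, L). dist K L < e})"

definition open_body :: "'a body set \<Rightarrow> bool" where
  "open_body U \<longleftrightarrow> (\<forall>K\<in>U. eventually (\<lambda>(K', L). K' = K \<longrightarrow> L \<in> U) uniformity)"

lemma dist_body_le_iff:
  "dist (K::'a body) L \<le> e \<longleftrightarrow>
     (\<forall>x\<in>body_set K. infdist x (body_set L) \<le> e) \<and> (\<forall>y\<in>body_set L. infdist y (body_set K) \<le> e)"
proof -
  have bdd: "bdd_above ((\<lambda>x. infdist x (body_set L)) ` body_set K)" for K L :: "'a body"
    by (rule bounded_imp_bdd_above, rule compact_imp_bounded, rule compact_continuous_image)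
       (auto intro!: continuous_intros)
  show ?thesis
    by (simp add: dist_body_def cSUP_le_iff bdd)
qed

lemma dist_body_le:
  assumes "dist (K::'a body) L \<le> e" "x \<in> body_set K"
  shows "\<exists>y\<in>body_set L. dist x y \<le> e"
proof -
  obtain y where "y \<in> body_set L" "infdist x (body_set L) = dist x y"
    using infdist_attains_inf[of "body_set L" x] by auto
  then show ?thesis using assms unfolding dist_body_le_iff by force
qed

lemma dist_body_leI:
  assumes "\<And>x. x \<in> body_set (K::'a body) \<Longrightarrow> \<exists>y\<in>body_set L. dist x y \<le> e"
    and "\<And>y. y \<in> body_set L \<Longrightarrow> \<exists>x\<in>body_set K. dist y x \<le> e"
  shows "dist K L \<le> e"
  unfolding dist_body_le_iff using assms by (meson infdist_le2)

lemma dist_body_sym: "dist (K::'a body) L = dist L K"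
  by (simp add: dist_body_def max.commute)

lemma dist_body_eq_0: "dist (K::'a body) L = 0 \<longleftrightarrow> K = L"
proof
  assume d: "dist K L = 0"
  have "body_set K \<subseteq> body_set L" "body_set L \<subseteq> body_set K"
    using dist_body_le[of K L 0] dist_body_le[of L K 0] d by (force simp: dist_body_sym)+
  then show "K = L" by (simp add: body_set_inject[symmetric])
next
  assume KL: "K = L"
  obtain x where x: "x \<in> body_set K" using body_set_props(1)[of K] by blast
  have "dist K L \<le> 0" unfolding dist_body_le_iff using KL by simp
  moreover have "\<not> dist K L < 0"
  proof
    assume lt: "dist K L < 0"
    have "infdist x (body_set L) \<le> dist K L"
      using dist_body_le_iff[of K L "dist K L"] x by auto
    then show False using lt infdist_nonneg[of x "body_set L"] by linarith
  qed
  ultimately show "dist K L = 0" by linarith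
qed

instance
proof
  fix K L M :: "'a body"
  show "dist K L = 0 \<longleftrightarrow> K = L" by (rule dist_body_eq_0)
  show "dist K L \<le> dist K M + dist L M"
  proof (rule dist_body_leI)
    fix x assume "x \<in> body_set K"
    then obtain z where z: "z \<in> body_set M" "dist x z \<le> dist K M" using dist_body_le by blast
    then obtain y where "y \<in> body_set L" "dist z y \<le> dist L M"
      using dist_body_le[of M L "dist L M"] by (auto simp: dist_body_sym)
    then show "\<exists>y\<in>body_set L. dist x y \<le> dist K M + dist L M"
      using z by (meson add_mono dist_triangle order_trans)
  next
    fix x assume "x \<in> body_set L"
    then obtain z where z: "z \<in> body_set M" "dist x z \<le> dist L M" using dist_body_le by blast
    then obtain y where "y \<in> body_set K" "dist z y \<le> dist K M"
      using dist_body_le[of M K "dist K M"] by (auto simp: dist_body_sym)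
    then show "\<exists>y\<in>body_set K. dist x y \<le> dist K M + dist L M"
      using z by (smt (verit) dist_triangle)
  qed
qed (simp_all add: uniformity_body_def open_body_def)

end


section \<open>The space of continuous translation-invariant valuations\<close>

text \<open>In the additivity condition, \<open>M\<close> and \<open>N\<close> are the bodies \<open>K \<union> L\<close> and \<open>K \<inter> L\<close>; the intersection
  is automatically nonempty when \<open>K \<union> L\<close> is convex.\<close>

typedef (overloaded) 'a val = "{\<phi> :: 'a::euclidean_space body \<Rightarrow> complex.
    continuous_on UNIV \<phi> \<and>
    (\<forall>x K. \<phi> (translate_body x K) = \<phi> K) \<and>
    (\<forall>K L M N. body_set M = body_set K \<union> body_set L \<and> body_set N = body_set K \<inter> body_set L
       \<longrightarrow> \<phi> M + \<phi> N = \<phi> K + \<phi> L)}"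
  morphisms val_at Val
  by (rule exI[of _ "\<lambda>_. 0"]) simp

setup_lifting type_definition_val

lemma val_continuous: "continuous_on UNIV (val_at \<phi>)"
  and val_translate: "val_at \<phi> (translate_body x K) = val_at \<phi> K"
  and val_additive: "body_set M = body_set K \<union> body_set L \<Longrightarrow> body_set N = body_set K \<inter> body_set L
       \<Longrightarrow> val_at \<phi> M + val_at \<phi> N = val_at \<phi> K + val_at \<phi> L"
  using val_at[of \<phi>] by blast+

text \<open>Multiplication by complex scalars; the library classes only provide \<open>scaleR\<close>.\<close>

lift_definition scaleC_val :: "complex \<Rightarrow> 'a::euclidean_space val \<Rightarrow> 'a val"
  is "\<lambda>c \<phi> K. c * \<phi> K"
  by (auto intro!: continuous_intros simp flip: distrib_left)

text \<open>The unit ball serves as the fixed bounded set with nonempty interior that occurs in the norm.\<close>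

definition unit_bodies :: "'a::euclidean_space body set" where
  "unit_bodies = {K. body_set K \<subseteq> cball 0 1}"

lemma unit_bodies_convergent_subseq:
  assumes K: "\<And>m::nat. K m \<in> (unit_bodies :: 'a::euclidean_space body set)"
  shows "\<exists>L r. strict_mono r \<and> (K \<circ> r) \<longlonglongrightarrow> L"
proof -
  let ?S = "cball 0 1 :: 'a set"
  define F where "F = (\<lambda>m x. infdist x (body_set (K m)))"
  have sub: "body_set (K m) \<subseteq> ?S" for m using K by (auto simp: unit_bodies_def)
  have Lip: "\<bar>F m x - F m y\<bar> \<le> norm (x - y)" for m x y
    unfolding F_def using infdist_triangle_abs[of x "body_set (K m)" y] by (simp add: dist_norm)
  have bnd: "norm (F m x) \<le> 2" if "x \<in> ?S" for m x
  proof -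
    obtain y where y: "y \<in> body_set (K m)" using body_set_props(1)[of "K m"] by blast
    then have "F m x \<le> dist x y" unfolding F_def by (rule infdist_le)
    also have "\<dots> \<le> norm x + norm y" by (simp add: dist_norm norm_triangle_ineq4)
    also have "\<dots> \<le> 2" using y sub that by (smt (verit) mem_cball_0 subsetD)
    finally show ?thesis by (simp add: F_def infdist_nonneg)
  qed
  obtain g r where g: "continuous_on ?S g" and r: "strict_mono (r :: nat \<Rightarrow> nat)"
    and unif: "\<And>e. 0 < e \<Longrightarrow> \<exists>N. \<forall>n x. n \<ge> N \<and> x \<in> ?S \<longrightarrow> norm (F (r n) x - g x) < e"
  proof (rule Arzela_Ascoli[of ?S F 2])
    fix x :: 'a and e :: real assume "x \<in> ?S" "0 < e"
    then show "\<exists>d>0. \<forall>n y. y \<in> ?S \<and> norm (x - y) < d \<longrightarrow> norm (F n x - F n y) < e"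
      using Lip by (intro exI[of _ e]) (auto intro: le_less_trans)
  qed (use bnd in auto)
  define L where "L = {x\<in>?S. g x = 0}"
  have near: "\<exists>N. \<forall>j\<ge>N. \<forall>x\<in>body_set (K (r j)). \<exists>y\<in>L. dist x y \<le> e" if e: "e > 0" for e
  proof -
    obtain N where N: "\<And>n x. n \<ge> N \<Longrightarrow> x \<in> ?S \<Longrightarrow> norm (F (r n) x - g x) < e/2"
      using unif[of "e/2"] e by auto
    show ?thesis
    proof (intro exI[of _ N] allI impI ballI)
      fix j x assume j: "j \<ge> N" and x: "x \<in> body_set (K (r j))"
      have xS: "x \<in> ?S" using x sub by blast
      have "\<exists>y. y \<in> body_set (K (r i)) \<and> dist x y \<le> e" if i: "i \<ge> N" for i
      proof -
        have "F (r j) x = 0" using x by (simp add: F_def)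
        then have "F (r i) x < e"
          using N[OF i xS] N[OF j xS] by (auto simp: abs_if split: if_splits)
        moreover obtain y where "y \<in> body_set (K (r i))" "F (r i) x = dist x y"
          using infdist_attains_inf[of "body_set (K (r i))" x] by (auto simp: F_def)
        ultimately show ?thesis by force
      qed
      then obtain y where y: "\<And>i. i \<ge> N \<Longrightarrow> y i \<in> body_set (K (r i)) \<and> dist x (y i) \<le> e"
        by metis
      have "\<forall>i. y (i + N) \<in> ?S" using y sub by (meson le_add2 subsetD)
      then obtain l q where l: "l \<in> ?S" and q: "strict_mono q" and lim: "((\<lambda>i. y (i + N)) \<circ> q) \<longlonglongrightarrow> l"
        using compact_cball unfolding compact_def by metis
      have "dist x l \<le> e"
        by (rule LIMSEQ_le_const2[OF tendsto_dist[OF tendsto_const lim]]) (use y in auto)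
      moreover have "g l = 0"
      proof -
        have "(\<lambda>i. g (((\<lambda>i. y (i + N)) \<circ> q) i)) \<longlonglongrightarrow> g l"
          by (rule continuous_on_tendsto_compose[OF g lim l])
             (use \<open>\<forall>i. y (i + N) \<in> ?S\<close> in auto)
        moreover have "(\<lambda>i. g (((\<lambda>i. y (i + N)) \<circ> q) i)) \<longlonglongrightarrow> 0"
        proof (rule LIMSEQ_I)
          fix d :: real assume "d > 0"
          then obtain M where M: "\<And>n x. n \<ge> M \<Longrightarrow> x \<in> ?S \<Longrightarrow> norm (F (r n) x - g x) < d"
            using unif by blast
          have "norm (g (y (q i + N)) - 0) < d" if "i \<ge> M" for i
          proof -
            have "q i + N \<ge> M" using that seq_suble[OF q, of i] by linarith
            moreover have "F (r (q i + N)) (y (q i + N)) = 0"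
              using y[of "q i + N"] by (simp add: F_def)
            ultimately show ?thesis using M[of "q i + N" "y (q i + N)"] \<open>\<forall>i. y (i + N) \<in> ?S\<close> by auto
          qed
          then show "\<exists>M. \<forall>i\<ge>M. norm (g (((\<lambda>i. y (i + N)) \<circ> q) i) - 0) < d" by auto
        qed
        ultimately show ?thesis using LIMSEQ_unique by blast
      qed
      ultimately show "\<exists>y\<in>L. dist x y \<le> e" using l by (auto simp: L_def)
    qed
  qed
  have "L \<noteq> {}"
  proof -
    obtain N where "\<forall>j\<ge>N. \<forall>x\<in>body_set (K (r j)). \<exists>y\<in>L. dist x y \<le> 1" using near[of 1] by auto
    then show ?thesis using body_set_props(1)[of "K (r N)"] by blast
  qed
  moreover have "compact L"
  proof -
    have "L = ?S \<inter> g -` {0}" by (auto simp: L_def)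
    moreover have "closed (?S \<inter> g -` {0})"
      by (rule continuous_closed_preimage[OF g]) auto
    ultimately show ?thesis
      by (metis bounded_Int bounded_cball compact_eq_bounded_closed)
  qed
  moreover have "convex L"
  proof (rule convexI)
    fix x y and u v :: real
    assume x: "x \<in> L" and y: "y \<in> L" and uv: "0 \<le> u" "0 \<le> v" "u + v = 1"
    define z where "z = u *\<^sub>R x + v *\<^sub>R y"
    have zS: "z \<in> ?S" unfolding z_def
      by (rule convexD[OF convex_cball _ _ uv]) (use x y in \<open>auto simp: L_def\<close>)
    have "F m z \<le> F m x + F m y" for m
    proof -
      obtain a where a: "a \<in> body_set (K m)" "F m x = dist x a"
        using infdist_attains_inf[of "body_set (K m)" x] by (auto simp: F_def)
      obtain b where b: "b \<in> body_set (K m)" "F m y = dist y b"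
        using infdist_attains_inf[of "body_set (K m)" y] by (auto simp: F_def)
      have "u *\<^sub>R a + v *\<^sub>R b \<in> body_set (K m)"
        using a b uv by (intro convexD) auto
      then have "F m z \<le> dist z (u *\<^sub>R a + v *\<^sub>R b)" unfolding F_def by (rule infdist_le)
      also have "\<dots> = norm (u *\<^sub>R (x - a) + v *\<^sub>R (y - b))"
        by (simp add: z_def dist_norm algebra_simps)
      also have "\<dots> \<le> u * norm (x - a) + v * norm (y - b)"
        using uv by (metis abs_of_nonneg norm_scaleR norm_triangle_ineq)
      also have "\<dots> \<le> 1 * norm (x - a) + 1 * norm (y - b)"
        by (intro add_mono mult_right_mono) (use uv in auto)
      finally show ?thesis using a b by (simp add: dist_norm)
    qed
    then have ineq: "F (r m) z \<le> F (r m) x + F (r m) y" for m .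
    have "\<bar>g z\<bar> \<le> e" if "e > 0" for e
    proof -
      have e3: "e/3 > 0" using that by simp
      obtain N where N: "\<And>n x. n \<ge> N \<Longrightarrow> x \<in> ?S \<Longrightarrow> norm (F (r n) x - g x) < e/3"
        using unif[OF e3] by blast
      have "g x = 0" "g y = 0" "x \<in> ?S" "y \<in> ?S" using x y by (auto simp: L_def)
      moreover have "F (r N) z \<ge> 0" by (simp add: F_def infdist_nonneg)
      ultimately show ?thesis
        using N[of N x] N[of N y] N[of N z] zS ineq[of N] unfolding real_norm_def by linarith
    qed
    then have "g z = 0" using dense_ge by (metis abs_le_zero_iff less_imp_le)
    then show "u *\<^sub>R x + v *\<^sub>R y \<in> L" using zS by (auto simp: L_def z_def)
  qed
  ultimately have setL: "body_set (Body L) = L" by (simp add: body_set_Body)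
  have "(K \<circ> r) \<longlonglongrightarrow> Body L"
  proof (rule metric_LIMSEQ_I)
    fix e :: real assume "e > 0"
    then have e: "e/2 > 0" by simp
    obtain N where N: "\<forall>j\<ge>N. \<forall>x\<in>body_set (K (r j)). \<exists>y\<in>L. dist x y \<le> e/2" using near[OF e] by blast
    obtain M where M: "\<And>n x. n \<ge> M \<Longrightarrow> x \<in> ?S \<Longrightarrow> norm (F (r n) x - g x) < e/2"
      using unif[OF e] by blast
    have "dist (K (r j)) (Body L) \<le> e/2" if "j \<ge> max N M" for j
    proof (rule dist_body_leI)
      show "\<exists>y\<in>body_set (Body L). dist x y \<le> e/2" if "x \<in> body_set (K (r j))" for x
        using N that \<open>j \<ge> max N M\<close> by (auto simp: setL)
    next
      fix y assume "y \<in> body_set (Body L)"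
      then have "y \<in> L" by (simp only: setL)
      then have y: "y \<in> ?S" "g y = 0" by (simp_all add: L_def)
      then have "F (r j) y < e/2" using M[of j y] that by auto
      moreover obtain a where "a \<in> body_set (K (r j))" "F (r j) y = dist y a"
        using infdist_attains_inf[of "body_set (K (r j))" y] by (auto simp: F_def)
      ultimately show "\<exists>x\<in>body_set (K (r j)). dist y x \<le> e/2" by force
    qed
    then have "\<forall>j\<ge>max N M. dist ((K \<circ> r) j) (Body L) < e"
      using \<open>e > 0\<close> by (smt (verit) comp_apply field_sum_of_halves)
    then show "\<exists>N. \<forall>j\<ge>N. dist ((K \<circ> r) j) (Body L) < e" by blast
  qed
  then show ?thesis using r by blast
qed

lemma val_bounded: "bdd_above ((\<lambda>K. cmod (val_at \<phi> K)) ` unit_bodies)"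
proof (rule ccontr)
  assume "\<not> ?thesis"
  then have "\<forall>m::nat. \<exists>K\<in>unit_bodies. cmod (val_at \<phi> K) > real m"
    by (auto simp: bdd_above_def not_le)
  then obtain K where K: "\<And>m. K m \<in> unit_bodies" "\<And>m. cmod (val_at \<phi> (K m)) > real m"
    by metis
  then obtain L r where r: "strict_mono (r::nat\<Rightarrow>nat)" and lim: "(K \<circ> r) \<longlonglongrightarrow> L"
    using unit_bodies_convergent_subseq by blast
  have "(\<lambda>m. val_at \<phi> ((K \<circ> r) m)) \<longlonglongrightarrow> val_at \<phi> L"
    by (rule continuous_on_tendsto_compose[OF val_continuous lim]) auto
  then have "Bseq (\<lambda>m. val_at \<phi> ((K \<circ> r) m))" by (intro convergent_imp_Bseq convergentI)
  then obtain B where B: "\<And>m. cmod (val_at \<phi> (K (r m))) \<le> B" unfolding Bseq_def by auto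
  obtain m :: nat where "B < real m" using reals_Archimedean2 by blast
  also have "\<dots> \<le> real (r m)" using seq_suble[OF r, of m] by simp
  finally show False using K(2)[of "r m"] B[of m] by linarith
qed

lemma val_eq_0_of_unit_bodies:
  assumes unit: "\<And>K. K \<in> unit_bodies \<Longrightarrow> val_at (\<phi>::'a::euclidean_space val) K = 0"
  shows "val_at \<phi> K = 0"
proof -
  define d where "d = 1 / real DIM('a)"
  have d: "d > 0" by (simp add: d_def)
  define width_le where
    "width_le = (\<lambda>K (b::'a) c. \<forall>x\<in>body_set K. \<forall>y\<in>body_set K. x \<bullet> b - y \<bullet> b \<le> c)"
  have "(\<forall>b\<in>Basis - D. width_le K b d) \<Longrightarrow> val_at \<phi> K = 0" if "finite D" for D K
    using that
  proof (induction D arbitrary: K rule: finite_induct)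
    case empty
    obtain p where p: "p \<in> body_set K" using body_set_props(1)[of K] by blast
    have "norm (x - p) \<le> 1" if "x \<in> body_set K" for x
    proof -
      have "norm (x - p) \<le> (\<Sum>b\<in>Basis. \<bar>(x - p) \<bullet> b\<bar>)" by (rule norm_le_l1)
      also have "\<dots> \<le> (\<Sum>b\<in>(Basis::'a set). d)"
        using empty p that by (intro sum_mono) (auto simp: width_le_def inner_diff_left abs_le_iff)
      also have "\<dots> = 1" by (simp add: d_def)
      finally show ?thesis .
    qed
    then have "translate_body (- p) K \<in> unit_bodies"
      by (auto simp: unit_bodies_def translate_body.rep_eq)
    then have "val_at \<phi> (translate_body (- p) K) = 0" by (rule unit)
    then show ?case by (simp add: val_translate)
  next
    case (insert b D)
    have "val_at \<phi> K = 0"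
      if "\<forall>b\<in>Basis - insert b D. width_le K b d" "width_le K b (real m * d)" for m K
      using that
    proof (induction m arbitrary: K)
      case 0
      then have "width_le K b d" using d by (fastforce simp: width_le_def)
      then show ?case using 0 insert.IH[of K] by auto
    next
      case (Suc m)
      have "compact ((\<lambda>x. x \<bullet> b) ` body_set K)"
        by (intro compact_continuous_image continuous_intros) auto
      then obtain a where a: "a \<in> body_set K" "\<And>x. x \<in> body_set K \<Longrightarrow> a \<bullet> b \<le> x \<bullet> b"
        using compact_attains_inf[of "(\<lambda>x. x \<bullet> b) ` body_set K"] body_set_props(1)[of K] by auto
      define c where "c = a \<bullet> b + d"
      show ?case
      proof (cases "\<exists>z\<in>body_set K. z \<bullet> b > c")
        case False
        then have "x \<bullet> b \<le> c" if "x \<in> body_set K" for x using that by force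
        then have "width_le K b d" using a(2) by (force simp: width_le_def c_def)
        then show ?thesis using Suc.prems insert.IH[of K] by auto
      next
        case True
        then obtain z where z: "z \<in> body_set K" "z \<bullet> b > c" by blast
        let ?A = "body_set K \<inter> {x. b \<bullet> x \<le> c}" and ?B = "body_set K \<inter> {x. b \<bullet> x \<ge> c}"
        have "\<exists>w\<in>body_set K. b \<bullet> w = c"
          using connected_ivt_hyperplane[of "body_set K" a z b c] a z d convex_connected[of "body_set K"]
          by (auto simp: c_def inner_commute)
        then obtain w where w: "w \<in> body_set K" "b \<bullet> w = c" by blast
        have A: "body_set (Body ?A) = ?A"
          using w by (intro body_set_Body)
            (auto intro!: compact_Int_closed convex_Int closed_halfspace_le convex_halfspace_le)
        have B: "body_set (Body ?B) = ?B"
          using w by (intro body_set_Body)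
            (auto intro!: compact_Int_closed convex_Int closed_halfspace_ge convex_halfspace_ge)
        have AB: "body_set (Body (?A \<inter> ?B)) = ?A \<inter> ?B"
          using w by (intro body_set_Body)
            (auto intro!: compact_Int compact_Int_closed convex_Int closed_halfspace_ge convex_halfspace_ge
               closed_halfspace_le convex_halfspace_le)
        have mono: "width_le M b' e" if "width_le K b' e" "body_set M \<subseteq> body_set K" for M b' e
          using that by (auto simp: width_le_def)
        have "val_at \<phi> K + val_at \<phi> (Body (?A \<inter> ?B)) = val_at \<phi> (Body ?A) + val_at \<phi> (Body ?B)"
          by (rule val_additive) (use A B AB in auto)
        moreover have "val_at \<phi> (Body ?A) = 0"
        proof (rule insert.IH)
          have "width_le (Body ?A) b d" using a(2) A by (force simp: width_le_def c_def inner_commute)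
          then show "\<forall>b\<in>Basis - D. width_le (Body ?A) b d"
            using Suc.prems(1) mono[of _ d "Body ?A"] A by blast
        qed
        moreover have "val_at \<phi> (Body (?A \<inter> ?B)) = 0"
        proof (rule insert.IH)
          have "width_le (Body (?A \<inter> ?B)) b d" using AB d by (force simp: width_le_def inner_commute)
          then show "\<forall>b\<in>Basis - D. width_le (Body (?A \<inter> ?B)) b d"
            using Suc.prems(1) mono[of _ d "Body (?A \<inter> ?B)"] AB by blast
        qed
        moreover have "val_at \<phi> (Body ?B) = 0"
        proof (rule Suc.IH)
          show "\<forall>b\<in>Basis - insert b D. width_le (Body ?B) b d"
            using Suc.prems(1) mono[of _ d "Body ?B"] B by blast
          have "x \<bullet> b - y \<bullet> b \<le> real m * d" if "x \<in> ?B" "y \<in> ?B" for x y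
          proof -
            have "x \<bullet> b - a \<bullet> b \<le> real (Suc m) * d"
              using Suc.prems(2) that a by (auto simp: width_le_def)
            moreover have "y \<bullet> b \<ge> a \<bullet> b + d" using that by (auto simp: c_def inner_commute)
            ultimately show ?thesis by (simp add: algebra_simps)
          qed
          then show "width_le (Body ?B) b (real m * d)" by (auto simp: width_le_def B)
        qed
        ultimately show ?thesis by simp
      qed
    qed
    moreover have "\<exists>m. width_le K b (real m * d)"
    proof -
      have "bounded ((\<lambda>x. x \<bullet> b) ` body_set K)"
        by (intro compact_imp_bounded compact_continuous_image continuous_intros) auto
      then obtain C where C: "\<And>x. x \<in> body_set K \<Longrightarrow> \<bar>x \<bullet> b\<bar> \<le> C" by (auto simp: bounded_iff)
      obtain m where "2 * C / d < real m" using reals_Archimedean2 by blast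
      then have "2 * C \<le> real m * d" using d by (simp add: field_simps)
      moreover have "x \<bullet> b - y \<bullet> b \<le> 2 * C" if "x \<in> body_set K" "y \<in> body_set K" for x y
        using C[OF that(1)] C[OF that(2)] by linarith
      ultimately have "width_le K b (real m * d)" unfolding width_le_def by (meson order_trans)
      then show ?thesis ..
    qed
    ultimately show ?case using insert.prems by blast
  qed
  from this[of Basis] show ?thesis by simp
qed

instantiation val :: (euclidean_space) real_normed_vector
begin

lift_definition zero_val :: "'a val" is "\<lambda>_. 0" by simp

lift_definition plus_val :: "'a val \<Rightarrow> 'a val \<Rightarrow> 'a val" is "\<lambda>\<phi> \<psi> K. \<phi> K + \<psi> K"
  subgoal premises prems for \<phi> \<psi>
  proof (intro conjI allI impI)
    show "continuous_on UNIV (\<lambda>K. \<phi> K + \<psi> K)" using prems by (simp add: continuous_on_add)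
    show "\<phi> (translate_body x K) + \<psi> (translate_body x K) = \<phi> K + \<psi> K" for x K
      using prems by simp
    fix K L M N :: "'a body"
    assume "body_set M = body_set K \<union> body_set L \<and> body_set N = body_set K \<inter> body_set L"
    then have "\<phi> M + \<phi> N = \<phi> K + \<phi> L" "\<psi> M + \<psi> N = \<psi> K + \<psi> L" using prems by blast+
    from arg_cong2[OF this, of "(+)"]
    show "\<phi> M + \<psi> M + (\<phi> N + \<psi> N) = \<phi> K + \<psi> K + (\<phi> L + \<psi> L)" by (simp only: ac_simps)
  qed
  done

lift_definition uminus_val :: "'a val \<Rightarrow> 'a val" is "\<lambda>\<phi> K. - \<phi> K"
  subgoal premises prems for \<phi>
  proof (intro conjI allI impI)
    show "continuous_on UNIV (\<lambda>K. - \<phi> K)" using prems by (simp add: continuous_on_minus)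
    show "- \<phi> (translate_body x K) = - \<phi> K" for x K using prems by simp
    fix K L M N :: "'a body"
    assume "body_set M = body_set K \<union> body_set L \<and> body_set N = body_set K \<inter> body_set L"
    then have "\<phi> M + \<phi> N = \<phi> K + \<phi> L" using prems by blast
    then show "- \<phi> M + - \<phi> N = - \<phi> K + - \<phi> L" by (simp only: minus_add_distrib[symmetric])
  qed
  done

definition minus_val :: "'a val \<Rightarrow> 'a val \<Rightarrow> 'a val" where
  "minus_val \<phi> \<psi> = \<phi> + - \<psi>"

definition scaleR_val :: "real \<Rightarrow> 'a val \<Rightarrow> 'a val" where
  "scaleR_val c = scaleC_val (complex_of_real c)"

definition norm_val :: "'a val \<Rightarrow> real" where
  "norm_val \<phi> = (SUP K\<in>unit_bodies. cmod (val_at \<phi> K))"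

definition sgn_val :: "'a val \<Rightarrow> 'a val" where
  "sgn_val \<phi> = inverse (norm \<phi>) *\<^sub>R \<phi>"

definition dist_val :: "'a val \<Rightarrow> 'a val \<Rightarrow> real" where
  "dist_val \<phi> \<psi> = norm (\<phi> - \<psi>)"

definition uniformity_val :: "('a val \<times> 'a val) filter" where
  "uniformity_val = (INF e\<in>{0<..}. principal {(\<phi>, \<psi>). dist \<phi> \<psi> < e})"

definition open_val :: "'a val set \<Rightarrow> bool" where
  "open_val U \<longleftrightarrow> (\<forall>\<phi>\<in>U. eventually (\<lambda>(\<phi>', \<psi>). \<phi>' = \<phi> \<longrightarrow> \<psi> \<in> U) uniformity)"

lemma val_eqI: "(\<And>K. val_at \<phi> K = val_at \<psi> K) \<Longrightarrow> \<phi> = \<psi>"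
  by (simp add: val_at_inject[symmetric] fun_eq_iff)

lemma val_at_simps [simp]:
  "val_at 0 K = 0" "val_at (\<phi> + \<psi>) K = val_at \<phi> K + val_at \<psi> K" "val_at (- \<phi>) K = - val_at \<phi> K"
  "val_at (\<phi> - \<psi>) K = val_at \<phi> K - val_at \<psi> K" "val_at (r *\<^sub>R \<phi>) K = complex_of_real r * val_at \<phi> K"
  "val_at (scaleC_val c \<phi>) K = c * val_at \<phi> K"
  by (simp_all add: zero_val.rep_eq plus_val.rep_eq uminus_val.rep_eq minus_val_def scaleR_val_def
      scaleC_val.rep_eq)

lemma unit_bodies_nonempty: "(unit_bodies :: 'a body set) \<noteq> {}"
proof -
  have "(0 :: 'a body) \<in> unit_bodies" by (simp add: unit_bodies_def zero_body.rep_eq)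
  then show ?thesis by blast
qed

lemma norm_val_le_iff: "norm (\<phi>::'a val) \<le> e \<longleftrightarrow> (\<forall>K\<in>unit_bodies. cmod (val_at \<phi> K) \<le> e)"
  unfolding norm_val_def by (rule cSUP_le_iff[OF unit_bodies_nonempty val_bounded])

lemma cmod_le_norm_val: "K \<in> unit_bodies \<Longrightarrow> cmod (val_at (\<phi>::'a val) K) \<le> norm \<phi>"
  using norm_val_le_iff by blast

instance
proof
  fix \<phi> \<psi> :: "'a val" and r :: real
  obtain K where K: "K \<in> (unit_bodies :: 'a body set)" using unit_bodies_nonempty by blast
  show "norm \<phi> = 0 \<longleftrightarrow> \<phi> = 0"
  proof
    assume "norm \<phi> = 0"
    then have "\<And>K. K \<in> unit_bodies \<Longrightarrow> val_at \<phi> K = 0" using norm_val_le_iff[of \<phi> 0] by simp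
    then show "\<phi> = 0" by (intro val_eqI) (simp add: val_eq_0_of_unit_bodies)
  next
    assume "\<phi> = 0"
    then have "norm \<phi> \<le> 0" by (simp add: norm_val_le_iff)
    then show "norm \<phi> = 0" using cmod_le_norm_val[OF K, of \<phi>] norm_ge_zero[of "val_at \<phi> K"] by linarith
  qed
  show "norm (\<phi> + \<psi>) \<le> norm \<phi> + norm \<psi>"
    unfolding norm_val_le_iff
  proof
    fix K :: "'a body" assume K: "K \<in> unit_bodies"
    have "cmod (val_at (\<phi> + \<psi>) K) \<le> cmod (val_at \<phi> K) + cmod (val_at \<psi> K)"
      by (simp add: norm_triangle_ineq)
    then show "cmod (val_at (\<phi> + \<psi>) K) \<le> norm \<phi> + norm \<psi>"
      using cmod_le_norm_val[OF K, of \<phi>] cmod_le_norm_val[OF K, of \<psi>] by linarith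
  qed
  have le: "norm (r *\<^sub>R \<phi>) \<le> \<bar>r\<bar> * norm \<phi>" for r :: real and \<phi> :: "'a val"
    unfolding norm_val_le_iff by (simp add: norm_mult mult_left_mono cmod_le_norm_val)
  have assoc: "a *\<^sub>R b *\<^sub>R \<phi> = (a * b) *\<^sub>R \<phi>" for a b :: real and \<phi> :: "'a val"
    by (rule val_eqI) simp
  have one: "1 *\<^sub>R \<phi> = \<phi>" for \<phi> :: "'a val" by (rule val_eqI) simp
  show "norm (r *\<^sub>R \<phi>) = \<bar>r\<bar> * norm \<phi>"
  proof (cases "r = 0")
    case True
    moreover have "norm \<phi> \<ge> 0" using cmod_le_norm_val[OF K, of \<phi>] norm_ge_zero[of "val_at \<phi> K"] by linarith
    moreover have "norm (r *\<^sub>R \<phi>) \<ge> 0"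
      using cmod_le_norm_val[OF K, of "r *\<^sub>R \<phi>"] norm_ge_zero[of "val_at (r *\<^sub>R \<phi>) K"] by linarith
    ultimately show ?thesis using le[of r \<phi>] by simp
  next
    case False
    have "norm \<phi> = norm (inverse r *\<^sub>R r *\<^sub>R \<phi>)" using False by (simp add: assoc one)
    also have "\<dots> \<le> \<bar>inverse r\<bar> * norm (r *\<^sub>R \<phi>)" by (rule le)
    finally have "\<bar>r\<bar> * norm \<phi> \<le> norm (r *\<^sub>R \<phi>)" using False by (simp add: field_simps)
    then show ?thesis using le[of r \<phi>] by simp
  qed
qed (simp add: sgn_val_def dist_val_def uniformity_val_def open_val_def; fail |
     rule val_eqI, simp add: algebra_simps)+

end

section \<open>Smooth maps, smooth bodies and smooth valuations\<close>

primrec C_k_on :: "nat \<Rightarrow> 'a::real_normed_vector set \<Rightarrow> ('a \<Rightarrow> 'b::real_normed_vector) \<Rightarrow> bool" where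
  "C_k_on 0 S f \<longleftrightarrow> continuous_on S f"
| "C_k_on (Suc k) S f \<longleftrightarrow> (\<forall>x\<in>S. f differentiable at x) \<and>
     (\<forall>v. C_k_on k S (\<lambda>x. frechet_derivative f (at x) v))"

text \<open>Used for open sets in finite-dimensional spaces only; there, it does not matter that
  continuity of the iterated derivatives is required direction by direction.\<close>

definition smooth_on :: "'a::real_normed_vector set \<Rightarrow> ('a \<Rightarrow> 'b::real_normed_vector) \<Rightarrow> bool" where
  "smooth_on S f \<longleftrightarrow> (\<forall>k. C_k_on k S f)"

text \<open>The bodies with smooth and strictly convex boundary. Near each of its boundary points, the body
  is a sublevel set of a smooth function with nonvanishing differential (in particular, the body has
  nonempty interior). Strict convexity is understood in the sense of differential geometry: the
  second fundamental form of the boundary is positive definite, i.e. the Hessian of the defining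
  function is positive definite on the tangent space. (If flat boundary points were admitted, as for
  \<open>x\<^sup>4 + y\<^sup>4 \<le> 1\<close>, the valuation \<open>K \<mapsto> vol (A + K)\<close> would in general not be smooth.)\<close>

definition smooth_bodies :: "'a::euclidean_space body set" where
  "smooth_bodies = {A. \<forall>p\<in>frontier (body_set A). \<exists>U f.
     open U \<and> p \<in> U \<and> smooth_on U (f :: 'a \<Rightarrow> real) \<and> body_set A \<inter> U = {x\<in>U. f x \<le> 0} \<and>
     (\<exists>v. frechet_derivative f (at p) v \<noteq> 0) \<and>
     (\<forall>v. v \<noteq> 0 \<and> frechet_derivative f (at p) v = 0 \<longrightarrow>
        frechet_derivative (\<lambda>x. frechet_derivative f (at x) v) (at p) v > 0)}"

definition GL :: "('a::euclidean_space \<Rightarrow>\<^sub>L 'a) set" where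
  "GL = {g. bij (blinfun_apply g)}"

lemma body_set_image_body_Un_Int:
  fixes g :: "'a::euclidean_space \<Rightarrow>\<^sub>L 'a"
  assumes M: "body_set M = body_set K \<union> body_set L" and N: "body_set N = body_set K \<inter> body_set L"
  shows "body_set (image_body g M) = body_set (image_body g K) \<union> body_set (image_body g L)"
    and "body_set (image_body g N) = body_set (image_body g K) \<inter> body_set (image_body g L)"
proof -
  have lin: "linear (blinfun_apply g)"
    by (simp add: blinfun.bounded_linear_right bounded_linear.linear)
  show "body_set (image_body g M) = body_set (image_body g K) \<union> body_set (image_body g L)"
    by (simp add: image_body.rep_eq M image_Un)
  have "g x \<in> g ` body_set N" if x: "x \<in> body_set K" and y: "y \<in> body_set L" and xy: "g x = g y" for x y
  proof -
    have seg: "closed_segment x y \<subseteq> body_set K \<union> body_set L"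
      using closed_segment_subset[of x "body_set M" y] x y body_set_props(3)[of M]
      unfolding M by blast
    have "closed_segment x y \<inter> body_set K \<inter> body_set L \<noteq> {}"
    proof
      assume "closed_segment x y \<inter> body_set K \<inter> body_set L = {}"
      then have "body_set K \<inter> body_set L \<inter> closed_segment x y = {}" by blast
      then show False
        using connected_closedD[OF connected_segment(1)[of x y] _ seg] x y by auto
    qed
    then obtain z where z: "z \<in> closed_segment x y" "z \<in> body_set N" using N by blast
    then obtain u where "z = (1 - u) *\<^sub>R x + u *\<^sub>R y" by (auto simp: closed_segment_def)
    then have "g z = (1 - u) *\<^sub>R g x + u *\<^sub>R g x" using xy by (simp add: blinfun.bilinear_simps)
    then have "g z = g x" by (simp add: scaleR_left_distrib[symmetric])
    then show ?thesis using z by (metis imageI)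
  qed
  then show "body_set (image_body g N) = body_set (image_body g K) \<inter> body_set (image_body g L)"
    unfolding image_body.rep_eq using N by (auto 0 3)
qed

lemma continuous_on_image_body: "continuous_on UNIV (image_body (g :: 'a::euclidean_space \<Rightarrow>\<^sub>L 'a))"
proof -
  have "dist (image_body g K) (image_body g L) \<le> norm g * dist K L" for K L
  proof (rule dist_body_leI)
    fix x assume "x \<in> body_set (image_body g K)"
    then obtain a where a: "a \<in> body_set K" "x = g a" by (auto simp: image_body.rep_eq)
    then obtain b where b: "b \<in> body_set L" "dist a b \<le> dist K L" using dist_body_le by blast
    have "dist x (g b) \<le> norm g * dist a b"
      using a norm_blinfun[of g "a - b"] by (simp add: dist_norm blinfun.diff_right)
    also have "\<dots> \<le> norm g * dist K L" using b by (intro mult_left_mono) auto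
    finally show "\<exists>y\<in>body_set (image_body g L). dist x y \<le> norm g * dist K L"
      using b by (auto simp: image_body.rep_eq)
  next
    fix x assume "x \<in> body_set (image_body g L)"
    then obtain a where a: "a \<in> body_set L" "x = g a" by (auto simp: image_body.rep_eq)
    then obtain b where b: "b \<in> body_set K" "dist a b \<le> dist K L"
      using dist_body_le[of L K "dist K L" a] by (auto simp: dist_commute[of L K])
    have "dist x (g b) \<le> norm g * dist a b"
      using a norm_blinfun[of g "a - b"] by (simp add: dist_norm blinfun.diff_right)
    also have "\<dots> \<le> norm g * dist K L" using b by (intro mult_left_mono) auto
    finally show "\<exists>y\<in>body_set (image_body g K). dist x y \<le> norm g * dist K L"
      using b by (auto simp: image_body.rep_eq)
  qed
  then have "(norm g)-lipschitz_on UNIV (image_body g)" by (intro lipschitz_onI) auto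
  then show ?thesis by (rule lipschitz_on_continuous_on)
qed

lemma image_body_translate: "image_body g (translate_body x K) = translate_body (g x) (image_body g K)"
  by (transfer, auto simp: image_image blinfun.add_right)

text \<open>The action \<open>(g \<phi>) K = \<phi> (g\<inverse> K)\<close>, meaningful for \<open>g \<in> GL\<close>.\<close>

lift_definition act :: "('a::euclidean_space \<Rightarrow>\<^sub>L 'a) \<Rightarrow> 'a val \<Rightarrow> 'a val"
  is "\<lambda>g \<phi> K. \<phi> (image_body (Blinfun (inv (blinfun_apply g))) K)"
  subgoal premises prems for g \<phi>
  proof -
    have "continuous_on UNIV (\<lambda>K. \<phi> (image_body (Blinfun (inv (blinfun_apply g))) K))"
      using prems by (intro continuous_on_compose2[OF _ continuous_on_image_body]) auto
    then show ?thesis using prems by (auto simp: image_body_translate body_set_image_body_Un_Int)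
  qed
  done

definition smooth_vals :: "'a::euclidean_space val set" where
  "smooth_vals = {\<phi>. smooth_on GL (\<lambda>g. act g \<phi>)}"

text \<open>The topology on the smooth valuations induced from the \<open>C\<^sup>\<infinity>\<close> topology on maps from \<open>GL\<close> to valuations
  by \<open>\<phi> \<mapsto> (g \<mapsto> g \<phi>)\<close>: uniform convergence on compact sets of all iterated directional derivatives.\<close>

primrec iter_deriv :: "'a list \<Rightarrow> ('a::real_normed_vector \<Rightarrow> 'b::real_normed_vector) \<Rightarrow> 'a \<Rightarrow> 'b" where
  "iter_deriv [] f = f"
| "iter_deriv (v # vs) f = iter_deriv vs (\<lambda>x. frechet_derivative f (at x) v)"

definition smooth_vals_topology :: "'a::euclidean_space val topology" where
  "smooth_vals_topology = topology_generated_by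
     {{\<psi>\<in>smooth_vals. \<forall>g\<in>C. dist (iter_deriv vs (\<lambda>g. act g \<psi>) g) (iter_deriv vs (\<lambda>g. act g \<phi>) g) < e}
      |\<phi> C vs e. \<phi> \<in> smooth_vals \<and> compact C \<and> C \<subseteq> GL \<and> e > 0}"

section \<open>Mixed volumes\<close>

text \<open>The mixed volume is the symmetric Minkowski-multilinear functional of \<open>n = DIM('a)\<close> bodies
  normalized by \<open>V(K, \<dots>, K) = vol K\<close>; it is put to zero on lists of any other length.\<close>

definition is_mixed_volume :: "('a::euclidean_space body list \<Rightarrow> real) \<Rightarrow> bool" where
  "is_mixed_volume V \<longleftrightarrow>
     (\<forall>Ks Ls. mset Ks = mset Ls \<longrightarrow> V Ks = V Ls) \<and>
     (\<forall>K L Ms s t. 0 \<le> s \<longrightarrow> 0 \<le> t \<longrightarrow>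
        V ((scale_body s K + scale_body t L) # Ms) = s * V (K # Ms) + t * V (L # Ms)) \<and>
     (\<forall>K. V (replicate DIM('a) K) = vol K) \<and>
     (\<forall>Ks. length Ks \<noteq> DIM('a) \<longrightarrow> V Ks = 0)"

definition mixed_volume :: "'a::euclidean_space body list \<Rightarrow> real" where
  "mixed_volume = (THE V. is_mixed_volume V)"

text \<open>In \<open>mixed_val\<close> and \<open>mu\<close>, the argument of \<open>Val\<close> always is a continuous translation-invariant
  valuation, by the continuity and additivity properties of (mixed) volumes; this is not proved here.
  For \<open>length As = n - k\<close>, \<open>mixed_val As\<close> is \<open>K \<mapsto> V(K, \<dots>, K, A\<^sub>1, \<dots>, A\<^sub>n\<^sub>-\<^sub>k)\<close> with \<open>K\<close> repeated \<open>k\<close> times.\<close>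

definition mixed_val :: "'a::euclidean_space body list \<Rightarrow> 'a val" where
  "mixed_val As =
     Val (\<lambda>K. complex_of_real (mixed_volume (replicate (DIM('a) - length As) K @ As)))"

section \<open>The convolution product\<close>

definition mu :: "'a::euclidean_space body \<Rightarrow> 'a val" where
  "mu A = Val (\<lambda>K. complex_of_real (vol (A + K)))"

text \<open>The convolution is the unique product with the following properties. Its existence is a theorem,
  which is not available here; so the convolution is not a constant but any \<open>conv\<close> with
  \<open>is_convolution conv\<close>. Such a \<open>conv\<close> is relevant on \<open>smooth_vals\<close> only.\<close>

definition is_convolution :: "('a::euclidean_space val \<Rightarrow> 'a val \<Rightarrow> 'a val) \<Rightarrow> bool" where
  "is_convolution conv \<longleftrightarrow>
     (\<forall>\<phi>\<in>smooth_vals. \<forall>\<psi>\<in>smooth_vals. conv \<phi> \<psi> \<in> smooth_vals) \<and>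
     (\<forall>\<phi>\<in>smooth_vals. \<forall>\<phi>'\<in>smooth_vals. \<forall>\<psi>\<in>smooth_vals.
        conv (\<phi> + \<phi>') \<psi> = conv \<phi> \<psi> + conv \<phi>' \<psi> \<and> conv \<psi> (\<phi> + \<phi>') = conv \<psi> \<phi> + conv \<psi> \<phi>') \<and>
     (\<forall>c. \<forall>\<phi>\<in>smooth_vals. \<forall>\<psi>\<in>smooth_vals.
        conv (scaleC_val c \<phi>) \<psi> = scaleC_val c (conv \<phi> \<psi>) \<and>
        conv \<phi> (scaleC_val c \<psi>) = scaleC_val c (conv \<phi> \<psi>)) \<and>
     continuous_map (prod_topology smooth_vals_topology smooth_vals_topology) smooth_vals_topology
       (\<lambda>(\<phi>, \<psi>). conv \<phi> \<psi>) \<and>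
     (\<forall>A\<in>smooth_bodies. \<forall>B\<in>smooth_bodies. conv (mu A) (mu B) = mu (A + B))"

end

theory Submission
  imports Defs "HOL-Combinatorics.Multiset_Permutations"
begin

text \<open>A mixed volume valuation is a finite linear combination of valuations \<open>mu X\<close> with smooth bodies \<open>X\<close>:
  evaluate the polynomial \<open>t \<mapsto> vol (K + t\<^sub>1 A\<^sub>1 + \<dots> + t\<^sub>m A\<^sub>m)\<close> at finitely many positive \<open>t\<close> and extract the
  coefficient of \<open>t\<^sub>1 \<cdots> t\<^sub>m\<close>. Since \<open>mu X * mu Y = mu (X + Y)\<close>, the convolution of two mixed volume valuations
  is obtained by two successive extractions from \<open>vol (K + X + Y)\<close>, which together contribute the
  factor \<open>l! k! / ((k + l - n)! n!)\<close>. This rests on three facts.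

  Mixed volumes exist: a sum of polytopes with positive coefficients \<open>t\<close> is, up to a null set, the
  diffeomorphic image of the space under \<open>\<Sum> t\<^sub>i grad f\<^sub>i\<close> with functions \<open>f\<^sub>i\<close> of log-sum-exp type, hence its
  volume is the integral of a determinant and thus a polynomial in \<open>t\<close>; approximate general bodies by polytopes.

  Sums and dilates of smooth bodies are smooth: the support function of a smooth body \<open>A\<close> is smooth
  away from the origin and \<open>A\<close> has a small ball as a summand; conversely, every body with these two
  properties is smooth.

  \<open>mu A\<close> is a smooth valuation: \<open>g (mu A)\<close> is \<open>1 / \<bar>det g\<bar>\<close> times a combination of mixed volume
  valuations of copies of \<open>g A\<close>. Mixed volumes are Lipschitz with respect to combinations of support
  functions, and the derivative of a smooth family of support functions is, locally, the difference of
  another such family and a multiple of the norm. So the derivatives of mixed volume valuations of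
  smooth families are again combinations of such valuations.\<close>

section \<open>Calculus of smooth maps\<close>

lemma C_k_on_subset: "C_k_on k S f \<Longrightarrow> T \<subseteq> S \<Longrightarrow> C_k_on k T f"
  by (induction k arbitrary: f) (auto intro: continuous_on_subset)

lemma C_k_on_cong:
  assumes "open S" "\<And>x. x \<in> S \<Longrightarrow> f x = g x" "C_k_on k S f"
  shows "C_k_on k S g"
  using assms(2,3)
proof (induction k arbitrary: f g)
  case 0
  then show ?case by (simp cong: continuous_on_cong)
next
  case (Suc k)
  have eq: "frechet_derivative f (at x) = frechet_derivative g (at x)" if "x \<in> S" for x
    using frechet_derivative_transform_within_open[of f x S g] Suc.prems assms(1) that by auto
  have "C_k_on k S (\<lambda>x. frechet_derivative g (at x) v)" for v
    by (rule Suc.IH[of "\<lambda>x. frechet_derivative f (at x) v"]) (use Suc.prems eq in auto)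
  moreover have "g differentiable at x" if "x \<in> S" for x
    using Suc.prems that assms(1) unfolding differentiable_def C_k_on.simps
    by (meson has_derivative_transform_within_open)
  ultimately show ?case by simp
qed

lemma C_k_on_SucI:
  assumes "open S" and der: "\<And>x. x \<in> S \<Longrightarrow> (f has_derivative f' x) (at x)"
    and "\<And>v. C_k_on k S (\<lambda>x. f' x v)"
  shows "C_k_on (Suc k) S f"
proof -
  have "frechet_derivative f (at x) = f' x" if "x \<in> S" for x
    using der[OF that] frechet_derivative_at by metis
  then have "C_k_on k S (\<lambda>x. frechet_derivative f (at x) v)" for v
    by (intro C_k_on_cong[OF assms(1) _ assms(3)[of v]]) auto
  then show ?thesis using der by (auto simp: differentiable_def)
qed

lemma C_k_on_Suc_imp: "C_k_on (Suc k) S f \<Longrightarrow> C_k_on k S f"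
proof (induction k arbitrary: f)
  case 0
  then show ?case
    by (auto intro!: continuous_at_imp_continuous_on differentiable_imp_continuous_within)
next
  case (Suc k)
  show ?case
    unfolding C_k_on.simps(2)
  proof (intro conjI ballI allI)
    show "f differentiable at x" if "x \<in> S" for x using Suc.prems that by simp
    show "C_k_on k S (\<lambda>x. frechet_derivative f (at x) v)" for v
      by (rule Suc.IH) (use Suc.prems in simp)
  qed
qed

lemma C_k_on_imp_continuous_on: "C_k_on k S f \<Longrightarrow> continuous_on S f"
  by (induction k) (use C_k_on_Suc_imp in \<open>auto simp del: C_k_on.simps(2)\<close>)

lemma C_k_on_local:
  assumes "\<And>x. x \<in> S \<Longrightarrow> \<exists>T. open T \<and> x \<in> T \<and> C_k_on k T f"
  shows "C_k_on k S f"
  using assms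
proof (induction k arbitrary: f)
  case 0
  have "isCont f x" if "x \<in> S" for x
    using 0[OF that] by (auto simp: continuous_on_eq_continuous_at)
  then show ?case by (simp add: continuous_at_imp_continuous_on)
next
  case (Suc k)
  have "C_k_on k S (\<lambda>x. frechet_derivative f (at x) v)" for v
    by (rule Suc.IH) (metis Suc.prems C_k_on.simps(2))
  moreover have "f differentiable at x" if "x \<in> S" for x
    by (metis Suc.prems C_k_on.simps(2) that)
  ultimately show ?case by simp
qed

lemma C_k_on_const [simp]: "C_k_on k S (\<lambda>_. c)"
  by (induction k arbitrary: c) auto

lemma C_k_on_add:
  assumes "C_k_on k S f" "C_k_on k S g" "open S"
  shows "C_k_on k S (\<lambda>x. f x + g x)"
  using assms(1,2)
proof (induction k arbitrary: f g)
  case 0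
  then show ?case by (simp add: continuous_on_add)
next
  case (Suc k)
  show ?case
  proof (rule C_k_on_SucI[OF assms(3)])
    fix x assume "x \<in> S"
    then show "((\<lambda>x. f x + g x) has_derivative
       (\<lambda>v. frechet_derivative f (at x) v + frechet_derivative g (at x) v)) (at x)"
      using Suc.prems by (intro has_derivative_add) (simp_all add: frechet_derivative_works[symmetric])
  qed (use Suc in auto)
qed

lemma C_k_on_linear:
  assumes "bounded_linear L" "C_k_on k S f" "open S"
  shows "C_k_on k S (\<lambda>x. L (f x))"
  using assms(2)
proof (induction k arbitrary: f)
  case 0
  then show ?case
    using continuous_on_compose2[OF linear_continuous_on[OF assms(1), of UNIV], of S f] by auto
next
  case (Suc k)
  show ?case
  proof (rule C_k_on_SucI[OF assms(3)])
    fix x assume "x \<in> S"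
    then show "((\<lambda>x. L (f x)) has_derivative (\<lambda>v. L (frechet_derivative f (at x) v))) (at x)"
      using Suc.prems
      by (intro bounded_linear.has_derivative[OF assms(1)]) (simp add: frechet_derivative_works[symmetric])
  qed (use Suc in auto)
qed

lemma C_k_on_bounded_linear:
  assumes "bounded_linear L"
  shows "C_k_on k S L"
proof -
  have "C_k_on k UNIV L"
  proof (cases k)
    case 0
    then show ?thesis by (simp add: linear_continuous_on assms)
  next
    case (Suc m)
    have "C_k_on (Suc m) UNIV L"
      by (rule C_k_on_SucI[where f'="\<lambda>_. L"]) (auto intro: bounded_linear_imp_has_derivative assms)
    then show ?thesis using Suc by simp
  qed
  then show ?thesis by (rule C_k_on_subset) simp
qed

lemma C_k_on_bilinear:
  assumes B: "bounded_bilinear B" and "C_k_on k S f" "C_k_on k S g" "open S"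
  shows "C_k_on k S (\<lambda>x. B (f x) (g x))"
  using assms(2,3)
proof (induction k arbitrary: f g)
  case 0
  then show ?case by (auto intro: bounded_bilinear.continuous_on[OF B])
next
  case (Suc k)
  show ?case
  proof (rule C_k_on_SucI[OF assms(4)])
    fix x assume "x \<in> S"
    then show "((\<lambda>x. B (f x) (g x)) has_derivative
       (\<lambda>v. B (f x) (frechet_derivative g (at x) v) + B (frechet_derivative f (at x) v) (g x))) (at x)"
      using Suc.prems
      by (intro bounded_bilinear.FDERIV[OF B]) (simp_all add: frechet_derivative_works[symmetric])
  next
    fix v
    have "C_k_on k S f" "C_k_on k S g" using Suc.prems C_k_on_Suc_imp by blast+
    then show "C_k_on k S (\<lambda>x. B (f x) (frechet_derivative g (at x) v) + B (frechet_derivative f (at x) v) (g x))"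
      by (intro C_k_on_add[OF _ _ assms(4)] Suc.IH) (use Suc.prems in auto)
  qed
qed

lemma C_k_on_sum:
  assumes "\<And>i. i \<in> I \<Longrightarrow> C_k_on k S (f i)" "open S"
  shows "C_k_on k S (\<lambda>x. \<Sum>i\<in>I. f i x)"
  using assms(1) by (induction I rule: infinite_finite_induct) (auto intro: C_k_on_add assms(2))

lemma linear_sum_Basis:
  fixes L :: "'b::euclidean_space \<Rightarrow> 'c::real_vector"
  assumes "linear L"
  shows "L x = (\<Sum>b\<in>Basis. (x \<bullet> b) *\<^sub>R L b)"
proof -
  have "L x = L (\<Sum>b\<in>Basis. (x \<bullet> b) *\<^sub>R b)" by (simp add: euclidean_representation)
  also have "\<dots> = (\<Sum>b\<in>Basis. (x \<bullet> b) *\<^sub>R L b)"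
    using assms by (simp add: linear_sum linear_scale)
  finally show ?thesis .
qed

lemma C_k_on_compose:
  fixes f :: "'a::real_normed_vector \<Rightarrow> 'b::euclidean_space" and g :: "'b \<Rightarrow> 'c::real_normed_vector"
  assumes "C_k_on k S f" "C_k_on k T g" and ST: "open S" "f ` S \<subseteq> T"
  shows "C_k_on k S (\<lambda>x. g (f x))"
  using assms(1,2)
proof (induction k arbitrary: g)
  case 0
  then show ?case using ST by (auto intro: continuous_on_compose2)
next
  case (Suc k)
  let ?f' = "\<lambda>x. frechet_derivative f (at x)" and ?g' = "\<lambda>x. frechet_derivative g (at x)"
  have f: "(f has_derivative ?f' x) (at x)" and g: "(g has_derivative ?g' (f x)) (at (f x))"
    if "x \<in> S" for x
    using Suc.prems that ST by (auto simp: frechet_derivative_works[symmetric])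
  show ?case
  proof (rule C_k_on_SucI[OF ST(1)])
    fix x assume x: "x \<in> S"
    have "(\<lambda>v. \<Sum>b\<in>Basis. (?f' x v \<bullet> b) *\<^sub>R ?g' (f x) b) = (\<lambda>v. ?g' (f x) (?f' x v))"
      by (rule ext, rule linear_sum_Basis[OF has_derivative_linear[OF g[OF x]], symmetric])
    then show "((\<lambda>x. g (f x)) has_derivative
       (\<lambda>v. \<Sum>b\<in>Basis. (?f' x v \<bullet> b) *\<^sub>R ?g' (f x) b)) (at x)"
      using diff_chain_at[OF f[OF x] g[OF x]] by (simp only: o_def)
  next
    fix v
    have "C_k_on k S (\<lambda>x. (?f' x v \<bullet> b) *\<^sub>R ?g' (f x) b)" for b
    proof (rule C_k_on_bilinear[OF bounded_bilinear_scaleR _ _ ST(1)])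
      show "C_k_on k S (\<lambda>x. ?f' x v \<bullet> b)"
        by (rule C_k_on_linear[OF bounded_linear_inner_left _ ST(1)]) (use Suc.prems in simp)
      show "C_k_on k S (\<lambda>x. ?g' (f x) b)"
        by (rule Suc.IH) (use Suc.prems C_k_on_Suc_imp in auto)
    qed
    then show "C_k_on k S (\<lambda>x. \<Sum>b\<in>Basis. (?f' x v \<bullet> b) *\<^sub>R ?g' (f x) b)"
      by (intro C_k_on_sum ST(1))
  qed
qed

lemma smooth_on_subset: "smooth_on S f \<Longrightarrow> T \<subseteq> S \<Longrightarrow> smooth_on T f"
  unfolding smooth_on_def using C_k_on_subset by blast

lemma smooth_on_cong:
  "open S \<Longrightarrow> (\<And>x. x \<in> S \<Longrightarrow> f x = g x) \<Longrightarrow> smooth_on S f \<Longrightarrow> smooth_on S g"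
  unfolding smooth_on_def by (intro allI C_k_on_cong[of S f g]) auto

lemma smooth_on_imp_continuous_on: "smooth_on S f \<Longrightarrow> continuous_on S f"
  unfolding smooth_on_def using C_k_on_imp_continuous_on by blast

lemma smooth_on_has_derivative:
  "smooth_on S f \<Longrightarrow> x \<in> S \<Longrightarrow> (f has_derivative frechet_derivative f (at x)) (at x)"
  unfolding frechet_derivative_works[symmetric] by (metis smooth_on_def C_k_on.simps(2))

lemma smooth_on_frechet_derivative:
  "smooth_on S f \<Longrightarrow> smooth_on S (\<lambda>x. frechet_derivative f (at x) v)"
  unfolding smooth_on_def by (metis C_k_on.simps(2))

lemma smooth_on_const [simp]: "smooth_on S (\<lambda>_. c)"
  by (simp add: smooth_on_def)

lemma smooth_on_bounded_linear: "bounded_linear L \<Longrightarrow> smooth_on S L"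
  by (simp add: smooth_on_def C_k_on_bounded_linear)

lemma smooth_on_id: "smooth_on S (\<lambda>x. x)"
  by (rule smooth_on_bounded_linear) simp

lemma smooth_on_add: "smooth_on S f \<Longrightarrow> smooth_on S g \<Longrightarrow> open S \<Longrightarrow> smooth_on S (\<lambda>x. f x + g x)"
  by (simp add: smooth_on_def C_k_on_add)

lemma smooth_on_linear:
  "bounded_linear L \<Longrightarrow> smooth_on S f \<Longrightarrow> open S \<Longrightarrow> smooth_on S (\<lambda>x. L (f x))"
  by (simp add: smooth_on_def C_k_on_linear)

lemma smooth_on_diff:
  "smooth_on S f \<Longrightarrow> smooth_on S g \<Longrightarrow> open S \<Longrightarrow> smooth_on S (\<lambda>x. f x - g x)"
  using smooth_on_add[of S f "\<lambda>x. - g x"] smooth_on_linear[of uminus S g]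
  by (simp add: bounded_linear_minus)

lemma smooth_on_bilinear:
  "bounded_bilinear B \<Longrightarrow> smooth_on S f \<Longrightarrow> smooth_on S g \<Longrightarrow> open S \<Longrightarrow> smooth_on S (\<lambda>x. B (f x) (g x))"
  by (simp add: smooth_on_def C_k_on_bilinear)

lemmas smooth_on_scaleR = smooth_on_bilinear[OF bounded_bilinear_scaleR]
  and smooth_on_inner = smooth_on_bilinear[OF bounded_bilinear_inner]

lemma smooth_on_sum:
  "(\<And>i. i \<in> I \<Longrightarrow> smooth_on S (f i)) \<Longrightarrow> open S \<Longrightarrow> smooth_on S (\<lambda>x. \<Sum>i\<in>I. f i x)"
  unfolding smooth_on_def by (intro allI C_k_on_sum) auto

lemma smooth_on_compose:
  fixes f :: "'a::real_normed_vector \<Rightarrow> 'b::euclidean_space" and g :: "'b \<Rightarrow> 'c::real_normed_vector"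
  assumes "smooth_on S f" "smooth_on T g" "open S" "f ` S \<subseteq> T"
  shows "smooth_on S (\<lambda>x. g (f x))"
  unfolding smooth_on_def
proof
  fix k
  have "C_k_on k S f" "C_k_on k T g" using assms(1,2) by (simp_all add: smooth_on_def)
  then show "C_k_on k S (\<lambda>x. g (f x))" using assms(3,4) by (rule C_k_on_compose)
qed

lemma smooth_on_Pair:
  assumes "smooth_on S f" "smooth_on S g" "open S"
  shows "smooth_on S (\<lambda>x. (f x, g x))"
proof -
  have "bounded_linear (\<lambda>y. (y, 0 :: 'c))" "bounded_linear (\<lambda>z. (0 :: 'b, z))"
    by (simp_all add: bounded_linear_Pair bounded_linear_ident bounded_linear_zero)
  from smooth_on_add[OF smooth_on_linear[OF this(1) assms(1,3)] smooth_on_linear[OF this(2) assms(2,3)] assms(3)]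
  show ?thesis by simp
qed

lemma smooth_on_powr: "smooth_on {0<..} (\<lambda>x::real. x powr a)"
  unfolding smooth_on_def
proof
  fix k
  show "C_k_on k {0<..} (\<lambda>x::real. x powr a)"
  proof (induction k arbitrary: a)
    case 0
    have "continuous_on {0<..} (\<lambda>x::real. x powr a)"
      by (rule continuous_on_powr) (auto intro: continuous_on_id)
    then show ?case by simp
  next
    case (Suc k)
    show ?case
    proof (rule C_k_on_SucI)
      fix x :: real assume "x \<in> {0<..}"
      then have "((\<lambda>x. x powr a) has_real_derivative a * x powr (a - 1)) (at x)"
        by (intro has_real_derivative_powr) simp
      then show "((\<lambda>x. x powr a) has_derivative (\<lambda>v. a * x powr (a - 1) * v)) (at x)"
        by (simp add: has_field_derivative_def)
    next
      fix v
      have "bounded_linear (\<lambda>y. a * y * v)"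
        by (intro bounded_linear_mult_left bounded_linear_const_mult bounded_linear_mult_const
            bounded_linear_ident)
      from C_k_on_linear[OF this Suc.IH, of "a - 1"]
      show "C_k_on k {0<..} (\<lambda>x. a * x powr (a - 1) * v)" by simp
    qed simp
  qed
qed

lemma smooth_on_norm: "smooth_on (- {0}) (norm :: 'a::euclidean_space \<Rightarrow> real)"
proof -
  have "smooth_on (- {0::'a}) (\<lambda>x. x \<bullet> x)"
    by (intro smooth_on_inner smooth_on_id) auto
  then have "smooth_on (- {0::'a}) (\<lambda>x. (x \<bullet> x) powr (1/2))"
    by (rule smooth_on_compose[OF _ smooth_on_powr]) (auto simp: image_subset_iff)
  moreover have "(x \<bullet> x) powr (1/2) = norm x" for x :: 'a
    by (simp add: powr_half_sqrt norm_eq_sqrt_inner)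
  ultimately show ?thesis by simp
qed

lemma has_derivative_bilinear_vanishing:
  assumes B: "bounded_bilinear B" and p: "isCont p u" and f: "(f has_derivative f') (at u)" and f0: "f u = 0"
  shows "((\<lambda>x. B (p x) (f x)) has_derivative (\<lambda>v. B (p u) (f' v))) (at u)"
proof -
  interpret bounded_bilinear B by (rule B)
  obtain K where K: "K > 0" "\<And>a b. norm (B a b) \<le> norm a * norm b * K" using pos_bounded by blast
  have bl: "bounded_linear f'" using f by (rule has_derivative_bounded_linear)
  obtain M where M: "M > 0" "\<And>v. norm (f' v) \<le> norm v * M"
    using bounded_linear.pos_bounded[OF bl] by blast
  have "((\<lambda>x. B (p x - p u) (f x)) has_derivative (\<lambda>v. 0)) (at u)"
    unfolding has_derivative_at_alt
  proof (intro conjI allI impI)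
    fix e :: real assume e: "e > 0"
    define e' where "e' = e / (K * (M + 1))"
    have e': "e' > 0" using e K M by (simp add: e'_def)
    obtain d1 where d1: "d1 > 0" "\<And>x. norm (x - u) < d1 \<Longrightarrow> norm (p x - p u) < e'"
      using p e' unfolding continuous_at_eps_delta dist_norm by metis
    obtain d2 where d2: "d2 > 0" "\<And>x. norm (x - u) < d2 \<Longrightarrow> norm (f x - f u - f' (x - u)) \<le> 1 * norm (x - u)"
      using f unfolding has_derivative_at_alt by (meson zero_less_one)
    have "norm (B (p x - p u) (f x) - B (p u - p u) (f u) - 0) \<le> e * norm (x - u)"
      if x: "norm (x - u) < min d1 d2" for x
    proof -
      have "norm (f x) \<le> norm (f x - f u - f' (x - u)) + norm (f' (x - u))"
        using norm_triangle_ineq[of "f x - f u - f' (x - u)" "f' (x - u)"] f0 by simp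
      also have "\<dots> \<le> (M + 1) * norm (x - u)" using d2(2)[of x] M(2)[of "x - u"] x by (simp add: algebra_simps)
      finally have fx: "norm (f x) \<le> (M + 1) * norm (x - u)" .
      have "norm (B (p x - p u) (f x)) \<le> norm (p x - p u) * norm (f x) * K" by (rule K)
      also have "\<dots> \<le> e' * ((M + 1) * norm (x - u)) * K"
        using d1(2)[of x] x fx K e' by (intro mult_right_mono mult_mono) auto
      also have "\<dots> = (e' * (K * (M + 1))) * norm (x - u)" by (simp only: ac_simps)
      also have "e' * (K * (M + 1)) = e" using K(1) M(1) by (simp add: e'_def add_pos_pos less_imp_neq[symmetric])
      finally show ?thesis by (simp add: f0 zero_right)
    qed
    then show "\<exists>d>0. \<forall>x. norm (x - u) < d \<longrightarrow>
        norm (B (p x - p u) (f x) - B (p u - p u) (f u) - 0) \<le> e * norm (x - u)"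
      using d1(1) d2(1) by (intro exI[of _ "min d1 d2"]) simp
  qed simp
  moreover have "((\<lambda>x. B (p u) (f x)) has_derivative (\<lambda>v. B (p u) (f' v))) (at u)"
    by (rule bounded_linear.has_derivative[OF bounded_linear_right f])
  ultimately have "((\<lambda>x. B (p x - p u) (f x) + B (p u) (f x)) has_derivative (\<lambda>v. 0 + B (p u) (f' v))) (at u)"
    by (rule has_derivative_add)
  then show ?thesis by (simp add: diff_left)
qed

lemma implicit_has_derivative:
  assumes Y: "isCont Y u" and Phi: "(\<Phi> has_derivative A) (at (Y u))"
    and R: "(R has_derivative R') (at u)"
    and eq: "open U" "u \<in> U" "\<And>x. x \<in> U \<Longrightarrow> \<Phi> (Y x) = R x"
    and B: "bounded_linear B" "\<And>w. B (A w) = w"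
  shows "(Y has_derivative (\<lambda>v. B (R' v))) (at u)"
proof -
  have R'bl: "bounded_linear R'" using R by (rule has_derivative_bounded_linear)
  have BR: "bounded_linear (\<lambda>v. B (R' v))" by (rule bounded_linear_compose[OF B(1) R'bl])
  obtain K where K: "K > 0" "\<And>w. norm (B w) \<le> norm w * K"
    using bounded_linear.pos_bounded[OF B(1)] by blast
  obtain M where M: "M > 0" "\<And>v. norm (B (R' v)) \<le> norm v * M"
    using bounded_linear.pos_bounded[OF BR] by blast
  have Bdiff: "B (x - y) = B x - B y" for x y
    using B(1) by (simp add: bounded_linear.linear linear_diff)
  show ?thesis unfolding has_derivative_at_alt
  proof (intro conjI allI impI BR)
    fix e :: real assume e: "e > 0"
    define e1 where "e1 = e / (2 * K)"
    define e2 where "e2 = min (1 / (2 * K)) (e / (4 * K * (M + e + 1)))"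
    have e1: "e1 > 0" and e2: "e2 > 0" using e K M by (auto simp: e1_def e2_def)
    obtain d1 where d1: "d1 > 0" "\<And>x. norm (x - u) < d1 \<Longrightarrow> norm (R x - R u - R' (x - u)) \<le> e1 * norm (x - u)"
      using R e1 unfolding has_derivative_at_alt by meson
    obtain d2 where d2: "d2 > 0" "\<And>y. norm (y - Y u) < d2 \<Longrightarrow> norm (\<Phi> y - \<Phi> (Y u) - A (y - Y u)) \<le> e2 * norm (y - Y u)"
      using Phi e2 unfolding has_derivative_at_alt by meson
    obtain d3 where d3: "d3 > 0" "\<And>x. norm (x - u) < d3 \<Longrightarrow> norm (Y x - Y u) < d2"
      using Y d2(1) unfolding continuous_at_eps_delta dist_norm by metis
    obtain d4 where d4: "d4 > 0" "\<And>x. norm (x - u) < d4 \<Longrightarrow> x \<in> U"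
      using eq(1,2) unfolding open_dist dist_norm by metis
    have "norm (Y x - Y u - B (R' (x - u))) \<le> e * norm (x - u)"
      if x: "norm (x - u) < min (min d1 d3) d4" for x
    proof -
      define dY where "dY = Y x - Y u"
      define r1 where "r1 = R x - R u - R' (x - u)"
      define r2 where "r2 = \<Phi> (Y x) - \<Phi> (Y u) - A dY"
      have r1: "norm r1 \<le> e1 * norm (x - u)" using d1(2) x by (simp add: r1_def)
      have r2: "norm r2 \<le> e2 * norm dY" using d2(2) d3(2) x by (simp add: r2_def dY_def)
      have "A dY = R' (x - u) + r1 - r2"
        using eq(3)[of x] eq(3)[of u] eq(2) d4(2)[of x] x by (simp add: r1_def r2_def)
      then have "dY = B (R' (x - u) + r1 - r2)" using B(2) by metis
      then have dY: "dY - B (R' (x - u)) = B r1 - B r2"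
        using B(1) by (simp add: bounded_linear.linear linear_diff linear_add)
      have n: "norm (dY - B (R' (x - u))) \<le> K * e1 * norm (x - u) + K * e2 * norm dY"
      proof -
        have "norm (B r1) \<le> e1 * norm (x - u) * K" "norm (B r2) \<le> e2 * norm dY * K"
          using K(2)[of r1] K(2)[of r2] mult_right_mono[OF r1, of K] mult_right_mono[OF r2, of K] K(1)
          by linarith+
        then show ?thesis unfolding dY using norm_triangle_ineq4[of "B r1" "B r2"]
          by (simp add: mult.commute mult.left_commute)
      qed
      have Ke2: "K * e2 \<le> 1 / 2" "K * e2 \<le> e / (4 * (M + e + 1))"
      proof -
        have "K * e2 \<le> K * (1 / (2 * K))" "K * e2 \<le> K * (e / (4 * K * (M + e + 1)))"
          unfolding e2_def using K(1) by (intro mult_left_mono; simp)+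
        then show "K * e2 \<le> 1 / 2" "K * e2 \<le> e / (4 * (M + e + 1))" using K(1) by auto
      qed
      have Ke1: "K * e1 = e / 2" using K(1) by (simp add: e1_def)
      have "norm dY \<le> norm (dY - B (R' (x - u))) + norm (B (R' (x - u)))"
        using norm_triangle_ineq[of "dY - B (R' (x - u))" "B (R' (x - u))"] by simp
      also have "\<dots> \<le> e / 2 * norm (x - u) + 1 / 2 * norm dY + M * norm (x - u)"
        using n Ke1 mult_right_mono[OF Ke2(1), of "norm dY"] M(2)[of "x - u"] by (simp add: mult.commute)
      finally have "norm dY \<le> 2 * (M + e + 1) * norm (x - u) - norm (x - u) * (e + 2)"
        by (simp add: algebra_simps)
      also have "\<dots> \<le> 2 * (M + e + 1) * norm (x - u)" using e by simp
      finally have dYn: "norm dY \<le> 2 * (M + e + 1) * norm (x - u)" .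
      have "K * e2 * norm dY \<le> e / (4 * (M + e + 1)) * (2 * (M + e + 1) * norm (x - u))"
        using Ke2(2) dYn e M by (intro mult_mono) auto
      also have "\<dots> = e / 2 * norm (x - u)"
      proof -
        have "M + e + 1 > 0" using M e by simp
        then show ?thesis by (simp add: field_simps)
      qed
      finally have "K * e2 * norm dY \<le> e / 2 * norm (x - u)" .
      then show ?thesis using n Ke1 by (simp add: dY_def)
    qed
    then show "\<exists>d>0. \<forall>x. norm (x - u) < d \<longrightarrow> norm (Y x - Y u - B (R' (x - u))) \<le> e * norm (x - u)"
      using d1(1) d3(1) d4(1) by (intro exI[of _ "min (min d1 d3) d4"]) simp
  qed
qed

lemma bounded_linear_left_inverse:
  fixes A :: "'b::euclidean_space \<Rightarrow> 'c::euclidean_space"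
  assumes "linear A" "inj A"
  obtains B where "bounded_linear B" "\<And>w. B (A w) = w"
proof -
  obtain B where "linear B" "B \<circ> A = id" using linear_injective_left_inverse[OF assms] by blast
  then show ?thesis using that[of B] by (auto simp: linear_conv_bounded_linear fun_eq_iff)
qed

lemma linear_system_solution_rearranged:
  fixes A :: "'a \<Rightarrow> 'b::euclidean_space \<Rightarrow> 'c::euclidean_space"
  assumes "linear (A u)" "linear (A u0)" "A u (q u) = c u"
  shows "A u0 (q u) = c u - (\<Sum>b\<in>Basis. (q u \<bullet> b) *\<^sub>R (A u b - A u0 b))"
  using linear_sum_Basis[OF assms(1), of "q u"] linear_sum_Basis[OF assms(2), of "q u"] assms(3)
  by (simp add: scaleR_diff_right sum_subtractf)

lemma isCont_linear_system_solution:
  fixes A :: "'a::real_normed_vector \<Rightarrow> 'b::euclidean_space \<Rightarrow> 'c::euclidean_space"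
  assumes S: "open S" "u0 \<in> S" and lin: "\<And>u. u \<in> S \<Longrightarrow> linear (A u)" and inj: "inj (A u0)"
    and A: "\<And>b. isCont (\<lambda>u. A u b) u0" and c: "isCont c u0"
    and q: "\<And>u. u \<in> S \<Longrightarrow> A u (q u) = c u"
  shows "isCont q u0"
proof -
  obtain B where B: "bounded_linear B" "\<And>w. B (A u0 w) = w"
    using bounded_linear_left_inverse[OF lin[OF S(2)] inj] by blast
  obtain K where K: "K > 0" "\<And>w. norm (B w) \<le> norm w * K"
    using bounded_linear.pos_bounded[OF B(1)] by blast
  define \<delta> where "\<delta> u = (\<Sum>b\<in>Basis. norm (A u b - A u0 b))" for u
  have d: "(\<delta> \<longlongrightarrow> 0) (at u0)"
  proof -
    have "(\<delta> \<longlongrightarrow> (\<Sum>b\<in>(Basis :: 'b set). norm (A u0 b - A u0 b))) (at u0)"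
      unfolding \<delta>_def using A by (intro tendsto_intros) (simp add: isCont_def)
    then show ?thesis by simp
  qed
  have n: "((\<lambda>u. norm (c u - c u0)) \<longlongrightarrow> 0) (at u0)"
    using c by (intro tendsto_norm_zero) (simp add: isCont_def LIM_zero)
  have small: "\<forall>\<^sub>F u in at u0. K * \<delta> u < 1 / 2"
  proof -
    have "((\<lambda>u. K * \<delta> u) \<longlongrightarrow> K * 0) (at u0)" by (intro tendsto_intros d)
    then show ?thesis by (rule order_tendstoD) simp
  qed
  have inS: "\<forall>\<^sub>F u in at u0. u \<in> S" using S by (rule eventually_at_in_open')
  have "\<forall>\<^sub>F u in at u0. norm (q u - q u0) \<le> 2 * K * (norm (c u - c u0) + \<delta> u * norm (q u0))"
    using small inS
  proof eventually_elim
    case (elim u)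
    have "B (A u0 (q u) - A u0 (q u0)) = B (A u0 (q u - q u0))"
      using lin[OF S(2)] by (simp add: linear_diff)
    then have "q u - q u0 = B (A u0 (q u) - A u0 (q u0))" using B(2) by simp
    also have "A u0 (q u) = c u - (\<Sum>b\<in>Basis. (q u \<bullet> b) *\<^sub>R (A u b - A u0 b))"
      by (rule linear_system_solution_rearranged) (use lin S q elim in auto)
    also have "A u0 (q u0) = c u0" using q S by blast
    finally have "q u - q u0 = B (c u - c u0 - (\<Sum>b\<in>Basis. (q u \<bullet> b) *\<^sub>R (A u b - A u0 b)))"
      by (simp add: algebra_simps)
    then have "norm (q u - q u0) \<le> norm (c u - c u0 - (\<Sum>b\<in>Basis. (q u \<bullet> b) *\<^sub>R (A u b - A u0 b))) * K"
      using K(2) by metis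
    also have "\<dots> \<le> (norm (c u - c u0) + norm (\<Sum>b\<in>Basis. (q u \<bullet> b) *\<^sub>R (A u b - A u0 b))) * K"
      using K(1) by (intro mult_right_mono norm_triangle_ineq4) auto
    also have "norm (\<Sum>b\<in>Basis. (q u \<bullet> b) *\<^sub>R (A u b - A u0 b)) \<le> (\<Sum>b\<in>Basis. norm (q u) * norm (A u b - A u0 b))"
      by (intro sum_norm_le) (simp add: Basis_le_norm mult_right_mono)
    also have "\<dots> = norm (q u) * \<delta> u" by (simp add: \<delta>_def sum_distrib_left)
    also have "\<dots> \<le> (norm (q u0) + norm (q u - q u0)) * \<delta> u"
      by (intro mult_right_mono) (auto simp: \<delta>_def norm_triangle_sub intro: sum_nonneg)
    finally have "norm (q u - q u0) \<le> K * (norm (c u - c u0) + norm (q u0) * \<delta> u) + (K * \<delta> u) * norm (q u - q u0)"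
      using K(1) by (simp add: algebra_simps)
    also have "\<dots> \<le> K * (norm (c u - c u0) + norm (q u0) * \<delta> u) + (1 / 2) * norm (q u - q u0)"
      using elim by (intro add_left_mono mult_right_mono) auto
    finally show ?case by (simp add: algebra_simps)
  qed
  moreover have "((\<lambda>u. 2 * K * (norm (c u - c u0) + \<delta> u * norm (q u0))) \<longlongrightarrow> 2 * K * (0 + 0 * norm (q u0))) (at u0)"
    by (intro tendsto_mult tendsto_add tendsto_const d n)
  ultimately have "((\<lambda>u. q u - q u0) \<longlongrightarrow> 0) (at u0)"
    by (intro Lim_null_comparison[of "\<lambda>u. q u - q u0"]) simp_all
  then show ?thesis by (simp add: isCont_def LIM_zero_cancel)
qed

lemma has_derivative_linear_system_solution:
  fixes A :: "'a::real_normed_vector \<Rightarrow> 'b::euclidean_space \<Rightarrow> 'c::euclidean_space"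
  assumes S: "open S" "u0 \<in> S" and lin: "\<And>u. u \<in> S \<Longrightarrow> linear (A u)" and inj: "inj (A u0)"
    and A: "\<And>b. ((\<lambda>u. A u b) has_derivative A' b) (at u0)" and c: "(c has_derivative c') (at u0)"
    and q: "\<And>u. u \<in> S \<Longrightarrow> A u (q u) = c u"
  obtains q' where "(q has_derivative q') (at u0)"
    "\<And>v. A u0 (q' v) = c' v - (\<Sum>b\<in>Basis. (q u0 \<bullet> b) *\<^sub>R A' b v)"
proof -
  have qc: "isCont q u0"
    by (rule isCont_linear_system_solution[where A=A and c=c and S=S])
       (use S lin inj q has_derivative_continuous[OF A] has_derivative_continuous[OF c] in auto)
  obtain B where B: "bounded_linear B" "\<And>w. B (A u0 w) = w"
    using bounded_linear_left_inverse[OF lin[OF S(2)] inj] by blast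
  define r where "r u = c u - (\<Sum>b\<in>Basis. (q u \<bullet> b) *\<^sub>R (A u b - A u0 b))" for u
  define r' where "r' v = c' v - (\<Sum>b\<in>Basis. (q u0 \<bullet> b) *\<^sub>R A' b v)" for v
  have r: "(r has_derivative r') (at u0)"
    unfolding r_def[abs_def] r'_def[abs_def]
  proof (intro has_derivative_diff c has_derivative_sum)
    fix b :: 'b assume "b \<in> Basis"
    have "((\<lambda>u. A u b - A u0 b) has_derivative (\<lambda>v. A' b v - 0)) (at u0)"
      by (intro has_derivative_diff A has_derivative_const)
    then show "((\<lambda>x. (q x \<bullet> b) *\<^sub>R (A x b - A u0 b)) has_derivative (\<lambda>x. (q u0 \<bullet> b) *\<^sub>R A' b x)) (at u0)"
      using has_derivative_bilinear_vanishing[where p="\<lambda>x. q x \<bullet> b" and u=u0 and f="\<lambda>u. A u b - A u0 b" and f'="A' b",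
          OF bounded_bilinear_scaleR] qc by simp
  qed
  have eq: "A u0 (q u) = r u" if "u \<in> S" for u
    unfolding r_def by (rule linear_system_solution_rearranged) (use lin S q that in auto)
  have qB: "((\<lambda>u. B (r u)) has_derivative (\<lambda>v. B (r' v))) (at u0)"
    by (rule bounded_linear.has_derivative[OF B(1) r])
  have q': "(q has_derivative (\<lambda>v. B (r' v))) (at u0)"
    by (rule has_derivative_transform_within_open[OF qB S]) (use eq B in metis)
  have "bounded_linear (A u0)" using lin[OF S(2)] by (simp add: linear_conv_bounded_linear)
  from bounded_linear.has_derivative[OF this q']
  have "((\<lambda>u. A u0 (q u)) has_derivative (\<lambda>v. A u0 (B (r' v)))) (at u0)" .
  moreover have "((\<lambda>u. A u0 (q u)) has_derivative r') (at u0)"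
    by (rule has_derivative_transform_within_open[OF r S]) (simp add: eq)
  ultimately have "(\<lambda>v. A u0 (B (r' v))) = r'" by (rule has_derivative_unique)
  then have "A u0 (B (r' v)) = c' v - (\<Sum>b\<in>Basis. (q u0 \<bullet> b) *\<^sub>R A' b v)" for v
    by (metis r'_def)
  with q' show ?thesis by (rule that)
qed

lemma C_k_on_linear_system_solution:
  fixes A :: "'a::real_normed_vector \<Rightarrow> 'b::euclidean_space \<Rightarrow> 'c::euclidean_space"
  assumes S: "open S" and lin: "\<And>u. u \<in> S \<Longrightarrow> linear (A u)" and inj: "\<And>u. u \<in> S \<Longrightarrow> inj (A u)"
    and A: "\<And>b. C_k_on k S (\<lambda>u. A u b)" and c: "C_k_on k S c"
    and q: "\<And>u. u \<in> S \<Longrightarrow> A u (q u) = c u"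
  shows "C_k_on k S q"
  using A c q
proof (induction k arbitrary: c q)
  case 0
  have "isCont q u" if "u \<in> S" for u
    by (rule isCont_linear_system_solution[where A=A and c=c and S=S])
       (use 0 S that lin inj in \<open>auto simp: continuous_on_eq_continuous_at\<close>)
  then show ?case by (simp add: continuous_at_imp_continuous_on)
next
  case (Suc k)
  let ?A' = "\<lambda>u b. frechet_derivative (\<lambda>u. A u b) (at u)" and ?c' = "\<lambda>u. frechet_derivative c (at u)"
  have "\<forall>u\<in>S. \<exists>q'. (q has_derivative q') (at u) \<and>
      (\<forall>v. A u (q' v) = ?c' u v - (\<Sum>b\<in>Basis. (q u \<bullet> b) *\<^sub>R ?A' u b v))"
  proof
    fix u assume u: "u \<in> S"
    have "((\<lambda>u. A u b) has_derivative ?A' u b) (at u)" "(c has_derivative ?c' u) (at u)" for b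
      using Suc.prems(1)[of b] Suc.prems(2) u by (auto simp: frechet_derivative_works[symmetric])
    then obtain q' where "(q has_derivative q') (at u)"
        "\<And>v. A u (q' v) = ?c' u v - (\<Sum>b\<in>Basis. (q u \<bullet> b) *\<^sub>R ?A' u b v)"
      using has_derivative_linear_system_solution[where A=A and c=c and S=S and q=q and A'="?A' u" and c'="?c' u",
          OF S u lin inj[OF u] _ _ Suc.prems(3)] by blast
    then show "\<exists>q'. (q has_derivative q') (at u) \<and>
      (\<forall>v. A u (q' v) = ?c' u v - (\<Sum>b\<in>Basis. (q u \<bullet> b) *\<^sub>R ?A' u b v))" by blast
  qed
  from bchoice[OF this] obtain q' where q': "\<And>u. u \<in> S \<Longrightarrow> (q has_derivative q' u) (at u)"
    and Aq': "\<And>u v. u \<in> S \<Longrightarrow> A u (q' u v) = ?c' u v - (\<Sum>b\<in>Basis. (q u \<bullet> b) *\<^sub>R ?A' u b v)"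
    by blast
  have Ck: "C_k_on k S (\<lambda>u. A u b)" "C_k_on k S c" for b
    by (rule C_k_on_Suc_imp, rule Suc.prems)+
  have qk: "C_k_on k S q" by (rule Suc.IH[OF Ck Suc.prems(3)])
  show ?case
  proof (rule C_k_on_SucI[OF S q'])
    fix v
    have "C_k_on k S (\<lambda>u. - ((q u \<bullet> b) *\<^sub>R ?A' u b v))" for b
      using Suc.prems(1)[of b]
      by (intro C_k_on_linear[OF bounded_linear_minus[OF bounded_linear_ident]]
          C_k_on_bilinear[OF bounded_bilinear_scaleR] C_k_on_linear[OF bounded_linear_inner_left] qk S) auto
    then have "C_k_on k S (\<lambda>u. ?c' u v + (\<Sum>b\<in>Basis. - ((q u \<bullet> b) *\<^sub>R ?A' u b v)))"
      using Suc.prems(2) by (intro C_k_on_add C_k_on_sum S) auto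
    then have "C_k_on k S (\<lambda>u. ?c' u v - (\<Sum>b\<in>Basis. (q u \<bullet> b) *\<^sub>R ?A' u b v))"
      by (simp add: sum_negf)
    then show "C_k_on k S (\<lambda>u. q' u v)"
      by (rule Suc.IH[where c="\<lambda>u. ?c' u v - (\<Sum>b\<in>Basis. (q u \<bullet> b) *\<^sub>R ?A' u b v)", OF Ck(1)]) (rule Aq')
  qed
qed

text \<open>The solution is assumed to be continuous, so that the implicit function theorem reduces to
  implicit differentiation.\<close>

theorem smooth_on_implicit:
  fixes Y :: "'a::real_normed_vector \<Rightarrow> 'b::euclidean_space" and \<Phi> :: "'b \<Rightarrow> 'c::euclidean_space"
  assumes U: "open U" and Y: "continuous_on U Y" and \<Phi>: "smooth_on T \<Phi>" and YT: "Y ` U \<subseteq> T"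
    and R: "smooth_on U R" and eq: "\<And>u. u \<in> U \<Longrightarrow> \<Phi> (Y u) = R u"
    and inj: "\<And>u. u \<in> U \<Longrightarrow> inj (frechet_derivative \<Phi> (at (Y u)))"
  shows "smooth_on U Y"
  unfolding smooth_on_def
proof
  fix k
  let ?A = "\<lambda>u. frechet_derivative \<Phi> (at (Y u))" and ?R' = "\<lambda>u. frechet_derivative R (at u)"
  have Phi': "(\<Phi> has_derivative ?A u) (at (Y u))" if "u \<in> U" for u
    using smooth_on_has_derivative[OF \<Phi>] YT that by blast
  have R': "(R has_derivative ?R' u) (at u)" if "u \<in> U" for u
    using smooth_on_has_derivative[OF R that] .
  have linA: "linear (?A u)" if "u \<in> U" for u
    using Phi'[OF that] by (rule has_derivative_linear)
  have "\<forall>u\<in>U. \<exists>Y'. (Y has_derivative Y') (at u) \<and> (\<forall>v. ?A u (Y' v) = ?R' u v)"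
  proof
    fix u assume u: "u \<in> U"
    obtain B where "bounded_linear B" "\<And>w. B (?A u w) = w"
      using bounded_linear_left_inverse[OF linA[OF u] inj[OF u]] by blast
    then have Y': "(Y has_derivative (\<lambda>v. B (?R' u v))) (at u)"
      using Y U u eq Phi'[OF u] R'[OF u]
      by (intro implicit_has_derivative[where \<Phi>=\<Phi> and R=R and U=U and A="?A u"])
        (auto simp: continuous_on_eq_continuous_at)
    have "((\<lambda>u. \<Phi> (Y u)) has_derivative (\<lambda>v. ?A u (B (?R' u v)))) (at u)"
      using diff_chain_at[OF Y' Phi'[OF u]] by (simp add: o_def)
    moreover have "((\<lambda>u. \<Phi> (Y u)) has_derivative ?R' u) (at u)"
      by (rule has_derivative_transform_within_open[OF R'[OF u] U u]) (simp add: eq)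
    ultimately have "(\<lambda>v. ?A u (B (?R' u v))) = ?R' u" by (rule has_derivative_unique)
    then have "\<forall>v. ?A u (B (?R' u v)) = ?R' u v" by (simp add: fun_eq_iff)
    with Y' show "\<exists>Y'. (Y has_derivative Y') (at u) \<and> (\<forall>v. ?A u (Y' v) = ?R' u v)" by blast
  qed
  from bchoice[OF this] obtain Y' where Y': "\<And>u. u \<in> U \<Longrightarrow> (Y has_derivative Y' u) (at u)"
    and AY': "\<And>u v. u \<in> U \<Longrightarrow> ?A u (Y' u v) = ?R' u v"
    by blast
  show "C_k_on k U Y"
  proof (induction k)
    case 0
    then show ?case using Y by simp
  next
    case (Suc k)
    show ?case
    proof (rule C_k_on_SucI[OF U Y'])
      fix v
      show "C_k_on k U (\<lambda>u. Y' u v)"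
      proof (rule C_k_on_linear_system_solution[where A="?A" and c="\<lambda>u. ?R' u v", OF U linA inj _ _ AY'])
        show "C_k_on k U (\<lambda>u. ?A u b)" for b
          by (rule C_k_on_compose[where g="\<lambda>y. frechet_derivative \<Phi> (at y) b", OF Suc _ U YT])
             (use smooth_on_frechet_derivative[OF \<Phi>, of b] in \<open>simp add: smooth_on_def\<close>)
        show "C_k_on k U (\<lambda>u. ?R' u v)"
          using smooth_on_frechet_derivative[OF R, of v] by (simp add: smooth_on_def)
      qed
    qed
  qed
qed

section \<open>Lebesgue measure of polytopes\<close>

subsection \<open>Coordinates\<close>

text \<open>The change of variables formula of the library is about \<open>real ^ 'n\<close> for a well-ordered finite
  index type \<open>'n\<close>; the type of basis vectors provides such an index type for any Euclidean space.\<close>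

typedef (overloaded) 'a basis_ix = "Basis :: 'a::euclidean_space set"
  morphisms basis_vec Basis_ix using SOME_Basis by blast

instance basis_ix :: (euclidean_space) finite
proof
  show "finite (UNIV :: 'a basis_ix set)"
    by (metis finite_Basis finite_imageI type_definition.Abs_image type_definition_basis_ix)
qed

instantiation basis_ix :: (euclidean_space) wellorder
begin

definition basis_enum :: "'a basis_ix \<Rightarrow> nat" where
  "basis_enum = (SOME f. inj f)"

definition less_eq_basis_ix :: "'a basis_ix \<Rightarrow> 'a basis_ix \<Rightarrow> bool" where
  "i \<le> j \<longleftrightarrow> basis_enum i \<le> basis_enum j"

definition less_basis_ix :: "'a basis_ix \<Rightarrow> 'a basis_ix \<Rightarrow> bool" where
  "i < j \<longleftrightarrow> basis_enum i < basis_enum j"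

instance
proof
  have "\<exists>f :: 'a basis_ix \<Rightarrow> nat. inj f"
    using finite_imp_inj_to_nat_seg[of "UNIV :: 'a basis_ix set"] by auto
  then have inj: "inj (basis_enum :: 'a basis_ix \<Rightarrow> nat)"
    unfolding basis_enum_def by (rule someI_ex)
  fix i j k :: "'a basis_ix"
  show "i < j \<longleftrightarrow> i \<le> j \<and> \<not> j \<le> i" "i \<le> i" "i \<le> j \<Longrightarrow> j \<le> k \<Longrightarrow> i \<le> k" "i \<le> j \<or> j \<le> i"
    by (auto simp: less_basis_ix_def less_eq_basis_ix_def)
  show "i \<le> j \<Longrightarrow> j \<le> i \<Longrightarrow> i = j"
    using inj by (auto simp: less_eq_basis_ix_def inj_def)
  fix P assume *: "\<And>x. (\<And>y :: 'a basis_ix. y < x \<Longrightarrow> P y) \<Longrightarrow> P x"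
  show "P i"
  proof (induction i rule: measure_induct_rule[of basis_enum])
    case (less x)
    show ?case by (rule *, rule less.IH) (simp add: less_basis_ix_def)
  qed
qed

end

definition coords :: "'a::euclidean_space \<Rightarrow> real ^ 'a basis_ix" where
  "coords x = (\<chi> i. x \<bullet> basis_vec i)"

definition of_coords :: "real ^ 'a basis_ix \<Rightarrow> 'a::euclidean_space" where
  "of_coords y = (\<Sum>i\<in>UNIV. (y $ i) *\<^sub>R basis_vec i)"

lemma sum_basis_ix: "(\<Sum>i\<in>UNIV. f (basis_vec i)) = (\<Sum>b\<in>(Basis :: 'a::euclidean_space set). f b)"
  by (rule sum.reindex_bij_betw[of basis_vec])
     (metis bij_betw_imageI basis_vec_inject inj_onI type_definition.Rep_range type_definition_basis_ix)

lemma of_coords_coords [simp]: "of_coords (coords x) = x"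
  by (simp add: of_coords_def coords_def sum_basis_ix[where f="\<lambda>b. (x \<bullet> b) *\<^sub>R b"] euclidean_representation)

lemma inner_basis_vec: "basis_vec i \<bullet> basis_vec j = (if i = j then 1 else 0)"
  using basis_vec[of i] basis_vec[of j] by (auto simp: inner_Basis basis_vec_inject)

lemma coords_of_coords [simp]: "coords (of_coords y) = y"
  by (simp add: of_coords_def coords_def vec_eq_iff inner_sum_left inner_basis_vec
      if_distrib[where f="\<lambda>x. _ * x"] cong: if_cong)

lemma linear_coords: "linear coords"
  by (rule linearI) (simp_all add: coords_def vec_eq_iff inner_add_left)

lemma linear_of_coords: "linear of_coords"
  by (rule linearI) (simp_all add: of_coords_def scaleR_add_left sum.distrib scaleR_sum_right)

lemma inj_coords: "inj coords"
  by (metis injI of_coords_coords)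

lemma surj_coords: "surj coords"
  by (metis surjI coords_of_coords)

lemma distr_lborel_coords: "distr lborel borel (coords :: 'a::euclidean_space \<Rightarrow> _) = lborel"
proof (rule lborel_eqI[symmetric])
  have m: "(coords :: 'a \<Rightarrow> _) \<in> borel_measurable borel"
    by (intro borel_measurable_continuous_onI linear_continuous_on)
       (simp add: linear_conv_bounded_linear[symmetric] linear_coords)
  fix l u :: "real ^ 'a basis_ix"
  assume le: "\<And>b. b \<in> Basis \<Longrightarrow> l \<bullet> b \<le> u \<bullet> b"
  have comp: "of_coords y \<bullet> b = y $ Basis_ix b" if "b \<in> Basis" for y :: "real ^ 'a basis_ix" and b
  proof -
    have "coords (of_coords y) $ Basis_ix b = of_coords y \<bullet> b"
      using that by (simp add: coords_def Basis_ix_inverse del: coords_of_coords)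
    then show ?thesis by simp
  qed
  have "coords x \<in> box l u \<longleftrightarrow> x \<in> box (of_coords l) (of_coords u)" for x :: 'a
  proof -
    have "(\<forall>b\<in>Basis. l $ Basis_ix b < x \<bullet> b \<and> x \<bullet> b < u $ Basis_ix b) \<longleftrightarrow>
          (\<forall>i. l $ i < x \<bullet> basis_vec i \<and> x \<bullet> basis_vec i < u $ i)"
      by (metis Basis_ix_inverse basis_vec basis_vec_inverse)
    then show ?thesis by (simp add: mem_box_cart(1) mem_box(1)[of x] comp coords_def)
  qed
  then have "coords -` box l u = box (of_coords l) (of_coords u :: 'a)" by auto
  then have "emeasure (distr lborel borel coords) (box l u) = emeasure lborel (box (of_coords l) (of_coords u :: 'a))"
    using m by (simp add: emeasure_distr)
  also have "\<dots> = (\<Prod>b\<in>Basis. (of_coords u - of_coords l :: 'a) \<bullet> b)"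
  proof (rule emeasure_lborel_box)
    fix b :: 'a assume b: "b \<in> Basis"
    have "axis (Basis_ix b) 1 \<in> (Basis :: (real ^ 'a basis_ix) set)" by (simp add: axis_in_Basis_iff)
    from le[OF this] show "of_coords l \<bullet> b \<le> of_coords u \<bullet> b" by (simp add: comp b inner_axis)
  qed
  also have "(\<Prod>b\<in>Basis. (of_coords u - of_coords l :: 'a) \<bullet> b) = (\<Prod>b\<in>(Basis :: 'a set). (u - l) $ Basis_ix b)"
    by (rule prod.cong) (simp_all add: inner_diff_left comp)
  also have "\<dots> = (\<Prod>i\<in>UNIV. (u - l) $ i)"
    by (rule prod.reindex_bij_betw[of Basis_ix])
       (metis bij_betw_imageI Basis_ix_inject inj_onI type_definition.Abs_image type_definition_basis_ix)
  also have "\<dots> = (\<Prod>b\<in>Basis. (u - l) \<bullet> b)"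
  proof -
    have "(\<Prod>b\<in>(\<lambda>i. axis i 1) ` UNIV. (u - l) \<bullet> b) = (\<Prod>i\<in>UNIV. (u - l) $ i)"
      by (subst prod.reindex) (auto simp: inj_on_def axis_eq_axis inner_axis)
    moreover have "(Basis :: (real ^ 'a basis_ix) set) = (\<lambda>i. axis i 1) ` UNIV"
      by (auto simp: Basis_vec_def)
    ultimately show ?thesis by simp
  qed
  finally show "emeasure (distr lborel borel coords) (box l u) = (\<Prod>b\<in>Basis. (u - l) \<bullet> b)" .
qed simp

lemma measure_coords_image:
  fixes K :: "'a::euclidean_space set"
  assumes "compact K"
  shows "measure lebesgue (coords ` K) = measure lborel K"
proof -
  have bl: "bounded_linear (coords :: 'a \<Rightarrow> _)"
    by (simp add: linear_conv_bounded_linear[symmetric] linear_coords)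
  then have m: "(coords :: 'a \<Rightarrow> _) \<in> borel_measurable borel"
    by (intro borel_measurable_continuous_onI linear_continuous_on)
  have c: "compact (coords ` K)"
    by (intro compact_continuous_image assms linear_continuous_on bl)
  then have b: "coords ` K \<in> sets borel" by (intro borel_closed compact_imp_closed)
  have "measure lborel (coords ` K) = measure (distr lborel borel coords) (coords ` K)"
    by (simp add: distr_lborel_coords)
  also have "\<dots> = measure lborel (coords -` coords ` K)"
    using m b by (simp add: measure_distr)
  also have "coords -` coords ` K = K" by (rule inj_vimage_image_eq[OF inj_coords])
  finally show ?thesis using b by simp
qed

subsection \<open>The gradient of log-sum-exp\<close>

definition expsum :: "'a::euclidean_space set \<Rightarrow> 'a \<Rightarrow> real" where
  "expsum F x = (\<Sum>v\<in>F. exp (x \<bullet> v))"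

definition lse_grad :: "'a::euclidean_space set \<Rightarrow> 'a \<Rightarrow> 'a" where
  "lse_grad F x = (\<Sum>v\<in>F. (exp (x \<bullet> v) / expsum F x) *\<^sub>R v)"

definition lse_hess :: "'a::euclidean_space set \<Rightarrow> 'a \<Rightarrow> 'a \<Rightarrow> 'a" where
  "lse_hess F x u = (\<Sum>v\<in>F. (exp (x \<bullet> v) / expsum F x * ((v - lse_grad F x) \<bullet> u)) *\<^sub>R v)"

context
  fixes F :: "'a::euclidean_space set"
  assumes F: "finite F" "F \<noteq> {}"
begin

lemma expsum_pos: "expsum F x > 0"
  unfolding expsum_def using F by (intro sum_pos) auto

lemma expsum_weights: "(\<Sum>v\<in>F. exp (x \<bullet> v) / expsum F x) = 1"
  using expsum_pos[of x] by (simp add: sum_divide_distrib[symmetric] expsum_def)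

lemma lse_grad_in_hull: "lse_grad F x \<in> convex hull F"
  unfolding lse_grad_def
  by (rule convex_sum) (use F expsum_pos[of x] expsum_weights[of x] in \<open>auto simp: hull_inc less_imp_le\<close>)

lemma expsum_has_derivative:
  "(expsum F has_derivative (\<lambda>u. \<Sum>v\<in>F. exp (x \<bullet> v) * (u \<bullet> v))) (at x)"
  unfolding expsum_def by (auto intro!: derivative_eq_intros simp: mult.commute)

lemma lse_grad_inner: "lse_grad F x \<bullet> u = (\<Sum>v\<in>F. exp (x \<bullet> v) * (u \<bullet> v)) / expsum F x"
  unfolding lse_grad_def inner_sum_left sum_divide_distrib
  by (rule sum.cong) (simp_all add: inner_commute)

lemma ln_expsum_has_derivative:
  "((\<lambda>x. ln (expsum F x)) has_derivative (\<lambda>u. lse_grad F x \<bullet> u)) (at x)"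
proof -
  have "((\<lambda>x. ln (expsum F x)) has_derivative (\<lambda>u. (1 / expsum F x) * (\<Sum>v\<in>F. exp (x \<bullet> v) * (u \<bullet> v)))) (at x)"
    using expsum_pos[of x] by (auto intro!: derivative_eq_intros expsum_has_derivative simp: field_simps)
  then show ?thesis
    by (simp add: lse_grad_inner)
qed

lemma lse_grad_has_derivative: "(lse_grad F has_derivative lse_hess F x) (at x)"
proof -
  let ?Z = "expsum F" and ?Z' = "\<lambda>u. \<Sum>v\<in>F. exp (x \<bullet> v) * (u \<bullet> v)"
  have Z: "?Z x \<noteq> 0" using expsum_pos[of x] by simp
  have Z': "?Z' u / ?Z x = lse_grad F x \<bullet> u" for u
    by (simp add: lse_grad_inner)
  have "((\<lambda>x. exp (x \<bullet> v) / ?Z x) has_derivative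
      (\<lambda>u. exp (x \<bullet> v) / ?Z x * ((v - lse_grad F x) \<bullet> u))) (at x)" for v
  proof -
    have "((\<lambda>x. exp (x \<bullet> v) / ?Z x) has_derivative
      (\<lambda>u. - exp (x \<bullet> v) * (inverse (?Z x) * ?Z' u * inverse (?Z x)) + (exp (x \<bullet> v) * (u \<bullet> v)) / ?Z x)) (at x)"
    proof (rule has_derivative_divide[OF _ expsum_has_derivative Z])
      show "((\<lambda>x. exp (x \<bullet> v)) has_derivative (\<lambda>u. exp (x \<bullet> v) * (u \<bullet> v))) (at x)"
        by (auto intro!: derivative_eq_intros simp: mult.commute)
    qed
    moreover have "- exp (x \<bullet> v) * (inverse (?Z x) * ?Z' u * inverse (?Z x)) + (exp (x \<bullet> v) * (u \<bullet> v)) / ?Z x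
       = exp (x \<bullet> v) / ?Z x * ((v - lse_grad F x) \<bullet> u)" for u
    proof -
      have "- exp (x \<bullet> v) * (inverse (?Z x) * ?Z' u * inverse (?Z x)) = - (exp (x \<bullet> v) / ?Z x) * (?Z' u / ?Z x)"
        by (simp add: divide_inverse)
      then show ?thesis unfolding Z' by (simp add: inner_diff_left inner_commute algebra_simps)
    qed
    ultimately show ?thesis by simp
  qed
  then have "((\<lambda>x. \<Sum>v\<in>F. (exp (x \<bullet> v) / expsum F x) *\<^sub>R v) has_derivative
      (\<lambda>u. \<Sum>v\<in>F. (exp (x \<bullet> v) / expsum F x * ((v - lse_grad F x) \<bullet> u)) *\<^sub>R v)) (at x)"
    by (intro has_derivative_sum has_derivative_scaleR_left)
  then show ?thesis by (simp only: lse_grad_def[symmetric] lse_hess_def[symmetric])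
qed

lemma lse_hess_inner:
  "u \<bullet> lse_hess F x u = (\<Sum>v\<in>F. exp (x \<bullet> v) / expsum F x * ((v - lse_grad F x) \<bullet> u)\<^sup>2)"
proof -
  let ?p = "\<lambda>v. exp (x \<bullet> v) / expsum F x" and ?T = "lse_grad F x"
  have "(\<Sum>v\<in>F. ?p v * ((v - ?T) \<bullet> u)) = (\<Sum>v\<in>F. ?p v * (v \<bullet> u)) - (\<Sum>v\<in>F. ?p v) * (?T \<bullet> u)"
    by (simp only: inner_diff_left right_diff_distrib sum_subtractf sum_distrib_right)
  moreover have "?T \<bullet> u = (\<Sum>v\<in>F. ?p v * (v \<bullet> u))" by (simp add: lse_grad_def inner_sum_left)
  ultimately have 0: "(\<Sum>v\<in>F. ?p v * ((v - ?T) \<bullet> u)) = 0" by (simp add: expsum_weights)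
  have "(\<Sum>v\<in>F. ?p v * ((v - ?T) \<bullet> u)\<^sup>2)
      = (\<Sum>v\<in>F. ?p v * ((v - ?T) \<bullet> u) * (v \<bullet> u)) - (\<Sum>v\<in>F. ?p v * ((v - ?T) \<bullet> u)) * (?T \<bullet> u)"
    by (simp only: power2_eq_square inner_diff_left right_diff_distrib left_diff_distrib sum_subtractf
        sum_distrib_right mult.assoc)
  also have "\<dots> = u \<bullet> lse_hess F x u"
    unfolding 0 by (simp add: lse_hess_def inner_sum_right inner_commute[of u])
  finally show ?thesis by simp
qed

lemma lse_hess_nonneg: "u \<bullet> lse_hess F x u \<ge> 0"
  unfolding lse_hess_inner using expsum_pos[of x] by (intro sum_nonneg) simp

lemma lse_hess_pos:
  assumes int: "interior (convex hull F) \<noteq> {}" and u: "u \<noteq> 0"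
  shows "u \<bullet> lse_hess F x u > 0"
proof (rule ccontr)
  assume "\<not> ?thesis"
  then have "(\<Sum>v\<in>F. exp (x \<bullet> v) / expsum F x * ((v - lse_grad F x) \<bullet> u)\<^sup>2) = 0"
    using lse_hess_nonneg[of u x] lse_hess_inner[of u x] by linarith
  then have "\<forall>v\<in>F. (v - lse_grad F x) \<bullet> u = 0"
    using F expsum_pos[of x] by (subst (asm) sum_nonneg_eq_0_iff) (auto simp: less_imp_neq[symmetric])
  then have "F \<subseteq> {v. u \<bullet> v = u \<bullet> lse_grad F x}" by (auto simp: inner_diff_left inner_commute[of u])
  then have "convex hull F \<subseteq> {v. u \<bullet> v = u \<bullet> lse_grad F x}"
    by (intro hull_minimal) (simp_all add: convex_hyperplane)
  then have "interior (convex hull F) \<subseteq> interior {v. u \<bullet> v = u \<bullet> lse_grad F x}" by (rule interior_mono)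
  then show False using int interior_hyperplane[OF u] by auto
qed

lemma inner_le_ln_expsum:
  assumes "y \<in> convex hull F"
  shows "x \<bullet> y \<le> ln (expsum F x)"
proof -
  have "F \<subseteq> {y. x \<bullet> y \<le> ln (expsum F x)}"
  proof
    fix v assume "v \<in> F"
    then have "exp (x \<bullet> v) \<le> expsum F x"
      unfolding expsum_def by (intro member_le_sum) (use F in auto)
    then show "v \<in> {y. x \<bullet> y \<le> ln (expsum F x)}" using expsum_pos[of x] by (simp add: ln_ge_iff)
  qed
  then have "convex hull F \<subseteq> {y. x \<bullet> y \<le> ln (expsum F x)}"
    by (intro hull_minimal) (simp_all add: convex_halfspace_le)
  then show ?thesis using assms by auto
qed

end

subsection \<open>Volume as an integral of determinants\<close>

lemma det_matrix_pos:
  fixes L :: "real ^ 'n \<Rightarrow> real ^ 'n::finite"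
  assumes L: "linear L" and pos: "\<And>u. u \<noteq> 0 \<Longrightarrow> u \<bullet> L u > 0"
  shows "det (matrix L) > 0"
proof (rule ccontr)
  assume neg: "\<not> ?thesis"
  define M where "M s u = (1 - s) *\<^sub>R u + s *\<^sub>R L u" for s :: real and u
  have linM: "linear (M s)" for s
    using L by (intro linearI) (simp_all add: M_def linear_add linear_scale algebra_simps)
  have detM: "det (matrix (M s)) \<noteq> 0" if "0 \<le> s" "s \<le> 1" for s
  proof -
    have "u = 0" if "M s u = 0" for u
    proof (rule ccontr)
      assume u: "u \<noteq> 0"
      have "u \<bullet> M s u = (1 - s) * (u \<bullet> u) + s * (u \<bullet> L u)" by (simp add: M_def inner_add_right)
      moreover have "u \<bullet> u > 0" "u \<bullet> L u > 0" using u pos by auto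
      ultimately have "u \<bullet> M s u > 0"
        using \<open>0 \<le> s\<close> \<open>s \<le> 1\<close>
        by (cases "s = 0") (auto intro!: add_nonneg_pos mult_pos_pos mult_nonneg_nonneg)
      then show False using that by simp
    qed
    then have "inj (M s)" using linM linear_injective_0 by blast
    then show ?thesis using det_nz_iff_inj[OF linM] by blast
  qed
  have mM: "matrix (M s) = (1 - s) *\<^sub>R mat 1 + s *\<^sub>R matrix L" for s
    by (simp add: matrix_def M_def vec_eq_iff mat_def axis_def)
  have "continuous_on {0..1} (\<lambda>s. det (matrix (M s)))"
    unfolding mM det_def by (intro continuous_intros)
  moreover have "det (matrix (M 0)) = 1" by (simp add: mM)
  moreover have "det (matrix (M 1)) \<le> 0" using neg by (simp add: mM)
  ultimately obtain s where "0 \<le> s" "s \<le> 1" "det (matrix (M s)) = 0"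
    using IVT2'[of "\<lambda>s. det (matrix (M s))" 1 0 0] by auto
  then show False using detM by blast
qed

text \<open>The map \<open>T = \<Sum> t\<^sub>i grad ln (expsum F\<^sub>i)\<close> is a diffeomorphism onto a convex set that lies between
  the interior and the closure of \<open>\<Sum> t\<^sub>i conv F\<^sub>i\<close>; surjectivity is obtained by minimizing the
  coercive function \<open>\<Sum> t\<^sub>i ln (expsum F\<^sub>i x) - z \<bullet> x\<close>.\<close>

proposition measure_sum_polytopes:
  fixes F :: "'i \<Rightarrow> (real ^ 'n::{finite,wellorder}) set" and P :: "(real ^ 'n::_) set"
  assumes I: "finite I" and F: "\<And>i. i \<in> I \<Longrightarrow> finite (F i)"
    and int: "\<And>i. i \<in> I \<Longrightarrow> interior (convex hull F i) \<noteq> {}"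
    and t: "\<And>i. i \<in> I \<Longrightarrow> 0 \<le> t i" and tpos: "\<exists>i\<in>I. t i > 0"
    and P: "compact P" "convex P"
    and PI: "\<And>y. y \<in> P \<longleftrightarrow> (\<exists>s. (\<forall>i\<in>I. s i \<in> convex hull F i) \<and> y = (\<Sum>i\<in>I. t i *\<^sub>R s i))"
  defines "A \<equiv> \<lambda>x. \<Sum>i\<in>I. t i *\<^sub>R matrix (lse_hess (F i) x)"
  shows "(\<lambda>x. det (A x)) absolutely_integrable_on UNIV"
    and "integral UNIV (\<lambda>x. det (A x)) = measure lebesgue P"
proof -
  have Fne: "F i \<noteq> {}" if "i \<in> I" for i using int[OF that] by auto
  define T where "T x = (\<Sum>i\<in>I. t i *\<^sub>R lse_grad (F i) x)" for x
  define T' where "T' x u = (\<Sum>i\<in>I. t i *\<^sub>R lse_hess (F i) x u)" for x u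
  have T': "(T has_derivative T' x) (at x)" for x
    unfolding T_def T'_def
    by (intro has_derivative_sum has_derivative_scaleR_right lse_grad_has_derivative F Fne)
  have linT': "linear (T' x)" for x using T' by (rule has_derivative_linear)
  have hl: "linear (lse_hess (F i) x)" if "i \<in> I" for i x
    using lse_grad_has_derivative[OF F[OF that] Fne[OF that]] by (rule has_derivative_linear)
  have AT': "matrix (T' x) = A x" for x
    unfolding A_def T'_def by (simp add: matrix_def vec_eq_iff)
  have pos: "u \<bullet> T' x u > 0" if u: "u \<noteq> 0" for u x
  proof -
    obtain i where i: "i \<in> I" "t i > 0" using tpos by blast
    have "u \<bullet> T' x u = (\<Sum>i\<in>I. t i * (u \<bullet> lse_hess (F i) x u))"
      by (simp add: T'_def inner_sum_right)
    also have "\<dots> > 0"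
      by (rule sum_pos2[OF I i(1)])
         (use i t lse_hess_pos[OF F[OF i(1)] Fne[OF i(1)] int[OF i(1)] u] lse_hess_nonneg[OF F Fne]
          in \<open>auto intro: mult_nonneg_nonneg\<close>)
    finally show ?thesis .
  qed
  have detpos: "det (A x) > 0" for x
    unfolding AT'[symmetric] using det_matrix_pos[OF linT' pos] .
  have inj: "inj T"
  proof (rule injI, rule ccontr)
    fix x y assume eq: "T x = T y" and ne: "x \<noteq> y"
    let ?g = "\<lambda>s. T (x + s *\<^sub>R (y - x)) \<bullet> (y - x)"
    have "\<exists>d. (?g has_real_derivative d) (at s) \<and> d > 0" for s
    proof (intro exI conjI)
      have "((\<lambda>s. x + s *\<^sub>R (y - x)) has_derivative (\<lambda>h. h *\<^sub>R (y - x))) (at s)"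
        by (auto intro!: derivative_eq_intros)
      from diff_chain_at[OF this T'[of "x + s *\<^sub>R (y - x)"]]
      have "((\<lambda>s. T (x + s *\<^sub>R (y - x))) has_derivative (\<lambda>h. h *\<^sub>R T' (x + s *\<^sub>R (y - x)) (y - x))) (at s)"
        by (simp add: o_def linear_scale[OF linT'])
      from has_derivative_inner_left[OF this, of "y - x"]
      show "(?g has_real_derivative ((y - x) \<bullet> T' (x + s *\<^sub>R (y - x)) (y - x))) (at s)"
        by (simp add: has_field_derivative_def inner_commute mult.commute mult_commute_abs)
      show "(y - x) \<bullet> T' (x + s *\<^sub>R (y - x)) (y - x) > 0" using ne by (intro pos) simp
    qed
    then have "?g 0 < ?g 1" by (intro DERIV_pos_imp_increasing[of 0 1 ?g]) (simp, blast)
    then show False using eq by simp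
  qed
  have range: "range T \<subseteq> P"
  proof
    fix y assume "y \<in> range T"
    then obtain x where "y = T x" by blast
    then show "y \<in> P"
      unfolding PI T_def using lse_grad_in_hull[OF F Fne] by (intro exI[of _ "\<lambda>i. lse_grad (F i) x"]) simp
  qed
  have int_range: "interior P \<subseteq> range T"
  proof
    fix z assume "z \<in> interior P"
    then obtain d where d: "d > 0" "cball z d \<subseteq> P" by (auto simp: mem_interior_cball)
    define G where "G x = (\<Sum>i\<in>I. t i * ln (expsum (F i) x)) - z \<bullet> x" for x
    have G': "(G has_derivative (\<lambda>u. (T x - z) \<bullet> u)) (at x)" for x
    proof -
      have "(G has_derivative (\<lambda>u. (\<Sum>i\<in>I. t i * (lse_grad (F i) x \<bullet> u)) - z \<bullet> u)) (at x)"
        unfolding G_def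
        by (intro has_derivative_diff has_derivative_sum has_derivative_mult_right ln_expsum_has_derivative F Fne
            has_derivative_inner_right has_derivative_ident)
      then show ?thesis by (simp add: T_def inner_diff_left inner_sum_left)
    qed
    have coerc: "G x \<ge> d * norm x" for x
    proof (cases "x = 0")
      case True
      have "0 \<le> ln (expsum (F i) x)" if "i \<in> I" for i
        using inner_le_ln_expsum[OF F[OF that] Fne[OF that] lse_grad_in_hull[OF F[OF that] Fne[OF that]], of x x] True
        by simp
      then show ?thesis using True t by (auto simp: G_def intro!: sum_nonneg)
    next
      case False
      have "z + (d / norm x) *\<^sub>R x \<in> P" using d False by (intro subsetD[OF d(2)]) (simp add: dist_norm)
      then obtain s where s: "\<And>i. i \<in> I \<Longrightarrow> s i \<in> convex hull F i" "z + (d / norm x) *\<^sub>R x = (\<Sum>i\<in>I. t i *\<^sub>R s i)"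
        using PI by blast
      have "x \<bullet> z + d * norm x = x \<bullet> (z + (d / norm x) *\<^sub>R x)"
        using False by (simp add: inner_add_right dot_square_norm power2_eq_square)
      also have "\<dots> = (\<Sum>i\<in>I. t i * (x \<bullet> s i))" unfolding s(2) by (simp add: inner_sum_right)
      also have "\<dots> \<le> (\<Sum>i\<in>I. t i * ln (expsum (F i) x))"
        by (intro sum_mono mult_left_mono inner_le_ln_expsum F Fne s t)
      finally show ?thesis by (simp add: G_def inner_commute)
    qed
    define r where "r = G 0 / d + 1"
    have G0: "G 0 \<ge> 0" using coerc[of 0] by simp
    then have r: "r > 0" using d by (simp add: r_def add_nonneg_pos)
    have "continuous_on (cball 0 r) G"
      by (intro continuous_at_imp_continuous_on ballI has_derivative_continuous[OF G'])
    then obtain x0 where x0: "x0 \<in> cball 0 r" "\<And>x. x \<in> cball 0 r \<Longrightarrow> G x0 \<le> G x"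
      using continuous_attains_inf[of "cball 0 r" G] r by auto
    have min: "G x0 \<le> G x" for x
    proof (cases "x \<in> cball 0 r")
      case False
      have "G x0 \<le> G 0" using x0 r by auto
      also have "\<dots> \<le> d * r" using d by (simp add: r_def algebra_simps)
      also have "\<dots> \<le> d * norm x" using False d by simp
      also have "\<dots> \<le> G x" by (rule coerc)
      finally show ?thesis .
    qed (use x0 in auto)
    have "(\<lambda>u. (T x0 - z) \<bullet> u) = (\<lambda>u. 0)"
      by (rule differential_zero_maxmin[of x0 UNIV G]) (use G' min in auto)
    then have "(T x0 - z) \<bullet> (T x0 - z) = 0" by metis
    then show "z \<in> range T" by (metis eq_iff_diff_eq_0 inner_eq_zero_iff rangeI)
  qed
  have Pl: "P \<in> lmeasurable" using P(1) by (rule lmeasurable_compact)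
  have neg: "negligible (P - range T \<union> (range T - P))"
  proof (rule negligible_subset[OF negligible_convex_frontier[OF P(2)]])
    show "P - range T \<union> (range T - P) \<subseteq> frontier P"
      using range int_range closure_subset[of P] by (auto simp: frontier_def)
  qed
  have Tl: "range T \<in> lmeasurable" by (rule lmeasurable_negligible_symdiff[OF Pl neg])
  have TP: "measure lebesgue (range T) = measure lebesgue P" by (rule measure_negligible_symdiff[OF Pl neg])
  have "(\<lambda>_. 1 :: real ^ 1) absolutely_integrable_on range T"
    using Tl by (simp add: absolutely_integrable_on_const)
  then have "(\<lambda>x. \<bar>det (matrix (T' x))\<bar> *\<^sub>R (\<lambda>_. 1 :: real ^ 1) (T x)) absolutely_integrable_on UNIV \<and>
     integral UNIV (\<lambda>x. \<bar>det (matrix (T' x))\<bar> *\<^sub>R (\<lambda>_. 1 :: real ^ 1) (T x)) = integral (range T) (\<lambda>_. 1)"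
    using has_absolute_integral_change_of_variables[of UNIV T T' "\<lambda>_. 1 :: real ^ 1" "integral (range T) (\<lambda>_. 1)"]
      T' inj by (simp add: inj_on_def)
  then have *: "(\<lambda>x. det (A x) *\<^sub>R (1 :: real ^ 1)) absolutely_integrable_on UNIV"
    "integral UNIV (\<lambda>x. det (A x) *\<^sub>R (1 :: real ^ 1)) = integral (range T) (\<lambda>_. 1)"
    using detpos by (simp_all add: AT' abs_of_pos)
  have comp: "bounded_linear (\<lambda>x :: real ^ 1. x $ 1)" by (rule bounded_linear_vec_nth)
  show "(\<lambda>x. det (A x)) absolutely_integrable_on UNIV"
    using absolutely_integrable_linear[OF *(1) comp] by (simp add: o_def)
  have "integral UNIV (\<lambda>x. det (A x)) = integral UNIV ((\<lambda>x :: real ^ 1. x $ 1) \<circ> (\<lambda>x. det (A x) *\<^sub>R 1))"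
    by (simp add: o_def)
  also have "\<dots> = integral (range T) (\<lambda>_. 1 :: real ^ 1) $ 1"
    using *(1) by (subst integral_linear[OF _ comp]) (simp_all add: *(2) set_lebesgue_integral_eq_integral(1))
  also have "\<dots> = integral (range T) ((\<lambda>x :: real ^ 1. x $ 1) \<circ> (\<lambda>_. 1))"
    by (rule integral_linear[OF _ comp, symmetric]) (rule integrable_on_const[OF Tl])
  also have "\<dots> = measure lebesgue P" using lmeasure_integral[OF Tl] TP by (simp add: o_def)
  finally show "integral UNIV (\<lambda>x. det (A x)) = measure lebesgue P" .
qed

section \<open>Mixed volumes\<close>

subsection \<open>Minkowski addition and scaling of bodies\<close>

lemma mem_body_plus: "x \<in> body_set (K + L) \<longleftrightarrow> (\<exists>a\<in>body_set K. \<exists>b\<in>body_set L. x = a + b)"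
  by (auto simp: plus_body.rep_eq set_plus_def)

lemma body_eqI: "(\<And>x. x \<in> body_set K \<longleftrightarrow> x \<in> body_set L) \<Longrightarrow> K = L"
  by (metis body_set_inject set_eqI)

lemma body_set_0 [simp]: "body_set 0 = {0}"
  by (rule zero_body.rep_eq)

lemma mem_body_sum:
  assumes "finite I"
  shows "x \<in> body_set (\<Sum>i\<in>I. B i) \<longleftrightarrow> (\<exists>s. (\<forall>i\<in>I. s i \<in> body_set (B i)) \<and> x = (\<Sum>i\<in>I. s i))"
  using assms
proof (induction I arbitrary: x rule: finite_induct)
  case (insert i I)
  have "x \<in> body_set (\<Sum>i\<in>insert i I. B i) \<longleftrightarrow>
      (\<exists>a\<in>body_set (B i). \<exists>s. (\<forall>i\<in>I. s i \<in> body_set (B i)) \<and> x = a + (\<Sum>i\<in>I. s i))"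
    unfolding sum.insert[OF insert.hyps] mem_body_plus Bex_def insert.IH by blast
  also have "\<dots> \<longleftrightarrow> (\<exists>s. (\<forall>i\<in>insert i I. s i \<in> body_set (B i)) \<and> x = (\<Sum>i\<in>insert i I. s i))"
  proof (intro iffI; elim bexE exE conjE)
    fix a s assume "a \<in> body_set (B i)" "\<forall>i\<in>I. s i \<in> body_set (B i)" "x = a + sum s I"
    moreover have "sum (s(i := a)) I = sum s I" using insert by (intro sum.cong) auto
    ultimately show "\<exists>s. (\<forall>i\<in>insert i I. s i \<in> body_set (B i)) \<and> x = (\<Sum>i\<in>insert i I. s i)"
      using insert by (intro exI[of _ "s(i := a)"]) auto
  next
    fix s assume "\<forall>i\<in>insert i I. s i \<in> body_set (B i)" "x = sum s (insert i I)"
    then show "\<exists>a\<in>body_set (B i). \<exists>s. (\<forall>i\<in>I. s i \<in> body_set (B i)) \<and> x = a + (\<Sum>i\<in>I. s i)"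
      using insert by (intro bexI[of _ "s i"] exI[of _ s]) auto
  qed
  finally show ?case .
qed simp

lemma mem_scale_body: "x \<in> body_set (scale_body t K) \<longleftrightarrow> (\<exists>a\<in>body_set K. x = t *\<^sub>R a)"
  by (auto simp: scale_body.rep_eq)

lemma scale_body_0 [simp]: "scale_body 0 K = 0"
proof -
  obtain p where "p \<in> body_set K" using body_set_props(1)[of K] by blast
  then show ?thesis by (intro body_eqI) (auto simp: mem_scale_body)
qed

lemma scale_body_1 [simp]: "scale_body 1 K = K"
  by (intro body_eqI) (auto simp: mem_scale_body)

lemma scale_body_of_0 [simp]: "scale_body t 0 = 0"
  by (intro body_eqI) (auto simp: mem_scale_body)

lemma scale_scale_body: "scale_body s (scale_body t K) = scale_body (s * t) K"
  by (simp add: body_set_inject[symmetric] scale_body.rep_eq image_image)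

lemma scale_body_add: "scale_body t (K + L) = scale_body t K + scale_body t L"
  by (intro body_eqI) (force simp: mem_scale_body mem_body_plus scaleR_add_right)

lemma scale_body_add_left:
  assumes "0 \<le> s" "0 \<le> t"
  shows "scale_body (s + t) K = scale_body s K + scale_body t K"
proof (intro body_eqI iffI)
  fix x assume "x \<in> body_set (scale_body (s + t) K)"
  then obtain a where "a \<in> body_set K" "x = s *\<^sub>R a + t *\<^sub>R a" by (auto simp: mem_scale_body scaleR_add_left)
  then show "x \<in> body_set (scale_body s K + scale_body t K)"
    unfolding mem_body_plus by (intro bexI[of _ "s *\<^sub>R a"] bexI[of _ "t *\<^sub>R a"]) (auto simp: mem_scale_body)
next
  fix x assume "x \<in> body_set (scale_body s K + scale_body t K)"
  then obtain a b where ab: "a \<in> body_set K" "b \<in> body_set K" "x = s *\<^sub>R a + t *\<^sub>R b"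
    by (auto simp: mem_scale_body mem_body_plus)
  show "x \<in> body_set (scale_body (s + t) K)"
  proof (cases "s + t = 0")
    case True
    then have "s = 0" "t = 0" using assms by auto
    then show ?thesis using ab by simp
  next
    case False
    then have "(s / (s + t)) *\<^sub>R a + (t / (s + t)) *\<^sub>R b \<in> body_set K"
      using ab assms by (intro convexD) (auto simp: add_divide_distrib[symmetric])
    moreover have "x = (s + t) *\<^sub>R ((s / (s + t)) *\<^sub>R a + (t / (s + t)) *\<^sub>R b)"
      using False ab by (simp add: scaleR_add_right)
    ultimately show ?thesis by (auto simp: mem_scale_body)
  qed
qed

lemma sum_const_body: "finite I \<Longrightarrow> (\<Sum>i\<in>I. K) = scale_body (real (card I)) K"
proof (induction I rule: finite_induct)
  case (insert i I)
  then show ?case using scale_body_add_left[of 1 "real (card I)" K] by simp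
qed simp

lemma body_sum_mono:
  "finite I \<Longrightarrow> (\<And>i. i \<in> I \<Longrightarrow> body_set (B i) \<subseteq> body_set (C i)) \<Longrightarrow> body_set (\<Sum>i\<in>I. B i) \<subseteq> body_set (\<Sum>i\<in>I. C i)"
  by (fastforce simp: mem_body_sum)

lemma dist_body_plus:
  fixes K L :: "'a::euclidean_space body"
  shows "dist (K + L) (K' + L') \<le> dist K K' + dist L L'"
proof -
  have *: "\<exists>y\<in>body_set (K' + L'). dist x y \<le> dist K K' + dist L L'" if x: "x \<in> body_set (K + L)" for x and K K' L L' :: "'a body"
  proof -
    obtain a b where ab: "a \<in> body_set K" "b \<in> body_set L" "x = a + b" using x by (auto simp: mem_body_plus)
    obtain a' b' where "a' \<in> body_set K'" "dist a a' \<le> dist K K'" "b' \<in> body_set L'" "dist b b' \<le> dist L L'"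
      using dist_body_le[OF order_refl ab(1)] dist_body_le[OF order_refl ab(2)] by blast
    then show ?thesis using ab dist_triangle_add[of a b a' b'] by (force simp: mem_body_plus)
  qed
  show ?thesis
    by (rule dist_body_leI) (rule *, assumption, subst (1 2) dist_commute, rule *, assumption)
qed

lemma dist_scale_body:
  fixes K L :: "'a::euclidean_space body"
  shows "dist (scale_body t K) (scale_body t L) \<le> \<bar>t\<bar> * dist K L"
proof -
  have *: "\<exists>y\<in>body_set (scale_body t L). dist x y \<le> \<bar>t\<bar> * dist K L" if x: "x \<in> body_set (scale_body t K)" for x and K L :: "'a body"
  proof -
    obtain a where a: "a \<in> body_set K" "x = t *\<^sub>R a" using x by (auto simp: mem_scale_body)
    obtain b where "b \<in> body_set L" "dist a b \<le> dist K L" using dist_body_le[OF order_refl a(1)] by blast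
    moreover have "dist (t *\<^sub>R a) (t *\<^sub>R b) = \<bar>t\<bar> * dist a b"
      by (simp add: dist_norm scaleR_diff_right[symmetric] del: scaleR_diff_right)
    ultimately show ?thesis
      using a by (intro bexI[of _ "t *\<^sub>R b"]) (auto simp: mem_scale_body mult_left_mono)
  qed
  show ?thesis
    by (rule dist_body_leI) (rule *, assumption, subst dist_commute, rule *, assumption)
qed

lemma tendsto_body_plus:
  fixes K L :: "'b \<Rightarrow> 'a::euclidean_space body"
  assumes "(K \<longlongrightarrow> K0) F" "(L \<longlongrightarrow> L0) F"
  shows "((\<lambda>x. K x + L x) \<longlongrightarrow> K0 + L0) F"
proof (subst tendsto_dist_iff, rule Lim_null_comparison)
  show "\<forall>\<^sub>F x in F. norm (dist (K x + L x) (K0 + L0)) \<le> dist (K x) K0 + dist (L x) L0"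
    by (rule always_eventually) (simp add: dist_body_plus)
  show "((\<lambda>x. dist (K x) K0 + dist (L x) L0) \<longlongrightarrow> 0) F"
    using assms[unfolded tendsto_dist_iff[of _ K0] tendsto_dist_iff[of _ L0]] by (rule tendsto_add_zero)
qed

lemma tendsto_scale_body:
  fixes K :: "'b \<Rightarrow> 'a::euclidean_space body"
  assumes "(K \<longlongrightarrow> K0) F"
  shows "((\<lambda>x. scale_body t (K x)) \<longlongrightarrow> scale_body t K0) F"
proof (subst tendsto_dist_iff, rule Lim_null_comparison)
  show "\<forall>\<^sub>F x in F. norm (dist (scale_body t (K x)) (scale_body t K0)) \<le> \<bar>t\<bar> * dist (K x) K0"
    by (rule always_eventually) (simp add: dist_scale_body)
  show "((\<lambda>x. \<bar>t\<bar> * dist (K x) K0) \<longlongrightarrow> 0) F"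
    using assms[unfolded tendsto_dist_iff[of _ K0]] by (rule tendsto_mult_right_zero)
qed

lemma tendsto_body_sum:
  fixes K :: "'i \<Rightarrow> 'b \<Rightarrow> 'a::euclidean_space body"
  assumes "\<And>i. i \<in> I \<Longrightarrow> (K i \<longlongrightarrow> K0 i) F"
  shows "((\<lambda>x. \<Sum>i\<in>I. K i x) \<longlongrightarrow> (\<Sum>i\<in>I. K0 i)) F"
  using assms by (induction I rule: infinite_finite_induct) (auto intro: tendsto_body_plus)

subsection \<open>Volume\<close>

lemma vol_lebesgue: "vol K = measure lebesgue (body_set K)"
  by (simp add: vol_def borel_closed)

lemma lmeasurable_body: "body_set K \<in> lmeasurable"
  by (simp add: lmeasurable_compact)

lemma vol_0 [simp]: "vol (0 :: 'a::euclidean_space body) = 0"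
  by (simp add: vol_lebesgue)

lemma vol_nonneg: "vol K \<ge> 0"
  by (simp add: vol_def)

lemma vol_mono: "body_set K \<subseteq> body_set L \<Longrightarrow> vol K \<le> vol L"
  unfolding vol_lebesgue by (rule measure_mono_fmeasurable) (auto simp: lmeasurable_body)

lemma vol_scale_body: "0 \<le> t \<Longrightarrow> vol (scale_body t K) = t ^ DIM('a) * vol (K :: 'a::euclidean_space body)"
  unfolding vol_lebesgue scale_body.rep_eq using measure_lebesgue_affine[of t 0 "body_set K"] by simp

lemma vol_translate_body [simp]: "vol (translate_body x K) = vol K"
  unfolding vol_lebesgue translate_body.rep_eq by (rule measure_translation)

text \<open>Limits from outside only; lower semicontinuity of the volume will follow from the multilinearity
  of mixed volumes.\<close>

lemma vol_tendsto_outer: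
  fixes X :: "nat \<Rightarrow> 'a::euclidean_space body"
  assumes sub: "\<And>m. body_set K \<subseteq> body_set (X m)" and lim: "X \<longlonglongrightarrow> K"
  shows "(\<lambda>m. vol (X m)) \<longlonglongrightarrow> vol K"
proof (rule LIMSEQ_I)
  fix e :: real assume e: "e > 0"
  obtain d where d: "d > 0" "\<And>T. T \<in> lmeasurable \<Longrightarrow> (\<And>y. y \<in> T \<Longrightarrow> \<exists>x. x \<in> body_set K \<and> dist x y < d)
      \<Longrightarrow> measure lebesgue T < measure lebesgue (body_set K) + e"
    using measure_semicontinuous_with_hausdist_explicit[OF _ negligible_convex_frontier e, of "body_set K"] by auto
  obtain N where N: "\<And>m. m \<ge> N \<Longrightarrow> dist (X m) K < d"
    using metric_LIMSEQ_D[OF lim d(1)] by blast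
  have "norm (vol (X m) - vol K) < e" if m: "m \<ge> N" for m
  proof -
    have "vol (X m) < vol K + e"
      unfolding vol_lebesgue
    proof (rule d(2)[OF lmeasurable_body])
      fix y assume "y \<in> body_set (X m)"
      then obtain x where "x \<in> body_set K" "dist y x \<le> dist (X m) K" using dist_body_le by blast
      then show "\<exists>x. x \<in> body_set K \<and> dist x y < d" using N[OF m] by (auto simp: dist_commute)
    qed
    then show ?thesis using vol_mono[OF sub, of m] by simp
  qed
  then show "\<exists>N. \<forall>m\<ge>N. norm (vol (X m) - vol K) < e" by blast
qed

definition hull_body :: "'a::euclidean_space set \<Rightarrow> 'a body" where
  "hull_body F = Body (convex hull F)"

lemma body_set_hull_body:
  assumes "compact F" "F \<noteq> {}"
  shows "body_set (hull_body F) = convex hull F"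
  unfolding hull_body_def using assms by (intro body_set_Body) (auto simp: compact_convex_hull convex_convex_hull)

lemma outer_polytope:
  fixes K :: "'a::euclidean_space body"
  assumes e: "e > 0"
  obtains F where "finite F" "interior (convex hull F) \<noteq> {}" "body_set K \<subseteq> convex hull F" "dist (hull_body F) K \<le> e"
proof -
  define U where "U = (\<Union>x\<in>body_set K. \<Union>y\<in>ball 0 e. {x + y})"
  have U: "open U" "convex U"
    unfolding U_def by (auto intro: open_sums convex_sums)
  have KU: "body_set K \<subseteq> U" using e by (force simp: U_def)
  have "\<exists>Fb. finite (fst Fb) \<and> convex hull (fst Fb) \<subseteq> U \<and> x \<in> snd Fb \<and> open (snd Fb) \<and> snd Fb \<subseteq> convex hull (fst Fb)"
    if x: "x \<in> body_set K" for x
  proof -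
    obtain a b where "cbox a b \<subseteq> U" "x \<in> box a b"
      by (rule open_contains_cbox[OF U(1), of x]) (use KU x in auto)
    moreover obtain F where "finite F" "cbox a b = convex hull F" by (rule closed_interval_as_convex_hull)
    moreover have "box a b \<subseteq> convex hull F" using \<open>cbox a b = convex hull F\<close> box_subset_cbox[of a b] by simp
    ultimately show ?thesis by (intro exI[of _ "(F, box a b)"]) (simp add: open_box)
  qed
  then have "\<forall>x\<in>body_set K. \<exists>Fb. finite (fst Fb) \<and> convex hull (fst Fb) \<subseteq> U \<and> x \<in> snd Fb \<and> open (snd Fb) \<and> snd Fb \<subseteq> convex hull (fst Fb)"
    by blast
  from bchoice[OF this] obtain Fb where Fb': "\<forall>x\<in>body_set K. finite (fst (Fb x)) \<and> convex hull (fst (Fb x)) \<subseteq> U \<and> x \<in> snd (Fb x) \<and>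
      open (snd (Fb x)) \<and> snd (Fb x) \<subseteq> convex hull (fst (Fb x))" ..
  define F where "F x = fst (Fb x)" for x
  define b where "b x = snd (Fb x)" for x
  have Fb: "finite (F x)" "convex hull (F x) \<subseteq> U" "x \<in> b x" "open (b x)" "b x \<subseteq> convex hull (F x)"
    if "x \<in> body_set K" for x
    using Fb' that by (simp_all add: F_def b_def)
  have "compact (body_set K)" by simp
  then obtain D where D: "D \<subseteq> body_set K" "finite D" "body_set K \<subseteq> (\<Union>x\<in>D. b x)"
    by (rule compactE_image[of "body_set K" "body_set K" b]) (use Fb in auto)
  define G where "G = (\<Union>x\<in>D. F x)"
  have sub: "convex hull (F x) \<subseteq> convex hull G" if "x \<in> D" for x
    unfolding G_def by (rule hull_mono) (use that in blast)
  have K: "body_set K \<subseteq> convex hull G" using D Fb(5) sub by blast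
  have "F x \<subseteq> U" if "x \<in> D" for x using D(1) Fb(2)[of x] that hull_subset[of "F x" convex] by blast
  then have GU: "convex hull G \<subseteq> U"
    unfolding G_def by (intro hull_minimal U) blast
  obtain p where p: "p \<in> body_set K" using body_set_props(1)[of K] by blast
  then obtain x where x: "x \<in> D" "p \<in> b x" using D by blast
  have "interior (convex hull G) \<noteq> {}"
    using x Fb(4,5)[of x] D(1) sub[of x] interior_maximal[of "b x" "convex hull G"] by blast
  moreover have fin: "finite G" using D Fb by (auto simp: G_def)
  moreover have "dist (hull_body G) K \<le> e"
  proof (rule dist_body_leI)
    have ne: "G \<noteq> {}" using K p by auto
    note G = body_set_hull_body[OF finite_imp_compact[OF fin] ne]
    show "\<exists>y\<in>body_set K. dist x y \<le> e" if "x \<in> body_set (hull_body G)" for x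
      using that GU unfolding G by (force simp: U_def dist_norm)
    show "\<exists>x\<in>body_set (hull_body G). dist y x \<le> e" if "y \<in> body_set K" for y
      using that K e unfolding G by (intro bexI[of _ y]) auto
  qed
  ultimately show ?thesis using that K by blast
qed

lemma vol_sum_polytopes:
  fixes F :: "'i \<Rightarrow> 'a::euclidean_space set"
  assumes I: "finite I" and F: "\<And>i. i \<in> I \<Longrightarrow> finite (F i)"
    and int: "\<And>i. i \<in> I \<Longrightarrow> interior (convex hull F i) \<noteq> {}" and t: "\<And>i. i \<in> I \<Longrightarrow> 0 \<le> t i"
  defines "A \<equiv> \<lambda>x. \<Sum>i\<in>I. t i *\<^sub>R matrix (lse_hess (coords ` F i) x)"
  shows "(\<lambda>x. det (A x)) absolutely_integrable_on UNIV"
    and "integral UNIV (\<lambda>x. det (A x)) = vol (\<Sum>i\<in>I. scale_body (t i) (hull_body (F i)))"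
proof -
  let ?X = "\<Sum>i\<in>I. scale_body (t i) (hull_body (F i))"
  let ?P = "coords ` body_set ?X"
  have bl: "bounded_linear (coords :: 'a \<Rightarrow> _)"
    by (simp add: linear_conv_bounded_linear[symmetric] linear_coords)
  have hull: "body_set (hull_body (F i)) = convex hull F i" if "i \<in> I" for i
    using F[OF that] int[OF that] by (intro body_set_hull_body finite_imp_compact) auto
  have cF: "finite (coords ` F i)" if "i \<in> I" for i using F that by blast
  have cint: "interior (convex hull (coords ` F i)) \<noteq> {}" if "i \<in> I" for i
  proof -
    have "open (coords ` interior (convex hull F i))"
      by (rule open_surjective_linear_image[OF _ linear_coords surj_coords]) simp
    moreover have "coords ` interior (convex hull F i) \<subseteq> convex hull (coords ` F i)"
      using interior_subset convex_hull_linear_image[OF linear_coords, of "F i"] by blast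
    ultimately have "coords ` interior (convex hull F i) \<subseteq> interior (convex hull (coords ` F i))"
      by (simp add: interior_maximal)
    then show ?thesis using int[OF that] by blast
  qed
  have cP: "compact ?P" "convex ?P"
    by (auto intro!: compact_continuous_image linear_continuous_on bl convex_linear_image linear_coords)
  have P: "y \<in> ?P \<longleftrightarrow> (\<exists>s. (\<forall>i\<in>I. s i \<in> convex hull (coords ` F i)) \<and> y = (\<Sum>i\<in>I. t i *\<^sub>R s i))" for y
  proof
    assume "y \<in> ?P"
    then obtain z where "z \<in> body_set ?X" "y = coords z" by blast
    then obtain r where r: "\<And>i. i \<in> I \<Longrightarrow> r i \<in> body_set (scale_body (t i) (hull_body (F i)))" "y = coords (sum r I)"
      unfolding mem_body_sum[OF I] by blast
    then have "\<forall>i\<in>I. \<exists>a. a \<in> convex hull F i \<and> r i = t i *\<^sub>R a" using hull by (fastforce simp: mem_scale_body)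
    then obtain a where a: "\<And>i. i \<in> I \<Longrightarrow> a i \<in> convex hull F i \<and> r i = t i *\<^sub>R a i" by metis
    then have "y = (\<Sum>i\<in>I. t i *\<^sub>R coords (a i))"
      using r by (simp add: linear_sum[OF linear_coords] linear_scale[OF linear_coords])
    moreover have "\<forall>i\<in>I. coords (a i) \<in> convex hull (coords ` F i)"
      using a convex_hull_linear_image[OF linear_coords] by blast
    ultimately show "\<exists>s. (\<forall>i\<in>I. s i \<in> convex hull (coords ` F i)) \<and> y = (\<Sum>i\<in>I. t i *\<^sub>R s i)"
      by (intro exI[of _ "\<lambda>i. coords (a i)"]) simp
  next
    assume "\<exists>s. (\<forall>i\<in>I. s i \<in> convex hull (coords ` F i)) \<and> y = (\<Sum>i\<in>I. t i *\<^sub>R s i)"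
    then obtain s where s: "\<And>i. i \<in> I \<Longrightarrow> s i \<in> convex hull (coords ` F i)" "y = (\<Sum>i\<in>I. t i *\<^sub>R s i)" by blast
    have "of_coords (s i) \<in> convex hull F i" if "i \<in> I" for i
    proof -
      have "s i \<in> coords ` (convex hull F i)" using s(1)[OF that] convex_hull_linear_image[OF linear_coords] by blast
      then show ?thesis by auto
    qed
    then have "(\<Sum>i\<in>I. t i *\<^sub>R of_coords (s i)) \<in> body_set ?X"
      unfolding mem_body_sum[OF I] mem_scale_body
      using hull by (intro exI[of _ "\<lambda>i. t i *\<^sub>R of_coords (s i)"]) auto
    moreover have "coords (\<Sum>i\<in>I. t i *\<^sub>R of_coords (s i)) = y"
      using s(2) by (simp add: linear_sum[OF linear_coords] linear_scale[OF linear_coords])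
    ultimately show "y \<in> ?P" by (intro image_eqI[of y coords "\<Sum>i\<in>I. t i *\<^sub>R of_coords (s i)"]) simp_all
  qed
  have "(\<lambda>x. det (A x)) absolutely_integrable_on UNIV \<and> integral UNIV (\<lambda>x. det (A x)) = vol ?X"
  proof (cases "\<exists>i\<in>I. t i > 0")
    case True
    have "measure lebesgue ?P = vol ?X" by (simp add: vol_def measure_coords_image)
    then show ?thesis
      unfolding A_def using measure_sum_polytopes[OF I cF cint t True cP P] by auto
  next
    case False
    then have t0: "t i = 0" if "i \<in> I" for i using t that by force
    have "det (0 :: real ^ 'a basis_ix ^ 'a basis_ix) = 0" using det_0 by (simp add: mat_0)
    then have "det (A x) = 0" for x by (simp add: A_def t0)
    then show ?thesis using t0 by simp
  qed
  then show "(\<lambda>x. det (A x)) absolutely_integrable_on UNIV" "integral UNIV (\<lambda>x. det (A x)) = vol ?X" by auto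
qed

subsection \<open>Polarization\<close>

definition polarize :: "('i set \<Rightarrow> real) \<Rightarrow> 'i set \<Rightarrow> real" where
  "polarize f I = (\<Sum>S\<in>Pow I. (-1) ^ (card I - card S) * f S)"

definition words :: "'i set \<Rightarrow> nat \<Rightarrow> 'i list set" where
  "words S m = {xs. set xs \<subseteq> S \<and> length xs = m}"

lemma finite_words [simp]: "finite S \<Longrightarrow> finite (words S m)"
  by (simp add: words_def finite_lists_length_eq)

lemma words_0 [simp]: "words S 0 = {[]}"
  by (auto simp: words_def)

lemma sum_words_Suc: "(\<Sum>xs\<in>words S (Suc m). f xs) = (\<Sum>i\<in>S. \<Sum>xs\<in>words S m. f (i # xs))"
proof -
  have "(\<Sum>i\<in>S. \<Sum>xs\<in>words S m. f (i # xs)) = (\<Sum>(i, xs)\<in>S \<times> words S m. f (i # xs))"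
    by (rule sum.cartesian_product)
  also have "\<dots> = (\<Sum>xs\<in>words S (Suc m). f xs)"
    by (rule sum.reindex_bij_witness[of _ "\<lambda>xs. (hd xs, tl xs)" "\<lambda>(i, xs). i # xs"])
       (auto simp: words_def length_Suc_conv)
  finally show ?thesis by simp
qed

lemma polarize_words:
  assumes I: "finite I"
  shows "polarize (\<lambda>S. \<Sum>xs\<in>words S (card I). G xs) I = (\<Sum>xs\<in>permutations_of_set I. G xs)"
proof -
  let ?c = "\<lambda>S. (-1) ^ (card I - card S) :: real"
  have alt: "(\<Sum>S\<in>Pow I. if X \<subseteq> S then ?c S else 0) = (if X = I then 1 else 0)" if X: "X \<subseteq> I" for X
  proof -
    have "(\<Prod>i\<in>I - S. if i \<in> X then 0 else 1) = (if X \<subseteq> S then 1 else 0 :: real)" for S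
    proof (cases "X \<subseteq> S")
      case True
      then show ?thesis by (auto intro!: prod.neutral)
    next
      case False
      then show ?thesis using X I by (auto intro!: prod_zero)
    qed
    then have "(\<Sum>S\<in>Pow I. if X \<subseteq> S then ?c S else 0)
        = (\<Sum>S\<in>Pow I. ?c S * (\<Prod>i\<in>S. 1) * (\<Prod>i\<in>I - S. if i \<in> X then 0 else 1))"
      by (intro sum.cong) auto
    also have "\<dots> = (\<Prod>i\<in>I. 1 - (if i \<in> X then 0 else 1))" by (rule prod_diff_conv_sum'[OF I, symmetric])
    also have "\<dots> = (if X = I then 1 else 0)" using I X by (auto intro!: prod.neutral prod_zero)
    finally show ?thesis .
  qed
  have "polarize (\<lambda>S. \<Sum>xs\<in>words S (card I). G xs) I
      = (\<Sum>S\<in>Pow I. \<Sum>xs\<in>words I (card I). if set xs \<subseteq> S then ?c S * G xs else 0)"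
    unfolding polarize_def
  proof (rule sum.cong[OF refl])
    fix S assume "S \<in> Pow I"
    then have "words S (card I) = {xs \<in> words I (card I). set xs \<subseteq> S}" by (auto simp: words_def)
    then show "?c S * (\<Sum>xs\<in>words S (card I). G xs) = (\<Sum>xs\<in>words I (card I). if set xs \<subseteq> S then ?c S * G xs else 0)"
      using I by (simp add: sum.inter_filter sum_distrib_left if_distrib[where f="\<lambda>x. _ * x"] cong: if_cong)
  qed
  also have "\<dots> = (\<Sum>xs\<in>words I (card I). G xs * (\<Sum>S\<in>Pow I. if set xs \<subseteq> S then ?c S else 0))"
    by (subst sum.swap, intro sum.cong refl) (simp add: sum_distrib_left if_distrib mult.commute cong: if_cong)
  also have "\<dots> = (\<Sum>xs\<in>words I (card I). if set xs = I then G xs else 0)"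
    by (intro sum.cong refl) (simp add: alt words_def)
  also have "\<dots> = (\<Sum>xs\<in>{xs \<in> words I (card I). set xs = I}. G xs)" using I by (simp add: sum.inter_filter)
  also have "{xs \<in> words I (card I). set xs = I} = permutations_of_set I"
  proof -
    have "length xs = card I \<longleftrightarrow> distinct xs" if "set xs = I" for xs
      using that card_distinct[of xs] distinct_card[of xs] by auto
    then show ?thesis unfolding words_def permutations_of_set_def by blast
  qed
  finally show ?thesis .
qed

lemma prod_list_sum_words:
  fixes a :: "'j \<Rightarrow> 'i \<Rightarrow> real"
  shows "prod_list (map (\<lambda>j. \<Sum>i\<in>S. a j i) js) = (\<Sum>xs\<in>words S (length js). prod_list (map2 a js xs))"
proof (induction js)
  case (Cons j js)
  show ?case
    by (simp add: Cons sum_words_Suc sum_product)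
qed simp

lemma prod_list_map2_linear:
  fixes a b c :: "'j \<Rightarrow> 'i \<Rightarrow> real"
  assumes "length js = length xs" "distinct xs" "k \<in> set xs"
    and eq: "\<And>j i. i \<in> set xs \<Longrightarrow> i \<noteq> k \<Longrightarrow> a j i = b j i \<and> a j i = c j i" and k: "\<And>j. a j k = s * b j k + t * c j k"
  shows "prod_list (map2 a js xs) = s * prod_list (map2 b js xs) + t * prod_list (map2 c js xs)"
  using assms(1-4)
proof (induction js xs rule: list_induct2)
  case (Cons j js x xs)
  show ?case
  proof (cases "x = k")
    case True
    then have "a j' i = b j' i \<and> a j' i = c j' i" if "(j', i) \<in> set (zip js xs)" for j' i
      using Cons.prems set_zip_rightD[OF that] by auto
    then have "map2 a js xs = map2 b js xs" "map2 a js xs = map2 c js xs" by auto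
    then have "map2 b js xs = map2 a js xs" "map2 c js xs = map2 a js xs" by simp_all
    then show ?thesis using True by (simp only: zip_Cons_Cons list.map prod_list.Cons prod.case k) (simp add: algebra_simps)
  next
    case False
    have "prod_list (map2 a js xs) = s * prod_list (map2 b js xs) + t * prod_list (map2 c js xs)"
    proof (rule Cons.IH)
      show "distinct xs" "k \<in> set xs" using Cons.prems(1,2) False by auto
      show "a j i = b j i \<and> a j i = c j i" if "i \<in> set xs" "i \<noteq> k" for i j
        using Cons.prems(3)[of i j] that by simp
    qed
    moreover have "a j x = b j x" "a j x = c j x" using Cons.prems(3)[of x j] False by auto
    ultimately show ?thesis
      by (simp only: zip_Cons_Cons list.map prod_list.Cons prod.case) (simp add: algebra_simps)
  qed
qed simp

lemma polarize_det_linear: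
  fixes M N L :: "'i \<Rightarrow> real ^ 'n::finite ^ 'n"
  assumes I: "finite I" "card I = CARD('n)" "k \<in> I"
    and eq: "\<And>i. i \<in> I \<Longrightarrow> i \<noteq> k \<Longrightarrow> M i = N i \<and> M i = L i" and k: "M k = s *\<^sub>R N k + t *\<^sub>R L k"
  shows "polarize (\<lambda>S. det (\<Sum>i\<in>S. M i)) I
       = s * polarize (\<lambda>S. det (\<Sum>i\<in>S. N i)) I + t * polarize (\<lambda>S. det (\<Sum>i\<in>S. L i)) I"
proof -
  obtain js :: "'n list" where js: "set js = UNIV" "distinct js" using finite_distinct_list[OF finite[of "UNIV :: 'n set"]] by blast
  have len: "length js = card I" using js I by (metis distinct_card)
  define D where "D M xs = (\<Sum>p | p permutes (UNIV :: 'n set). of_int (sign p) * prod_list (map2 (\<lambda>j i. M i $ j $ p j) js xs))"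
    for M :: "'i \<Rightarrow> real ^ 'n ^ 'n" and xs
  have det: "det (\<Sum>i\<in>S. M i) = (\<Sum>xs\<in>words S (card I). D M xs)" for S and M :: "'i \<Rightarrow> real ^ 'n ^ 'n"
  proof -
    have UNIV: "prod f UNIV = prod_list (map f js)" for f :: "'n \<Rightarrow> real"
      using prod.distinct_set_conv_list[OF js(2), of f] js(1) by simp
    have "det (\<Sum>i\<in>S. M i) = (\<Sum>p | p permutes (UNIV :: 'n set). of_int (sign p) *
        (\<Sum>xs\<in>words S (card I). prod_list (map2 (\<lambda>j i. M i $ j $ p j) js xs)))"
      unfolding det_def UNIV sum_component prod_list_sum_words len ..
    also have "\<dots> = (\<Sum>xs\<in>words S (card I). D M xs)"
      unfolding D_def sum_distrib_left by (rule sum.swap)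
    finally show ?thesis .
  qed
  have "D M xs = s * D N xs + t * D L xs" if "xs \<in> permutations_of_set I" for xs
  proof -
    have "prod_list (map2 (\<lambda>j i. M i $ j $ p j) js xs)
        = s * prod_list (map2 (\<lambda>j i. N i $ j $ p j) js xs) + t * prod_list (map2 (\<lambda>j i. L i $ j $ p j) js xs)" for p
    proof (rule prod_list_map2_linear[where k=k])
      have xs: "set xs = I" "distinct xs" using that by (auto simp: permutations_of_set_def)
      show "length js = length xs" using len distinct_card[OF xs(2)] xs(1) by simp
      show "distinct xs" "k \<in> set xs" using xs I by auto
      show "M i $ j $ p j = N i $ j $ p j \<and> M i $ j $ p j = L i $ j $ p j" if "i \<in> set xs" "i \<noteq> k" for i j
        using eq[of i] that xs by metis
      show "M k $ j $ p j = s * N k $ j $ p j + t * L k $ j $ p j" for j by (simp add: k)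
    qed
    then show ?thesis by (simp add: D_def sum_distrib_left sum.distrib algebra_simps)
  qed
  then show ?thesis
    unfolding det polarize_words[OF I(1)] by (simp add: sum_distrib_left sum.distrib)
qed

subsection \<open>Existence of mixed volumes\<close>

lemma polarize_cong: "(\<And>S. S \<subseteq> I \<Longrightarrow> f S = g S) \<Longrightarrow> polarize f I = polarize g I"
  by (auto simp: polarize_def intro: sum.cong)

lemma sum_merge_last:
  fixes h :: "nat \<Rightarrow> 'c::comm_monoid_add"
  assumes n: "0 < n" and S: "S \<subseteq> {..<n}" and 0: "0 \<notin> S \<Longrightarrow> h 0 = 0 \<and> h n = 0"
    and h: "\<And>i. 0 < i \<Longrightarrow> i < n \<Longrightarrow> i \<notin> S \<Longrightarrow> h i = 0"
  shows "(\<Sum>i\<le>n. h i) = (\<Sum>i\<in>S. if i = 0 then h 0 + h n else h i)"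
proof -
  have fin: "finite S" using S finite_subset by blast
  have "(\<Sum>i<n. h i) = (\<Sum>i\<in>S. h i)"
  proof (rule sum.mono_neutral_right)
    show "\<forall>i\<in>{..<n} - S. h i = 0"
    proof
      fix i assume "i \<in> {..<n} - S"
      then show "h i = 0" using 0 h[of i] by (cases "i = 0") auto
    qed
  qed (use S in auto)
  moreover have "{..n} = insert n {..<n}" by auto
  ultimately have *: "(\<Sum>i\<le>n. h i) = h n + (\<Sum>i\<in>S. h i)" by simp
  show ?thesis
  proof (cases "0 \<in> S")
    case True
    have "(\<Sum>i\<in>S - {0}. if i = 0 then h 0 + h n else h i) = (\<Sum>i\<in>S - {0}. h i)" by (rule sum.cong) auto
    then show ?thesis
      unfolding * using fin True by (simp add: sum.remove[of S 0] add.assoc add.left_commute)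
  next
    case False
    then have "(\<Sum>i\<in>S. if i = 0 then h 0 + h n else h i) = (\<Sum>i\<in>S. h i)" by (intro sum.cong) auto
    then show ?thesis unfolding * using 0 False by simp
  qed
qed

context
  fixes n :: nat
  assumes n: "n = DIM('a::euclidean_space)"
begin

lemma polarize_vol_linear_polytopes:
  fixes F :: "nat \<Rightarrow> 'a set"
  assumes F: "\<And>i. finite (F i)" and int: "\<And>i. interior (convex hull F i) \<noteq> {}" and st: "0 \<le> s" "0 \<le> t"
  defines "X \<equiv> \<lambda>s t i. if i = 0 then scale_body s (hull_body (F 0)) + scale_body t (hull_body (F n)) else hull_body (F i)"
  shows "polarize (\<lambda>S. vol (\<Sum>i\<in>S. X s t i)) {..<n}
    = s * polarize (\<lambda>S. vol (\<Sum>i\<in>S. X 1 0 i)) {..<n} + t * polarize (\<lambda>S. vol (\<Sum>i\<in>S. X 0 1 i)) {..<n}"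
proof -
  have n0: "0 < n" by (simp add: n)
  define A where "A i x = matrix (lse_hess (coords ` F i) x)" for i x
  define M where "M s t x i = (if i = 0 then s *\<^sub>R A 0 x + t *\<^sub>R A n x else A i x)" for s t :: real and x i
  have v: "(\<lambda>x. det (\<Sum>i\<in>S. M s t x i)) absolutely_integrable_on UNIV"
    "integral UNIV (\<lambda>x. det (\<Sum>i\<in>S. M s t x i)) = vol (\<Sum>i\<in>S. X s t i)"
    if S: "S \<subseteq> {..<n}" and st: "0 \<le> s" "0 \<le> t" for S s t
  proof -
    define \<tau> where "\<tau> i = (if i = 0 then if 0 \<in> S then s else 0 else if i = n then if 0 \<in> S then t else 0
        else if i \<in> S then 1 else 0)" for i
    have "(\<Sum>i\<le>n. \<tau> i *\<^sub>R A i x) = (\<Sum>i\<in>S. M s t x i)" for x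
    proof -
      have "(\<Sum>i\<le>n. \<tau> i *\<^sub>R A i x) = (\<Sum>i\<in>S. if i = 0 then \<tau> 0 *\<^sub>R A 0 x + \<tau> n *\<^sub>R A n x else \<tau> i *\<^sub>R A i x)"
        by (rule sum_merge_last[OF n0 S]) (auto simp: \<tau>_def)
      also have "\<dots> = (\<Sum>i\<in>S. M s t x i)"
        using S n0 by (intro sum.cong) (auto simp: \<tau>_def M_def)
      finally show ?thesis .
    qed
    moreover have "(\<Sum>i\<le>n. scale_body (\<tau> i) (hull_body (F i))) = (\<Sum>i\<in>S. X s t i)"
    proof -
      have "(\<Sum>i\<le>n. scale_body (\<tau> i) (hull_body (F i))) = (\<Sum>i\<in>S. if i = 0
          then scale_body (\<tau> 0) (hull_body (F 0)) + scale_body (\<tau> n) (hull_body (F n)) else scale_body (\<tau> i) (hull_body (F i)))"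
        by (rule sum_merge_last[OF n0 S]) (auto simp: \<tau>_def)
      also have "\<dots> = (\<Sum>i\<in>S. X s t i)"
        using S n0 by (intro sum.cong) (auto simp: \<tau>_def X_def)
      finally show ?thesis .
    qed
    moreover have "0 \<le> \<tau> i" for i using st by (simp add: \<tau>_def)
    ultimately show "(\<lambda>x. det (\<Sum>i\<in>S. M s t x i)) absolutely_integrable_on UNIV"
        "integral UNIV (\<lambda>x. det (\<Sum>i\<in>S. M s t x i)) = vol (\<Sum>i\<in>S. X s t i)"
      using vol_sum_polytopes[of "{..n}" F \<tau>] F int by (simp_all add: A_def)
  qed
  have W: "((\<lambda>x. polarize (\<lambda>S. det (\<Sum>i\<in>S. M s t x i)) {..<n}) has_integral
      polarize (\<lambda>S. vol (\<Sum>i\<in>S. X s t i)) {..<n}) UNIV" if st: "0 \<le> s" "0 \<le> t" for s t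
    unfolding polarize_def
  proof (intro has_integral_sum has_integral_mult_right)
    fix S assume "S \<in> Pow {..<n}"
    then have "S \<subseteq> {..<n}" by blast
    from v[OF this st] show "((\<lambda>x. det (\<Sum>i\<in>S. M s t x i)) has_integral vol (\<Sum>i\<in>S. X s t i)) UNIV"
      by (metis integrable_integral set_lebesgue_integral_eq_integral(1))
  qed simp
  have card: "card {..<n} = CARD('a basis_ix)"
  proof -
    have "CARD('a basis_ix) = card (Basis :: 'a set)"
      using type_definition.card[OF type_definition_basis_ix] by metis
    then show ?thesis by (simp add: n)
  qed
  have "polarize (\<lambda>S. det (\<Sum>i\<in>S. M s t x i)) {..<n}
      = s * polarize (\<lambda>S. det (\<Sum>i\<in>S. M 1 0 x i)) {..<n} + t * polarize (\<lambda>S. det (\<Sum>i\<in>S. M 0 1 x i)) {..<n}" for x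
    by (rule polarize_det_linear[OF _ card, of 0]) (use n0 in \<open>auto simp: M_def\<close>)
  then have "((\<lambda>x. polarize (\<lambda>S. det (\<Sum>i\<in>S. M s t x i)) {..<n}) has_integral
      s * polarize (\<lambda>S. vol (\<Sum>i\<in>S. X 1 0 i)) {..<n} + t * polarize (\<lambda>S. vol (\<Sum>i\<in>S. X 0 1 i)) {..<n}) UNIV"
    using W[of 1 0] W[of 0 1] by (simp add: has_integral_add has_integral_mult_right)
  with W[OF st] show ?thesis by (rule has_integral_unique)
qed

lemma polarize_vol_linear:
  fixes K :: "nat \<Rightarrow> 'a body"
  assumes st: "0 \<le> s" "0 \<le> t"
  defines "X \<equiv> \<lambda>s t i. if i = 0 then scale_body s (K 0) + scale_body t (K n) else K i"
  shows "polarize (\<lambda>S. vol (\<Sum>i\<in>S. X s t i)) {..<n}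
    = s * polarize (\<lambda>S. vol (\<Sum>i\<in>S. X 1 0 i)) {..<n} + t * polarize (\<lambda>S. vol (\<Sum>i\<in>S. X 0 1 i)) {..<n}"
proof -
  have "\<exists>F. finite F \<and> interior (convex hull F) \<noteq> {} \<and> body_set (K i) \<subseteq> convex hull F \<and>
      dist (hull_body F) (K i) \<le> inverse (real (Suc m))" for i m
    by (rule outer_polytope[of "inverse (real (Suc m))" "K i"]) (simp, blast)
  then obtain F where F: "\<And>i m. finite (F i m)" "\<And>i m. interior (convex hull F i m) \<noteq> {}"
    "\<And>i m. body_set (K i) \<subseteq> convex hull F i m" "\<And>i m. dist (hull_body (F i m)) (K i) \<le> inverse (real (Suc m))"
    by metis
  define Y where "Y m s t i = (if i = 0 then scale_body s (hull_body (F 0 m)) + scale_body t (hull_body (F n m)) else hull_body (F i m))"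
    for m s t i
  have sub: "body_set (K i) \<subseteq> body_set (hull_body (F i m))" for i m
  proof -
    have "F i m \<noteq> {}" using F(2)[of i m] by auto
    then show ?thesis using F(1,3) by (simp add: body_set_hull_body finite_imp_compact)
  qed
  have lim: "(\<lambda>m. hull_body (F i m)) \<longlonglongrightarrow> K i" for i
  proof (subst tendsto_dist_iff, rule Lim_null_comparison)
    show "\<forall>\<^sub>F m in sequentially. norm (dist (hull_body (F i m)) (K i)) \<le> inverse (real (Suc m))"
      using F(4) by simp
    show "(\<lambda>m. inverse (real (Suc m))) \<longlonglongrightarrow> 0" by (rule LIMSEQ_inverse_real_of_nat)
  qed
  have W: "(\<lambda>m. polarize (\<lambda>S. vol (\<Sum>i\<in>S. Y m s t i)) {..<n}) \<longlonglongrightarrow> polarize (\<lambda>S. vol (\<Sum>i\<in>S. X s t i)) {..<n}" for s t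
    unfolding polarize_def
  proof (intro tendsto_sum tendsto_mult_left vol_tendsto_outer)
    fix S assume S: "S \<in> Pow {..<n}"
    show "body_set (\<Sum>i\<in>S. X s t i) \<subseteq> body_set (\<Sum>i\<in>S. Y m s t i)" for m
    proof (rule body_sum_mono)
      show "finite S" using S finite_subset by blast
      fix i
      show "body_set (X s t i) \<subseteq> body_set (Y m s t i)"
        using sub[of _ m] by (fastforce simp: X_def Y_def mem_body_plus mem_scale_body)
    qed
    have "(\<lambda>m. Y m s t i) \<longlonglongrightarrow> X s t i" for i
      by (auto simp: X_def Y_def intro!: tendsto_body_plus tendsto_scale_body lim)
    then show "(\<lambda>m. \<Sum>i\<in>S. Y m s t i) \<longlonglongrightarrow> (\<Sum>i\<in>S. X s t i)" by (intro tendsto_body_sum)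
  qed
  have "polarize (\<lambda>S. vol (\<Sum>i\<in>S. Y m s t i)) {..<n}
    = s * polarize (\<lambda>S. vol (\<Sum>i\<in>S. Y m 1 0 i)) {..<n} + t * polarize (\<lambda>S. vol (\<Sum>i\<in>S. Y m 0 1 i)) {..<n}" for m
    unfolding Y_def by (rule polarize_vol_linear_polytopes) (use F st in auto)
  then have "(\<lambda>m. polarize (\<lambda>S. vol (\<Sum>i\<in>S. Y m s t i)) {..<n}) \<longlonglongrightarrow>
    s * polarize (\<lambda>S. vol (\<Sum>i\<in>S. X 1 0 i)) {..<n} + t * polarize (\<lambda>S. vol (\<Sum>i\<in>S. X 0 1 i)) {..<n}"
    using W[of 1 0] W[of 0 1] by (simp add: tendsto_add tendsto_mult_left)
  with W[of s t] show ?thesis by (rule LIMSEQ_unique)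
qed

end

definition polarized_volume :: "'a::euclidean_space body list \<Rightarrow> real" where
  "polarized_volume Ks = (if length Ks = DIM('a)
     then polarize (\<lambda>S. vol (\<Sum>i\<in>S. Ks ! i)) {..<DIM('a)} / fact DIM('a) else 0)"

lemma polarized_volume_linear:
  fixes K L :: "'a::euclidean_space body"
  assumes st: "0 \<le> s" "0 \<le> t"
  shows "polarized_volume ((scale_body s K + scale_body t L) # Ms)
    = s * polarized_volume (K # Ms) + t * polarized_volume (L # Ms)"
proof (cases "Suc (length Ms) = DIM('a)")
  case True
  define B where "B i = (if i = 0 then K else if i = DIM('a) then L else Ms ! (i - 1))" for i
  define X where "X s t i = (if i = 0 then scale_body s (B 0) + scale_body t (B DIM('a)) else B i)" for s t i
  have *: "polarize (\<lambda>S. vol (\<Sum>i\<in>S. ((scale_body s K + scale_body t L) # Ms) ! i)) {..<DIM('a)}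
      = polarize (\<lambda>S. vol (\<Sum>i\<in>S. X s t i)) {..<DIM('a)}" for s t
    by (rule polarize_cong, rule arg_cong[where f=vol], rule sum.cong)
       (auto simp: X_def B_def nth_Cons' subset_iff)
  have "polarize (\<lambda>S. vol (\<Sum>i\<in>S. X s t i)) {..<DIM('a)}
    = s * polarize (\<lambda>S. vol (\<Sum>i\<in>S. X 1 0 i)) {..<DIM('a)} + t * polarize (\<lambda>S. vol (\<Sum>i\<in>S. X 0 1 i)) {..<DIM('a)}"
    unfolding X_def by (rule polarize_vol_linear[OF refl st])
  then show ?thesis
    using True *[of s t] *[of 1 0] *[of 0 1] by (simp add: polarized_volume_def add_divide_distrib)
qed (simp add: polarized_volume_def)

lemma polarized_volume_mset:
  assumes "mset Ks = mset Ls"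
  shows "polarized_volume Ks = polarized_volume (Ls :: 'a::euclidean_space body list)"
proof (cases "length Ls = DIM('a)")
  case True
  obtain p where p: "p permutes {..<length Ls}" "permute_list p Ls = Ks"
    using assms by (rule mset_eq_permutation)
  let ?I = "{..<length Ls}"
  have len: "length Ks = length Ls" using assms by (rule mset_eq_length)
  have "polarize (\<lambda>S. vol (\<Sum>i\<in>S. Ks ! i)) ?I = polarize (\<lambda>S. vol (\<Sum>i\<in>S. Ls ! p i)) ?I"
    by (rule polarize_cong, rule arg_cong[where f=vol], rule sum.cong)
       (use p in \<open>auto simp: permute_list_nth subset_iff\<close>)
  also have "\<dots> = polarize (\<lambda>S. vol (\<Sum>i\<in>S. Ls ! i)) ?I"
    unfolding polarize_def
  proof (rule sum.reindex_bij_betw[of "(`) p" "Pow ?I", symmetric, THEN trans[OF _ sum.cong], OF _ refl, symmetric])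
    show "bij_betw ((`) p) (Pow ?I) (Pow ?I)" by (intro bij_betw_Pow permutes_imp_bij p)
    fix S
    have inj: "inj_on p S" using permutes_inj[OF p(1)] by (rule inj_on_subset) simp
    show "(-1) ^ (card ?I - card (p ` S)) * vol (\<Sum>i\<in>p ` S. Ls ! i) = (-1) ^ (card ?I - card S) * vol (\<Sum>i\<in>S. Ls ! p i)"
      using inj by (simp add: card_image sum.reindex)
  qed
  finally show ?thesis using True len by (simp add: polarized_volume_def)
qed (use mset_eq_length[OF assms] in \<open>simp add: polarized_volume_def\<close>)

lemma polarized_volume_replicate: "polarized_volume (replicate DIM('a) K) = vol (K :: 'a::euclidean_space body)"
proof -
  let ?I = "{..<DIM('a)}"
  have "polarize (\<lambda>S. vol (\<Sum>i\<in>S. replicate DIM('a) K ! i)) ?I = polarize (\<lambda>S. \<Sum>xs\<in>words S (card ?I). vol K) ?I"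
  proof (rule polarize_cong)
    fix S assume S: "S \<subseteq> ?I"
    then have fin: "finite S" using finite_subset by blast
    have "(\<Sum>i\<in>S. replicate DIM('a) K ! i) = (\<Sum>i\<in>S. K)" by (rule sum.cong) (use S in auto)
    then have "vol (\<Sum>i\<in>S. replicate DIM('a) K ! i) = real (card S) ^ DIM('a) * vol K"
      using fin by (simp add: sum_const_body vol_scale_body)
    moreover have "card (words S DIM('a)) = card S ^ DIM('a)"
      using fin by (simp add: words_def card_lists_length_eq)
    ultimately show "vol (\<Sum>i\<in>S. replicate DIM('a) K ! i) = (\<Sum>xs\<in>words S (card ?I). vol K)" by simp
  qed
  also have "\<dots> = fact DIM('a) * vol K" unfolding polarize_words[OF finite_lessThan] by simp
  finally show ?thesis by (simp add: polarized_volume_def)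
qed

lemma is_mixed_volume_polarized_volume: "is_mixed_volume polarized_volume"
  unfolding is_mixed_volume_def
proof (intro conjI allI impI)
  show "polarized_volume Ks = 0" if "length Ks \<noteq> DIM('a)" for Ks :: "'a body list"
    using that by (simp add: polarized_volume_def)
qed (rule polarized_volume_mset polarized_volume_linear polarized_volume_replicate; assumption)+

lemma is_mixed_volume_sum:
  assumes V: "is_mixed_volume (V :: 'a::euclidean_space body list \<Rightarrow> real)"
  shows "V ((\<Sum>i\<in>S. K i) # Ms) = (\<Sum>i\<in>S. V (K i # Ms))"
proof -
  have lin: "V ((scale_body s K + scale_body t L) # Ms) = s * V (K # Ms) + t * V (L # Ms)" if "0 \<le> s" "0 \<le> t" for s t K L
    using V that by (simp add: is_mixed_volume_def)
  have "V (0 # Ms) = 0" using lin[of 0 0 0 0] by simp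
  moreover have "V ((K + L) # Ms) = V (K # Ms) + V (L # Ms)" for K L using lin[of 1 1 K L] by simp
  ultimately show ?thesis by (induction S rule: infinite_finite_induct) simp_all
qed

lemma is_mixed_volume_mset:
  "is_mixed_volume V \<Longrightarrow> mset Ks = mset Ls \<Longrightarrow> V Ks = V Ls"
  unfolding is_mixed_volume_def by blast

lemma is_mixed_volume_replicate_sum:
  assumes V: "is_mixed_volume (V :: 'a::euclidean_space body list \<Rightarrow> real)" and S: "finite S"
  shows "V (replicate m (\<Sum>i\<in>S. K i) @ ys) = (\<Sum>xs\<in>words S m. V (map K xs @ ys))"
proof (induction m arbitrary: ys)
  case (Suc m)
  let ?X = "\<Sum>i\<in>S. K i"
  have "V (replicate (Suc m) ?X @ ys) = (\<Sum>i\<in>S. V (K i # replicate m ?X @ ys))"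
    using is_mixed_volume_sum[OF V, of K S "replicate m ?X @ ys"] by simp
  also have "\<dots> = (\<Sum>i\<in>S. V (replicate m ?X @ K i # ys))"
    by (intro sum.cong refl is_mixed_volume_mset[OF V]) simp
  also have "\<dots> = (\<Sum>i\<in>S. \<Sum>xs\<in>words S m. V (map K xs @ K i # ys))" by (simp only: Suc)
  also have "\<dots> = (\<Sum>i\<in>S. \<Sum>xs\<in>words S m. V (map K (i # xs) @ ys))"
    by (intro sum.cong refl is_mixed_volume_mset[OF V]) simp
  finally show ?case by (simp add: sum_words_Suc)
qed simp

lemma is_mixed_volume_unique:
  assumes V: "is_mixed_volume (V :: 'a::euclidean_space body list \<Rightarrow> real)"
  shows "V = polarized_volume"
proof
  fix Ks :: "'a body list"
  show "V Ks = polarized_volume Ks"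
  proof (cases "length Ks = DIM('a)")
    case True
    let ?I = "{..<DIM('a)}"
    have "polarize (\<lambda>S. vol (\<Sum>i\<in>S. Ks ! i)) ?I = polarize (\<lambda>S. \<Sum>xs\<in>words S (card ?I). V (map ((!) Ks) xs)) ?I"
    proof (rule polarize_cong)
      fix S assume "S \<subseteq> ?I"
      then have fin: "finite S" using finite_subset by blast
      have "vol (\<Sum>i\<in>S. Ks ! i) = V (replicate DIM('a) (\<Sum>i\<in>S. Ks ! i))" using V unfolding is_mixed_volume_def by metis
      then show "vol (\<Sum>i\<in>S. Ks ! i) = (\<Sum>xs\<in>words S (card ?I). V (map ((!) Ks) xs))"
        using is_mixed_volume_replicate_sum[OF V fin, of "DIM('a)" "(!) Ks" "[]"] by simp
    qed
    also have "\<dots> = (\<Sum>xs\<in>permutations_of_set ?I. V (map ((!) Ks) xs))" by (rule polarize_words[OF finite_lessThan])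
    also have "\<dots> = (\<Sum>xs\<in>permutations_of_set ?I. V Ks)"
    proof (rule sum.cong[OF refl], rule is_mixed_volume_mset[OF V])
      fix xs assume "xs \<in> permutations_of_set ?I"
      then have "mset xs = mset [0..<length Ks]"
        using True set_eq_iff_mset_eq_distinct[of xs "[0..<length Ks]"]
        by (simp add: permutations_of_set_def atLeast0LessThan)
      then have "mset (map ((!) Ks) xs) = mset (map ((!) Ks) [0..<length Ks])" by (simp only: mset_map)
      then show "mset (map ((!) Ks) xs) = mset Ks" by (simp only: map_nth)
    qed
    also have "\<dots> = fact DIM('a) * V Ks" by simp
    finally show ?thesis using True by (simp add: polarized_volume_def)
  next
    case False
    then have "V Ks = 0" using V unfolding is_mixed_volume_def by blast
    then show ?thesis using False by (simp add: polarized_volume_def)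
  qed
qed

lemma is_mixed_volume_mixed_volume: "is_mixed_volume mixed_volume"
  unfolding mixed_volume_def
  by (rule theI[of is_mixed_volume, OF is_mixed_volume_polarized_volume is_mixed_volume_unique])

lemma mixed_volume_eq_polarized: "mixed_volume = polarized_volume"
  by (rule is_mixed_volume_unique[OF is_mixed_volume_mixed_volume])

lemmas mixed_volume_mset = is_mixed_volume_mset[OF is_mixed_volume_mixed_volume]
  and mixed_volume_sum = is_mixed_volume_sum[OF is_mixed_volume_mixed_volume]

lemma mixed_volume_linear:
  "0 \<le> s \<Longrightarrow> 0 \<le> t \<Longrightarrow> mixed_volume ((scale_body s K + scale_body t L) # Ms)
    = s * mixed_volume (K # Ms) + t * mixed_volume (L # Ms)"
  using is_mixed_volume_mixed_volume unfolding is_mixed_volume_def by blast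

lemma mixed_volume_replicate [simp]: "mixed_volume (replicate DIM('a) K) = vol (K :: 'a::euclidean_space body)"
  using is_mixed_volume_mixed_volume unfolding is_mixed_volume_def by blast

lemma mixed_volume_add: "mixed_volume ((K + L) # Ms) = mixed_volume (K # Ms) + mixed_volume (L # Ms)"
  using mixed_volume_linear[of 1 1 K L Ms] by simp

lemma mixed_volume_scale: "0 \<le> s \<Longrightarrow> mixed_volume (scale_body s K # Ms) = s * mixed_volume (K # Ms)"
  using mixed_volume_linear[of s 0 K K Ms] by simp

lemma mixed_volume_replicate_scale:
  assumes "0 \<le> s"
  shows "mixed_volume (replicate p (scale_body s K) @ Ms) = s ^ p * mixed_volume (replicate p K @ Ms)"
proof (induction p arbitrary: Ms)
  case (Suc p)
  have "mixed_volume (replicate (Suc p) (scale_body s K) @ Ms) = s * mixed_volume (K # replicate p (scale_body s K) @ Ms)"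
    by (simp add: mixed_volume_scale assms)
  also have "mixed_volume (K # replicate p (scale_body s K) @ Ms) = mixed_volume (replicate p (scale_body s K) @ K # Ms)"
    by (rule mixed_volume_mset) simp
  also have "\<dots> = s ^ p * mixed_volume (replicate p K @ K # Ms)" by (rule Suc)
  also have "mixed_volume (replicate p K @ K # Ms) = mixed_volume (replicate (Suc p) K @ Ms)"
    by (rule mixed_volume_mset) simp
  finally show ?case by simp
qed simp

lemma binomial_sum_Suc:
  fixes f :: "nat \<Rightarrow> real"
  shows "(\<Sum>i\<le>Suc p. real (Suc p choose i) * f i) = (\<Sum>i\<le>p. real (p choose i) * f i) + (\<Sum>i\<le>p. real (p choose i) * f (Suc i))"
proof -
  have "(\<Sum>i\<le>Suc p. real (Suc p choose i) * f i) = f 0 + (\<Sum>i\<le>p. real (p choose i) * f (Suc i)) + (\<Sum>i\<le>p. real (p choose Suc i) * f (Suc i))"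
    by (simp only: sum.atMost_Suc_shift) (simp add: sum.distrib distrib_right)
  moreover have "(\<Sum>i\<le>p. real (p choose i) * f i) = (\<Sum>i\<le>Suc p. real (p choose i) * f i)" by simp
  moreover have "\<dots> = f 0 + (\<Sum>i\<le>p. real (p choose Suc i) * f (Suc i))"
    by (simp only: sum.atMost_Suc_shift) simp
  ultimately show ?thesis by linarith
qed

lemma mixed_volume_binomial:
  "mixed_volume (replicate p (K + L) @ Ms)
    = (\<Sum>i\<le>p. real (p choose i) * mixed_volume (replicate (p - i) K @ replicate i L @ Ms))"
proof (induction p arbitrary: Ms)
  case (Suc p)
  let ?W = "\<lambda>i. mixed_volume (replicate (Suc p - i) K @ replicate i L @ Ms)"
  have swap: "mixed_volume (X # replicate p (K + L) @ Ms) = mixed_volume (replicate p (K + L) @ X # Ms)" for X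
    by (rule mixed_volume_mset) simp
  have "mixed_volume (replicate (Suc p) (K + L) @ Ms)
      = (\<Sum>i\<le>p. real (p choose i) * mixed_volume (replicate (p - i) K @ replicate i L @ K # Ms))
      + (\<Sum>i\<le>p. real (p choose i) * mixed_volume (replicate (p - i) K @ replicate i L @ L # Ms))"
    unfolding replicate_Suc append_Cons mixed_volume_add unfolding swap Suc ..
  also have "(\<Sum>i\<le>p. real (p choose i) * mixed_volume (replicate (p - i) K @ replicate i L @ K # Ms))
      = (\<Sum>i\<le>p. real (p choose i) * ?W i)"
    by (intro sum.cong refl arg_cong2[where f="(*)"] mixed_volume_mset) (simp add: Suc_diff_le)
  also have "(\<Sum>i\<le>p. real (p choose i) * mixed_volume (replicate (p - i) K @ replicate i L @ L # Ms))
      = (\<Sum>i\<le>p. real (p choose i) * ?W (Suc i))"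
    by (intro sum.cong refl arg_cong2[where f="(*)"] mixed_volume_mset) simp
  finally show ?case by (simp only: binomial_sum_Suc)
qed simp

subsection \<open>Lipschitz bounds\<close>

definition unit_ball_body :: "'a::euclidean_space body" where
  "unit_ball_body = Body (cball 0 1)"

lemma body_set_unit_ball [simp]: "body_set unit_ball_body = cball 0 1"
  unfolding unit_ball_body_def by (rule body_set_Body) auto

lemma body_sum_subset_cball:
  assumes S: "S \<subseteq> {..<n}" and K: "\<And>i. i \<in> S \<Longrightarrow> body_set (K i) \<subseteq> cball 0 r" and r: "0 \<le> r"
  shows "body_set (\<Sum>i\<in>S. K i) \<subseteq> cball 0 (real n * r)"
proof
  fix x assume "x \<in> body_set (\<Sum>i\<in>S. K i)"
  moreover have fin: "finite S" using S finite_subset by blast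
  ultimately obtain s where s: "\<And>i. i \<in> S \<Longrightarrow> s i \<in> body_set (K i)" "x = sum s S"
    unfolding mem_body_sum[OF fin] by blast
  have "norm x \<le> (\<Sum>i\<in>S. r)" unfolding s(2) using s(1) K by (intro sum_norm_le) force
  also have "\<dots> \<le> real n * r" using card_mono[OF finite_lessThan S] r by (simp add: mult_right_mono)
  finally show "x \<in> cball 0 (real n * r)" by simp
qed

lemma polarize_bound:
  assumes "finite I" "\<And>S. S \<subseteq> I \<Longrightarrow> \<bar>f S\<bar> \<le> M"
  shows "\<bar>polarize f I\<bar> \<le> 2 ^ card I * M"
proof -
  have "\<bar>polarize f I\<bar> \<le> (\<Sum>S\<in>Pow I. \<bar>(-1) ^ (card I - card S) * f S\<bar>)"
    unfolding polarize_def by (rule sum_abs)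
  also have "\<dots> \<le> (\<Sum>S\<in>Pow I. M)" using assms(2) by (intro sum_mono) (auto simp: abs_mult power_abs)
  also have "\<dots> = 2 ^ card I * M" using assms(1) by (simp add: card_Pow)
  finally show ?thesis .
qed

lemma mixed_volume_bounded:
  assumes r: "0 \<le> r"
  obtains C where "0 \<le> C"
    "\<And>Ks :: 'a::euclidean_space body list. (\<And>K. K \<in> set Ks \<Longrightarrow> body_set K \<subseteq> cball 0 r) \<Longrightarrow> \<bar>mixed_volume Ks\<bar> \<le> C"
proof
  let ?n = "DIM('a)"
  let ?B = "scale_body (real ?n * r) unit_ball_body :: 'a body"
  show "0 \<le> 2 ^ ?n * vol ?B / fact ?n" by (simp add: vol_nonneg)
  have B: "body_set ?B = cball 0 (real ?n * r)"
  proof (cases "r = 0")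
    case False
    then show ?thesis using r cball_scale[of "real ?n * r" 0 1] by (simp add: scale_body.rep_eq)
  qed (simp add: scale_body.rep_eq image_constant_conv)
  fix Ks :: "'a body list" assume Ks: "\<And>K. K \<in> set Ks \<Longrightarrow> body_set K \<subseteq> cball 0 r"
  show "\<bar>mixed_volume Ks\<bar> \<le> 2 ^ ?n * vol ?B / fact ?n"
  proof (cases "length Ks = ?n")
    case True
    have "\<bar>vol (\<Sum>i\<in>S. Ks ! i)\<bar> \<le> vol ?B" if S: "S \<subseteq> {..<?n}" for S
    proof -
      have "body_set (\<Sum>i\<in>S. Ks ! i) \<subseteq> body_set ?B"
        unfolding B using S True by (intro body_sum_subset_cball Ks r) auto
      then show ?thesis using vol_mono vol_nonneg by (metis abs_of_nonneg)
    qed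
    then have "\<bar>polarize (\<lambda>S. vol (\<Sum>i\<in>S. Ks ! i)) {..<?n}\<bar> \<le> 2 ^ card {..<?n} * vol ?B"
      by (intro polarize_bound) auto
    then show ?thesis
      using True by (simp add: mixed_volume_eq_polarized polarized_volume_def divide_right_mono)
  qed (simp add: mixed_volume_eq_polarized polarized_volume_def vol_nonneg)
qed

lemma mem_plus_scaled_ball:
  assumes s: "0 \<le> s"
  shows "x \<in> body_set (L + scale_body s unit_ball_body) \<longleftrightarrow> (\<exists>y\<in>body_set L. dist x y \<le> s)"
proof
  show "\<exists>y\<in>body_set L. dist x y \<le> s" if h: "x \<in> body_set (L + scale_body s unit_ball_body)"
  proof -
    obtain y b where "y \<in> body_set L" "b \<in> body_set (scale_body s unit_ball_body)" "x = y + b"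
      using h unfolding mem_body_plus by blast
    moreover from this(2) obtain z where "norm z \<le> 1" "b = s *\<^sub>R z" by (auto simp: mem_scale_body)
    moreover have "s * norm z \<le> s * 1" using s \<open>norm z \<le> 1\<close> by (intro mult_left_mono)
    ultimately show ?thesis using s by (intro bexI[of _ y]) (auto simp: dist_norm)
  qed
next
  assume "\<exists>y\<in>body_set L. dist x y \<le> s"
  then obtain y where y: "y \<in> body_set L" "dist x y \<le> s" by blast
  show "x \<in> body_set (L + scale_body s unit_ball_body)"
  proof (cases "s = 0")
    case True
    then show ?thesis using y by simp
  next
    case False
    then have "norm ((1 / s) *\<^sub>R (x - y)) \<le> 1" using y s by (simp add: dist_norm divide_simps)
    moreover have "x = y + s *\<^sub>R ((1 / s) *\<^sub>R (x - y))" using False by simp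
    moreover have "s *\<^sub>R ((1 / s) *\<^sub>R (x - y)) \<in> body_set (scale_body s unit_ball_body)"
      using calculation(1) unfolding mem_scale_body by (intro bexI[of _ "(1 / s) *\<^sub>R (x - y)"]) auto
    ultimately show ?thesis using y(1) unfolding mem_body_plus by blast
  qed
qed

lemma vol_plus_scaled_ball_le:
  assumes r: "0 \<le> r"
  obtains C where "0 \<le> C" "\<And>L s. body_set L \<subseteq> cball 0 r \<Longrightarrow> 0 \<le> s \<Longrightarrow> s \<le> r \<Longrightarrow>
    vol (L + scale_body s unit_ball_body) \<le> vol (L :: 'a::euclidean_space body) + C * s"
proof -
  let ?n = "DIM('a)"
  obtain D where D: "0 \<le> D" "\<And>Ks :: 'a body list. (\<And>K. K \<in> set Ks \<Longrightarrow> body_set K \<subseteq> cball 0 (max r 1)) \<Longrightarrow> \<bar>mixed_volume Ks\<bar> \<le> D"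
    using mixed_volume_bounded[of "max r 1"] by (metis max.cobounded2 order_trans zero_le_one)
  show ?thesis
  proof
    show "0 \<le> 2 ^ ?n * (1 + r) ^ ?n * D" using D r by simp
    fix L :: "'a body" and s :: real assume L: "body_set L \<subseteq> cball 0 r" and s: "0 \<le> s" "s \<le> r"
    let ?V = "\<lambda>i. mixed_volume (replicate i unit_ball_body @ replicate (?n - i) L)"
    have V: "\<bar>?V i\<bar> \<le> D" for i
      by (rule D(2)) (use L in \<open>auto simp: subset_iff le_max_iff_disj split: if_splits\<close>)
    have summand: "real (?n choose i) * (s ^ i * ?V i) \<le> real (?n choose i) * (s * ((1 + r) ^ ?n * D))"
      if i: "i \<noteq> 0" "i \<le> ?n" for i
    proof -
      have "s ^ i = s * s ^ (i - 1)" using i by (cases i) auto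
      also have "s ^ (i - 1) \<le> (1 + r) ^ (i - 1)" using s by (intro power_mono) auto
      also have "(1 + r) ^ (i - 1) \<le> (1 + r) ^ ?n" using i r by (intro power_increasing) auto
      finally have pow: "s ^ i \<le> s * (1 + r) ^ ?n" using s by (simp add: mult_left_mono)
      have "s ^ i * ?V i \<le> s ^ i * D" using V[of i] s by (intro mult_left_mono) auto
      also have "\<dots> \<le> (s * (1 + r) ^ ?n) * D" using pow D by (intro mult_right_mono) auto
      finally have "s ^ i * ?V i \<le> s * (1 + r) ^ ?n * D" .
      then show ?thesis by (intro mult_left_mono) (simp_all add: mult.assoc)
    qed
    have "vol (L + scale_body s unit_ball_body) = mixed_volume (replicate ?n (L + scale_body s unit_ball_body) @ [])"
      by simp
    also have "\<dots> = (\<Sum>i\<le>?n. real (?n choose i) * mixed_volume (replicate i (scale_body s unit_ball_body) @ replicate (?n - i) L))"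
      unfolding mixed_volume_binomial
      by (intro sum.cong refl arg_cong2[where f="(*)"] mixed_volume_mset) simp
    also have "\<dots> = (\<Sum>i\<le>?n. real (?n choose i) * (s ^ i * ?V i))"
      by (simp only: mixed_volume_replicate_scale[OF s(1)])
    also have "\<dots> = vol L + (\<Sum>i\<in>{..?n} - {0}. real (?n choose i) * (s ^ i * ?V i))"
      by (simp add: sum.remove[of "{..?n}" 0])
    also have "(\<Sum>i\<in>{..?n} - {0}. real (?n choose i) * (s ^ i * ?V i))
        \<le> (\<Sum>i\<in>{..?n} - {0}. real (?n choose i) * (s * ((1 + r) ^ ?n * D)))"
      using summand by (intro sum_mono) auto
    also have "\<dots> \<le> (\<Sum>i\<in>{..?n}. real (?n choose i) * (s * ((1 + r) ^ ?n * D)))"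
      using s r D by (intro sum_mono2) auto
    also have "\<dots> = 2 ^ ?n * (s * ((1 + r) ^ ?n * D))"
    proof -
      have "(\<Sum>i\<le>?n. real (?n choose i)) = 2 ^ ?n"
        using choose_row_sum[of ?n] by (metis of_nat_numeral of_nat_power of_nat_sum)
      then show ?thesis by (simp add: sum_distrib_right[symmetric])
    qed
    finally show "vol (L + scale_body s unit_ball_body) \<le> vol L + 2 ^ ?n * (1 + r) ^ ?n * D * s"
      by (simp add: mult.commute mult.left_commute)
  qed
qed

lemma dist_body_le_diameter:
  assumes "body_set K \<subseteq> cball 0 r" "body_set L \<subseteq> cball 0 r"
  shows "dist (K :: 'a::euclidean_space body) L \<le> 2 * r"
proof -
  obtain a b where "a \<in> body_set K" "b \<in> body_set L" using body_set_props(1) by blast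
  moreover have "dist x y \<le> 2 * r" if "x \<in> cball 0 r" "y \<in> cball 0 r" for x y :: 'a
    using that dist_triangle2[of x y 0] by (auto simp: dist_norm)
  ultimately show ?thesis using assms by (intro dist_body_leI) blast+
qed

lemma vol_lipschitz:
  assumes r: "0 \<le> r"
  obtains C where "0 \<le> C" "\<And>K L. body_set K \<subseteq> cball 0 r \<Longrightarrow> body_set L \<subseteq> cball 0 r \<Longrightarrow>
    \<bar>vol K - vol (L :: 'a::euclidean_space body)\<bar> \<le> C * dist K L"
proof -
  obtain C where C: "0 \<le> C" "\<And>(L :: 'a body) s. body_set L \<subseteq> cball 0 (2 * r) \<Longrightarrow> 0 \<le> s \<Longrightarrow> s \<le> 2 * r \<Longrightarrow>
    vol (L + scale_body s unit_ball_body) \<le> vol L + C * s"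
    using vol_plus_scaled_ball_le[of "2 * r"] r by (metis mult_nonneg_nonneg zero_le_numeral)
  have *: "vol K - vol L \<le> C * dist K L" if KL: "body_set K \<subseteq> cball 0 r" "body_set L \<subseteq> cball 0 r" for K L :: "'a body"
  proof -
    have "body_set K \<subseteq> body_set (L + scale_body (dist K L) unit_ball_body)"
      using dist_body_le[OF order_refl] by (force simp: mem_plus_scaled_ball)
    then have "vol K \<le> vol (L + scale_body (dist K L) unit_ball_body)" by (rule vol_mono)
    also have "\<dots> \<le> vol L + C * dist K L"
      using KL r dist_body_le_diameter[OF KL] by (intro C(2)) (auto simp: subset_iff intro: order_trans)
    finally show ?thesis by simp
  qed
  show ?thesis
  proof (rule that[OF C(1)])
    fix K L :: "'a body" assume "body_set K \<subseteq> cball 0 r" "body_set L \<subseteq> cball 0 r"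
    then show "\<bar>vol K - vol L\<bar> \<le> C * dist K L" using *[of K L] *[of L K] by (simp add: dist_commute abs_le_iff)
  qed
qed

lemma body_subset_cball: obtains r where "0 \<le> r" "body_set K \<subseteq> cball 0 r"
proof -
  obtain r where "0 < r" "\<forall>x\<in>body_set K. norm x \<le> r" using body_set_props(5)[of K] unfolding bounded_pos by blast
  then show ?thesis using that[of r] by (simp add: subset_iff)
qed

lemma body_subset_cball_near:
  assumes "body_set K \<subseteq> cball 0 r" "dist L K \<le> e"
  shows "body_set (L :: 'a::euclidean_space body) \<subseteq> cball 0 (r + e)"
proof
  fix x assume "x \<in> body_set L"
  then obtain y where "y \<in> body_set K" "dist x y \<le> e" using dist_body_le assms(2) by blast
  then show "x \<in> cball 0 (r + e)"
    using assms(1) norm_triangle_sub[of x y] by (force simp: dist_norm)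
qed

lemma continuous_on_vol: "continuous_on UNIV (vol :: 'a::euclidean_space body \<Rightarrow> real)"
proof -
  have "(vol \<longlongrightarrow> vol K) (at K)" for K :: "'a body"
  proof -
    obtain r where r: "0 \<le> r" "body_set K \<subseteq> cball 0 r" by (rule body_subset_cball)
    obtain C where C: "0 \<le> C" "\<And>(K :: 'a body) L. body_set K \<subseteq> cball 0 (r + 1) \<Longrightarrow> body_set L \<subseteq> cball 0 (r + 1) \<Longrightarrow>
        \<bar>vol K - vol L\<bar> \<le> C * dist K L"
      using vol_lipschitz[of "r + 1"] r by (metis add_nonneg_nonneg zero_le_one)
    show ?thesis
    proof (rule LIM_zero_cancel, rule Lim_null_comparison)
      have "\<forall>\<^sub>F L in at K. dist L K < 1" by (simp add: eventually_at) (use zero_less_one in blast)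
      then show "\<forall>\<^sub>F L in at K. norm (vol L - vol K) \<le> C * dist L K"
      proof eventually_elim
        case (elim L)
        then have "body_set L \<subseteq> cball 0 (r + 1)" using body_subset_cball_near[OF r(2)] by simp
        moreover have "body_set K \<subseteq> cball 0 (r + 1)" using r(2) by (auto simp: subset_iff intro: order_trans)
        ultimately show ?case using C(2) by simp
      qed
      have "((\<lambda>L. dist L K) \<longlongrightarrow> 0) (at K)"
        by (rule tendsto_dist_iff[THEN iffD1, OF tendsto_ident_at])
      then show "((\<lambda>L. C * dist L K) \<longlongrightarrow> 0) (at K)" by (rule tendsto_mult_right_zero)
    qed
  qed
  then show ?thesis by (simp add: continuous_on_def)
qed

lemma dist_body_sum: "dist (\<Sum>i\<in>I. K i) (\<Sum>i\<in>I. L i :: 'a::euclidean_space body) \<le> (\<Sum>i\<in>I. dist (K i) (L i))"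
proof (induction I rule: infinite_finite_induct)
  case (insert i I)
  then show ?case using dist_body_plus[of "K i" "\<Sum>i\<in>I. K i" "L i" "\<Sum>i\<in>I. L i"] by simp
qed simp_all

lemma mixed_volume_lipschitz:
  assumes r: "0 \<le> r"
  obtains C where "0 \<le> C" "\<And>K L Ms. (\<And>M. M \<in> set (K # L # Ms) \<Longrightarrow> body_set M \<subseteq> cball 0 r) \<Longrightarrow>
    \<bar>mixed_volume (K # Ms) - mixed_volume (L # Ms)\<bar> \<le> C * dist K (L :: 'a::euclidean_space body)"
proof -
  let ?n = "DIM('a)"
  obtain C where C: "0 \<le> C" "\<And>(K :: 'a body) L. body_set K \<subseteq> cball 0 (real ?n * r) \<Longrightarrow> body_set L \<subseteq> cball 0 (real ?n * r) \<Longrightarrow>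
        \<bar>vol K - vol L\<bar> \<le> C * dist K L"
    using vol_lipschitz[of "real ?n * r"] r by (metis mult_nonneg_nonneg of_nat_0_le_iff)
  show ?thesis
  proof
    show "0 \<le> 2 ^ ?n * C / fact ?n" using C by simp
    fix K L :: "'a body" and Ms assume *: "\<And>M. M \<in> set (K # L # Ms) \<Longrightarrow> body_set M \<subseteq> cball 0 r"
    show "\<bar>mixed_volume (K # Ms) - mixed_volume (L # Ms)\<bar> \<le> 2 ^ ?n * C / fact ?n * dist K L"
    proof (cases "Suc (length Ms) = ?n")
      case True
      let ?f = "\<lambda>K S. vol (\<Sum>i\<in>S. (K # Ms) ! i)"
      have "\<bar>?f K S - ?f L S\<bar> \<le> C * dist K L" if S: "S \<subseteq> {..<?n}" for S
      proof -
        have fin: "finite S" using S finite_subset by blast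
        have in_set: "(M # Ms) ! i \<in> set (M # Ms)" if "i \<in> S" for i M
          using that S True by (intro nth_mem) auto
        have sub: "body_set (\<Sum>i\<in>S. (M # Ms) ! i) \<subseteq> cball 0 (real ?n * r)" if "M = K \<or> M = L" for M
        proof (rule body_sum_subset_cball[OF S _ r])
          fix i assume "i \<in> S"
          then show "body_set ((M # Ms) ! i) \<subseteq> cball 0 r" using in_set[of i M] that by (intro *) auto
        qed
        have "\<bar>?f K S - ?f L S\<bar> \<le> C * dist (\<Sum>i\<in>S. (K # Ms) ! i) (\<Sum>i\<in>S. (L # Ms) ! i)"
          by (intro C(2) sub) auto
        also have "\<dots> \<le> C * (\<Sum>i\<in>S. dist ((K # Ms) ! i) ((L # Ms) ! i))"
          by (intro mult_left_mono dist_body_sum C)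
        also have "(\<Sum>i\<in>S. dist ((K # Ms) ! i) ((L # Ms) ! i)) = (\<Sum>i\<in>S. if i = 0 then dist K L else 0)"
          by (intro sum.cong) (auto simp: nth_Cons')
        also have "\<dots> \<le> dist K L" using fin by (simp add: sum.delta)
        finally show ?thesis using C by (simp add: mult_left_mono)
      qed
      then have "\<bar>polarize (\<lambda>S. ?f K S - ?f L S) {..<?n}\<bar> \<le> 2 ^ card {..<?n} * (C * dist K L)"
        by (intro polarize_bound) auto
      moreover have "polarize (\<lambda>S. ?f K S - ?f L S) {..<?n} = polarize (?f K) {..<?n} - polarize (?f L) {..<?n}"
        by (simp add: polarize_def right_diff_distrib sum_subtractf)
      ultimately have "\<bar>(polarize (?f K) {..<?n} - polarize (?f L) {..<?n}) / fact ?n\<bar> \<le> 2 ^ ?n * (C * dist K L) / fact ?n"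
        by (simp add: divide_right_mono)
      then show ?thesis
        using True by (simp add: mixed_volume_eq_polarized polarized_volume_def diff_divide_distrib mult.assoc)
    qed (use C in \<open>simp add: mixed_volume_eq_polarized polarized_volume_def\<close>)
  qed
qed

section \<open>Support functions\<close>

definition supp_fun :: "'a::euclidean_space body \<Rightarrow> 'a \<Rightarrow> real" where
  "supp_fun K x = (SUP z\<in>body_set K. z \<bullet> x)"

lemma supp_fun_attained: obtains z where "z \<in> body_set K" "supp_fun K x = z \<bullet> x" "\<And>y. y \<in> body_set K \<Longrightarrow> y \<bullet> x \<le> z \<bullet> x"
proof -
  obtain z where z: "z \<in> body_set K" "\<And>y. y \<in> body_set K \<Longrightarrow> y \<bullet> x \<le> z \<bullet> x"
    using continuous_attains_sup[OF body_set_props(2,1)[of K] continuous_on_inner[OF continuous_on_id continuous_on_const], of x]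
    by blast
  have "supp_fun K x = z \<bullet> x"
    unfolding supp_fun_def by (rule cSup_eq_maximum) (use z in auto)
  then show ?thesis using that z by blast
qed

lemma supp_fun_ge: "z \<in> body_set K \<Longrightarrow> z \<bullet> x \<le> supp_fun K x"
  by (metis supp_fun_attained)

lemma supp_fun_le: "(\<And>z. z \<in> body_set K \<Longrightarrow> z \<bullet> x \<le> c) \<Longrightarrow> supp_fun K x \<le> c"
  by (metis supp_fun_attained)

lemma supp_fun_eqI: "z \<in> body_set K \<Longrightarrow> (\<And>y. y \<in> body_set K \<Longrightarrow> y \<bullet> x \<le> z \<bullet> x) \<Longrightarrow> supp_fun K x = z \<bullet> x"
  by (metis antisym supp_fun_ge supp_fun_le)

lemma supp_fun_plus: "supp_fun (K + L) x = supp_fun K x + supp_fun L x"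
proof (rule antisym)
  show "supp_fun (K + L) x \<le> supp_fun K x + supp_fun L x"
  proof (rule supp_fun_le)
    fix z assume "z \<in> body_set (K + L)"
    then obtain a b where "a \<in> body_set K" "b \<in> body_set L" "z = a + b" by (auto simp: mem_body_plus)
    then show "z \<bullet> x \<le> supp_fun K x + supp_fun L x"
      using supp_fun_ge[of a K x] supp_fun_ge[of b L x] by (simp add: inner_add_left)
  qed
  obtain a b where "a \<in> body_set K" "supp_fun K x = a \<bullet> x" "b \<in> body_set L" "supp_fun L x = b \<bullet> x"
    using supp_fun_attained by metis
  then show "supp_fun K x + supp_fun L x \<le> supp_fun (K + L) x"
    using supp_fun_ge[of "a + b" "K + L" x] by (auto simp: mem_body_plus inner_add_left)
qed

lemma supp_fun_0 [simp]: "supp_fun 0 x = 0"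
  by (simp add: supp_fun_def)

lemma supp_fun_scale_body:
  assumes t: "0 \<le> t"
  shows "supp_fun (scale_body t K) x = t * supp_fun K x"
proof -
  obtain z where z: "z \<in> body_set K" "supp_fun K x = z \<bullet> x" "\<And>y. y \<in> body_set K \<Longrightarrow> y \<bullet> x \<le> z \<bullet> x"
    by (rule supp_fun_attained[of K x]) (rule that)
  have "supp_fun (scale_body t K) x = (t *\<^sub>R z) \<bullet> x"
    by (rule supp_fun_eqI) (use z t in \<open>auto simp: mem_scale_body mult_left_mono\<close>)
  then show ?thesis using z by simp
qed

lemma supp_fun_scaleR:
  assumes t: "0 \<le> t"
  shows "supp_fun K (t *\<^sub>R x) = t * supp_fun K x"
proof -
  obtain z where z: "z \<in> body_set K" "supp_fun K x = z \<bullet> x" "\<And>y. y \<in> body_set K \<Longrightarrow> y \<bullet> x \<le> z \<bullet> x"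
    by (rule supp_fun_attained[of K x]) (rule that)
  have "supp_fun K (t *\<^sub>R x) = z \<bullet> (t *\<^sub>R x)"
    by (rule supp_fun_eqI) (use z t in \<open>auto simp: mult_left_mono\<close>)
  then show ?thesis using z by simp
qed

lemma supp_fun_sum: "supp_fun (\<Sum>i\<in>I. K i) x = (\<Sum>i\<in>I. supp_fun (K i) x)"
  by (induction I rule: infinite_finite_induct) (simp_all add: supp_fun_plus)

lemma supp_fun_unit_ball: "supp_fun unit_ball_body x = norm x"
proof (cases "x = 0")
  case False
  have "supp_fun unit_ball_body x = ((1 / norm x) *\<^sub>R x) \<bullet> x"
  proof (rule supp_fun_eqI)
    fix y :: 'a assume "y \<in> body_set unit_ball_body"
    then have "norm y * norm x \<le> 1 * norm x" by (intro mult_right_mono) auto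
    then have "y \<bullet> x \<le> 1 * norm x" using norm_cauchy_schwarz[of y x] by linarith
    also have "\<dots> = ((1 / norm x) *\<^sub>R x) \<bullet> x" using False by (simp add: dot_square_norm power2_eq_square)
    finally show "y \<bullet> x \<le> ((1 / norm x) *\<^sub>R x) \<bullet> x" .
  qed (use False in simp)
  then show ?thesis using False by (simp add: dot_square_norm power2_eq_square)
qed (use supp_fun_scaleR[of 0 unit_ball_body x] in simp)

lemma body_subset_plus_ball:
  fixes K L :: "'a::euclidean_space body"
  assumes s: "0 \<le> s" and le: "\<And>u. norm u = 1 \<Longrightarrow> supp_fun K u \<le> supp_fun L u + s" and x: "x \<in> body_set K"
  shows "\<exists>y\<in>body_set L. dist x y \<le> s"
proof -
  define y where "y = closest_point (body_set L) x"
  have y: "y \<in> body_set L" "\<And>z. z \<in> body_set L \<Longrightarrow> (x - y) \<bullet> (z - y) \<le> 0"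
    unfolding y_def by (auto intro!: closest_point_in_set closest_point_dot)
  have "dist x y \<le> s"
  proof (cases "x = y")
    case False
    define u where "u = (1 / norm (x - y)) *\<^sub>R (x - y)"
    have u: "norm u = 1" using False by (simp add: u_def)
    have "z \<bullet> u \<le> y \<bullet> u" if "z \<in> body_set L" for z
    proof -
      have "(z - y) \<bullet> u = (1 / norm (x - y)) * ((x - y) \<bullet> (z - y))" by (simp add: u_def inner_commute)
      also have "\<dots> \<le> 0" using y(2)[OF that] by (intro mult_nonneg_nonpos) auto
      finally show ?thesis by (simp add: inner_diff_left)
    qed
    then have "supp_fun L u = y \<bullet> u" by (rule supp_fun_eqI[OF y(1)])
    moreover have "x \<bullet> u \<le> supp_fun K u" using x by (rule supp_fun_ge)
    moreover have "(x - y) \<bullet> u = norm (x - y)" using False by (simp add: u_def dot_square_norm power2_eq_square)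
    ultimately show ?thesis using le[OF u] by (simp add: inner_diff_left dist_norm)
  qed (use s in simp)
  then show ?thesis using y(1) by blast
qed

lemma body_subsetI: "(\<And>u. norm u = 1 \<Longrightarrow> supp_fun K u \<le> supp_fun L u) \<Longrightarrow> body_set K \<subseteq> body_set L"
  using body_subset_plus_ball[of 0 K L] by force

lemma body_eq_supp_funI: "(\<And>u. norm u = 1 \<Longrightarrow> supp_fun K u = supp_fun L u) \<Longrightarrow> K = L"
  by (metis body_subsetI antisym body_set_inject order_refl)

lemma dist_body_le_supp_fun:
  assumes "0 \<le> s" "\<And>u. norm u = 1 \<Longrightarrow> \<bar>supp_fun K u - supp_fun L u\<bar> \<le> s"
  shows "dist K L \<le> s"
proof (rule dist_body_leI)
  show "\<exists>y\<in>body_set L. dist x y \<le> s" if "x \<in> body_set K" for x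
    by (rule body_subset_plus_ball[OF assms(1) _ that]) (use assms(2) in \<open>force simp: abs_le_iff\<close>)
  show "\<exists>x\<in>body_set K. dist y x \<le> s" if "y \<in> body_set L" for y
    by (rule body_subset_plus_ball[OF assms(1) _ that]) (use assms(2) in \<open>force simp: abs_le_iff\<close>)
qed

lemma mixed_volume_combination_bound:
  assumes r: "0 \<le> r"
  obtains C where "0 \<le> C"
    "\<And>(Ms :: 'a::euclidean_space body list) (I :: 'i set) a K s.
      \<lbrakk>\<And>M. M \<in> set Ms \<Longrightarrow> body_set M \<subseteq> cball 0 r; 0 \<le> s;
       \<And>u. norm u = 1 \<Longrightarrow> \<bar>\<Sum>i\<in>I. a i * supp_fun (K i) u\<bar> \<le> s\<rbrakk>
      \<Longrightarrow> \<bar>\<Sum>i\<in>I. a i * mixed_volume (K i # Ms)\<bar> \<le> C * s"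
proof -
  obtain C where C: "0 \<le> C" "\<And>(K :: 'a body) L Ms. (\<And>M. M \<in> set (K # L # Ms) \<Longrightarrow> body_set M \<subseteq> cball 0 (max r 1)) \<Longrightarrow>
      \<bar>mixed_volume (K # Ms) - mixed_volume (L # Ms)\<bar> \<le> C * dist K L"
    by (rule mixed_volume_lipschitz[of "max r 1"]) auto
  show ?thesis
  proof (rule that[OF C(1)])
    fix Ms :: "'a body list" and I :: "'i set" and a :: "'i \<Rightarrow> real" and K :: "'i \<Rightarrow> 'a body" and s :: real
    assume Ms: "\<And>M. M \<in> set Ms \<Longrightarrow> body_set M \<subseteq> cball 0 r" and s: "0 \<le> s"
      and le: "\<And>u. norm u = 1 \<Longrightarrow> \<bar>\<Sum>i\<in>I. a i * supp_fun (K i) u\<bar> \<le> s"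
    define P where "P = (\<Sum>i\<in>I. scale_body (max (a i) 0) (K i))"
    define N where "N = (\<Sum>i\<in>I. scale_body (max (- a i) 0) (K i))"
    have a: "max (a i) 0 * y - max (- a i) 0 * y = a i * y" for i y by (simp add: max_def algebra_simps)
    have mv: "mixed_volume (P # Ms) - mixed_volume (N # Ms) = (\<Sum>i\<in>I. a i * mixed_volume (K i # Ms))"
      by (simp add: P_def N_def mixed_volume_sum mixed_volume_scale sum_subtractf[symmetric] a)
    have "supp_fun P u - supp_fun N u = (\<Sum>i\<in>I. a i * supp_fun (K i) u)" for u
      by (simp add: P_def N_def supp_fun_sum supp_fun_scale_body sum_subtractf[symmetric] a)
    then have dist: "dist P N \<le> s" using le by (intro dist_body_le_supp_fun s) simp
    obtain p q where pq: "0 \<le> p" "body_set P \<subseteq> cball 0 p" "0 \<le> q" "body_set N \<subseteq> cball 0 q"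
      using body_subset_cball by metis
    define t where "t = p + q + 1"
    have t: "t > 0" using pq by (simp add: t_def)
    have ball: "body_set (scale_body (1 / t) X) \<subseteq> cball 0 (max r 1)" if "body_set X \<subseteq> cball 0 t" for X :: "'a body"
    proof
      fix x assume "x \<in> body_set (scale_body (1 / t) X)"
      then obtain z where "z \<in> body_set X" "x = (1 / t) *\<^sub>R z" by (auto simp: mem_scale_body)
      then have "norm x \<le> 1" using that t by (auto simp: subset_iff divide_simps)
      then show "x \<in> cball 0 (max r 1)" by simp
    qed
    have PN: "body_set P \<subseteq> cball 0 t" "body_set N \<subseteq> cball 0 t"
      using pq subset_cball[of p t 0] subset_cball[of q t 0] by (auto simp: t_def)
    have "\<bar>mixed_volume (scale_body (1 / t) P # Ms) - mixed_volume (scale_body (1 / t) N # Ms)\<bar>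
        \<le> C * dist (scale_body (1 / t) P) (scale_body (1 / t) N)"
    proof (rule C(2))
      fix M assume "M \<in> set (scale_body (1 / t) P # scale_body (1 / t) N # Ms)"
      then consider "M = scale_body (1 / t) P" | "M = scale_body (1 / t) N" | "M \<in> set Ms" by auto
      then show "body_set M \<subseteq> cball 0 (max r 1)"
      proof cases
        case 3
        from subset_trans[OF Ms[OF this] subset_cball] show ?thesis by simp
      qed (use ball PN in simp_all)
    qed
    also have "\<dots> \<le> C * (1 / t * s)"
    proof (rule mult_left_mono[OF _ C(1)])
      have "1 / t * dist P N \<le> 1 / t * s" using dist t by (intro mult_left_mono) auto
      then show "dist (scale_body (1 / t) P) (scale_body (1 / t) N) \<le> 1 / t * s"
        using dist_scale_body[of "1 / t" P N] t by simp
    qed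
    finally have "\<bar>(1 / t) * (mixed_volume (P # Ms) - mixed_volume (N # Ms))\<bar> \<le> (1 / t) * (C * s)"
      using t by (simp add: mixed_volume_scale right_diff_distrib mult.left_commute)
    then have "\<bar>mixed_volume (P # Ms) - mixed_volume (N # Ms)\<bar> \<le> C * s"
      using t by (simp add: abs_mult divide_le_cancel)
    then show "\<bar>\<Sum>i\<in>I. a i * mixed_volume (K i # Ms)\<bar> \<le> C * s" by (simp only: mv)
  qed
qed

section \<open>Mixed volume valuations\<close>

subsection \<open>Real-valued valuations\<close>

definition real_valuation :: "('a::euclidean_space body \<Rightarrow> real) \<Rightarrow> bool" where
  "real_valuation f \<longleftrightarrow> continuous_on UNIV f \<and> (\<forall>x K. f (translate_body x K) = f K) \<and>
    (\<forall>K L M N. body_set M = body_set K \<union> body_set L \<and> body_set N = body_set K \<inter> body_set L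
       \<longrightarrow> f M + f N = f K + f L)"

lemma val_at_Val_of_real:
  assumes "real_valuation f"
  shows "val_at (Val (\<lambda>K. complex_of_real (f K))) K = complex_of_real (f K)"
proof -
  have "complex_of_real (f M) + complex_of_real (f N) = complex_of_real (f K) + complex_of_real (f L)"
    if "body_set M = body_set K \<union> body_set L \<and> body_set N = body_set K \<inter> body_set L" for K L M N
    using assms that unfolding real_valuation_def of_real_add[symmetric] by metis
  moreover have "continuous_on UNIV (\<lambda>K. complex_of_real (f K))"
    using assms by (intro continuous_on_of_real) (simp add: real_valuation_def)
  moreover have "complex_of_real (f (translate_body x K)) = complex_of_real (f K)" for x K
    using assms by (simp add: real_valuation_def)
  ultimately show ?thesis by (subst Val_inverse) blast+
qed

lemma body_segment_meets_Int:
  fixes K L :: "'a::euclidean_space body"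
  assumes M: "body_set M = body_set K \<union> body_set L" and x: "x \<in> body_set K" and y: "y \<in> body_set L"
  shows "\<exists>u. 0 \<le> u \<and> u \<le> 1 \<and> (1 - u) *\<^sub>R x + u *\<^sub>R y \<in> body_set K \<inter> body_set L"
proof -
  have seg: "closed_segment x y \<subseteq> body_set K \<union> body_set L"
    using closed_segment_subset[of x "body_set M" y] x y body_set_props(3)[of M] unfolding M by blast
  have "body_set K \<inter> body_set L \<inter> closed_segment x y \<noteq> {}"
    using connected_closedD[OF connected_segment(1)[of x y] _ seg] x y by auto
  then show ?thesis by (auto simp: closed_segment_def)
qed

lemma body_Un_Int_plus:
  fixes K L :: "'a::euclidean_space body"
  assumes M: "body_set M = body_set K \<union> body_set L" and N: "body_set N = body_set K \<inter> body_set L"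
  shows "body_set (M + A) = body_set (K + A) \<union> body_set (L + A)"
    and "body_set (N + A) = body_set (K + A) \<inter> body_set (L + A)"
proof -
  show "body_set (M + A) = body_set (K + A) \<union> body_set (L + A)"
    by (simp only: set_eq_iff Un_iff mem_body_plus M bex_Un) blast
  have "z \<in> body_set (N + A)" if z: "z \<in> body_set (K + A)" "z \<in> body_set (L + A)" for z
  proof -
    obtain x a where x: "x \<in> body_set K" "a \<in> body_set A" "z = x + a" using z(1) unfolding mem_body_plus by blast
    obtain y b where y: "y \<in> body_set L" "b \<in> body_set A" "z = y + b" using z(2) unfolding mem_body_plus by blast
    obtain u where u: "0 \<le> u" "u \<le> 1" "(1 - u) *\<^sub>R x + u *\<^sub>R y \<in> body_set N"
      using body_segment_meets_Int[OF M x(1) y(1)] N by auto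
    have "(1 - u) *\<^sub>R a + u *\<^sub>R b \<in> body_set A" using x y u by (intro convexD) auto
    moreover have "z = ((1 - u) *\<^sub>R x + u *\<^sub>R y) + ((1 - u) *\<^sub>R a + u *\<^sub>R b)"
    proof -
      have "((1 - u) *\<^sub>R x + u *\<^sub>R y) + ((1 - u) *\<^sub>R a + u *\<^sub>R b) = (1 - u) *\<^sub>R (x + a) + u *\<^sub>R (y + b)"
        by (simp add: scaleR_add_right)
      also have "\<dots> = (1 - u) *\<^sub>R z + u *\<^sub>R z" using x y by simp
      finally show ?thesis by (simp add: scaleR_add_left[symmetric])
    qed
    ultimately show ?thesis using u(3) unfolding mem_body_plus by blast
  qed
  then show "body_set (N + A) = body_set (K + A) \<inter> body_set (L + A)"
    using N by (fastforce simp: mem_body_plus)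
qed

lemma translate_body_plus: "translate_body x K + A = translate_body x (K + A)"
  by (rule body_eqI) (force simp: mem_body_plus translate_body.rep_eq add.assoc image_iff)

lemma real_valuation_vol: "real_valuation vol"
  unfolding real_valuation_def
proof (intro conjI allI impI)
  fix K L M N :: "'a body"
  assume "body_set M = body_set K \<union> body_set L \<and> body_set N = body_set K \<inter> body_set L"
  then show "vol M + vol N = vol K + vol L"
    using measure_Un3[OF lmeasurable_body[of K] lmeasurable_body[of L]] by (simp add: vol_lebesgue)
qed (simp_all add: continuous_on_vol)

lemma real_valuation_plus:
  fixes f :: "'a::euclidean_space body \<Rightarrow> real"
  assumes f: "real_valuation f"
  shows "real_valuation (\<lambda>K. f (K + A))"
  unfolding real_valuation_def
proof (intro conjI allI impI)
  have "continuous_on UNIV (\<lambda>K. K + A)"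
    unfolding continuous_on_def by (intro ballI tendsto_body_plus tendsto_ident_at tendsto_const)
  then show "continuous_on UNIV (\<lambda>K. f (K + A))"
    using f continuous_on_compose2[of UNIV f UNIV "\<lambda>K. K + A"] by (simp add: real_valuation_def)
  show "f (translate_body x K + A) = f (K + A)" for x K
    using f by (simp add: real_valuation_def translate_body_plus)
  fix K L M N :: "'a body"
  assume "body_set M = body_set K \<union> body_set L \<and> body_set N = body_set K \<inter> body_set L"
  then have "body_set (M + A) = body_set (K + A) \<union> body_set (L + A) \<and> body_set (N + A) = body_set (K + A) \<inter> body_set (L + A)"
    using body_Un_Int_plus by blast
  then show "f (M + A) + f (N + A) = f (K + A) + f (L + A)"
    using f unfolding real_valuation_def by blast
qed

lemma real_valuation_0: "real_valuation (\<lambda>_. 0)"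
  by (simp add: real_valuation_def)

lemma real_valuation_add_scale:
  fixes f :: "'a::euclidean_space body \<Rightarrow> real"
  assumes f: "real_valuation f" and g: "real_valuation g"
  shows "real_valuation (\<lambda>K. c * f K + g K)"
  unfolding real_valuation_def
proof (intro conjI allI impI)
  show "continuous_on UNIV (\<lambda>K. c * f K + g K)"
    using f g by (intro continuous_intros) (simp_all add: real_valuation_def)
  show "c * f (translate_body x K) + g (translate_body x K) = c * f K + g K" for x K
    using f g by (simp add: real_valuation_def)
  fix K L M N :: "'a body"
  assume "body_set M = body_set K \<union> body_set L \<and> body_set N = body_set K \<inter> body_set L"
  then have "f M + f N = f K + f L" "g M + g N = g K + g L" using f g unfolding real_valuation_def by blast+
  then have "c * (f M + f N) + (g M + g N) = c * (f K + f L) + (g K + g L)" by simp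
  then show "c * f M + g M + (c * f N + g N) = c * f K + g K + (c * f L + g L)" by (simp add: algebra_simps)
qed

lemma val_at_mu: "val_at (mu A) K = complex_of_real (vol (K + A))"
  unfolding mu_def using val_at_Val_of_real[OF real_valuation_plus[OF real_valuation_vol, of A], of K]
  by (simp add: add.commute)

subsection \<open>Mixed volume valuations as combinations of \<open>mu\<close>\<close>

text \<open>A finite combination of evaluations at dilates of \<open>1\<close> that extracts one coefficient of a polynomial:
  replacing \<open>f(x)\<close> by \<open>f(2x) - 2\<^sup>d f(x)\<close> kills the coefficient of \<open>x\<^sup>d\<close> only.\<close>

lemma coefficient_extraction:
  assumes "finite D" "e \<notin> D"
  obtains ws :: "(real \<times> real) list" where "\<And>w s. (w, s) \<in> set ws \<Longrightarrow> 0 < s"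
    "(\<Sum>(w, s)\<leftarrow>ws. w * s ^ e) = 1" "\<And>d. d \<in> D \<Longrightarrow> (\<Sum>(w, s)\<leftarrow>ws. w * s ^ d) = 0"
proof -
  have "\<exists>ws :: (real \<times> real) list. (\<forall>(w, s)\<in>set ws. 0 < s) \<and>
    (\<Sum>(w, s)\<leftarrow>ws. w * s ^ e) = 1 \<and> (\<forall>d\<in>D. (\<Sum>(w, s)\<leftarrow>ws. w * s ^ d) = 0)"
    using assms
  proof (induction D rule: finite_induct)
    case empty
    show ?case by (intro exI[of _ "[(1, 1)]"]) simp
  next
    case (insert d D)
    then obtain ws :: "(real \<times> real) list" where ws: "\<forall>(w, s)\<in>set ws. 0 < s"
      "(\<Sum>(w, s)\<leftarrow>ws. w * s ^ e) = 1" "\<forall>d\<in>D. (\<Sum>(w, s)\<leftarrow>ws. w * s ^ d) = 0"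
      by auto
    define c where "c = (2 ^ e - 2 ^ d :: real)"
    have c: "c \<noteq> 0" using insert.prems by (auto simp: c_def)
    define vs where "vs = map (\<lambda>(w, s). (w / c, 2 * s)) ws @ map (\<lambda>(w, s). (- (2 ^ d * w / c), s)) ws"
    have vs: "(\<Sum>(w, s)\<leftarrow>vs. w * s ^ j) = (2 ^ j - 2 ^ d) / c * (\<Sum>(w, s)\<leftarrow>ws. w * s ^ j)" for j
    proof -
      have "(\<Sum>(w, s)\<leftarrow>map (\<lambda>(w, s). (w / c, 2 * s)) ws. w * s ^ j) = 2 ^ j / c * (\<Sum>(w, s)\<leftarrow>ws. w * s ^ j)"
        by (induction ws) (auto simp: power_mult_distrib algebra_simps)
      moreover have "(\<Sum>(w, s)\<leftarrow>map (\<lambda>(w, s). (- (2 ^ d * w / c), s)) ws. w * s ^ j) = - (2 ^ d / c) * (\<Sum>(w, s)\<leftarrow>ws. w * s ^ j)"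
        by (induction ws) (auto simp: algebra_simps)
      ultimately show ?thesis by (simp add: vs_def left_diff_distrib diff_divide_distrib)
    qed
    show ?case
    proof (intro exI[of _ vs] conjI)
      show "\<forall>(w, s)\<in>set vs. 0 < s" using ws(1) by (auto simp: vs_def)
      show "(\<Sum>(w, s)\<leftarrow>vs. w * s ^ e) = 1" unfolding vs ws(2) using c by (simp add: c_def)
      show "\<forall>j\<in>insert d D. (\<Sum>(w, s)\<leftarrow>vs. w * s ^ j) = 0" unfolding vs using ws(3) by auto
    qed
  qed
  then show ?thesis using that by blast
qed

lemma sum_list_pairs_sum_swap:
  fixes f :: "'x \<Rightarrow> 'y \<Rightarrow> 'i \<Rightarrow> real"
  shows "(\<Sum>(w, s)\<leftarrow>ws. \<Sum>i\<in>I. f w s i) = (\<Sum>i\<in>I. \<Sum>(w, s)\<leftarrow>ws. f w s i)"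
  by (induction ws) (auto simp: sum.distrib)

lemma mixed_volume_coefficient:
  fixes B :: "'a::euclidean_space body"
  assumes ws: "\<And>w s. (w, s) \<in> set ws \<Longrightarrow> 0 < s" "(\<Sum>(w, s)\<leftarrow>ws. w * s ^ e) = 1"
    "\<And>d. d \<in> {..p} - {e} \<Longrightarrow> (\<Sum>(w, s)\<leftarrow>ws. w * s ^ d) = 0" and e: "e \<le> p"
  shows "(\<Sum>(w, s)\<leftarrow>ws. w * mixed_volume (replicate p (K + scale_body s B) @ Ms))
    = real (p choose e) * mixed_volume (replicate (p - e) K @ replicate e B @ Ms)"
proof -
  let ?V = "\<lambda>i. mixed_volume (replicate (p - i) K @ replicate i B @ Ms)"
  have exp: "mixed_volume (replicate p (K + scale_body s B) @ Ms) = (\<Sum>i\<le>p. real (p choose i) * ?V i * s ^ i)"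
    if "0 < s" for s
    unfolding mixed_volume_binomial
  proof (rule sum.cong[OF refl])
    fix i
    have "mixed_volume (replicate (p - i) K @ replicate i (scale_body s B) @ Ms)
        = mixed_volume (replicate i (scale_body s B) @ replicate (p - i) K @ Ms)"
      by (rule mixed_volume_mset) simp
    also have "\<dots> = s ^ i * mixed_volume (replicate i B @ replicate (p - i) K @ Ms)"
      using that by (intro mixed_volume_replicate_scale) simp
    also have "mixed_volume (replicate i B @ replicate (p - i) K @ Ms) = ?V i" by (rule mixed_volume_mset) simp
    finally show "real (p choose i) * mixed_volume (replicate (p - i) K @ replicate i (scale_body s B) @ Ms)
        = real (p choose i) * ?V i * s ^ i" by simp
  qed
  have "(\<Sum>(w, s)\<leftarrow>ws. w * mixed_volume (replicate p (K + scale_body s B) @ Ms))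
      = (\<Sum>(w, s)\<leftarrow>ws. \<Sum>i\<le>p. real (p choose i) * ?V i * (w * s ^ i))"
    by (rule arg_cong[where f=sum_list], rule map_cong[OF refl])
       (use ws(1) exp in \<open>auto simp: sum_distrib_left algebra_simps\<close>)
  also have "\<dots> = (\<Sum>i\<le>p. \<Sum>(w, s)\<leftarrow>ws. real (p choose i) * ?V i * (w * s ^ i))"
    by (rule sum_list_pairs_sum_swap)
  also have "\<dots> = (\<Sum>i\<le>p. real (p choose i) * ?V i * (\<Sum>(w, s)\<leftarrow>ws. w * s ^ i))"
    by (rule sum.cong[OF refl]) (simp add: sum_list_const_mult[symmetric] case_prod_unfold)
  also have "\<dots> = (\<Sum>i\<le>p. if i = e then real (p choose e) * ?V e else 0)"
    by (rule sum.cong[OF refl]) (use ws(2,3) in auto)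
  also have "\<dots> = real (p choose e) * ?V e" using e by simp
  finally show ?thesis .
qed

text \<open>The case \<open>Cs = []\<close>, \<open>p = DIM('a)\<close> writes mixed volume valuations as combinations of the valuations
  \<open>mu X\<close>; the general case applies the same combination to a second mixed volume valuation.\<close>

lemma mixed_volume_combination:
  fixes As :: "'a::euclidean_space body list"
  assumes B: "B \<in> \<S>" and plus: "\<And>X Y. X \<in> \<S> \<Longrightarrow> Y \<in> \<S> \<Longrightarrow> X + Y \<in> \<S>"
    and scale: "\<And>X s. X \<in> \<S> \<Longrightarrow> 0 < s \<Longrightarrow> scale_body s X \<in> \<S>"
    and As: "set As \<subseteq> \<S>" "length As \<le> DIM('a)"
  obtains ws where "\<And>w X. (w, X) \<in> set ws \<Longrightarrow> X \<in> \<S>"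
    "\<And>p Cs K. length Cs + p = DIM('a) \<Longrightarrow> length As \<le> p \<Longrightarrow>
      (\<Sum>(w, X)\<leftarrow>ws. w * mixed_volume (replicate p (K + X) @ Cs))
      = fact p * fact (DIM('a) - length As) / (fact (p - length As) * fact DIM('a))
        * mixed_volume (replicate (p - length As) K @ As @ Cs)"
proof -
  let ?n = "DIM('a)"
  have "\<exists>ws. (\<forall>(w, X)\<in>set ws. X \<in> \<S>) \<and>
    (\<forall>p Cs K. length Cs + p = ?n \<longrightarrow> length As \<le> p \<longrightarrow>
      (\<Sum>(w, X)\<leftarrow>ws. w * mixed_volume (replicate p (K + X) @ Cs))
      = fact p * fact (?n - length As) / (fact (p - length As) * fact ?n)
        * mixed_volume (replicate (p - length As) K @ As @ Cs))"
    using As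
  proof (induction As)
    case Nil
    obtain ws :: "(real \<times> real) list" where ws: "\<And>w s. (w, s) \<in> set ws \<Longrightarrow> 0 < s"
      "(\<Sum>(w, s)\<leftarrow>ws. w * s ^ 0) = 1" "\<And>d. d \<in> {..?n} - {0} \<Longrightarrow> (\<Sum>(w, s)\<leftarrow>ws. w * s ^ d) = 0"
      by (rule coefficient_extraction[of "{..?n} - {0}" 0]) auto
    show ?case
    proof (intro exI[of _ "map (\<lambda>(w, s). (w, scale_body s B)) ws"] conjI allI impI)
      show "\<forall>(w, X)\<in>set (map (\<lambda>(w, s). (w, scale_body s B)) ws). X \<in> \<S>" using ws(1) scale[OF B] by auto
      fix p and Cs :: "'a body list" and K :: "'a body" assume p: "length Cs + p = ?n"
      have "(\<Sum>(w, s)\<leftarrow>ws. w * mixed_volume (replicate p (K + scale_body s B) @ Cs)) = mixed_volume (replicate p K @ Cs)"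
        using mixed_volume_coefficient[of ws 0 p K B Cs] ws p by simp
      then show "(\<Sum>(w, X)\<leftarrow>map (\<lambda>(w, s). (w, scale_body s B)) ws. w * mixed_volume (replicate p (K + X) @ Cs))
        = fact p * fact (?n - length []) / (fact (p - length []) * fact ?n) * mixed_volume (replicate (p - length []) K @ [] @ Cs)"
        by (simp add: o_def case_prod_unfold)
    qed
  next
    case (Cons A As)
    let ?m = "length As"
    have A: "A \<in> \<S>" and m: "?m < ?n" using Cons.prems by auto
    from Cons obtain ws where ws: "\<forall>(w, X)\<in>set ws. X \<in> \<S>"
      and ws': "\<And>p Cs K. length Cs + p = ?n \<Longrightarrow> ?m \<le> p \<Longrightarrow>
        (\<Sum>(w, X)\<leftarrow>ws. w * mixed_volume (replicate p (K + X) @ Cs))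
        = fact p * fact (?n - ?m) / (fact (p - ?m) * fact ?n) * mixed_volume (replicate (p - ?m) K @ As @ Cs)"
      by auto
    obtain vs :: "(real \<times> real) list" where vs: "\<And>w s. (w, s) \<in> set vs \<Longrightarrow> 0 < s"
      "(\<Sum>(w, s)\<leftarrow>vs. w * s ^ 1) = 1" "\<And>d. d \<in> {..?n} - {1} \<Longrightarrow> (\<Sum>(w, s)\<leftarrow>vs. w * s ^ d) = 0"
      by (rule coefficient_extraction[of "{..?n} - {1}" 1]) auto
    define \<gamma> where "\<gamma> = 1 / real (?n - ?m)"
    define us where "us = concat (map (\<lambda>(v, s). map (\<lambda>(w, X). (\<gamma> * v * w, scale_body s A + X)) ws) vs)"
    have us: "(\<Sum>(w, X)\<leftarrow>us. w * f X) = \<gamma> * (\<Sum>(v, s)\<leftarrow>vs. v * (\<Sum>(w, X)\<leftarrow>ws. w * f (scale_body s A + X)))"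
      for f :: "'a body \<Rightarrow> real"
    proof -
      have "(\<Sum>(w, X)\<leftarrow>map (\<lambda>(w, X). (\<gamma> * v * w, scale_body s A + X)) ws. w * f X)
          = \<gamma> * (v * (\<Sum>(w, X)\<leftarrow>ws. w * f (scale_body s A + X)))" for v s
        by (induction ws) (auto simp: algebra_simps)
      then show ?thesis
        unfolding us_def by (induction vs) (auto simp: algebra_simps)
    qed
    show ?case
    proof (intro exI[of _ us] conjI allI impI)
      show "\<forall>(w, X)\<in>set us. X \<in> \<S>" using ws vs(1) by (auto simp: us_def intro!: plus scale A)
      fix p and Cs :: "'a body list" and K :: "'a body" assume p: "length Cs + p = ?n" "length (A # As) \<le> p"
      have pm: "Suc ?m \<le> p" using p by simp
      let ?c = "fact p * fact (?n - ?m) / (fact (p - ?m) * fact ?n) :: real"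
      have inner: "(\<Sum>(w, X)\<leftarrow>ws. w * mixed_volume (replicate p (K + (scale_body s A + X)) @ Cs))
          = ?c * mixed_volume (replicate (p - ?m) (K + scale_body s A) @ As @ Cs)" for s
        using ws'[OF p(1), of "K + scale_body s A"] pm by (simp add: add.assoc)
      have "(\<Sum>(w, X)\<leftarrow>us. w * mixed_volume (replicate p (K + X) @ Cs))
          = \<gamma> * (\<Sum>(v, s)\<leftarrow>vs. v * (?c * mixed_volume (replicate (p - ?m) (K + scale_body s A) @ As @ Cs)))"
        unfolding us inner ..
      also have "\<dots> = \<gamma> * ?c * (\<Sum>(v, s)\<leftarrow>vs. v * mixed_volume (replicate (p - ?m) (K + scale_body s A) @ As @ Cs))"
        by (simp add: sum_list_const_mult[symmetric] case_prod_unfold mult.assoc mult.left_commute)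
      also have "(\<Sum>(v, s)\<leftarrow>vs. v * mixed_volume (replicate (p - ?m) (K + scale_body s A) @ As @ Cs))
          = real (p - ?m) * mixed_volume (replicate (p - ?m - 1) K @ A # As @ Cs)"
      proof -
        have z: "(\<Sum>(w, s)\<leftarrow>vs. w * s ^ d) = 0" if "d \<in> {..p - ?m} - {1}" for d
          using that p by (intro vs(3)) auto
        show ?thesis using mixed_volume_coefficient[of vs 1 "p - ?m" K A "As @ Cs", OF vs(1,2) z] pm by simp
      qed
      also have "\<gamma> * ?c * (real (p - ?m) * mixed_volume (replicate (p - ?m - 1) K @ A # As @ Cs))
          = fact p * fact (?n - length (A # As)) / (fact (p - length (A # As)) * fact ?n)
            * mixed_volume (replicate (p - length (A # As)) K @ (A # As) @ Cs)"
      proof -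
        obtain a where a: "?n - ?m = Suc a" using m by (metis Suc_diff_Suc)
        obtain b where b: "p - ?m = Suc b" using pm by (metis Suc_diff_Suc Suc_le_lessD)
        have "?n - Suc ?m = a" "p - Suc ?m = b" using a b by auto
        moreover have "\<gamma> * (fact p * fact (Suc a) / (fact (Suc b) * fact ?n)) * real (Suc b)
            = fact p * fact a / (fact b * fact ?n)"
          unfolding \<gamma>_def a fact_Suc by (simp add: divide_simps)
        ultimately show ?thesis unfolding a b by (simp add: mult.assoc[symmetric])
      qed
      finally show "(\<Sum>(w, X)\<leftarrow>us. w * mixed_volume (replicate p (K + X) @ Cs))
        = fact p * fact (?n - length (A # As)) / (fact (p - length (A # As)) * fact ?n)
            * mixed_volume (replicate (p - length (A # As)) K @ (A # As) @ Cs)" .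
    qed
  qed
  then show ?thesis using that by blast
qed

lemma real_valuation_combination: "real_valuation (\<lambda>K. \<Sum>(w, X)\<leftarrow>ws. w * vol (K + X))"
proof (induction ws)
  case (Cons a ws)
  obtain w X where "a = (w, X)" by fastforce
  then show ?case
    using real_valuation_add_scale[OF real_valuation_plus[OF real_valuation_vol, of X] Cons, of w] by simp
qed (simp add: real_valuation_0)

lemma val_at_mixed_val:
  fixes As :: "'a::euclidean_space body list"
  assumes "length As \<le> DIM('a)"
  shows "val_at (mixed_val As) K = complex_of_real (mixed_volume (replicate (DIM('a) - length As) K @ As))"
proof -
  obtain ws where ws: "\<And>p Cs K. length Cs + p = DIM('a) \<Longrightarrow> length As \<le> p \<Longrightarrow>
      (\<Sum>(w, X)\<leftarrow>ws. w * mixed_volume (replicate p (K + X) @ Cs))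
      = fact p * fact (DIM('a) - length As) / (fact (p - length As) * fact DIM('a))
        * mixed_volume (replicate (p - length As) K @ As @ Cs)"
    by (rule mixed_volume_combination[of 0 UNIV As]) (use assms in auto)
  have "mixed_volume (replicate (DIM('a) - length As) K @ As) = (\<Sum>(w, X)\<leftarrow>ws. w * vol (K + X))" for K
    using ws[of "[]" "DIM('a)" K] assms by simp
  then have "real_valuation (\<lambda>K. mixed_volume (replicate (DIM('a) - length As) K @ As))"
    using real_valuation_combination[of ws] by simp
  then show ?thesis unfolding mixed_val_def by (rule val_at_Val_of_real)
qed

lemma val_at_sum_list: "val_at (\<Sum>x\<leftarrow>xs. f x) K = (\<Sum>x\<leftarrow>xs. val_at (f x) K)"
  by (induction xs) auto

lemma val_at_sum: "val_at (\<Sum>x\<in>I. f x) K = (\<Sum>x\<in>I. val_at (f x) K)"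
  by (induction I rule: infinite_finite_induct) auto

section \<open>Support functions of smooth bodies\<close>

subsection \<open>Further calculus\<close>

lemma smooth_on_local:
  assumes "\<And>x. x \<in> S \<Longrightarrow> \<exists>T. open T \<and> x \<in> T \<and> smooth_on T f"
  shows "smooth_on S f"
  unfolding smooth_on_def
proof
  fix k
  show "C_k_on k S f"
  proof (rule C_k_on_local)
    fix x assume "x \<in> S"
    then obtain T where "open T" "x \<in> T" "smooth_on T f" using assms by blast
    then show "\<exists>T. open T \<and> x \<in> T \<and> C_k_on k T f" unfolding smooth_on_def by blast
  qed
qed

lemma frechet_derivative_eqI: "(f has_derivative f') (at x) \<Longrightarrow> frechet_derivative f (at x) = f'"
  using frechet_derivative_at by metis

definition grad :: "('a::euclidean_space \<Rightarrow> real) \<Rightarrow> 'a \<Rightarrow> 'a" where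
  "grad f x = (\<Sum>b\<in>Basis. frechet_derivative f (at x) b *\<^sub>R b)"

lemma frechet_derivative_grad:
  assumes "f differentiable at x"
  shows "frechet_derivative f (at x) v = grad f x \<bullet> v"
proof -
  have "frechet_derivative f (at x) v = (\<Sum>b\<in>Basis. (v \<bullet> b) *\<^sub>R frechet_derivative f (at x) b)"
    by (rule linear_sum_Basis[OF linear_frechet_derivative[OF assms]])
  also have "\<dots> = grad f x \<bullet> v"
    unfolding grad_def inner_sum_left by (rule sum.cong) (simp_all add: inner_commute mult.commute)
  finally show ?thesis .
qed

lemma grad_has_derivative:
  assumes "smooth_on U f" "x \<in> U"
  shows "(f has_derivative (\<lambda>v. grad f x \<bullet> v)) (at x)"
proof -
  have d: "(f has_derivative frechet_derivative f (at x)) (at x)" by (rule smooth_on_has_derivative[OF assms])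
  then have "f differentiable at x" by (auto simp: differentiable_def)
  then have "frechet_derivative f (at x) = (\<lambda>v. grad f x \<bullet> v)" by (simp add: fun_eq_iff frechet_derivative_grad)
  then show ?thesis using d by metis
qed

lemma smooth_on_grad: "smooth_on U f \<Longrightarrow> open U \<Longrightarrow> smooth_on U (grad f)"
  unfolding grad_def[abs_def]
  by (intro smooth_on_sum smooth_on_linear[OF bounded_linear_scaleR_left] smooth_on_frechet_derivative)

lemma has_derivative_along_line:
  assumes "(F has_derivative F') (at (x + t *\<^sub>R v))"
  shows "((\<lambda>t. F (x + t *\<^sub>R v)) has_vector_derivative F' v) (at t)"
proof -
  have "((\<lambda>t. x + t *\<^sub>R v) has_derivative (\<lambda>h. h *\<^sub>R v)) (at t)"
    by (auto intro!: derivative_eq_intros)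
  from diff_chain_at[OF this assms] show ?thesis
    by (simp add: has_vector_derivative_def o_def linear_scale[OF has_derivative_linear[OF assms]])
qed

lemma eventually_inj_linear_family:
  fixes A :: "'a::real_normed_vector \<Rightarrow> 'b::euclidean_space \<Rightarrow> 'c::euclidean_space"
  assumes S: "open S" "u0 \<in> S" and lin: "\<And>u. u \<in> S \<Longrightarrow> linear (A u)" and inj: "inj (A u0)"
    and A: "\<And>b. isCont (\<lambda>u. A u b) u0"
  shows "\<forall>\<^sub>F u in nhds u0. inj (A u)"
proof -
  obtain B where B: "bounded_linear B" "\<And>w. B (A u0 w) = w"
    using bounded_linear_left_inverse[OF lin[OF S(2)] inj] by blast
  obtain K where K: "K > 0" "\<And>w. norm (B w) \<le> norm w * K"
    using bounded_linear.pos_bounded[OF B(1)] by blast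
  define \<delta> where "\<delta> u = (\<Sum>b\<in>Basis. norm (A u b - A u0 b))" for u
  have "isCont \<delta> u0" unfolding \<delta>_def using A by (intro continuous_intros)
  then have "(\<delta> \<longlongrightarrow> \<delta> u0) (nhds u0)" by (simp add: isCont_def tendsto_at_iff_tendsto_nhds)
  moreover have "\<delta> u0 < 1 / K" using K by (simp add: \<delta>_def)
  ultimately have "\<forall>\<^sub>F u in nhds u0. \<delta> u < 1 / K" by (rule order_tendstoD)
  moreover have "\<forall>\<^sub>F u in nhds u0. u \<in> S" using S by (rule eventually_nhds_in_open)
  ultimately show ?thesis
  proof eventually_elim
    case (elim u)
    have "w = 0" if w: "A u w = 0" for w
    proof (rule ccontr)
      assume "w \<noteq> 0"
      have "A u0 w = A u w - (\<Sum>b\<in>Basis. (w \<bullet> b) *\<^sub>R (A u b - A u0 b))"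
        by (rule linear_system_solution_rearranged[of A u u0 "\<lambda>_. w" "\<lambda>u. A u w"]) (use lin S elim in auto)
      then have "norm w \<le> norm (\<Sum>b\<in>Basis. (w \<bullet> b) *\<^sub>R (A u b - A u0 b)) * K"
        using K(2)[of "A u0 w"] B(2)[of w] w by simp
      also have "norm (\<Sum>b\<in>Basis. (w \<bullet> b) *\<^sub>R (A u b - A u0 b)) \<le> (\<Sum>b\<in>Basis. norm w * norm (A u b - A u0 b))"
        by (intro sum_norm_le) (simp add: Basis_le_norm mult_right_mono)
      also have "\<dots> = norm w * \<delta> u" by (simp add: \<delta>_def sum_distrib_left)
      finally have "norm w * 1 \<le> norm w * (\<delta> u * K)" using K(1) by (simp add: mult.assoc)
      moreover have "\<delta> u * K < 1" using elim(1) K(1) by (simp add: field_simps)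
      ultimately show False using \<open>w \<noteq> 0\<close> by simp
    qed
    then show ?case using lin elim(2) linear_injective_0 by blast
  qed
qed

lemma smooth_on_lipschitz_cball:
  fixes F :: "'a::euclidean_space \<Rightarrow> 'b::real_normed_vector"
  assumes F: "smooth_on U F" and sub: "cball p r \<subseteq> U"
  obtains C where "0 < C" "\<And>x y. x \<in> cball p r \<Longrightarrow> y \<in> cball p r \<Longrightarrow> norm (F x - F y) \<le> C * norm (x - y)"
proof -
  let ?F' = "\<lambda>x. frechet_derivative F (at x)"
  have "continuous_on (cball p r) (\<lambda>x. \<Sum>b\<in>Basis. norm (?F' x b))"
    by (intro continuous_intros continuous_on_subset[OF smooth_on_imp_continuous_on[OF smooth_on_frechet_derivative[OF F]] sub])
  then have "bounded ((\<lambda>x. \<Sum>b\<in>Basis. norm (?F' x b)) ` cball p r)"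
    by (intro compact_imp_bounded compact_continuous_image) auto
  then obtain C where C: "0 < C" "\<And>x. x \<in> cball p r \<Longrightarrow> norm (\<Sum>b\<in>Basis. norm (?F' x b)) \<le> C"
    unfolding bounded_pos by auto
  have d: "(F has_derivative ?F' x) (at x)" if "x \<in> cball p r" for x
    using smooth_on_has_derivative[OF F] sub that by blast
  have "onorm (?F' x) \<le> C" if x: "x \<in> cball p r" for x
  proof (rule onorm_le)
    fix v
    have "?F' x v = (\<Sum>b\<in>Basis. (v \<bullet> b) *\<^sub>R ?F' x b)"
      by (rule linear_sum_Basis[OF has_derivative_linear[OF d[OF x]]])
    then have "norm (?F' x v) = norm (\<Sum>b\<in>Basis. (v \<bullet> b) *\<^sub>R ?F' x b)" by simp
    also have "\<dots> \<le> (\<Sum>b\<in>Basis. norm v * norm (?F' x b))"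
      by (intro sum_norm_le) (simp add: Basis_le_norm mult_right_mono)
    also have "\<dots> = norm v * (\<Sum>b\<in>Basis. norm (?F' x b))" by (simp add: sum_distrib_left)
    also have "\<dots> \<le> norm v * C" using C(2)[OF x] by (intro mult_left_mono) auto
    finally show "norm (?F' x v) \<le> C * norm v" by (simp add: mult.commute)
  qed
  then have "norm (F x - F y) \<le> C * norm (x - y)" if "x \<in> cball p r" "y \<in> cball p r" for x y
    using that by (intro differentiable_bound[of "cball p r" F ?F' C x y] convex_cball has_derivative_at_withinI[OF d])
  with C(1) show ?thesis using that by blast
qed

lemma inner_self_le_0_iff: "x \<bullet> x \<le> 0 \<longleftrightarrow> x = (0 :: 'a::real_inner)"
  unfolding not_less[symmetric] inner_gt_zero_iff by simp

subsection \<open>Maximizers of linear functionals\<close>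

lemma maximizers_monotone:
  assumes "a \<in> body_set K" "b \<in> body_set K" "supp_fun K u = a \<bullet> u" "supp_fun K v = b \<bullet> v"
  shows "(a - b) \<bullet> (u - v) \<ge> 0"
  using supp_fun_ge[of b K u] supp_fun_ge[of a K v] assms by (simp add: inner_diff_left inner_diff_right)

lemma grad_supp_fun_eq:
  assumes d: "(supp_fun K has_derivative D) (at u)" and z: "z \<in> body_set K" "supp_fun K u = z \<bullet> u"
  shows "D = (\<lambda>v. z \<bullet> v)"
proof -
  have "((\<lambda>v. supp_fun K v - z \<bullet> v) has_derivative (\<lambda>v. D v - z \<bullet> v)) (at u)"
    by (intro has_derivative_diff d has_derivative_inner_right has_derivative_ident)
  moreover have "\<forall>\<^sub>F v in at u. supp_fun K u - z \<bullet> u \<le> supp_fun K v - z \<bullet> v"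
    using supp_fun_ge[OF z(1)] z(2) by (intro always_eventually) simp
  ultimately have "(\<lambda>v. D v - z \<bullet> v) = (\<lambda>v. 0)" by (rule has_derivative_local_min)
  then show ?thesis by (metis eq_iff_diff_eq_0 ext)
qed

lemma maximizer_in_frontier:
  assumes "p \<in> body_set K" "supp_fun K u = p \<bullet> u" "u \<noteq> 0"
  shows "p \<in> frontier (body_set K)"
proof -
  have "p \<notin> interior (body_set K)"
  proof
    assume "p \<in> interior (body_set K)"
    then obtain e where e: "e > 0" "cball p e \<subseteq> body_set K" by (auto simp: mem_interior_cball)
    have "p + (e / norm u) *\<^sub>R u \<in> body_set K" using e assms(3) by (intro subsetD[OF e(2)]) (simp add: dist_norm)
    then have "(p + (e / norm u) *\<^sub>R u) \<bullet> u \<le> p \<bullet> u" using supp_fun_ge[of _ K u] assms(2) by simp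
    moreover have "(e / norm u) * (u \<bullet> u) > 0" using e assms(3) by simp
    ultimately show False by (simp add: inner_add_left)
  qed
  then show ?thesis using assms(1) closure_subset[of "body_set K"] by (auto simp: frontier_def)
qed

definition touch :: "'a::euclidean_space body \<Rightarrow> 'a \<Rightarrow> 'a" where
  "touch K u = (SOME z. z \<in> body_set K \<and> supp_fun K u = z \<bullet> u)"

lemma touch: "touch K u \<in> body_set K" "supp_fun K u = touch K u \<bullet> u"
proof -
  have "\<exists>z. z \<in> body_set K \<and> supp_fun K u = z \<bullet> u" by (rule supp_fun_attained[of K u]) blast
  then have "touch K u \<in> body_set K \<and> supp_fun K u = touch K u \<bullet> u"
    unfolding touch_def by (rule someI_ex)
  then show "touch K u \<in> body_set K" "supp_fun K u = touch K u \<bullet> u" by auto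
qed

lemma isCont_touch:
  assumes unique: "\<And>z. z \<in> body_set K \<Longrightarrow> supp_fun K u0 = z \<bullet> u0 \<Longrightarrow> z = touch K u0"
  shows "isCont (touch K) u0"
  unfolding continuous_at_eps_delta
proof (intro allI impI)
  fix e :: real assume e: "e > 0"
  let ?p = "touch K u0" and ?C = "body_set K - ball (touch K u0) e"
  show "\<exists>d>0. \<forall>u. dist u u0 < d \<longrightarrow> dist (touch K u) ?p < e"
  proof (cases "?C = {}")
    case True
    then have "dist (touch K u) ?p < e" for u using touch(1)[of K u] by (auto simp: dist_commute)
    then show ?thesis using zero_less_one by blast
  next
    case False
    have "compact ?C" by (intro compact_diff) auto
    then obtain c where c: "c \<in> ?C" "\<And>z. z \<in> ?C \<Longrightarrow> z \<bullet> u0 \<le> c \<bullet> u0"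
      using continuous_attains_sup[OF _ False, of "\<lambda>z. z \<bullet> u0"]
        continuous_on_inner[OF continuous_on_id continuous_on_const, of ?C u0] by auto
    have "c \<bullet> u0 \<noteq> supp_fun K u0" using unique[of c] c(1) e by auto
    then have gap: "c \<bullet> u0 < supp_fun K u0" using supp_fun_ge[of c K u0] c(1) by simp
    obtain r where r: "0 \<le> r" "body_set K \<subseteq> cball 0 r" by (rule body_subset_cball)
    have zr: "\<bar>z \<bullet> v\<bar> \<le> r * norm v" if "z \<in> body_set K" for z v
    proof -
      have "\<bar>z \<bullet> v\<bar> \<le> norm z * norm v" by (rule Cauchy_Schwarz_ineq2)
      also have "\<dots> \<le> r * norm v" using that r by (intro mult_right_mono) auto
      finally show ?thesis .
    qed
    define d where "d = (supp_fun K u0 - c \<bullet> u0) / (2 * r + 1)"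
    have d: "d > 0" using gap r by (simp add: d_def)
    have "dist (touch K u) ?p < e" if u: "dist u u0 < d" for u
    proof (rule ccontr)
      assume "\<not> ?thesis"
      then have "touch K u \<in> ?C" using touch(1)[of K u] by (auto simp: dist_commute)
      then have "touch K u \<bullet> u0 \<le> c \<bullet> u0" by (rule c(2))
      moreover have "?p \<bullet> u \<le> touch K u \<bullet> u" using supp_fun_ge[OF touch(1)[of K u0], of u] touch(2)[of K u] by simp
      ultimately have "supp_fun K u0 - c \<bullet> u0 \<le> touch K u \<bullet> (u - u0) - ?p \<bullet> (u - u0)"
        using touch(2)[of K u0] by (simp add: inner_diff_right)
      also have "\<dots> \<le> 2 * r * norm (u - u0)" using zr[OF touch(1)[of K u], of "u - u0"] zr[OF touch(1)[of K u0], of "u - u0"] by linarith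
      also have "\<dots> \<le> (2 * r + 1) * norm (u - u0)" by (intro mult_right_mono) auto
      also have "\<dots> < (2 * r + 1) * d" using u r by (intro mult_strict_left_mono) (auto simp: dist_norm)
      also have "\<dots> = supp_fun K u0 - c \<bullet> u0" using r by (simp add: d_def)
      finally show False by simp
    qed
    then show ?thesis using d by blast
  qed
qed

subsection \<open>Local defining functions\<close>

context
  fixes A :: "'a::euclidean_space body" and U and f :: "'a \<Rightarrow> real"
  assumes U: "open U" and f: "smooth_on U f" and AU: "body_set A \<inter> U = {x \<in> U. f x \<le> 0}"
begin

lemma defining_function_zero:
  assumes "p \<in> frontier (body_set A)" "p \<in> U"
  shows "f p = 0"
proof (rule ccontr)
  assume "f p \<noteq> 0"
  moreover have "p \<in> body_set A" using assms(1) by (simp add: frontier_def)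
  ultimately have "f p < 0" using AU assms(2) by force
  have "open (U \<inter> f -` {..<0})"
    by (intro continuous_open_preimage smooth_on_imp_continuous_on f U) simp
  moreover have "U \<inter> f -` {..<0} \<subseteq> body_set A" using AU by force
  ultimately have "U \<inter> f -` {..<0} \<subseteq> interior (body_set A)" by (simp add: interior_maximal)
  then show False using assms \<open>f p < 0\<close> by (auto simp: frontier_def)
qed

lemma normal_parallel_grad:
  assumes p: "p \<in> body_set A" "p \<in> U" and u: "u \<noteq> 0" "supp_fun A u = p \<bullet> u" and g: "grad f p \<noteq> 0"
  shows "\<exists>c>0. u = c *\<^sub>R grad f p"
proof -
  let ?g = "grad f p"
  have fp: "f p = 0"
    by (rule defining_function_zero) (use maximizer_in_frontier[of p A u] p u in auto)
  have neg: "u \<bullet> v \<le> 0" if v: "?g \<bullet> v < 0" for v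
  proof -
    have "((\<lambda>t. f (p + t *\<^sub>R v)) has_vector_derivative ?g \<bullet> v) (at 0)"
      using has_derivative_along_line[of f "\<lambda>v. ?g \<bullet> v" p 0 v] grad_has_derivative[OF f p(2)] by simp
    then have "DERIV (\<lambda>t. - f (p + t *\<^sub>R v)) 0 :> - (?g \<bullet> v)"
      by (intro DERIV_minus) (simp add: has_real_derivative_iff_has_vector_derivative)
    from DERIV_pos_inc_right[OF this] obtain d where d: "d > 0" "\<And>h. 0 < h \<Longrightarrow> h < d \<Longrightarrow> f (p + h *\<^sub>R v) < 0"
      using v fp by force
    have "\<forall>\<^sub>F h in at_right 0. p + h *\<^sub>R v \<in> U"
    proof -
      have "((\<lambda>h. p + h *\<^sub>R v) \<longlongrightarrow> p + 0 *\<^sub>R v) (at_right 0)" by (intro tendsto_intros)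
      then show ?thesis using U p(2) by (simp add: topological_tendstoD)
    qed
    moreover have "\<forall>\<^sub>F h in at_right 0. h \<in> {0<..<d}" using d(1) by (rule eventually_at_right_real)
    ultimately have "\<forall>\<^sub>F h in at_right 0. p + h *\<^sub>R v \<in> U \<and> 0 < h \<and> h < d"
      by eventually_elim auto
    from eventually_happens'[OF trivial_limit_at_right_real this]
    obtain h where h: "p + h *\<^sub>R v \<in> U" "0 < h" "h < d" by blast
    then have "p + h *\<^sub>R v \<in> {x \<in> U. f x \<le> 0}" using d(2)[of h] by simp
    then have "p + h *\<^sub>R v \<in> body_set A" using AU by blast
    then have "(p + h *\<^sub>R v) \<bullet> u \<le> p \<bullet> u" using supp_fun_ge[of "p + h *\<^sub>R v" A u] u(2) by simp
    then have "h * (u \<bullet> v) \<le> 0" by (simp add: inner_add_left inner_commute[of u v])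
    then show ?thesis using h(2) by (simp add: mult_le_0_iff)
  qed
  define c where "c = (u \<bullet> ?g) / (?g \<bullet> ?g)"
  define w where "w = u - c *\<^sub>R ?g"
  have gg: "?g \<bullet> ?g > 0" using g by simp
  have wg: "?g \<bullet> w = 0" using gg by (simp add: w_def c_def inner_diff_right inner_commute)
  have uwe: "u \<bullet> w \<le> e * (u \<bullet> ?g)" if "e > 0" for e
    using neg[of "w - e *\<^sub>R ?g"] that wg gg by (simp add: inner_diff_right)
  have lim: "u \<bullet> w \<le> e" if e: "e > 0" for e
  proof -
    define k where "k = e / (\<bar>u \<bullet> ?g\<bar> + 1)"
    have k: "k > 0" using e by (simp add: k_def add_nonneg_pos)
    have "u \<bullet> w \<le> k * (u \<bullet> ?g)" using k by (rule uwe)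
    also have "\<dots> \<le> k * (\<bar>u \<bullet> ?g\<bar> + 1)" using k by (intro mult_left_mono) auto
    also have "\<dots> = e" using abs_ge_zero[of "u \<bullet> ?g"] by (simp add: k_def)
    finally show ?thesis .
  qed
  have "u \<bullet> w \<le> 0" by (rule field_le_epsilon) (use lim in simp)
  moreover have "u \<bullet> w = w \<bullet> w"
    using wg by (simp add: w_def inner_diff_left)
  ultimately have "w = 0" by (simp add: inner_self_le_0_iff)
  then have ul: "u = c *\<^sub>R ?g" by (simp add: w_def)
  have "u \<bullet> (- ?g) \<le> 0" using gg by (intro neg) simp
  then have "c \<ge> 0" using gg by (simp add: c_def)
  moreover have "c \<noteq> 0" using ul u(1) by auto
  ultimately show ?thesis using ul by (intro exI[of _ c]) simp
qed

lemma maximizer_unique: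
  assumes p: "p \<in> body_set A" "p \<in> U" and u: "u \<noteq> 0" "supp_fun A u = p \<bullet> u" and g: "grad f p \<noteq> 0"
    and hess: "\<And>v. v \<noteq> 0 \<Longrightarrow> grad f p \<bullet> v = 0 \<Longrightarrow> frechet_derivative (grad f) (at p) v \<bullet> v > 0"
    and q: "q \<in> body_set A" "supp_fun A u = q \<bullet> u"
  shows "q = p"
proof (rule ccontr)
  assume "q \<noteq> p"
  define w where "w = q - p"
  have w0: "w \<noteq> 0" using \<open>q \<noteq> p\<close> by (simp add: w_def)
  obtain c where c: "c > 0" "u = c *\<^sub>R grad f p" using normal_parallel_grad[OF p u g] by blast
  have "u \<bullet> w = 0" using u(2) q(2) by (simp add: w_def inner_diff_right inner_commute)
  then have gw: "grad f p \<bullet> w = 0" using c by simp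
  have fp: "f p = 0"
    by (rule defining_function_zero) (use maximizer_in_frontier[of p A u] p u in auto)
  have f': "((\<lambda>t. f (p + t *\<^sub>R w)) has_real_derivative grad f (p + t *\<^sub>R w) \<bullet> w) (at t)" if "p + t *\<^sub>R w \<in> U" for t
    using has_derivative_along_line[OF grad_has_derivative[OF f that]]
    by (simp add: has_real_derivative_iff_has_vector_derivative)
  have "((\<lambda>t. grad f (p + t *\<^sub>R w)) has_vector_derivative frechet_derivative (grad f) (at p) w) (at 0)"
    using has_derivative_along_line[of "grad f" _ p 0 w] smooth_on_has_derivative[OF smooth_on_grad[OF f U] p(2)] by simp
  then have "((\<lambda>t. grad f (p + t *\<^sub>R w) \<bullet> w) has_real_derivative frechet_derivative (grad f) (at p) w \<bullet> w) (at 0)"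
    unfolding has_real_derivative_iff_has_vector_derivative
    by (rule bounded_linear.has_vector_derivative[OF bounded_linear_inner_left])
  from DERIV_pos_inc_right[OF this hess[OF w0 gw]]
  obtain d where d: "d > 0" "\<And>h. 0 < h \<Longrightarrow> h < d \<Longrightarrow> 0 < grad f (p + h *\<^sub>R w) \<bullet> w"
    using gw by force
  have "isCont (\<lambda>t. p + t *\<^sub>R w) 0" by (intro continuous_intros)
  then obtain d' where d': "d' > 0" "\<And>t. \<bar>t\<bar> < d' \<Longrightarrow> p + t *\<^sub>R w \<in> U"
    using U p(2) unfolding continuous_at_open by (metis (no_types, lifting) U abs_minus_commute add.right_neutral
        continuous_at_open diff_zero dist_real_def open_dist scale_zero_left p(2))
  define t where "t = min (min d d') 1 / 2"
  have t: "0 < t" "t < d" "t < d'" "t < 1" using d d' by (auto simp: t_def)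
  obtain z where z: "0 < z" "z < t" "f (p + t *\<^sub>R w) - f (p + 0 *\<^sub>R w) = (t - 0) * (grad f (p + z *\<^sub>R w) \<bullet> w)"
    using MVT2[of 0 t "\<lambda>t. f (p + t *\<^sub>R w)" "\<lambda>t. grad f (p + t *\<^sub>R w) \<bullet> w"] t f' d' by force
  then have "f (p + t *\<^sub>R w) > 0" using d(2)[of z] t fp by simp
  moreover have "p + t *\<^sub>R w \<in> body_set A"
  proof -
    have "(1 - t) *\<^sub>R p + t *\<^sub>R q \<in> body_set A" using p q t by (intro convexD) auto
    moreover have "(1 - t) *\<^sub>R p + t *\<^sub>R q = p + t *\<^sub>R w" by (simp add: w_def algebra_simps)
    ultimately show ?thesis by simp
  qed
  moreover have "p + t *\<^sub>R w \<in> U" using d'(2)[of t] t by simp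
  ultimately have "p + t *\<^sub>R w \<in> {x \<in> U. f x \<le> 0}" using AU by blast
  then show False using \<open>f (p + t *\<^sub>R w) > 0\<close> by simp
qed

end

subsection \<open>Support functions of smooth bodies are smooth\<close>

lemma smooth_body_defining_function:
  assumes A: "A \<in> smooth_bodies" and p: "p \<in> frontier (body_set (A :: 'a::euclidean_space body))"
  obtains U f where "open U" "p \<in> U" "smooth_on U (f :: 'a \<Rightarrow> real)" "body_set A \<inter> U = {x\<in>U. f x \<le> 0}"
    "grad f p \<noteq> 0" "\<And>v. v \<noteq> 0 \<Longrightarrow> grad f p \<bullet> v = 0 \<Longrightarrow> frechet_derivative (grad f) (at p) v \<bullet> v > 0"
proof -
  obtain U and f :: "'a \<Rightarrow> real" where U: "open U" "p \<in> U" and f: "smooth_on U f" and AU: "body_set A \<inter> U = {x\<in>U. f x \<le> 0}"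
    and nz: "\<exists>v. frechet_derivative f (at p) v \<noteq> 0"
    and hess: "\<And>v. v \<noteq> 0 \<Longrightarrow> frechet_derivative f (at p) v = 0 \<Longrightarrow>
        frechet_derivative (\<lambda>x. frechet_derivative f (at x) v) (at p) v > 0"
    using A p unfolding smooth_bodies_def by blast
  have f': "frechet_derivative f (at x) v = grad f x \<bullet> v" if "x \<in> U" for x v
    using frechet_derivative_eqI[OF grad_has_derivative[OF f that]] by simp
  show ?thesis
  proof (rule that[OF U f AU])
    show "grad f p \<noteq> 0" using nz f'[OF U(2)] by auto
    fix v assume v: "v \<noteq> 0" "grad f p \<bullet> v = 0"
    let ?H = "frechet_derivative (grad f) (at p)"
    have "((\<lambda>x. grad f x \<bullet> v) has_derivative (\<lambda>w. ?H w \<bullet> v)) (at p)"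
      by (intro has_derivative_inner_left smooth_on_has_derivative[OF smooth_on_grad[OF f U(1)] U(2)])
    then have "((\<lambda>x. frechet_derivative f (at x) v) has_derivative (\<lambda>w. ?H w \<bullet> v)) (at p)"
      by (rule has_derivative_transform_within_open[OF _ U]) (simp add: f')
    from frechet_derivative_eqI[OF this] show "?H v \<bullet> v > 0"
      using hess[OF v(1)] v(2) f'[OF U(2), of v] by simp
  qed
qed

lemma smooth_body_touch_unique:
  assumes A: "A \<in> smooth_bodies" and u: "u \<noteq> 0" and z: "z \<in> body_set A" "supp_fun A u = z \<bullet> u"
  shows "z = touch A u"
proof -
  have "touch A u \<in> frontier (body_set A)" using touch[of A u] u by (intro maximizer_in_frontier) auto
  then obtain U f where Uf: "open U" "touch A u \<in> U" "smooth_on U f" "body_set A \<inter> U = {x\<in>U. f x \<le> 0}"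
    "grad f (touch A u) \<noteq> 0" "\<And>v. v \<noteq> 0 \<Longrightarrow> grad f (touch A u) \<bullet> v = 0 \<Longrightarrow> frechet_derivative (grad f) (at (touch A u)) v \<bullet> v > 0"
    by (rule smooth_body_defining_function[OF A]) blast
  show ?thesis
  proof (rule maximizer_unique[where f=f and U=U and A=A and u=u and p="touch A u" and q=z])
    show "open U" "smooth_on U f" "body_set A \<inter> U = {x\<in>U. f x \<le> 0}" "touch A u \<in> U" "grad f (touch A u) \<noteq> 0"
      by (rule Uf)+
    show "touch A u \<in> body_set A" "supp_fun A u = touch A u \<bullet> u" by (rule touch)+
    show "frechet_derivative (grad f) (at (touch A u)) v \<bullet> v > 0" if "v \<noteq> 0" "grad f (touch A u) \<bullet> v = 0" for v
      using that by (rule Uf(6))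
  qed (rule u z)+
qed

lemma isCont_smooth_body_touch: "A \<in> smooth_bodies \<Longrightarrow> u \<noteq> 0 \<Longrightarrow> isCont (touch A) u"
  by (rule isCont_touch) (blast intro: smooth_body_touch_unique)

text \<open>The pair \<open>(x, c)\<close> of the touching point \<open>x\<close> of \<open>u\<close> and the multiplier \<open>c\<close> solves
  \<open>c grad f(x) = u\<close>, \<open>f(x) = 0\<close>.\<close>

lemma smooth_on_touch:
  fixes A :: "'a::euclidean_space body"
  assumes A: "A \<in> smooth_bodies"
  shows "smooth_on (- {0}) (touch A)"
proof (rule smooth_on_local)
  fix u0 :: 'a assume "u0 \<in> - {0}"
  then have u0: "u0 \<noteq> 0" by simp
  have "touch A u0 \<in> frontier (body_set A)" using touch[of A u0] u0 by (intro maximizer_in_frontier) auto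
  then obtain U f where U: "open U" "touch A u0 \<in> U" and f: "smooth_on U f" and AU: "body_set A \<inter> U = {x\<in>U. f x \<le> 0}"
    and g0: "grad f (touch A u0) \<noteq> 0"
    and hess: "\<And>v. v \<noteq> 0 \<Longrightarrow> grad f (touch A u0) \<bullet> v = 0 \<Longrightarrow> frechet_derivative (grad f) (at (touch A u0)) v \<bullet> v > 0"
    by (rule smooth_body_defining_function[OF A]) blast
  let ?g = "grad f"
  have g: "smooth_on U ?g" by (rule smooth_on_grad[OF f U(1)])
  have contg: "isCont ?g x" if "x \<in> U" for x
    using smooth_on_imp_continuous_on[OF g] U(1) that by (simp add: continuous_on_eq_continuous_at)
  define P where "P u \<longleftrightarrow> u \<noteq> 0 \<and> touch A u \<in> U \<and> ?g (touch A u) \<noteq> 0" for u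
  have contt: "isCont (touch A) u" if "u \<noteq> 0" for u using isCont_smooth_body_touch[OF A that] .
  have contgt: "isCont (\<lambda>u. ?g (touch A u)) u" if "P u" for u
    using that contt contg by (auto simp: P_def intro!: isCont_o2[of u "touch A" ?g])
  have evP: "\<forall>\<^sub>F u in nhds u0. P u"
  proof -
    have "P u0" using u0 U g0 by (simp add: P_def)
    then have lim: "(touch A \<longlongrightarrow> touch A u0) (nhds u0)" "((\<lambda>u. ?g (touch A u)) \<longlongrightarrow> ?g (touch A u0)) (nhds u0)"
      using contt[OF u0] contgt[of u0] tendsto_at_iff_tendsto_nhds[of "touch A" u0]
        tendsto_at_iff_tendsto_nhds[of "\<lambda>u. ?g (touch A u)" u0]
      unfolding isCont_def by blast+
    have "\<forall>\<^sub>F u in nhds u0. touch A u \<in> U" by (rule topological_tendstoD[OF lim(1) U])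
    moreover have "\<forall>\<^sub>F u in nhds u0. ?g (touch A u) \<in> - {0}"
      by (rule topological_tendstoD[OF lim(2)]) (use g0 in auto)
    moreover have "\<forall>\<^sub>F u in nhds u0. u \<in> - {0}" using u0 by (intro eventually_nhds_in_open) auto
    ultimately show ?thesis unfolding P_def by eventually_elim auto
  qed
  then obtain N where N: "open N" "u0 \<in> N" "\<And>u. u \<in> N \<Longrightarrow> P u" unfolding eventually_nhds by blast
  define c where "c u = (u \<bullet> ?g (touch A u)) / (?g (touch A u) \<bullet> ?g (touch A u))" for u
  define Y where "Y u = (touch A u, c u)" for u
  define \<Phi> where "\<Phi> z = (snd z *\<^sub>R ?g (fst z), f (fst z))" for z :: "'a \<times> real"
  have Y: "c u > 0" "c u *\<^sub>R ?g (touch A u) = u" "f (touch A u) = 0" if "u \<in> N" for u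
  proof -
    have u: "u \<noteq> 0" "touch A u \<in> U" "?g (touch A u) \<noteq> 0" using N(3)[OF that] by (auto simp: P_def)
    obtain k where k: "k > 0" "u = k *\<^sub>R ?g (touch A u)"
      using normal_parallel_grad[OF U(1) f AU touch(1) u(2,1) touch(2) u(3)] by blast
    have "c u = k" unfolding c_def by (subst (1) k(2)) (use u(3) in simp)
    then show "c u > 0" "c u *\<^sub>R ?g (touch A u) = u" using k by auto
    have "touch A u \<in> frontier (body_set A)" using touch[of A u] u by (intro maximizer_in_frontier) auto
    then show "f (touch A u) = 0" using u(2) by (rule defining_function_zero[OF U(1) f AU])
  qed
  have contY: "continuous_on N Y"
  proof (rule continuous_at_imp_continuous_on, rule ballI)
    fix u assume "u \<in> N"
    then have P: "P u" using N(3) by blast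
    then have "?g (touch A u) \<bullet> ?g (touch A u) \<noteq> 0" by (simp add: P_def)
    then show "isCont Y u"
      unfolding Y_def c_def using P contt[of u] contgt[OF P]
      by (intro continuous_intros) (auto simp: P_def)
  qed
  let ?T = "U \<times> (UNIV :: real set)"
  have T: "open ?T" using U(1) by (intro open_Times) auto
  have \<Phi>: "smooth_on ?T \<Phi>"
    unfolding \<Phi>_def[abs_def]
  proof (intro smooth_on_Pair smooth_on_scaleR T)
    show "smooth_on ?T snd" "smooth_on ?T (\<lambda>z. ?g (fst z))" "smooth_on ?T (\<lambda>z. f (fst z))"
      using smooth_on_compose[of ?T fst U ?g] smooth_on_compose[of ?T fst U f] T f g
      by (auto intro: smooth_on_bounded_linear bounded_linear_fst bounded_linear_snd)
  qed
  have YT: "Y ` N \<subseteq> ?T" using N(3) by (auto simp: Y_def P_def)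
  have \<Phi>': "frechet_derivative \<Phi> (at (x, k)) = (\<lambda>z. (k *\<^sub>R frechet_derivative ?g (at x) (fst z) + snd z *\<^sub>R ?g x, ?g x \<bullet> fst z))"
    if "x \<in> U" for x k
  proof (rule frechet_derivative_eqI)
    have "((\<lambda>z. ?g (fst z)) has_derivative (\<lambda>z. frechet_derivative ?g (at x) (fst z))) (at (x, k))"
      using diff_chain_at[OF has_derivative_fst[OF has_derivative_ident], of ?g "frechet_derivative ?g (at x)" "(x, k)"]
        smooth_on_has_derivative[OF g that] by (simp add: o_def)
    moreover have "((\<lambda>z. f (fst z)) has_derivative (\<lambda>z. ?g x \<bullet> fst z)) (at (x, k))"
      using diff_chain_at[OF has_derivative_fst[OF has_derivative_ident], of f "\<lambda>v. ?g x \<bullet> v" "(x, k)"]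
        grad_has_derivative[OF f that] by (simp add: o_def)
    ultimately show "(\<Phi> has_derivative (\<lambda>z. (k *\<^sub>R frechet_derivative ?g (at x) (fst z) + snd z *\<^sub>R ?g x, ?g x \<bullet> fst z))) (at (x, k))"
      unfolding \<Phi>_def by (auto intro!: derivative_eq_intros)
  qed
  let ?A = "\<lambda>u. frechet_derivative \<Phi> (at (Y u))"
  have lin: "linear (?A u)" if "u \<in> N" for u
    using smooth_on_has_derivative[OF \<Phi>, of "Y u"] YT that by (intro has_derivative_linear) auto
  have inj0: "inj (?A u0)"
  proof -
    have "z = 0" if "?A u0 z = 0" for z
    proof -
      have 1: "c u0 *\<^sub>R frechet_derivative ?g (at (touch A u0)) (fst z) + snd z *\<^sub>R ?g (touch A u0) = 0"
        and 2: "?g (touch A u0) \<bullet> fst z = 0"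
        using that unfolding Y_def \<Phi>'[OF U(2)] by (auto simp: zero_prod_def)
      have "(c u0 *\<^sub>R frechet_derivative ?g (at (touch A u0)) (fst z) + snd z *\<^sub>R ?g (touch A u0)) \<bullet> fst z = 0"
        unfolding 1 by simp
      then have "c u0 * (frechet_derivative ?g (at (touch A u0)) (fst z) \<bullet> fst z) = 0"
        using 2 by (simp add: inner_add_left)
      then have "fst z = 0" using hess[of "fst z"] 2 Y(1)[OF N(2)] by force
      moreover have "linear (frechet_derivative ?g (at (touch A u0)))"
        using smooth_on_has_derivative[OF g U(2)] by (rule has_derivative_linear)
      ultimately have "snd z = 0" using 1 g0 by (simp add: linear_0)
      with \<open>fst z = 0\<close> show ?thesis by (simp add: prod_eq_iff)
    qed
    then show ?thesis using lin[OF N(2)] linear_injective_0 by blast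
  qed
  have "isCont (\<lambda>u. ?A u b) u0" for b
  proof -
    have "isCont (\<lambda>z. frechet_derivative \<Phi> (at z) b) (Y u0)"
      using smooth_on_imp_continuous_on[OF smooth_on_frechet_derivative[OF \<Phi>, of b]] YT N(2)
      unfolding continuous_on_eq_continuous_at[OF T] by blast
    moreover have "isCont Y u0" using contY N by (simp add: continuous_on_eq_continuous_at)
    ultimately show ?thesis by (intro isCont_o2[of u0 Y "\<lambda>z. frechet_derivative \<Phi> (at z) b"])
  qed
  then have "\<forall>\<^sub>F u in nhds u0. inj (?A u)"
    using eventually_inj_linear_family[where A="?A" and S=N and ?u0.0=u0] N(1,2) lin inj0 by blast
  then obtain N' where N': "open N'" "u0 \<in> N'" "\<And>u. u \<in> N' \<Longrightarrow> inj (?A u)" unfolding eventually_nhds by blast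
  have "smooth_on (N \<inter> N') Y"
  proof (rule smooth_on_implicit[where \<Phi>=\<Phi> and T="?T" and R="\<lambda>u. (u, 0)"])
    show "continuous_on (N \<inter> N') Y" using contY by (rule continuous_on_subset) auto
    show "smooth_on (N \<inter> N') (\<lambda>u. (u, 0 :: real))" using N N' by (intro smooth_on_Pair smooth_on_id) auto
    show "\<Phi> (Y u) = (u, 0)" if "u \<in> N \<inter> N'" for u using that Y by (simp add: \<Phi>_def Y_def)
  qed (use N N' YT \<Phi> in auto)
  from smooth_on_linear[OF bounded_linear_fst this] have "smooth_on (N \<inter> N') (touch A)"
    using N N' by (auto simp: Y_def)
  then show "\<exists>T. open T \<and> u0 \<in> T \<and> smooth_on T (touch A)" using N N' by blast
qed

lemma smooth_on_supp_fun:
  assumes "A \<in> smooth_bodies"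
  shows "smooth_on (- {0}) (supp_fun A)"
proof -
  have "smooth_on (- {0}) (\<lambda>u. touch A u \<bullet> u)"
    by (intro smooth_on_inner smooth_on_touch assms smooth_on_id) auto
  moreover have "supp_fun A = (\<lambda>u. touch A u \<bullet> u)" by (rule ext) (rule touch(2))
  ultimately show ?thesis by (simp only:)
qed

subsection \<open>Rolling balls\<close>

lemma rolling_ball_local:
  fixes A :: "'a::euclidean_space body"
  assumes U: "open U" "p0 \<in> U" and f: "smooth_on U f" and AU: "body_set A \<inter> U = {x \<in> U. f x \<le> 0}"
    and g0: "grad f p0 \<noteq> 0"
  obtains e d where "0 < e" "0 < d" "\<And>p u \<delta>. dist p p0 < e \<Longrightarrow> p \<in> body_set A \<Longrightarrow> norm u = 1 \<Longrightarrow>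
    supp_fun A u = p \<bullet> u \<Longrightarrow> 0 < \<delta> \<Longrightarrow> \<delta> \<le> d \<Longrightarrow> cball (p - \<delta> *\<^sub>R u) \<delta> \<subseteq> body_set A"
proof -
  define c where "c = norm (grad f p0) / 2"
  have c: "c > 0" using g0 by (simp add: c_def)
  have g: "smooth_on U (grad f)" by (rule smooth_on_grad[OF f U(1)])
  obtain r1 where r1: "r1 > 0" "cball p0 r1 \<subseteq> U" using U by (meson open_contains_cball)
  have "isCont (grad f) p0"
    using smooth_on_imp_continuous_on[OF g] U by (simp add: continuous_on_eq_continuous_at)
  then obtain r2 where r2: "r2 > 0" "\<And>x. dist x p0 < r2 \<Longrightarrow> dist (grad f x) (grad f p0) < c"
    using c unfolding continuous_at_eps_delta by metis
  define r where "r = min r1 r2 / 3"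
  have r: "r > 0" "2 * r \<le> r1" "2 * r < r2" using r1 r2 by (auto simp: r_def)
  have sub: "cball p0 (2 * r) \<subseteq> U" using r r1 subset_cball[of "2 * r" r1 p0] by blast
  have cg: "norm (grad f x) \<ge> c" if "dist x p0 < r2" for x
    using r2(2)[OF that] norm_triangle_ineq2[of "grad f p0" "grad f p0 - grad f x"]
    by (simp add: dist_norm c_def norm_minus_commute)
  obtain C where C: "0 < C" "\<And>x y. x \<in> cball p0 (2 * r) \<Longrightarrow> y \<in> cball p0 (2 * r) \<Longrightarrow>
      norm (grad f x - grad f y) \<le> C * norm (x - y)"
    using smooth_on_lipschitz_cball[OF g sub] by blast
  define d where "d = min (r / 2) (c / (2 * C))"
  have d: "d > 0" using r c C by (simp add: d_def)
  show ?thesis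
  proof (rule that[OF r(1) d], rule subsetI)
    fix p u \<delta> z
    assume p: "dist p p0 < r" "p \<in> body_set A" and u: "norm u = 1" "supp_fun A u = p \<bullet> u"
      and \<delta>: "0 < \<delta>" "\<delta> \<le> d" and z: "z \<in> cball (p - \<delta> *\<^sub>R u) \<delta>"
    define w where "w = z - p"
    have pU: "p \<in> cball p0 (2 * r)" using p(1) r by (simp add: dist_commute)
    then have "p \<in> U" using sub by blast
    have g: "grad f p \<noteq> 0" "norm (grad f p) \<ge> c" using cg[of p] c p(1) r by auto
    have "u \<noteq> 0" using u by auto
    then obtain k where k: "k > 0" "u = k *\<^sub>R grad f p"
      using normal_parallel_grad[OF U(1) f AU p(2) \<open>p \<in> U\<close> _ u(2) g(1)] by blast
    have "norm (w + \<delta> *\<^sub>R u) \<le> \<delta>" using z by (simp add: w_def dist_norm norm_minus_commute algebra_simps)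
    then have "(norm (w + \<delta> *\<^sub>R u))\<^sup>2 \<le> \<delta>\<^sup>2" using \<delta> by (intro power_mono) auto
    moreover have "(norm (w + \<delta> *\<^sub>R u))\<^sup>2 = (norm w)\<^sup>2 + 2 * \<delta> * (w \<bullet> u) + \<delta>\<^sup>2"
    proof -
      have uu: "u \<bullet> u = 1" using u(1) by (simp add: norm_eq_1)
      have "(norm (w + \<delta> *\<^sub>R u))\<^sup>2 = (w + \<delta> *\<^sub>R u) \<bullet> (w + \<delta> *\<^sub>R u)" by (rule power2_norm_eq_inner)
      also have "\<dots> = w \<bullet> w + 2 * \<delta> * (w \<bullet> u) + \<delta> * \<delta> * (u \<bullet> u)"
        by (simp add: inner_add_left inner_add_right inner_commute[of u w] algebra_simps)
      finally show ?thesis by (simp add: uu power2_norm_eq_inner[of w] power2_eq_square[of \<delta>])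
    qed
    ultimately have wu: "(norm w)\<^sup>2 + 2 * \<delta> * (w \<bullet> u) \<le> 0" by simp
    have "norm w \<le> norm (w + \<delta> *\<^sub>R u) + norm (\<delta> *\<^sub>R u)" using norm_triangle_ineq4[of "w + \<delta> *\<^sub>R u" "\<delta> *\<^sub>R u"] by simp
    also have "\<dots> \<le> r" using \<open>norm (w + \<delta> *\<^sub>R u) \<le> \<delta>\<close> u \<delta> by (simp add: d_def)
    finally have wr: "norm w \<le> r" .
    have seg: "p + t *\<^sub>R w \<in> cball p0 (2 * r)" if "0 \<le> t" "t \<le> 1" for t
    proof -
      have "dist p0 (p + t *\<^sub>R w) \<le> dist p0 p + dist p (p + t *\<^sub>R w)" by (rule dist_triangle)
      also have "dist p (p + t *\<^sub>R w) = t * norm w" using that by (simp add: dist_norm)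
      also have "t * norm w \<le> 1 * norm w" using that by (intro mult_right_mono) auto
      finally show ?thesis using wr p(1) by (simp add: dist_commute)
    qed
    have "((\<lambda>t. f (p + t *\<^sub>R w)) has_real_derivative grad f (p + t *\<^sub>R w) \<bullet> w) (at t)" if "0 \<le> t" "t \<le> 1" for t
      using has_derivative_along_line[OF grad_has_derivative[OF f subsetD[OF sub seg[OF that]]]]
      by (simp add: has_real_derivative_iff_has_vector_derivative)
    then obtain t where t: "0 < t" "t < 1" "f (p + 1 *\<^sub>R w) - f (p + 0 *\<^sub>R w) = (1 - 0) * (grad f (p + t *\<^sub>R w) \<bullet> w)"
      using MVT2[of 0 1 "\<lambda>t. f (p + t *\<^sub>R w)" "\<lambda>t. grad f (p + t *\<^sub>R w) \<bullet> w"] by auto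
    have "grad f (p + t *\<^sub>R w) \<bullet> w = grad f p \<bullet> w + (grad f (p + t *\<^sub>R w) - grad f p) \<bullet> w" by (simp add: inner_diff_left)
    also have "(grad f (p + t *\<^sub>R w) - grad f p) \<bullet> w \<le> norm (grad f (p + t *\<^sub>R w) - grad f p) * norm w" by (rule norm_cauchy_schwarz)
    also have "\<dots> \<le> (C * norm w) * norm w"
    proof (rule mult_right_mono)
      have "norm (grad f (p + t *\<^sub>R w) - grad f p) \<le> C * norm (p + t *\<^sub>R w - p)" using t by (intro C(2) seg pU) auto
      also have "\<dots> \<le> C * norm w" using t C(1) by (simp add: mult_left_le_one_le)
      finally show "norm (grad f (p + t *\<^sub>R w) - grad f p) \<le> C * norm w" .
    qed simp
    finally have "f z - f p \<le> grad f p \<bullet> w + C * (norm w)\<^sup>2"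
      using t(3) by (simp add: w_def power2_eq_square mult.assoc)
    moreover have "f p \<le> 0" using AU p(2) \<open>p \<in> U\<close> by blast
    moreover have "grad f p \<bullet> w + C * (norm w)\<^sup>2 \<le> 0"
    proof -
      have k1: "k * norm (grad f p) = 1" using u(1) k by simp
      have "u \<bullet> w = k * (grad f p \<bullet> w)" using k(2) by (metis inner_scaleR_left)
      then have "norm (grad f p) * (u \<bullet> w) = (k * norm (grad f p)) * (grad f p \<bullet> w)" by simp
      then have gw: "grad f p \<bullet> w = norm (grad f p) * (u \<bullet> w)" unfolding k1 by simp
      have uw: "2 * \<delta> * (u \<bullet> w) \<le> - (norm w)\<^sup>2" using wu by (simp add: inner_commute)
      then have "2 * \<delta> * (u \<bullet> w) \<le> 0" using zero_le_power2[of "norm w"] by linarith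
      then have uw0: "u \<bullet> w \<le> 0" using \<delta>(1) by (simp add: mult_le_0_iff)
      have "2 * \<delta> * (grad f p \<bullet> w) \<le> 2 * \<delta> * (c * (u \<bullet> w))"
        unfolding gw using g(2) uw0 \<delta>(1) by (intro mult_left_mono mult_right_mono_neg) auto
      also have "\<dots> \<le> c * (- (norm w)\<^sup>2)" using mult_left_mono[OF uw, of c] c by (simp add: mult.commute mult.left_commute)
      finally have 1: "2 * \<delta> * (grad f p \<bullet> w) \<le> - (c * (norm w)\<^sup>2)" by simp
      have "\<delta> * (2 * C) \<le> c / (2 * C) * (2 * C)" using \<delta> C by (intro mult_right_mono) (auto simp: d_def)
      then have "2 * \<delta> * C \<le> c" using C by simp
      then have 2: "2 * \<delta> * (C * (norm w)\<^sup>2) \<le> c * (norm w)\<^sup>2"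
        using mult_right_mono[of "2 * \<delta> * C" c "(norm w)\<^sup>2"] by (simp add: mult.assoc)
      have "2 * \<delta> * (grad f p \<bullet> w + C * (norm w)\<^sup>2) \<le> 0" using 1 2 by (simp add: distrib_left)
      then show ?thesis using \<delta>(1) by (simp add: mult_le_0_iff)
    qed
    ultimately have "f z \<le> 0" by linarith
    moreover have "z \<in> U" using seg[of 1] sub by (auto simp: w_def)
    ultimately show "z \<in> body_set A" using AU by blast
  qed
qed

lemma rolling_ball:
  fixes A :: "'a::euclidean_space body"
  assumes A: "A \<in> smooth_bodies"
  obtains \<delta> where "0 < \<delta>" "\<And>u. norm u = 1 \<Longrightarrow> cball (touch A u - \<delta> *\<^sub>R u) \<delta> \<subseteq> body_set A"
proof -
  let ?F = "frontier (body_set A)"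
  let ?P = "\<lambda>p0 e d. 0 < e \<and> 0 < d \<and> (\<forall>p u \<delta>. dist p p0 < e \<longrightarrow> p \<in> body_set A \<longrightarrow> norm u = 1 \<longrightarrow>
    supp_fun A u = p \<bullet> u \<longrightarrow> 0 < \<delta> \<longrightarrow> \<delta> \<le> d \<longrightarrow> cball (p - \<delta> *\<^sub>R u) \<delta> \<subseteq> body_set A)"
  have "\<forall>p0\<in>?F. \<exists>ed. ?P p0 (fst ed) (snd ed)"
  proof
    fix p0 assume "p0 \<in> ?F"
    then obtain U f where "open U" "p0 \<in> U" "smooth_on U f" "body_set A \<inter> U = {x\<in>U. f x \<le> 0}" "grad f p0 \<noteq> 0"
      by (rule smooth_body_defining_function[OF A])
    then obtain e d where "?P p0 e d" by (rule rolling_ball_local[where A=A]) blast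
    then show "\<exists>ed. ?P p0 (fst ed) (snd ed)" by (intro exI[of _ "(e, d)"]) simp
  qed
  from bchoice[OF this] obtain ed where "\<forall>p0\<in>?F. ?P p0 (fst (ed p0)) (snd (ed p0))" ..
  then have ed: "0 < fst (ed p0)" "0 < snd (ed p0)" and roll: "\<And>p u \<delta>. dist p p0 < fst (ed p0) \<Longrightarrow> p \<in> body_set A \<Longrightarrow> norm u = 1 \<Longrightarrow>
    supp_fun A u = p \<bullet> u \<Longrightarrow> 0 < \<delta> \<Longrightarrow> \<delta> \<le> snd (ed p0) \<Longrightarrow> cball (p - \<delta> *\<^sub>R u) \<delta> \<subseteq> body_set A"
    if "p0 \<in> ?F" for p0
    using that by blast+
  have "compact ?F" by (intro compact_frontier) simp
  then obtain D where D: "D \<subseteq> ?F" "finite D" "?F \<subseteq> (\<Union>p\<in>D. ball p (fst (ed p)))"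
    by (rule compactE_image[of ?F ?F "\<lambda>p. ball p (fst (ed p))"]) (use ed in auto)
  define \<delta> where "\<delta> = Min (insert 1 ((snd \<circ> ed) ` D))"
  have \<delta>: "0 < \<delta>" "\<And>p. p \<in> D \<Longrightarrow> \<delta> \<le> snd (ed p)"
  proof -
    have "0 < x" if "x \<in> insert 1 ((snd \<circ> ed) ` D)" for x using that D(1) ed(2) by auto
    then show "0 < \<delta>" unfolding \<delta>_def using D(2) by (subst Min_gr_iff) auto
    show "\<delta> \<le> snd (ed p)" if "p \<in> D" for p
      unfolding \<delta>_def using D(2) that by (intro Min_le) auto
  qed
  show ?thesis
  proof (rule that[OF \<delta>(1)])
    fix u :: 'a assume u: "norm u = 1"
    have "touch A u \<in> ?F" using touch[of A u] u by (intro maximizer_in_frontier) auto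
    then obtain p where p: "p \<in> D" "dist (touch A u) p < fst (ed p)" using D(3) by (auto simp: dist_commute)
    then have "p \<in> ?F" using D(1) by blast
    then show "cball (touch A u - \<delta> *\<^sub>R u) \<delta> \<subseteq> body_set A"
      by (rule roll[OF _ p(2) touch(1) u touch(2) \<delta>(1) \<delta>(2)[OF p(1)]])
  qed
qed

lemma smooth_body_decomposition:
  fixes A :: "'a::euclidean_space body"
  assumes A: "A \<in> smooth_bodies"
  obtains A' \<delta> where "0 < \<delta>" "A = A' + scale_body \<delta> unit_ball_body" "smooth_on (- {0}) (supp_fun A')"
proof -
  obtain \<delta> where \<delta>: "0 < \<delta>" "\<And>u. norm u = 1 \<Longrightarrow> cball (touch A u - \<delta> *\<^sub>R u) \<delta> \<subseteq> body_set A"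
    by (rule rolling_ball[OF A]) blast
  define E where "E = {z. cball z \<delta> \<subseteq> body_set A}"
  have E: "E = (\<Inter>b\<in>cball 0 \<delta>. (\<lambda>z. z + b) -` body_set A)"
  proof (rule set_eqI)
    fix z
    have "z \<in> E \<longleftrightarrow> (\<forall>b\<in>cball 0 \<delta>. z + b \<in> body_set A)"
    proof
      assume "z \<in> E"
      then have "y \<in> body_set A" if "dist z y \<le> \<delta>" for y using that by (auto simp: E_def)
      then show "\<forall>b\<in>cball 0 \<delta>. z + b \<in> body_set A" by (simp add: dist_norm)
    next
      assume b: "\<forall>b\<in>cball 0 \<delta>. z + b \<in> body_set A"
      have "y \<in> body_set A" if "y \<in> cball z \<delta>" for y
        using bspec[OF b, of "y - z"] that by (simp add: dist_norm norm_minus_commute)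
      then show "z \<in> E" by (auto simp: E_def)
    qed
    then show "z \<in> E \<longleftrightarrow> z \<in> (\<Inter>b\<in>cball 0 \<delta>. (\<lambda>z. z + b) -` body_set A)" by simp
  qed
  obtain b :: 'a where "norm b = 1" using vector_choose_size[of 1] by auto
  then have "E \<noteq> {}" using \<delta>(2)[of b] by (auto simp: E_def)
  moreover have "compact E"
  proof -
    have "closed E" unfolding E by (intro closed_INT ballI continuous_closed_vimage continuous_intros) auto
    moreover have "E \<subseteq> body_set A" using \<delta>(1) by (force simp: E_def)
    ultimately show ?thesis by (metis body_set_props(5) bounded_subset compact_eq_bounded_closed)
  qed
  moreover have "convex E"
  proof -
    have "convex ((\<lambda>z. z + b) -` body_set A)" for b
    proof -
      have "(\<lambda>z. z + b) -` body_set A = (\<lambda>z. z - b) ` body_set A" by (force simp: image_iff)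
      then show ?thesis by (simp add: convex_translation_subtract)
    qed
    then show ?thesis unfolding E by (intro convex_INT)
  qed
  ultimately have setE: "body_set (Body E) = E" by (intro body_set_Body)
  have "supp_fun (Body E + scale_body \<delta> unit_ball_body) u = supp_fun A u" if u: "norm u = 1" for u
  proof (rule antisym)
    have "body_set (Body E + scale_body \<delta> unit_ball_body) \<subseteq> body_set A"
    proof
      fix x assume "x \<in> body_set (Body E + scale_body \<delta> unit_ball_body)"
      then obtain y where "y \<in> E" "dist x y \<le> \<delta>" using \<delta>(1) by (auto simp: mem_plus_scaled_ball setE)
      then show "x \<in> body_set A" by (auto simp: E_def dist_commute)
    qed
    then show "supp_fun (Body E + scale_body \<delta> unit_ball_body) u \<le> supp_fun A u"
      by (intro supp_fun_le supp_fun_ge) blast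
    have "touch A u - \<delta> *\<^sub>R u \<in> E" using \<delta>(2)[OF u] by (simp add: E_def)
    then have "(touch A u - \<delta> *\<^sub>R u) \<bullet> u \<le> supp_fun (Body E) u" by (intro supp_fun_ge) (simp add: setE)
    moreover have "u \<bullet> u = 1" using u by (simp add: norm_eq_1)
    ultimately show "supp_fun A u \<le> supp_fun (Body E + scale_body \<delta> unit_ball_body) u"
      using u \<delta>(1) touch(2)[of A u]
      by (simp add: supp_fun_plus supp_fun_scale_body supp_fun_unit_ball inner_diff_left)
  qed
  then have eq: "Body E + scale_body \<delta> unit_ball_body = A" by (rule body_eq_supp_funI)
  have "supp_fun (Body E) x = supp_fun A x - \<delta> * norm x" for x
    using \<delta>(1) by (simp add: eq[symmetric] supp_fun_plus supp_fun_scale_body supp_fun_unit_ball)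
  then have "supp_fun (Body E) = (\<lambda>x. supp_fun A x - \<delta> *\<^sub>R norm x)" by (simp add: fun_eq_iff)
  moreover have "smooth_on (- {0}) (\<lambda>x. supp_fun A x - \<delta> *\<^sub>R norm x)"
    by (intro smooth_on_diff smooth_on_supp_fun A smooth_on_scaleR smooth_on_const smooth_on_norm) auto
  ultimately show ?thesis using that[OF \<delta>(1) eq[symmetric]] by simp
qed

subsection \<open>A criterion for smoothness of bodies\<close>

text \<open>The defining function is \<open>dist(z, A')\<^sup>2 - \<delta>\<^sup>2\<close>. The vector \<open>u(z)\<close> from the nearest point of \<open>A'\<close> to
  \<open>z\<close> solves \<open>grad h(u) + u = z\<close> for the support function \<open>h\<close> of \<open>A'\<close>.\<close>

lemma parallel_body_smooth:
  fixes A' :: "'a::euclidean_space body"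
  assumes \<delta>: "0 < \<delta>" and h: "smooth_on (- {0}) (supp_fun A')"
  shows "A' + scale_body \<delta> unit_ball_body \<in> smooth_bodies"
proof -
  let ?A = "A' + scale_body \<delta> unit_ball_body"
  let ?U = "- body_set A'" and ?P = "closest_point (body_set A')"
  define u where "u z = z - ?P z" for z
  define f where "f z = u z \<bullet> u z - \<delta>\<^sup>2" for z
  let ?g = "grad (supp_fun A')"
  define \<Theta> where "\<Theta> v = ?g v + v" for v
  have U: "open ?U" by (intro open_Compl) simp
  have P: "?P z \<in> body_set A'" for z by (intro closest_point_in_set) auto
  have Pdot: "u z \<bullet> (x - ?P z) \<le> 0" if "x \<in> body_set A'" for z x
    unfolding u_def using that by (intro closest_point_dot) auto
  have supp: "supp_fun A' (u z) = ?P z \<bullet> u z" for z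
    by (rule supp_fun_eqI[OF P]) (use Pdot[of _ z] in \<open>simp add: inner_diff_right inner_commute\<close>)
  have u0: "u z \<noteq> 0" if "z \<in> ?U" for z using that P[of z] by (auto simp: u_def)
  have g: "smooth_on (- {0}) ?g" by (intro smooth_on_grad h) auto
  have \<Theta>: "smooth_on (- {0}) \<Theta>" unfolding \<Theta>_def[abs_def] by (intro smooth_on_add g smooth_on_id) auto
  have g_eq: "?g v = z" if "v \<noteq> 0" "z \<in> body_set A'" "supp_fun A' v = z \<bullet> v" for v z
  proof -
    have "(supp_fun A' has_derivative (\<lambda>w. ?g v \<bullet> w)) (at v)" using that by (intro grad_has_derivative[OF h]) simp
    from grad_supp_fun_eq[OF this that(2,3)] have "?g v \<bullet> w = z \<bullet> w" for w by metis
    then show ?thesis by (metis inner_commute vector_eq_rdot)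
  qed
  have \<Theta>u: "\<Theta> (u z) = z" if "z \<in> ?U" for z
    unfolding \<Theta>_def g_eq[OF u0[OF that] P supp] by (simp add: u_def)
  have contu: "continuous_on S u" for S
    unfolding u_def by (intro continuous_intros continuous_on_closest_point) auto
  have \<Theta>': "frechet_derivative \<Theta> (at v) = (\<lambda>w. frechet_derivative ?g (at v) w + w)" if "v \<noteq> 0" for v
    unfolding \<Theta>_def[abs_def]
    by (intro frechet_derivative_eqI has_derivative_add has_derivative_ident smooth_on_has_derivative[OF g]) (use that in simp)
  have gpos: "frechet_derivative ?g (at v) w \<bullet> w \<ge> 0" if v: "v \<noteq> 0" for v w
  proof -
    have gt: "?g x = touch A' x" if "x \<noteq> 0" for x using g_eq[OF that touch] .
    have "((\<lambda>t. ?g (v + t *\<^sub>R w)) has_vector_derivative frechet_derivative ?g (at v) w) (at 0)"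
      using has_derivative_along_line[of ?g _ v 0 w] smooth_on_has_derivative[OF g, of v] v by simp
    then have D: "((\<lambda>t. ?g (v + t *\<^sub>R w) \<bullet> w) has_real_derivative frechet_derivative ?g (at v) w \<bullet> w) (at 0)"
      unfolding has_real_derivative_iff_has_vector_derivative
      by (rule bounded_linear.has_vector_derivative[OF bounded_linear_inner_left])
    have "isCont (\<lambda>t. v + t *\<^sub>R w) 0" by (intro continuous_intros)
    then have "((\<lambda>t. v + t *\<^sub>R w) \<longlongrightarrow> v) (at 0)" by (simp add: isCont_def)
    from tendsto_imp_eventually_ne[OF this v] have "\<forall>\<^sub>F t in at 0. v + t *\<^sub>R w \<noteq> 0" .
    then have ev: "\<forall>\<^sub>F t in at_right 0. v + t *\<^sub>R w \<noteq> 0" by (auto simp: eventually_at_split)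
    show ?thesis
    proof (rule ccontr)
      assume "\<not> ?thesis"
      then have "- (frechet_derivative ?g (at v) w \<bullet> w) > 0" by simp
      from DERIV_pos_inc_right[OF DERIV_minus[OF D] this] obtain d where d: "d > 0"
        "\<And>t. 0 < t \<Longrightarrow> t < d \<Longrightarrow> ?g (v + t *\<^sub>R w) \<bullet> w < ?g v \<bullet> w" by force
      have "\<forall>\<^sub>F t in at_right 0. t \<in> {0<..<d}" using d(1) by (rule eventually_at_right_real)
      with ev have "\<forall>\<^sub>F t in at_right 0. v + t *\<^sub>R w \<noteq> 0 \<and> 0 < t \<and> t < d" by eventually_elim auto
      from eventually_happens'[OF trivial_limit_at_right_real this]
      obtain t where t: "v + t *\<^sub>R w \<noteq> 0" "0 < t" "t < d" by blast
      have "(touch A' (v + t *\<^sub>R w) - touch A' v) \<bullet> ((v + t *\<^sub>R w) - v) \<ge> 0"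
        by (rule maximizers_monotone[where K=A']) (rule touch)+
      then have "(?g (v + t *\<^sub>R w) - ?g v) \<bullet> w \<ge> 0"
        using t by (simp add: gt v zero_le_mult_iff)
      then show False using d(2)[OF t(2,3)] by (simp add: inner_diff_left)
    qed
  qed
  have \<Theta>pos: "frechet_derivative \<Theta> (at v) w \<bullet> w \<ge> w \<bullet> w" if "v \<noteq> 0" for v w
    using gpos[OF that, of w] by (simp add: \<Theta>'[OF that] inner_add_left)
  have u: "smooth_on ?U u"
  proof (rule smooth_on_implicit[where \<Phi>=\<Theta> and T="- {0}" and R="\<lambda>z. z"])
    show "inj (frechet_derivative \<Theta> (at (u z)))" if z: "z \<in> ?U" for z
    proof -
      have "linear (frechet_derivative \<Theta> (at (u z)))"
        using smooth_on_has_derivative[OF \<Theta>, of "u z"] u0[OF z] by (intro has_derivative_linear) auto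
      moreover have "w = 0" if "frechet_derivative \<Theta> (at (u z)) w = 0" for w
        using \<Theta>pos[OF u0[OF z], of w] that by (simp add: inner_self_le_0_iff)
      ultimately show ?thesis using linear_injective_0 by blast
    qed
  qed (use U contu \<Theta> u0 \<Theta>u in \<open>auto intro: smooth_on_id\<close>)
  have f: "smooth_on ?U f" unfolding f_def[abs_def] by (intro smooth_on_diff smooth_on_inner u U smooth_on_const)
  have f': "frechet_derivative f (at z) = (\<lambda>v. 2 * (u z \<bullet> v))" if z: "z \<in> ?U" for z
  proof -
    let ?q = "\<lambda>x. (x - ?P z) \<bullet> (x - ?P z) - \<delta>\<^sup>2"
    have q: "(?q has_derivative (\<lambda>v. 2 * (u z \<bullet> v))) (at z)"
      by (auto intro!: derivative_eq_intros simp: u_def inner_commute)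
    have "((\<lambda>x. ?q x - f x) has_derivative (\<lambda>v. 2 * (u z \<bullet> v) - frechet_derivative f (at z) v)) (at z)"
      by (intro has_derivative_diff q smooth_on_has_derivative[OF f z])
    moreover have "\<forall>\<^sub>F x in at z. ?q z - f z \<le> ?q x - f x"
    proof (intro always_eventually allI)
      fix x
      have "norm (u x) \<le> norm (x - ?P z)"
        using closest_point_le[OF _ P[of z], of x] by (simp add: u_def dist_norm)
      then have "(norm (u x))\<^sup>2 \<le> (norm (x - ?P z))\<^sup>2" by (intro power_mono) auto
      then show "?q z - f z \<le> ?q x - f x" by (simp add: f_def u_def power2_norm_eq_inner)
    qed
    ultimately have "(\<lambda>v. 2 * (u z \<bullet> v) - frechet_derivative f (at z) v) = (\<lambda>v. 0)" by (rule has_derivative_local_min)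
    then show ?thesis by (metis eq_iff_diff_eq_0 ext)
  qed
  show ?thesis
    unfolding smooth_bodies_def
  proof (intro CollectI ballI exI conjI allI impI)
    fix p assume p: "p \<in> frontier (body_set ?A)"
    show "open ?U" by (rule U)
    show "smooth_on ?U f" by (rule f)
    show pU: "p \<in> ?U"
    proof
      assume "p \<in> body_set A'"
      then have "ball p \<delta> \<subseteq> body_set ?A" using \<delta> by (auto simp: mem_plus_scaled_ball subset_iff dist_commute intro!: bexI[of _ p])
      then have "ball p \<delta> \<subseteq> interior (body_set ?A)" by (simp add: interior_maximal)
      moreover have "p \<in> ball p \<delta>" using \<delta> by simp
      ultimately have "p \<in> interior (body_set ?A)" by blast
      then show False using p by (simp add: frontier_def)
    qed
    show "body_set ?A \<inter> ?U = {x \<in> ?U. f x \<le> 0}"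
    proof -
      have "x \<in> body_set ?A \<longleftrightarrow> f x \<le> 0" for x
      proof -
        have "x \<in> body_set ?A \<longleftrightarrow> dist x (?P x) \<le> \<delta>"
          using P[of x] closest_point_le[of "body_set A'" _ x] \<delta> by (auto simp: mem_plus_scaled_ball intro: order_trans)
        also have "\<dots> \<longleftrightarrow> (norm (u x))\<^sup>2 \<le> \<delta>\<^sup>2" using \<delta> by (simp add: u_def dist_norm abs_le_square_iff[symmetric])
        finally show ?thesis by (simp add: f_def power2_norm_eq_inner)
      qed
      then show ?thesis by blast
    qed
    show "frechet_derivative f (at p) (u p) \<noteq> 0" using f'[OF pU] u0[OF pU] by simp
    fix v :: 'a assume v: "v \<noteq> 0 \<and> frechet_derivative f (at p) v = 0"
    let ?y = "frechet_derivative u (at p) v"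
    have up: "(u has_derivative frechet_derivative u (at p)) (at p)" by (rule smooth_on_has_derivative[OF u pU])
    have "((\<lambda>x. 2 * (u x \<bullet> v)) has_derivative (\<lambda>w. 2 * (frechet_derivative u (at p) w \<bullet> v))) (at p)"
      by (intro has_derivative_mult_right has_derivative_inner_left up)
    then have "((\<lambda>x. frechet_derivative f (at x) v) has_derivative (\<lambda>w. 2 * (frechet_derivative u (at p) w \<bullet> v))) (at p)"
      by (rule has_derivative_transform_within_open[OF _ U pU]) (simp add: f')
    then have D: "frechet_derivative (\<lambda>x. frechet_derivative f (at x) v) (at p) v = 2 * (?y \<bullet> v)"
      by (simp add: frechet_derivative_eqI)
    have "((\<lambda>x. \<Theta> (u x)) has_derivative (\<lambda>w. frechet_derivative \<Theta> (at (u p)) (frechet_derivative u (at p) w))) (at p)"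
      using diff_chain_at[OF up smooth_on_has_derivative[OF \<Theta>, of "u p"]] u0[OF pU] by (simp add: o_def)
    moreover have "((\<lambda>x. \<Theta> (u x)) has_derivative (\<lambda>w. w)) (at p)"
      by (rule has_derivative_transform_within_open[OF has_derivative_ident U pU]) (simp add: \<Theta>u)
    ultimately have "frechet_derivative \<Theta> (at (u p)) ?y = v" using has_derivative_unique by metis
    then have le: "?y \<bullet> ?y \<le> v \<bullet> ?y" using \<Theta>pos[OF u0[OF pU], of ?y] by simp
    have "?y \<noteq> 0"
    proof
      assume "?y = 0"
      moreover have "linear (frechet_derivative \<Theta> (at (u p)))"
        using smooth_on_has_derivative[OF \<Theta>, of "u p"] u0[OF pU] by (intro has_derivative_linear) auto
      ultimately show False using \<open>frechet_derivative \<Theta> (at (u p)) ?y = v\<close> v by (simp add: linear_0)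
    qed
    then have "0 < ?y \<bullet> ?y" by simp
    also note le
    finally show "0 < frechet_derivative (\<lambda>x. frechet_derivative f (at x) v) (at p) v"
      unfolding D by (simp add: inner_commute)
  qed
qed

theorem smooth_bodies_plus:
  assumes "A \<in> smooth_bodies" "B \<in> smooth_bodies"
  shows "A + B \<in> smooth_bodies"
proof -
  obtain A' a where A: "0 < a" "A = A' + scale_body a unit_ball_body" "smooth_on (- {0}) (supp_fun A')"
    by (rule smooth_body_decomposition[OF assms(1)])
  obtain B' b where B: "0 < b" "B = B' + scale_body b unit_ball_body" "smooth_on (- {0}) (supp_fun B')"
    by (rule smooth_body_decomposition[OF assms(2)])
  have "supp_fun (A' + B') = (\<lambda>x. supp_fun A' x + supp_fun B' x)" by (simp add: fun_eq_iff supp_fun_plus)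
  moreover have "smooth_on (- {0}) (\<lambda>x. supp_fun A' x + supp_fun B' x)" by (intro smooth_on_add A B) auto
  ultimately have "(A' + B') + scale_body (a + b) unit_ball_body \<in> smooth_bodies"
    using A(1) B(1) by (intro parallel_body_smooth) auto
  moreover have "(A' + B') + scale_body (a + b) unit_ball_body = A + B"
    using A(1,2) B(1,2) by (simp add: scale_body_add_left ac_simps)
  ultimately show ?thesis by simp
qed

lemma smooth_on_supp_fun_scale:
  assumes "smooth_on S (supp_fun A)" "0 \<le> s" "open S"
  shows "smooth_on S (supp_fun (scale_body s A))"
proof -
  have "supp_fun (scale_body s A) = (\<lambda>x. s *\<^sub>R supp_fun A x)"
    using assms(2) by (simp add: fun_eq_iff supp_fun_scale_body)
  moreover have "smooth_on S (\<lambda>x. s *\<^sub>R supp_fun A x)" by (intro smooth_on_scaleR smooth_on_const assms)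
  ultimately show ?thesis by simp
qed

theorem smooth_bodies_scale:
  assumes "A \<in> smooth_bodies" "0 < s"
  shows "scale_body s A \<in> smooth_bodies"
proof -
  obtain A' a where A: "0 < a" "A = A' + scale_body a unit_ball_body" "smooth_on (- {0}) (supp_fun A')"
    by (rule smooth_body_decomposition[OF assms(1)])
  have "scale_body s A = scale_body s A' + scale_body (s * a) unit_ball_body"
    using A(2) by (simp add: scale_body_add scale_scale_body)
  moreover have "scale_body s A' + scale_body (s * a) unit_ball_body \<in> smooth_bodies"
    using A(1) assms(2) by (intro parallel_body_smooth smooth_on_supp_fun_scale A(3)) auto
  ultimately show ?thesis by simp
qed

lemma smooth_on_supp_fun_unit_ball: "smooth_on (- {0}) (supp_fun (unit_ball_body :: 'a::euclidean_space body))"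
proof -
  have "supp_fun (unit_ball_body :: 'a body) = norm" by (simp add: fun_eq_iff supp_fun_unit_ball)
  then show ?thesis by (simp add: smooth_on_norm)
qed

theorem unit_ball_smooth: "(unit_ball_body :: 'a::euclidean_space body) \<in> smooth_bodies"
proof -
  let ?B = "unit_ball_body :: 'a body"
  have "scale_body (1/2) ?B + scale_body (1/2) ?B \<in> smooth_bodies"
    by (intro parallel_body_smooth smooth_on_supp_fun_scale smooth_on_supp_fun_unit_ball) auto
  then show ?thesis using scale_body_add_left[of "1/2" "1/2" ?B] by simp
qed

section \<open>Smooth families of bodies\<close>

text \<open>The parameter space is finite-dimensional, but not an instance of \<open>euclidean_space\<close>, since we need
  the space of linear maps.\<close>

locale finite_coordinates =
  fixes J :: "'j set" and e :: "'j \<Rightarrow> 'w::real_normed_vector" and \<phi> :: "'j \<Rightarrow> 'w \<Rightarrow> real"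
  assumes finite_J: "finite J" and linear_\<phi>: "\<And>j. bounded_linear (\<phi> j)"
    and representation: "\<And>v. (\<Sum>j\<in>J. \<phi> j v *\<^sub>R e j) = v"

definition smooth_family :: "'w::real_normed_vector set \<Rightarrow> ('w \<Rightarrow> 'a::euclidean_space body) \<Rightarrow> bool" where
  "smooth_family \<Omega> A \<longleftrightarrow> smooth_on (\<Omega> \<times> (- {0})) (\<lambda>z. supp_fun (A (fst z)) (snd z))"

lemma open_family_domain: "open \<Omega> \<Longrightarrow> open (\<Omega> \<times> (- {0 :: 'a::euclidean_space}))"
  by (intro open_Times) auto

lemma smooth_family_subset: "smooth_family \<Omega> A \<Longrightarrow> \<Omega>' \<subseteq> \<Omega> \<Longrightarrow> smooth_family \<Omega>' A"
  unfolding smooth_family_def by (erule smooth_on_subset) auto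

lemma smooth_family_const:
  assumes "smooth_on (- {0}) (supp_fun K)" "open \<Omega>"
  shows "smooth_family \<Omega> (\<lambda>_. K)"
  unfolding smooth_family_def
  by (rule smooth_on_compose[OF smooth_on_bounded_linear[OF bounded_linear_snd] assms(1) open_family_domain[OF assms(2)]]) auto

lemma has_derivative_curve:
  assumes "(F has_derivative F') (at (g + t *\<^sub>R v, x + t *\<^sub>R w))"
  shows "((\<lambda>t. F (g + t *\<^sub>R v, x + t *\<^sub>R w)) has_vector_derivative F' (v, w)) (at t)"
  using has_derivative_along_line[of F F' "(g, x)" t "(v, w)"] assms by simp

lemma smooth_on_curve:
  fixes F :: "'w::real_normed_vector \<times> 'a::real_normed_vector \<Rightarrow> real"
  assumes "smooth_on S F" "(g + t *\<^sub>R v, x + t *\<^sub>R w) \<in> S"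
  shows "((\<lambda>t. F (g + t *\<^sub>R v, x + t *\<^sub>R w)) has_real_derivative
     frechet_derivative F (at (g + t *\<^sub>R v, x + t *\<^sub>R w)) (v, w)) (at t)"
  unfolding has_real_derivative_iff_has_vector_derivative
  by (rule has_derivative_curve[OF smooth_on_has_derivative[OF assms]])

lemma parameter_derivative_homogeneous:
  fixes F :: "'w::real_normed_vector \<times> 'a::euclidean_space \<Rightarrow> real"
  assumes F: "smooth_on (\<Omega> \<times> (- {0})) F" and hom: "\<And>g x t. t > 0 \<Longrightarrow> F (g, t *\<^sub>R x) = t * F (g, x)"
    and g: "g \<in> \<Omega>" and x: "x \<noteq> 0" and t: "t > 0"
  shows "frechet_derivative F (at (g, t *\<^sub>R x)) (v, 0) = t * frechet_derivative F (at (g, x)) (v, 0)"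
proof -
  have d: "((\<lambda>s. F (g + s *\<^sub>R v, y)) has_real_derivative frechet_derivative F (at (g, y)) (v, 0)) (at 0)"
    if "y \<noteq> 0" for y
    using smooth_on_curve[OF F, of g 0 v y 0] g that by simp
  have "((\<lambda>s. t * F (g + s *\<^sub>R v, x)) has_real_derivative t * frechet_derivative F (at (g, x)) (v, 0)) (at 0)"
    by (rule DERIV_cmult[OF d[OF x]])
  then have "((\<lambda>s. F (g + s *\<^sub>R v, t *\<^sub>R x)) has_real_derivative t * frechet_derivative F (at (g, x)) (v, 0)) (at 0)"
    by (simp add: hom[OF t])
  moreover have "((\<lambda>s. F (g + s *\<^sub>R v, t *\<^sub>R x)) has_real_derivative frechet_derivative F (at (g, t *\<^sub>R x)) (v, 0)) (at 0)"
    by (rule d) (use x t in simp)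
  ultimately show ?thesis using DERIV_unique by blast
qed

context
  fixes F :: "'w::real_normed_vector \<times> 'a::euclidean_space \<Rightarrow> real" and \<Omega> :: "'w set"
  assumes \<Omega>: "open \<Omega>" and F: "smooth_on (\<Omega> \<times> (- {0})) F"
    and hom: "\<And>g x t. g \<in> \<Omega> \<Longrightarrow> x \<noteq> 0 \<Longrightarrow> t > 0 \<Longrightarrow> F (g, t *\<^sub>R x) = t * F (g, x)"
begin

lemma euler_homogeneous:
  assumes g: "g \<in> \<Omega>" and x: "x \<noteq> 0"
  shows "frechet_derivative F (at (g, x)) (0, x) = F (g, x)"
proof -
  have "((\<lambda>t. F (g + t *\<^sub>R 0, x + t *\<^sub>R x)) has_real_derivative frechet_derivative F (at (g + 0 *\<^sub>R 0, x + 0 *\<^sub>R x)) (0, x)) (at 0)"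
    by (rule smooth_on_curve[OF F]) (use g x in simp)
  then have "((\<lambda>t. F (g, x + t *\<^sub>R x)) has_real_derivative frechet_derivative F (at (g, x)) (0, x)) (at 0)" by simp
  moreover have "((\<lambda>t. F (g, x + t *\<^sub>R x)) has_real_derivative F (g, x)) (at 0)"
  proof (rule has_field_derivative_transform_within_open[where S="{-1<..}"])
    show "((\<lambda>t. (1 + t) * F (g, x)) has_real_derivative F (g, x)) (at 0)"
      by (auto intro!: derivative_eq_intros)
    show "(1 + t) * F (g, x) = F (g, x + t *\<^sub>R x)" if "t \<in> {-1<..}" for t
      using hom[OF g x, of "1 + t"] that by (simp add: scaleR_add_left)
  qed auto
  ultimately show ?thesis by (rule DERIV_unique)
qed

lemma frechet_space_sum:
  assumes G: "smooth_on (\<Omega> \<times> (- {0})) G" and z: "z \<in> \<Omega> \<times> (- {0 :: 'a})"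
  shows "frechet_derivative G (at z) (0, w) = (\<Sum>b\<in>Basis. (w \<bullet> b) *\<^sub>R frechet_derivative G (at z) (0, b))"
proof -
  have lin: "linear (frechet_derivative G (at z))"
    using smooth_on_has_derivative[OF G z] by (rule has_derivative_linear)
  have "linear (\<lambda>w. frechet_derivative G (at z) (0, w))"
    using linear_compose[OF _ lin, of "\<lambda>w. (0, w)"] by (simp add: o_def linear_conv_bounded_linear bounded_linear_Pair linear_iff)
  then show ?thesis by (rule linear_sum_Basis)
qed

text \<open>For unit vectors \<open>1 - x \<bullet> y = norm (x - y)\<^sup>2 / 2\<close>, so that a second-order Taylor estimate shows that
  \<open>F(g, \<cdot>) + c norm\<close> is the supremum of the linear functionals given by its gradients.\<close>

lemma homogeneous_quadratic_bound:
  assumes g0: "g0 \<in> \<Omega>"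
  obtains \<Omega>' C where "open \<Omega>'" "g0 \<in> \<Omega>'" "\<Omega>' \<subseteq> \<Omega>" "0 \<le> C"
    "\<And>g x y. g \<in> \<Omega>' \<Longrightarrow> norm x = 1 \<Longrightarrow> norm y = 1 \<Longrightarrow>
      \<bar>F (g, y) - frechet_derivative F (at (g, x)) (0, y)\<bar> \<le> C * (norm (x - y))\<^sup>2"
proof -
  let ?S = "\<Omega> \<times> (- {0 :: 'a})"
  let ?D1 = "\<lambda>b z. frechet_derivative F (at z) (0, b)"
  let ?D2 = "\<lambda>b b' z. frechet_derivative (?D1 b) (at z) (0, b')"
  let ?T = "cball 0 (3/2) - ball 0 (1/2) :: 'a set"
  define m where "m z = \<bar>F z\<bar> + (\<Sum>b\<in>Basis. \<bar>?D1 b z\<bar>) + (\<Sum>b\<in>Basis. \<Sum>b'\<in>Basis. \<bar>?D2 b b' z\<bar>)" for z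
  have D1: "smooth_on ?S (?D1 b)" for b by (rule smooth_on_frechet_derivative[OF F])
  have D2: "smooth_on ?S (?D2 b b')" for b b' by (rule smooth_on_frechet_derivative[OF D1])
  have T0: "?T \<subseteq> - {0}" by auto
  have cT: "compact ?T" by (intro compact_diff) auto
  have "continuous_on ?S m"
    unfolding m_def by (intro continuous_intros smooth_on_imp_continuous_on F D1 D2)
  then have cm: "continuous_on (\<Omega> \<times> ?T) m" by (rule continuous_on_subset) (use T0 in blast)
  obtain X where X: "g0 \<in> X" "open X" "\<forall>g\<in>X \<inter> \<Omega>. \<forall>x\<in>?T. dist (m (g, x)) (m (g0, x)) \<le> 1"
    by (rule continuous_on_prod_compactE[OF cm cT g0, of 1]) auto
  have "continuous_on ?T (\<lambda>x. m (g0, x))"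
    by (rule continuous_on_compose2[OF cm continuous_on_Pair[OF continuous_on_const continuous_on_id]]) (use g0 in auto)
  then have "bounded ((\<lambda>x. m (g0, x)) ` ?T)" by (intro compact_imp_bounded compact_continuous_image cT)
  then obtain M where M: "\<And>x. x \<in> ?T \<Longrightarrow> norm (m (g0, x)) \<le> M" unfolding bounded_iff by blast
  have m0: "0 \<le> m z" for z unfolding m_def by (intro add_nonneg_nonneg sum_nonneg) auto
  define C where "C = max M 0 + 1"
  have mC: "m (g, x) \<le> C" if "g \<in> X \<inter> \<Omega>" "x \<in> ?T" for g x
    using bspec[OF bspec[OF X(3) that(1)] that(2)] M[OF that(2)] by (simp add: C_def dist_real_def)
  have FC: "\<bar>F (g, x)\<bar> \<le> C" and D1C: "(\<Sum>b\<in>Basis. \<bar>?D1 b (g, x)\<bar>) \<le> C"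
    and D2C: "(\<Sum>b\<in>Basis. \<Sum>b'\<in>Basis. \<bar>?D2 b b' (g, x)\<bar>) \<le> C" if "g \<in> X \<inter> \<Omega>" "x \<in> ?T" for g x
  proof -
    have "0 \<le> (\<Sum>b\<in>Basis. \<bar>?D1 b (g, x)\<bar>)" "0 \<le> (\<Sum>b\<in>Basis. \<Sum>b'\<in>Basis. \<bar>?D2 b b' (g, x)\<bar>)"
      by (intro sum_nonneg; simp)+
    then show "\<bar>F (g, x)\<bar> \<le> C" "(\<Sum>b\<in>Basis. \<bar>?D1 b (g, x)\<bar>) \<le> C"
      "(\<Sum>b\<in>Basis. \<Sum>b'\<in>Basis. \<bar>?D2 b b' (g, x)\<bar>) \<le> C"
      using mC[OF that] unfolding m_def by linarith+
  qed
  have C0: "0 \<le> C" by (simp add: C_def)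
  have comp: "\<bar>w \<bullet> b\<bar> \<le> norm w" if "b \<in> Basis" for w b :: 'a using that by (rule Basis_le_norm)
  show ?thesis
  proof (rule that[of "X \<inter> \<Omega>" "8 * C"])
    fix g and x y :: 'a assume g: "g \<in> X \<inter> \<Omega>" and x: "norm x = 1" and y: "norm y = 1"
    have unit: "z \<in> ?T" if "norm z = 1" for z :: 'a using that by simp
    have gO: "g \<in> \<Omega>" using g by blast
    have x0: "x \<noteq> 0" using x by auto
    show "\<bar>F (g, y) - ?D1 y (g, x)\<bar> \<le> 8 * C * (norm (x - y))\<^sup>2"
    proof (cases "norm (x - y) \<ge> 1/2")
      case True
      have "?D1 y (g, x) = (\<Sum>b\<in>Basis. (y \<bullet> b) *\<^sub>R ?D1 b (g, x))"
        by (rule frechet_space_sum[OF F]) (use gO x0 in simp)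
      also have "\<bar>\<dots>\<bar> \<le> (\<Sum>b\<in>Basis. \<bar>?D1 b (g, x)\<bar>)"
      proof (rule order_trans[OF sum_abs], rule sum_mono)
        fix b :: 'a assume "b \<in> Basis"
        then show "\<bar>(y \<bullet> b) *\<^sub>R ?D1 b (g, x)\<bar> \<le> \<bar>?D1 b (g, x)\<bar>"
          using comp[of b y] y by (simp add: abs_mult mult_left_le_one_le)
      qed
      finally have "\<bar>?D1 y (g, x)\<bar> \<le> C" using D1C[OF g unit[OF x]] by linarith
      then have "\<bar>F (g, y) - ?D1 y (g, x)\<bar> \<le> 8 * C * (1/2)\<^sup>2"
        using FC[OF g unit[OF y]] by (simp add: power2_eq_square)
      also have "\<dots> \<le> 8 * C * (norm (x - y))\<^sup>2" using True C0 by (intro mult_left_mono power_mono) auto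
      finally show ?thesis .
    next
      case False
      define w where "w = y - x"
      have nw: "norm w < 1/2" using False by (simp add: w_def norm_minus_commute)
      have seg: "x + t *\<^sub>R w \<in> ?T" if "0 \<le> t" "t \<le> 1" for t
      proof -
        have "t * norm w \<le> 1 * norm w" using that by (intro mult_right_mono) auto
        then have "norm (t *\<^sub>R w) \<le> 1/2" using that nw by simp
        then show ?thesis
          using x norm_triangle_ineq[of x "t *\<^sub>R w"] norm_triangle_ineq4[of "x + t *\<^sub>R w" "t *\<^sub>R w"] by auto
      qed
      have segS: "(g + t *\<^sub>R 0, x + t *\<^sub>R w) \<in> ?S" if "0 \<le> t" "t \<le> 1" for t using seg[OF that] T0 gO by auto
      have "((\<lambda>t. F (g + t *\<^sub>R 0, x + t *\<^sub>R w)) has_real_derivative ?D1 w (g + t *\<^sub>R 0, x + t *\<^sub>R w)) (at t)"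
        if "0 \<le> t" "t \<le> 1" for t by (rule smooth_on_curve[OF F segS[OF that]])
      then obtain s where s: "0 < s" "s < 1" "F (g, x + 1 *\<^sub>R w) - F (g, x + 0 *\<^sub>R w) = (1 - 0) * ?D1 w (g, x + s *\<^sub>R w)"
        using MVT2[of 0 1 "\<lambda>t. F (g, x + t *\<^sub>R w)" "\<lambda>t. ?D1 w (g, x + t *\<^sub>R w)"] by auto
      have "((\<lambda>t. ?D1 w (g + t *\<^sub>R 0, x + t *\<^sub>R w)) has_real_derivative ?D2 w w (g + t *\<^sub>R 0, x + t *\<^sub>R w)) (at t)"
        if "0 \<le> t" "t \<le> 1" for t by (rule smooth_on_curve[OF D1 segS[OF that]])
      then obtain r where r: "0 < r" "r < s" "?D1 w (g, x + s *\<^sub>R w) - ?D1 w (g, x + 0 *\<^sub>R w) = (s - 0) * ?D2 w w (g, x + r *\<^sub>R w)"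
        using MVT2[of 0 s "\<lambda>t. ?D1 w (g, x + t *\<^sub>R w)" "\<lambda>t. ?D2 w w (g, x + t *\<^sub>R w)"] s by auto
      let ?z = "(g, x + r *\<^sub>R w)"
      have zT: "x + r *\<^sub>R w \<in> ?T" using r s by (intro seg) auto
      have zS: "?z \<in> ?S" using zT T0 gO by blast
      have "?D2 w w ?z = (\<Sum>b'\<in>Basis. (w \<bullet> b') *\<^sub>R ?D2 w b' ?z)" by (rule frechet_space_sum[OF D1 zS])
      also have "\<dots> = (\<Sum>b'\<in>Basis. (w \<bullet> b') *\<^sub>R (\<Sum>b\<in>Basis. (w \<bullet> b) *\<^sub>R ?D2 b b' ?z))"
      proof (rule sum.cong[OF refl])
        fix b' :: 'a
        have "((\<lambda>z. \<Sum>b\<in>Basis. (w \<bullet> b) *\<^sub>R ?D1 b z) has_derivative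
            (\<lambda>v. \<Sum>b\<in>Basis. (w \<bullet> b) *\<^sub>R frechet_derivative (?D1 b) (at ?z) v)) (at ?z)"
          by (intro has_derivative_sum has_derivative_scaleR_right smooth_on_has_derivative[OF D1 zS])
        then have "(?D1 w has_derivative (\<lambda>v. \<Sum>b\<in>Basis. (w \<bullet> b) *\<^sub>R frechet_derivative (?D1 b) (at ?z) v)) (at ?z)"
          by (rule has_derivative_transform_within_open[OF _ open_family_domain[OF \<Omega>] zS])
             (rule frechet_space_sum[OF F, symmetric])
        then have "?D2 w b' ?z = (\<Sum>b\<in>Basis. (w \<bullet> b) *\<^sub>R ?D2 b b' ?z)" by (simp add: frechet_derivative_eqI)
        then show "(w \<bullet> b') *\<^sub>R ?D2 w b' ?z = (w \<bullet> b') *\<^sub>R (\<Sum>b\<in>Basis. (w \<bullet> b) *\<^sub>R ?D2 b b' ?z)" by (rule arg_cong)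
      qed
      also have "\<bar>\<dots>\<bar> \<le> (\<Sum>b'\<in>Basis. norm w * (\<Sum>b\<in>Basis. norm w * \<bar>?D2 b b' ?z\<bar>))"
      proof (rule order_trans[OF sum_abs], rule sum_mono)
        fix b' :: 'a assume b': "b' \<in> Basis"
        have "\<bar>\<Sum>b\<in>Basis. (w \<bullet> b) *\<^sub>R ?D2 b b' ?z\<bar> \<le> (\<Sum>b\<in>Basis. norm w * \<bar>?D2 b b' ?z\<bar>)"
          by (rule order_trans[OF sum_abs], rule sum_mono) (simp add: abs_mult comp mult_right_mono)
        then show "\<bar>(w \<bullet> b') *\<^sub>R (\<Sum>b\<in>Basis. (w \<bullet> b) *\<^sub>R ?D2 b b' ?z)\<bar> \<le> norm w * (\<Sum>b\<in>Basis. norm w * \<bar>?D2 b b' ?z\<bar>)"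
          unfolding real_scaleR_def abs_mult by (intro mult_mono comp b') auto
      qed
      also have "\<dots> = (norm w)\<^sup>2 * (\<Sum>b\<in>Basis. \<Sum>b'\<in>Basis. \<bar>?D2 b b' ?z\<bar>)"
        unfolding sum_distrib_left[symmetric] by (subst sum.swap) (simp add: power2_eq_square mult.assoc)
      also have "\<dots> \<le> (norm w)\<^sup>2 * C" by (intro mult_left_mono D2C g zT) auto
      finally have D2w: "\<bar>?D2 w w ?z\<bar> \<le> (norm w)\<^sup>2 * C" .
      have lin: "linear (frechet_derivative F (at (g, x)))"
        using smooth_on_has_derivative[OF F, of "(g, x)"] gO x0 by (intro has_derivative_linear) auto
      have "?D1 y (g, x) = ?D1 w (g, x) + ?D1 x (g, x)"
        using linear_add[OF lin, of "(0, w)" "(0, x)"] by (simp add: w_def)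
      then have "F (g, y) - ?D1 y (g, x) = s * ?D2 w w ?z"
        using euler_homogeneous[OF gO x0] s(3) r(3) by (simp add: w_def)
      then have "\<bar>F (g, y) - ?D1 y (g, x)\<bar> \<le> 1 * \<bar>?D2 w w ?z\<bar>"
        using s by (simp add: abs_mult mult_left_le_one_le)
      also have "\<dots> \<le> (norm w)\<^sup>2 * C" using D2w by simp
      also have "\<dots> \<le> 8 * C * (norm w)\<^sup>2" using C0 by simp
      finally show ?thesis by (simp add: w_def norm_minus_commute)
    qed
  qed (use X g0 \<Omega> C0 in auto)
qed

lemma homogeneous_plus_norm_support:
  assumes g0: "g0 \<in> \<Omega>"
  obtains \<Omega>' c and P :: "'w \<Rightarrow> 'a body" where "open \<Omega>'" "g0 \<in> \<Omega>'" "\<Omega>' \<subseteq> \<Omega>" "smooth_family \<Omega>' P"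
    "\<And>g x. g \<in> \<Omega>' \<Longrightarrow> x \<noteq> 0 \<Longrightarrow> supp_fun (P g) x = F (g, x) + c * norm x"
proof -
  obtain \<Omega>' C where \<Omega>': "open \<Omega>'" "g0 \<in> \<Omega>'" "\<Omega>' \<subseteq> \<Omega>" and C0: "0 \<le> C"
    and C: "\<And>g x y. g \<in> \<Omega>' \<Longrightarrow> norm x = 1 \<Longrightarrow> norm y = 1 \<Longrightarrow>
      \<bar>F (g, y) - frechet_derivative F (at (g, x)) (0, y)\<bar> \<le> C * (norm (x - y))\<^sup>2"
    using homogeneous_quadratic_bound[OF g0] by blast
  define c where "c = 2 * C"
  define G where "G g x = (\<Sum>b\<in>Basis. frechet_derivative F (at (g, x)) (0, b) *\<^sub>R b) + c *\<^sub>R x" for g x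
  define P where "P g = Body (convex hull (G g ` sphere 0 1))" for g
  have Gy: "G g x \<bullet> y = frechet_derivative F (at (g, x)) (0, y) + c * (x \<bullet> y)" if "g \<in> \<Omega>" "x \<noteq> 0" for g x y
  proof -
    have "frechet_derivative F (at (g, x)) (0, y) = (\<Sum>b\<in>Basis. (y \<bullet> b) *\<^sub>R frechet_derivative F (at (g, x)) (0, b))"
      by (rule frechet_space_sum[OF F]) (use that in simp)
    also have "\<dots> = (\<Sum>b\<in>Basis. frechet_derivative F (at (g, x)) (0, b) * (b \<bullet> y))"
      by (rule sum.cong) (simp_all add: inner_commute mult.commute)
    finally show ?thesis by (simp add: G_def inner_add_left inner_sum_left)
  qed
  have setP: "body_set (P g) = convex hull (G g ` sphere 0 1)" if g: "g \<in> \<Omega>" for g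
  proof -
    have "continuous_on (sphere 0 1) (G g)"
      unfolding G_def
    proof (intro continuous_intros)
      fix b :: 'a
      show "continuous_on (sphere 0 1) (\<lambda>x. frechet_derivative F (at (g, x)) (0, b))"
        by (rule continuous_on_compose2[OF smooth_on_imp_continuous_on[OF smooth_on_frechet_derivative[OF F]]
              continuous_on_Pair[OF continuous_on_const continuous_on_id]]) (use g in auto)
    qed
    then have "compact (convex hull (G g ` sphere 0 1))"
      by (intro compact_convex_hull compact_continuous_image) auto
    moreover have "sphere 0 1 \<noteq> ({} :: 'a set)" by simp
    ultimately show ?thesis unfolding P_def by (intro body_set_Body) (auto simp: convex_convex_hull)
  qed
  have unit: "supp_fun (P g) y = F (g, y) + c" if g: "g \<in> \<Omega>'" and y: "norm y = 1" for g y
  proof -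
    have gO: "g \<in> \<Omega>" using g \<Omega>' by blast
    have y0: "y \<noteq> 0" using y by auto
    have eq: "G g y \<bullet> y = F (g, y) + c"
      using Gy[OF gO y0, of y] euler_homogeneous[OF gO y0] y by (simp add: norm_eq_1)
    have le: "G g x \<bullet> y \<le> F (g, y) + c" if x: "norm x = 1" for x
    proof -
      have "(norm (x - y))\<^sup>2 = 2 * (1 - x \<bullet> y)"
        using x y by (simp add: power2_norm_eq_inner inner_diff_left inner_diff_right inner_commute[of y x] norm_eq_1)
      then have "C * (norm (x - y))\<^sup>2 = c * (1 - x \<bullet> y)" by (simp only:) (simp add: c_def)
      then have "\<bar>F (g, y) - frechet_derivative F (at (g, x)) (0, y)\<bar> \<le> c * (1 - x \<bullet> y)"
        using C[OF g x y] by simp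
      moreover have "x \<noteq> 0" using x by auto
      ultimately show ?thesis using Gy[OF gO, of x y] by (simp add: algebra_simps)
    qed
    have "convex hull (G g ` sphere 0 1) \<subseteq> {z. y \<bullet> z \<le> F (g, y) + c}"
    proof (rule hull_minimal)
      show "G g ` sphere 0 1 \<subseteq> {z. y \<bullet> z \<le> F (g, y) + c}"
        using le by (auto simp: inner_commute[of y])
    qed (rule convex_halfspace_le)
    moreover have "G g y \<in> convex hull (G g ` sphere 0 1)" using y by (intro hull_inc) auto
    ultimately have "supp_fun (P g) y = G g y \<bullet> y"
      by (intro supp_fun_eqI) (auto simp: setP[OF gO] eq inner_commute[of y])
    then show ?thesis using eq by simp
  qed
  have supp: "supp_fun (P g) x = F (g, x) + c * norm x" if g: "g \<in> \<Omega>'" and x: "x \<noteq> 0" for g x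
  proof -
    let ?u = "(1 / norm x) *\<^sub>R x"
    have u: "norm ?u = 1" "norm x *\<^sub>R ?u = x" using x by auto
    have "supp_fun (P g) x = norm x * supp_fun (P g) ?u" using supp_fun_scaleR[of "norm x" "P g" ?u] u(2) by simp
    also have "\<dots> = norm x * F (g, ?u) + c * norm x" using unit[OF g u(1)] by (simp add: distrib_left)
    also have "norm x * F (g, ?u) = F (g, x)" using hom[of g ?u "norm x"] g \<Omega>'(3) x u(2) by auto
    finally show ?thesis .
  qed
  have "smooth_family \<Omega>' P"
    unfolding smooth_family_def
  proof (rule smooth_on_cong[OF open_family_domain[OF \<Omega>'(1)]])
    have "smooth_on (\<Omega>' \<times> (- {0})) (\<lambda>z :: 'w \<times> 'a. norm (snd z))"
      by (rule smooth_on_compose[OF smooth_on_bounded_linear[OF bounded_linear_snd] smooth_on_norm open_family_domain[OF \<Omega>'(1)]]) auto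
    then show "smooth_on (\<Omega>' \<times> (- {0})) (\<lambda>z. F z + c *\<^sub>R norm (snd z))"
      using \<Omega>' by (intro smooth_on_add smooth_on_scaleR smooth_on_const smooth_on_subset[OF F] open_family_domain) auto
    fix z :: "'w \<times> 'a" assume "z \<in> \<Omega>' \<times> (- {0})"
    then have "fst z \<in> \<Omega>'" "snd z \<noteq> 0" by auto
    from supp[OF this] show "F z + c *\<^sub>R norm (snd z) = supp_fun (P (fst z)) (snd z)" by simp
  qed
  then show ?thesis using that \<Omega>' supp by blast
qed

end

lemma isCont_smooth_family:
  fixes A :: "'w::real_normed_vector \<Rightarrow> 'a::euclidean_space body"
  assumes A: "smooth_family \<Omega> A" and \<Omega>: "open \<Omega>" and g0: "g0 \<in> \<Omega>"
  shows "isCont A g0"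
  unfolding continuous_at_eps_delta
proof (intro allI impI)
  fix \<epsilon> :: real assume \<epsilon>: "\<epsilon> > 0"
  have cont: "continuous_on (\<Omega> \<times> sphere 0 1) (\<lambda>z. supp_fun (A (fst z)) (snd z))"
    by (rule continuous_on_subset[OF smooth_on_imp_continuous_on[OF A[unfolded smooth_family_def]]]) auto
  obtain X where X: "g0 \<in> X" "open X"
    "\<forall>g\<in>X \<inter> \<Omega>. \<forall>x\<in>sphere 0 1. dist (supp_fun (A (fst (g, x))) (snd (g, x))) (supp_fun (A (fst (g0, x))) (snd (g0, x))) \<le> \<epsilon> / 2"
    by (rule continuous_on_prod_compactE[OF cont compact_sphere g0, of "\<epsilon> / 2"]) (use \<epsilon> in auto)
  have dist: "dist (A g) (A g0) < \<epsilon>" if g: "g \<in> X \<inter> \<Omega>" for g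
  proof -
    have "dist (A g) (A g0) \<le> \<epsilon> / 2"
    proof (rule dist_body_le_supp_fun)
      show "\<bar>supp_fun (A g) u - supp_fun (A g0) u\<bar> \<le> \<epsilon> / 2" if "norm u = 1" for u
        using bspec[OF bspec[OF X(3) g], of u] that by (simp add: dist_real_def)
    qed (use \<epsilon> in simp)
    then show ?thesis using \<epsilon> by simp
  qed
  have "open (X \<inter> \<Omega>)" "g0 \<in> X \<inter> \<Omega>" using X \<Omega> g0 by auto
  then obtain d where "d > 0" "ball g0 d \<subseteq> X \<inter> \<Omega>" using open_contains_ball by blast
  then show "\<exists>d>0. \<forall>g. dist g g0 < d \<longrightarrow> dist (A g) (A g0) < \<epsilon>"
    using dist by (intro exI[of _ d]) (auto simp: dist_commute subset_iff)
qed

context finite_coordinates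
begin

lemma frechet_parameter_sum:
  fixes F :: "'w \<times> 'a::euclidean_space \<Rightarrow> real"
  assumes F: "smooth_on S F" and z: "z \<in> S"
  shows "frechet_derivative F (at z) (v, 0) = (\<Sum>j\<in>J. \<phi> j v * frechet_derivative F (at z) (e j, 0))"
proof -
  have lin: "linear (frechet_derivative F (at z))"
    using smooth_on_has_derivative[OF F z] by (rule has_derivative_linear)
  have lin': "linear (\<lambda>v. frechet_derivative F (at z) (v, 0))"
    using linear_compose[OF _ lin, of "\<lambda>v. (v, 0)"] by (simp add: o_def linear_iff)
  have "frechet_derivative F (at z) (v, 0) = frechet_derivative F (at z) (\<Sum>j\<in>J. \<phi> j v *\<^sub>R e j, 0)"
    by (simp only: representation)
  also have "\<dots> = (\<Sum>j\<in>J. frechet_derivative F (at z) (\<phi> j v *\<^sub>R e j, 0))" by (rule linear_sum[OF lin'])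
  also have "\<dots> = (\<Sum>j\<in>J. \<phi> j v * frechet_derivative F (at z) (e j, 0))"
    by (rule sum.cong[OF refl]) (use linear_scale[OF lin'] in simp)
  finally show ?thesis .
qed

lemma uniform_first_order:
  fixes F :: "'w \<times> 'a::euclidean_space \<Rightarrow> real"
  assumes \<Omega>: "open \<Omega>" and F: "smooth_on (\<Omega> \<times> (- {0})) F" and g0: "g0 \<in> \<Omega>" and \<epsilon>: "\<epsilon> > 0"
  obtains d where "d > 0" "\<And>g x. norm (g - g0) < d \<Longrightarrow> norm x = 1 \<Longrightarrow>
    \<bar>F (g, x) - F (g0, x) - (\<Sum>j\<in>J. \<phi> j (g - g0) * frechet_derivative F (at (g0, x)) (e j, 0))\<bar> \<le> \<epsilon> * norm (g - g0)"
proof -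
  let ?D = "\<lambda>j z. frechet_derivative F (at z) (e j, 0)"
  have "\<forall>j. \<exists>K. \<forall>v. norm (\<phi> j v) \<le> norm v * K \<and> K > 0"
    using bounded_linear.pos_bounded[OF linear_\<phi>] by blast
  then obtain K where K: "\<And>j v. norm (\<phi> j v) \<le> norm v * K j" "\<And>j. K j > 0" by metis
  define k where "k = (\<Sum>j\<in>J. K j) + 1"
  have k: "k > 0" unfolding k_def using K(2) by (intro add_nonneg_pos sum_nonneg) (auto simp: less_imp_le)
  define \<eta> where "\<eta> = \<epsilon> / k"
  have \<eta>: "\<eta> > 0" using \<epsilon> k by (simp add: \<eta>_def)
  have "\<exists>X. g0 \<in> X \<and> open X \<and> (\<forall>g\<in>X \<inter> \<Omega>. \<forall>x\<in>sphere 0 1. dist (?D j (g, x)) (?D j (g0, x)) \<le> \<eta>)" for j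
  proof -
    have "continuous_on (\<Omega> \<times> sphere 0 1) (?D j)"
      by (rule continuous_on_subset[OF smooth_on_imp_continuous_on[OF smooth_on_frechet_derivative[OF F]]]) auto
    from continuous_on_prod_compactE[OF this compact_sphere g0 \<eta>] show ?thesis by metis
  qed
  then obtain X where X: "\<And>j. g0 \<in> X j" "\<And>j. open (X j)"
    "\<And>j g x. g \<in> X j \<inter> \<Omega> \<Longrightarrow> x \<in> sphere 0 1 \<Longrightarrow> dist (?D j (g, x)) (?D j (g0, x)) \<le> \<eta>" by metis
  have "open (\<Omega> \<inter> (\<Inter>j\<in>J. X j))" "g0 \<in> \<Omega> \<inter> (\<Inter>j\<in>J. X j)" using X \<Omega> g0 finite_J by auto
  then obtain d where d: "d > 0" "ball g0 d \<subseteq> \<Omega> \<inter> (\<Inter>j\<in>J. X j)" using open_contains_ball by blast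
  show ?thesis
  proof (rule that[OF d(1)])
    fix g and x :: 'a assume g: "norm (g - g0) < d" and x: "norm x = 1"
    let ?v = "g - g0"
    have in_ball: "g0 + t *\<^sub>R ?v \<in> ball g0 d" if "0 \<le> t" "t \<le> 1" for t
    proof -
      have "t * norm ?v \<le> 1 * norm ?v" using that by (intro mult_right_mono) auto
      then show ?thesis using g that by (simp add: dist_norm)
    qed
    have inS: "(g0 + t *\<^sub>R ?v, x + t *\<^sub>R 0) \<in> \<Omega> \<times> (- {0})" if "0 \<le> t" "t \<le> 1" for t
      using in_ball[OF that] d(2) x by auto
    have "((\<lambda>t. F (g0 + t *\<^sub>R ?v, x + t *\<^sub>R 0)) has_real_derivative
        frechet_derivative F (at (g0 + t *\<^sub>R ?v, x + t *\<^sub>R 0)) (?v, 0)) (at t)" if "0 \<le> t" "t \<le> 1" for t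
      by (rule smooth_on_curve[OF F inS[OF that]])
    then obtain t where t: "0 < t" "t < 1"
      "F (g0 + 1 *\<^sub>R ?v, x) - F (g0 + 0 *\<^sub>R ?v, x) = (1 - 0) * frechet_derivative F (at (g0 + t *\<^sub>R ?v, x)) (?v, 0)"
      using MVT2[of 0 1 "\<lambda>t. F (g0 + t *\<^sub>R ?v, x)" "\<lambda>t. frechet_derivative F (at (g0 + t *\<^sub>R ?v, x)) (?v, 0)"] by auto
    let ?z = "(g0 + t *\<^sub>R ?v, x)"
    have z: "?z \<in> \<Omega> \<times> (- {0})" using inS[of t] t by simp
    have "F (g, x) - F (g0, x) - (\<Sum>j\<in>J. \<phi> j ?v * ?D j (g0, x)) = (\<Sum>j\<in>J. \<phi> j ?v * (?D j ?z - ?D j (g0, x)))"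
      using t(3) frechet_parameter_sum[OF F z, of ?v] by (simp add: right_diff_distrib sum_subtractf)
    also have "\<bar>\<dots>\<bar> \<le> (\<Sum>j\<in>J. (norm ?v * K j) * \<eta>)"
    proof (rule order_trans[OF sum_abs], rule sum_mono)
      fix j assume j: "j \<in> J"
      have "g0 + t *\<^sub>R ?v \<in> X j \<inter> \<Omega>" using in_ball[of t] t d(2) j by auto
      then have "\<bar>?D j ?z - ?D j (g0, x)\<bar> \<le> \<eta>" using X(3)[of "g0 + t *\<^sub>R ?v" j x] x by (simp add: dist_real_def)
      moreover have "\<bar>\<phi> j ?v\<bar> \<le> norm ?v * K j" using K(1)[of j ?v] by simp
      ultimately show "\<bar>\<phi> j ?v * (?D j ?z - ?D j (g0, x))\<bar> \<le> (norm ?v * K j) * \<eta>"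
        unfolding abs_mult using K(2)[of j] by (intro mult_mono) auto
    qed
    also have "\<dots> = norm ?v * \<eta> * (\<Sum>j\<in>J. K j)"
      unfolding sum_distrib_left by (rule sum.cong) (simp_all add: mult.commute mult.left_commute)
    also have "\<dots> \<le> norm ?v * \<eta> * k" using \<eta> by (intro mult_left_mono) (auto simp: k_def)
    also have "\<dots> = \<epsilon> * norm ?v" using k by (simp add: \<eta>_def)
    finally show "\<bar>F (g, x) - F (g0, x) - (\<Sum>j\<in>J. \<phi> j ?v * ?D j (g0, x))\<bar> \<le> \<epsilon> * norm ?v" .
  qed
qed

end

subsection \<open>Mixed volume valuations of families\<close>

lemma supp_fun_diff_le_dist: "norm u = 1 \<Longrightarrow> \<bar>supp_fun K u - supp_fun L u\<bar> \<le> dist K (L :: 'a::euclidean_space body)"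
proof -
  assume u: "norm u = 1"
  have *: "supp_fun K u \<le> supp_fun L u + dist K L" for K L :: "'a body"
  proof (rule supp_fun_le)
    fix z assume "z \<in> body_set K"
    then obtain y where y: "y \<in> body_set L" "dist z y \<le> dist K L" using dist_body_le by blast
    have "z \<bullet> u = y \<bullet> u + (z - y) \<bullet> u" by (simp add: inner_diff_left)
    also have "(z - y) \<bullet> u \<le> norm (z - y) * norm u" by (rule norm_cauchy_schwarz)
    finally show "z \<bullet> u \<le> supp_fun L u + dist K L" using supp_fun_ge[OF y(1), of u] y(2) u by (simp add: dist_norm)
  qed
  show ?thesis using *[of K L] *[of L K] by (simp add: dist_commute abs_le_iff)
qed

lemma mixed_val_combination_bound:
  assumes r: "0 \<le> r"
  obtains C where "0 \<le> C"
    "\<And>(xs :: 'a::euclidean_space body list) ys (I :: 'i set) a K s.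
      \<lbrakk>\<And>M. M \<in> set (xs @ ys) \<Longrightarrow> body_set M \<subseteq> cball 0 r; length xs + length ys < DIM('a); 0 \<le> s;
       \<And>u. norm u = 1 \<Longrightarrow> \<bar>\<Sum>i\<in>I. a i * supp_fun (K i) u\<bar> \<le> s\<rbrakk>
      \<Longrightarrow> norm (\<Sum>i\<in>I. a i *\<^sub>R mixed_val (xs @ K i # ys)) \<le> C * s"
proof -
  let ?n = "DIM('a)"
  obtain C where C: "0 \<le> C"
    "\<And>(Ms :: 'a body list) (I :: 'i set) a K s.
      \<lbrakk>\<And>M. M \<in> set Ms \<Longrightarrow> body_set M \<subseteq> cball 0 (max r 1); 0 \<le> s;
       \<And>u. norm u = 1 \<Longrightarrow> \<bar>\<Sum>i\<in>I. a i * supp_fun (K i) u\<bar> \<le> s\<rbrakk>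
      \<Longrightarrow> \<bar>\<Sum>i\<in>I. a i * mixed_volume (K i # Ms)\<bar> \<le> C * s"
    by (rule mixed_volume_combination_bound[of "max r 1", where 'i='i and 'a='a]) auto
  show ?thesis
  proof (rule that[OF C(1)])
    fix xs ys :: "'a body list" and I :: "'i set" and a :: "'i \<Rightarrow> real" and K :: "'i \<Rightarrow> 'a body" and s :: real
    assume ball: "\<And>M. M \<in> set (xs @ ys) \<Longrightarrow> body_set M \<subseteq> cball 0 r" and len: "length xs + length ys < ?n"
      and s: "0 \<le> s" and le: "\<And>u. norm u = 1 \<Longrightarrow> \<bar>\<Sum>i\<in>I. a i * supp_fun (K i) u\<bar> \<le> s"
    show "norm (\<Sum>i\<in>I. a i *\<^sub>R mixed_val (xs @ K i # ys)) \<le> C * s"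
      unfolding norm_val_le_iff
    proof
      fix X :: "'a body" assume X: "X \<in> unit_bodies"
      define m where "m = ?n - length (xs @ K undefined # ys)"
      define Ms where "Ms = replicate m X @ xs @ ys"
      have "val_at (mixed_val (xs @ K i # ys)) X = complex_of_real (mixed_volume (K i # Ms))" for i
      proof -
        have "val_at (mixed_val (xs @ K i # ys)) X = complex_of_real (mixed_volume (replicate m X @ xs @ K i # ys))"
          using val_at_mixed_val[of "xs @ K i # ys" X] len by (simp add: m_def)
        also have "mixed_volume (replicate m X @ xs @ K i # ys) = mixed_volume (K i # Ms)"
          by (rule mixed_volume_mset) (simp add: Ms_def)
        finally show ?thesis .
      qed
      then have "val_at (\<Sum>i\<in>I. a i *\<^sub>R mixed_val (xs @ K i # ys)) X = complex_of_real (\<Sum>i\<in>I. a i * mixed_volume (K i # Ms))"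
        by (simp add: val_at_sum)
      then have "cmod (val_at (\<Sum>i\<in>I. a i *\<^sub>R mixed_val (xs @ K i # ys)) X) = \<bar>\<Sum>i\<in>I. a i * mixed_volume (K i # Ms)\<bar>"
        by (simp only: norm_of_real real_norm_def)
      also have "\<dots> \<le> C * s"
      proof (rule C(2)[OF _ s le])
        fix M assume "M \<in> set Ms"
        then have "M = X \<or> M \<in> set (xs @ ys)" by (auto simp: Ms_def split: if_splits)
        then show "body_set M \<subseteq> cball 0 (max r 1)"
        proof
          assume "M = X"
          then have "body_set M \<subseteq> cball 0 1" using X by (simp add: unit_bodies_def)
          then show ?thesis using subset_cball[of 1 "max r 1" 0] by (rule subset_trans) simp
        next
          assume "M \<in> set (xs @ ys)"
          then show ?thesis using subset_cball[of r "max r 1" 0] by (intro subset_trans[OF ball]) simp_all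
        qed
      qed
      finally show "cmod (val_at (\<Sum>i\<in>I. a i *\<^sub>R mixed_val (xs @ K i # ys)) X) \<le> C * s" .
    qed
  qed
qed

lemma mixed_val_dist_list:
  assumes r: "0 \<le> r"
  obtains C where "0 \<le> C"
    "\<And>(xs :: 'a::euclidean_space body list) Ks Ls.
      \<lbrakk>length Ks = length Ls; \<And>M. M \<in> set (xs @ Ks @ Ls) \<Longrightarrow> body_set M \<subseteq> cball 0 r; length xs + length Ks \<le> DIM('a)\<rbrakk>
      \<Longrightarrow> norm (mixed_val (xs @ Ks) - mixed_val (xs @ Ls)) \<le> C * (\<Sum>(K, L)\<leftarrow>zip Ks Ls. dist K L)"
proof -
  obtain C where C: "0 \<le> C"
    "\<And>(xs :: 'a body list) ys (I :: bool set) a K s.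
      \<lbrakk>\<And>M. M \<in> set (xs @ ys) \<Longrightarrow> body_set M \<subseteq> cball 0 r; length xs + length ys < DIM('a); 0 \<le> s;
       \<And>u. norm u = 1 \<Longrightarrow> \<bar>\<Sum>i\<in>I. a i * supp_fun (K i) u\<bar> \<le> s\<rbrakk>
      \<Longrightarrow> norm (\<Sum>i\<in>I. a i *\<^sub>R mixed_val (xs @ K i # ys)) \<le> C * s"
    by (rule mixed_val_combination_bound[OF r, where 'i=bool and 'a='a]) blast
  have slot: "norm (mixed_val (xs @ K # ys) - mixed_val (xs @ L # ys)) \<le> C * dist K L"
    if "\<And>M. M \<in> set (xs @ ys) \<Longrightarrow> body_set M \<subseteq> cball 0 r" "length xs + length ys < DIM('a)" for xs ys and K L :: "'a body"
    using C(2)[where xs=xs and ys=ys and s="dist K L" and I=UNIV and a="\<lambda>b. if b then 1 else -1" and K="\<lambda>b. if b then K else L"] that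
      supp_fun_diff_le_dist[of _ K L] by (simp add: UNIV_bool)
  show ?thesis
  proof (rule that[OF C(1)])
    fix xs Ks Ls :: "'a body list"
    assume len: "length Ks = length Ls" and ball: "\<And>M. M \<in> set (xs @ Ks @ Ls) \<Longrightarrow> body_set M \<subseteq> cball 0 r"
      and n: "length xs + length Ks \<le> DIM('a)"
    show "norm (mixed_val (xs @ Ks) - mixed_val (xs @ Ls)) \<le> C * (\<Sum>(K, L)\<leftarrow>zip Ks Ls. dist K L)"
      using len ball n
    proof (induction Ks Ls arbitrary: xs rule: list_induct2)
      case (Cons K Ks L Ls)
      have "norm (mixed_val (xs @ K # Ks) - mixed_val (xs @ L # Ls))
          \<le> norm (mixed_val (xs @ K # Ks) - mixed_val (xs @ L # Ks)) + norm (mixed_val (xs @ L # Ks) - mixed_val (xs @ L # Ls))"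
        using norm_triangle_ineq[of "mixed_val (xs @ K # Ks) - mixed_val (xs @ L # Ks)" "mixed_val (xs @ L # Ks) - mixed_val (xs @ L # Ls)"] by simp
      moreover have "norm (mixed_val (xs @ K # Ks) - mixed_val (xs @ L # Ks)) \<le> C * dist K L"
      proof (rule slot)
        show "body_set M \<subseteq> cball 0 r" if "M \<in> set (xs @ Ks)" for M using that by (intro Cons.prems(1)) auto
        show "length xs + length Ks < DIM('a)" using Cons.prems(2) by simp
      qed
      moreover have "norm (mixed_val ((xs @ [L]) @ Ks) - mixed_val ((xs @ [L]) @ Ls)) \<le> C * (\<Sum>(K, L)\<leftarrow>zip Ks Ls. dist K L)"
      proof (rule Cons.IH)
        show "body_set M \<subseteq> cball 0 r" if "M \<in> set ((xs @ [L]) @ Ks @ Ls)" for M using that by (intro Cons.prems(1)) auto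
        show "length (xs @ [L]) + length Ks \<le> DIM('a)" using Cons.prems(2) by simp
      qed
      ultimately show ?case by (simp add: distrib_left)
    qed simp
  qed
qed

lemma bodies_subset_cball: "\<exists>r\<ge>0. \<forall>K\<in>set Ks. body_set K \<subseteq> cball 0 r"
proof (induction Ks)
  case Nil
  show ?case by (intro exI[of _ 0]) simp
next
  case (Cons K Ks)
  then obtain r where r: "0 \<le> r" "\<forall>K\<in>set Ks. body_set K \<subseteq> cball 0 r" by blast
  obtain q where q: "0 \<le> q" "body_set K \<subseteq> cball 0 q" by (rule body_subset_cball)
  have "body_set L \<subseteq> cball 0 (max q r)" if "L \<in> set (K # Ks)" for L
  proof (cases "L = K")
    case True
    then show ?thesis using subset_trans[OF q(2) subset_cball[of q "max q r"]] by simp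
  next
    case False
    then have "body_set L \<subseteq> cball 0 r" using that r by simp
    then show ?thesis using subset_cball[of r "max q r" 0] by (rule subset_trans) simp
  qed
  then show ?case using q by (intro exI[of _ "max q r"]) simp
qed

lemma eventually_families_bounded:
  fixes xs :: "('w::real_normed_vector \<Rightarrow> 'a::euclidean_space body) list"
  assumes "\<And>X. X \<in> set xs \<Longrightarrow> isCont X g0"
  obtains r where "0 \<le> r" "\<forall>\<^sub>F g in nhds g0. \<forall>X\<in>set xs. body_set (X g) \<subseteq> cball 0 r"
proof -
  obtain r where r: "0 \<le> r" "\<forall>K\<in>set (map (\<lambda>X. X g0) xs). body_set K \<subseteq> cball 0 r"
    using bodies_subset_cball[of "map (\<lambda>X. X g0) xs"] by blast
  have "\<forall>\<^sub>F g in nhds g0. body_set (X g) \<subseteq> cball 0 (r + 1)" if X: "X \<in> set xs" for X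
  proof -
    have "(X \<longlongrightarrow> X g0) (nhds g0)"
      using assms[OF X] tendsto_at_iff_tendsto_nhds[of X g0] unfolding isCont_def by blast
    then have "\<forall>\<^sub>F g in nhds g0. dist (X g) (X g0) < 1" by (rule tendstoD) simp
    then show ?thesis
    proof eventually_elim
      case (elim g)
      have "body_set (X g0) \<subseteq> cball 0 r" using r X by simp
      then show ?case by (rule body_subset_cball_near) (use elim in simp)
    qed
  qed
  then have "\<forall>\<^sub>F g in nhds g0. \<forall>X\<in>set xs. body_set (X g) \<subseteq> cball 0 (r + 1)"
    by (simp add: eventually_ball_finite)
  then show ?thesis using that[of "r + 1"] r by simp
qed

lemma isCont_mixed_val:
  fixes As :: "('w::real_normed_vector \<Rightarrow> 'a::euclidean_space body) list"
  assumes As: "\<And>A. A \<in> set As \<Longrightarrow> isCont A g0" and len: "length As \<le> DIM('a)"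
  shows "isCont (\<lambda>g. mixed_val (map (\<lambda>A. A g) As)) g0"
proof -
  obtain r where r: "0 \<le> r" "\<forall>\<^sub>F g in nhds g0. \<forall>X\<in>set As. body_set (X g) \<subseteq> cball 0 r"
    by (rule eventually_families_bounded[of As g0]) (use As in auto)
  obtain C where C: "0 \<le> C"
    "\<And>(xs :: 'a body list) Ks Ls.
      \<lbrakk>length Ks = length Ls; \<And>M. M \<in> set (xs @ Ks @ Ls) \<Longrightarrow> body_set M \<subseteq> cball 0 r; length xs + length Ks \<le> DIM('a)\<rbrakk>
      \<Longrightarrow> norm (mixed_val (xs @ Ks) - mixed_val (xs @ Ls)) \<le> C * (\<Sum>(K, L)\<leftarrow>zip Ks Ls. dist K L)"
    by (rule mixed_val_dist_list[OF r(1), where 'a='a]) blast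
  have r0: "\<forall>X\<in>set As. body_set (X g0) \<subseteq> cball 0 r" using eventually_nhds_x_imp_x[OF r(2)] .
  have "\<forall>\<^sub>F g in at g0. \<forall>X\<in>set As. body_set (X g) \<subseteq> cball 0 r"
    using r(2) by (rule eventually_nhds_conv_at[THEN iffD1, THEN conjunct1])
  then have ev: "\<forall>\<^sub>F g in at g0. norm (mixed_val (map (\<lambda>A. A g) As) - mixed_val (map (\<lambda>A. A g0) As)) \<le> C * (\<Sum>A\<leftarrow>As. dist (A g) (A g0))"
  proof eventually_elim
    case (elim g)
    have "norm (mixed_val ([] @ map (\<lambda>A. A g) As) - mixed_val ([] @ map (\<lambda>A. A g0) As))
        \<le> C * (\<Sum>(K, L)\<leftarrow>zip (map (\<lambda>A. A g) As) (map (\<lambda>A. A g0) As). dist K L)"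
      by (rule C(2)) (use elim r0 len in auto)
    moreover have "(\<Sum>(K, L)\<leftarrow>zip (map (\<lambda>A. A g) As) (map (\<lambda>A. A g0) As). dist K L) = (\<Sum>A\<leftarrow>As. dist (A g) (A g0))"
      by (induction As) auto
    ultimately show ?case by simp
  qed
  have "((\<lambda>g. \<Sum>A\<leftarrow>As. dist (A g) (A g0)) \<longlongrightarrow> 0) (at g0)"
    using As
  proof (induction As)
    case (Cons A As)
    have "(A \<longlongrightarrow> A g0) (at g0)" using Cons.prems[of A] by (simp add: isCont_def)
    then have "((\<lambda>g. dist (A g) (A g0)) \<longlongrightarrow> 0) (at g0)" by (rule tendsto_dist_iff[THEN iffD1])
    from tendsto_add[OF this Cons.IH] Cons.prems show ?case by simp
  qed simp
  from tendsto_mult_right_zero[OF this, of C]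
  have "((\<lambda>g. mixed_val (map (\<lambda>A. A g) As) - mixed_val (map (\<lambda>A. A g0) As)) \<longlongrightarrow> 0) (at g0)"
    by (rule Lim_null_comparison[OF ev])
  then show ?thesis unfolding isCont_def by (rule LIM_zero_cancel)
qed

lemma sum_option_bool:
  assumes "finite J"
  shows "(\<Sum>i\<in>insert None (Some ` J) \<times> (UNIV :: bool set). f i)
    = f (None, True) + f (None, False) + (\<Sum>j\<in>J. f (Some j, True) + f (Some j, False))"
proof -
  have "(\<Sum>i\<in>insert None (Some ` J) \<times> (UNIV :: bool set). f i) = (\<Sum>i\<in>insert None (Some ` J). f (i, True) + f (i, False))"
    unfolding sum.cartesian_product' by (simp only: UNIV_bool) (simp add: add.commute)
  also have "\<dots> = f (None, True) + f (None, False) + (\<Sum>j\<in>J. f (Some j, True) + f (Some j, False))"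
    using assms by (simp add: sum.reindex)
  finally show ?thesis .
qed

abbreviation family_fun :: "('w \<Rightarrow> 'a::euclidean_space body) \<Rightarrow> 'w \<times> 'a \<Rightarrow> real" where
  "family_fun A \<equiv> \<lambda>z. supp_fun (A (fst z)) (snd z)"

context finite_coordinates
begin

lemma slot_has_derivative:
  fixes A :: "'w \<Rightarrow> 'a::euclidean_space body"
  assumes \<Omega>: "open \<Omega>" "g0 \<in> \<Omega>" and A: "smooth_family \<Omega> A" and xs: "\<And>X. X \<in> set xs \<Longrightarrow> isCont X g0"
    and len: "length xs + length ys < DIM('a)"
    and P: "\<And>j x. j \<in> J \<Longrightarrow> norm x = 1 \<Longrightarrow>
      supp_fun (P j) x = frechet_derivative (family_fun A) (at (g0, x)) (e j, 0) + c j"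
  defines "M \<equiv> \<lambda>g K. mixed_val (map (\<lambda>X. X g) xs @ K # ys)"
  shows "((\<lambda>g. M g (A g) - M g (A g0)) has_derivative
      (\<lambda>v. \<Sum>j\<in>J. \<phi> j v *\<^sub>R (M g0 (P j) - c j *\<^sub>R M g0 unit_ball_body))) (at g0)"
proof -
  have contM: "isCont (\<lambda>g. M g K) g0" for K
  proof -
    have "isCont (\<lambda>g. mixed_val (map (\<lambda>X. X g) (xs @ (\<lambda>_. K) # map (\<lambda>Y _. Y) ys))) g0"
    proof (rule isCont_mixed_val)
      fix X assume "X \<in> set (xs @ (\<lambda>_. K) # map (\<lambda>Y _. Y) ys)"
      then have "X \<in> set xs \<or> (\<exists>Y. X = (\<lambda>_. Y))" by auto
      then show "isCont X g0" using xs by auto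
    qed (use len in simp)
    then show ?thesis by (simp add: M_def o_def)
  qed
  define Q where "Q j g = M g (P j) - c j *\<^sub>R M g unit_ball_body" for j g
  have contQ: "isCont (Q j) g0" for j unfolding Q_def by (intro continuous_intros contM)
  define main where "main g = (\<Sum>j\<in>J. \<phi> j (g - g0) *\<^sub>R Q j g)" for g
  have main: "(main has_derivative (\<lambda>v. \<Sum>j\<in>J. \<phi> j v *\<^sub>R Q j g0)) (at g0)"
    unfolding main_def
  proof (rule has_derivative_sum)
    fix j
    have "((\<lambda>g. g - g0) has_derivative (\<lambda>v. v)) (at g0)" by (auto intro!: derivative_eq_intros)
    from bounded_linear.has_derivative[OF linear_\<phi> this]
    have "((\<lambda>g. \<phi> j (g - g0)) has_derivative (\<lambda>v. \<phi> j v)) (at g0)" .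
    moreover have "\<phi> j (g0 - g0) = 0" using linear_\<phi>[of j] by (simp add: linear_simps(3))
    ultimately show "((\<lambda>g. \<phi> j (g - g0) *\<^sub>R Q j g) has_derivative (\<lambda>v. \<phi> j v *\<^sub>R Q j g0)) (at g0)"
      using has_derivative_bilinear_vanishing[OF bounded_bilinear.flip[OF bounded_bilinear_scaleR] contQ, of "\<lambda>g. \<phi> j (g - g0)" "\<phi> j" j] by simp
  qed
  define err where "err g = (M g (A g) - M g (A g0)) - main g" for g
  have err: "(err has_derivative (\<lambda>v. 0)) (at g0)"
    unfolding has_derivative_at_alt
  proof (intro conjI allI impI)
    fix \<epsilon> :: real assume \<epsilon>: "\<epsilon> > 0"
    obtain r1 where r1: "0 \<le> r1" "\<forall>\<^sub>F g in nhds g0. \<forall>X\<in>set xs. body_set (X g) \<subseteq> cball 0 r1"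
      by (rule eventually_families_bounded[of xs g0]) (use xs in auto)
    obtain r2 where r2: "0 \<le> r2" "\<forall>K\<in>set ys. body_set K \<subseteq> cball 0 r2" using bodies_subset_cball[of ys] by blast
    define r where "r = max r1 r2"
    have r: "0 \<le> r" using r1 by (simp add: r_def)
    obtain C where C: "0 \<le> C"
      "\<And>(xs :: 'a body list) ys (I :: ('j option \<times> bool) set) a K s.
      \<lbrakk>\<And>M. M \<in> set (xs @ ys) \<Longrightarrow> body_set M \<subseteq> cball 0 r; length xs + length ys < DIM('a); 0 \<le> s;
       \<And>u. norm u = 1 \<Longrightarrow> \<bar>\<Sum>i\<in>I. a i * supp_fun (K i) u\<bar> \<le> s\<rbrakk>
      \<Longrightarrow> norm (\<Sum>i\<in>I. a i *\<^sub>R mixed_val (xs @ K i # ys)) \<le> C * s"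
      by (rule mixed_val_combination_bound[OF r, where 'i="'j option \<times> bool" and 'a='a]) blast
    define \<eta> where "\<eta> = \<epsilon> / (C + 1)"
    have \<eta>: "\<eta> > 0" "C * \<eta> \<le> \<epsilon>" using \<epsilon> C(1) by (auto simp: \<eta>_def field_simps)
    obtain d1 where d1: "d1 > 0" "\<And>g x. norm (g - g0) < d1 \<Longrightarrow> norm x = 1 \<Longrightarrow>
      \<bar>family_fun A (g, x) - family_fun A (g0, x) - (\<Sum>j\<in>J. \<phi> j (g - g0) * frechet_derivative (family_fun A) (at (g0, x)) (e j, 0))\<bar>
        \<le> \<eta> * norm (g - g0)"
      by (rule uniform_first_order[OF \<Omega>(1) A[unfolded smooth_family_def] \<Omega>(2) \<eta>(1)]) blast
    obtain d2 where d2: "d2 > 0" "\<And>g. dist g g0 < d2 \<Longrightarrow> \<forall>X\<in>set xs. body_set (X g) \<subseteq> cball 0 r1"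
      using r1(2) unfolding eventually_nhds_metric by blast
    have "norm (err g) \<le> \<epsilon> * norm (g - g0)" if g: "norm (g - g0) < min d1 d2" for g
    proof -
      define a where "a i = (case i of (None, b) \<Rightarrow> if b then 1 else - 1
        | (Some j, b) \<Rightarrow> if b then - \<phi> j (g - g0) else \<phi> j (g - g0) * c j)" for i
      define K where "K i = (case i of (None, b) \<Rightarrow> if b then A g else A g0
        | (Some j, b) \<Rightarrow> if b then P j else unit_ball_body)" for i
      let ?I = "insert None (Some ` J) \<times> (UNIV :: bool set)"
      have "err g = (\<Sum>i\<in>?I. a i *\<^sub>R M g (K i))"
        unfolding sum_option_bool[OF finite_J]
        by (simp add: err_def main_def Q_def a_def K_def sum_negf[symmetric] algebra_simps)
          (simp add: sum.distrib[symmetric])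
      also have "norm \<dots> \<le> C * (\<eta> * norm (g - g0))"
        unfolding M_def
      proof (rule C(2))
        fix X assume "X \<in> set (map (\<lambda>X. X g) xs @ ys)"
        then consider Z where "Z \<in> set xs" "X = Z g" | "X \<in> set ys" by auto
        then show "body_set X \<subseteq> cball 0 r"
        proof cases
          case 1
          then have "body_set X \<subseteq> cball 0 r1" using d2(2)[of g] g by (simp add: dist_norm)
          then show ?thesis using subset_cball[of r1 r 0] by (rule subset_trans) (simp add: r_def)
        next
          case 2
          then have "body_set X \<subseteq> cball 0 r2" using r2 by simp
          then show ?thesis using subset_cball[of r2 r 0] by (rule subset_trans) (simp add: r_def)
        qed
      next
        fix u :: 'a assume u: "norm u = 1"
        have "(\<Sum>i\<in>?I. a i * supp_fun (K i) u)
          = family_fun A (g, u) - family_fun A (g0, u) - (\<Sum>j\<in>J. \<phi> j (g - g0) * frechet_derivative (family_fun A) (at (g0, u)) (e j, 0))"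
          unfolding sum_option_bool[OF finite_J]
          by (simp add: a_def K_def P u supp_fun_unit_ball sum_negf[symmetric] algebra_simps)
            (simp add: sum.distrib[symmetric])
        then show "\<bar>\<Sum>i\<in>?I. a i * supp_fun (K i) u\<bar> \<le> \<eta> * norm (g - g0)" using d1(2)[of g u] g u by simp
      qed (use len \<eta> in auto)
      also have "\<dots> \<le> \<epsilon> * norm (g - g0)" using mult_right_mono[OF \<eta>(2), of "norm (g - g0)"] by (simp add: mult.assoc)
      finally show ?thesis .
    qed
    moreover have "err g0 = 0"
      using bounded_linear.linear[OF linear_\<phi>] by (simp add: err_def main_def linear_0)
    ultimately show "\<exists>d>0. \<forall>g. norm (g - g0) < d \<longrightarrow> norm (err g - err g0 - 0) \<le> \<epsilon> * norm (g - g0)"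
      using d1(1) d2(1) by (intro exI[of _ "min d1 d2"]) simp
  qed simp
  have "((\<lambda>g. err g + main g) has_derivative (\<lambda>v. 0 + (\<Sum>j\<in>J. \<phi> j v *\<^sub>R Q j g0))) (at g0)"
    by (rule has_derivative_add[OF err main])
  then show ?thesis by (simp add: err_def Q_def)
qed

lemma mixed_val_list_has_derivative:
  fixes As :: "('w \<Rightarrow> 'a::euclidean_space body) list"
  assumes \<Omega>: "open \<Omega>" "g0 \<in> \<Omega>" and As: "\<And>A. A \<in> set As \<Longrightarrow> smooth_family \<Omega> A"
    and xs: "\<And>X. X \<in> set xs \<Longrightarrow> isCont X g0" and len: "length xs + length As \<le> DIM('a)"
    and P: "\<And>i j x. i < length As \<Longrightarrow> j \<in> J \<Longrightarrow> norm x = 1 \<Longrightarrow>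
      supp_fun (P i j) x = frechet_derivative (family_fun (As ! i)) (at (g0, x)) (e j, 0) + c i j"
  defines "at0 \<equiv> map (\<lambda>X. X g0)"
  shows "((\<lambda>g. mixed_val (map (\<lambda>X. X g) (xs @ As)) - mixed_val (map (\<lambda>X. X g) xs @ at0 As)) has_derivative
      (\<lambda>v. \<Sum>i<length As. \<Sum>j\<in>J. \<phi> j v *\<^sub>R (mixed_val (at0 xs @ (at0 As)[i := P i j])
        - c i j *\<^sub>R mixed_val (at0 xs @ (at0 As)[i := unit_ball_body])))) (at g0)"
  using As xs len P
proof (induction As arbitrary: xs P c)
  case Nil
  then show ?case by (simp add: at0_def)
next
  case (Cons A As)
  have A: "smooth_family \<Omega> A" using Cons.prems(1) by simp
  have "((\<lambda>g. mixed_val (map (\<lambda>X. X g) xs @ A g # at0 As) - mixed_val (map (\<lambda>X. X g) xs @ A g0 # at0 As)) has_derivative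
      (\<lambda>v. \<Sum>j\<in>J. \<phi> j v *\<^sub>R (mixed_val (map (\<lambda>X. X g0) xs @ P 0 j # at0 As)
        - c 0 j *\<^sub>R mixed_val (map (\<lambda>X. X g0) xs @ unit_ball_body # at0 As)))) (at g0)"
  proof (rule slot_has_derivative[OF \<Omega> A])
    show "isCont X g0" if "X \<in> set xs" for X using that by (rule Cons.prems(2))
    show "length xs + length (at0 As) < DIM('a)" using Cons.prems(3) by (simp add: at0_def)
    show "supp_fun (P 0 j) x = frechet_derivative (family_fun A) (at (g0, x)) (e j, 0) + c 0 j"
      if "j \<in> J" "norm x = 1" for j x
      using Cons.prems(4)[of 0 j x] that by simp
  qed
  moreover have "((\<lambda>g. mixed_val (map (\<lambda>X. X g) ((xs @ [A]) @ As)) - mixed_val (map (\<lambda>X. X g) (xs @ [A]) @ at0 As)) has_derivative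
      (\<lambda>v. \<Sum>i<length As. \<Sum>j\<in>J. \<phi> j v *\<^sub>R (mixed_val (at0 (xs @ [A]) @ (at0 As)[i := P (Suc i) j])
        - c (Suc i) j *\<^sub>R mixed_val (at0 (xs @ [A]) @ (at0 As)[i := unit_ball_body])))) (at g0)"
  proof (rule Cons.IH)
    show "smooth_family \<Omega> X" if "X \<in> set As" for X using that by (intro Cons.prems(1)) simp
    show "isCont X g0" if "X \<in> set (xs @ [A])" for X
    proof (cases "X = A")
      case True
      then show ?thesis using isCont_smooth_family[OF A \<Omega>] by simp
    next
      case False
      then show ?thesis using that by (intro Cons.prems(2)) auto
    qed
    show "length (xs @ [A]) + length As \<le> DIM('a)" using Cons.prems(3) by simp
    show "supp_fun (P (Suc i) j) x = frechet_derivative (family_fun (As ! i)) (at (g0, x)) (e j, 0) + c (Suc i) j"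
      if "i < length As" "j \<in> J" "norm x = 1" for i j x
      using Cons.prems(4)[of "Suc i" j x] that by simp
  qed
  ultimately have "((\<lambda>g. (mixed_val (map (\<lambda>X. X g) xs @ A g # at0 As) - mixed_val (map (\<lambda>X. X g) xs @ A g0 # at0 As))
     + (mixed_val (map (\<lambda>X. X g) ((xs @ [A]) @ As)) - mixed_val (map (\<lambda>X. X g) (xs @ [A]) @ at0 As))) has_derivative
     (\<lambda>v. (\<Sum>j\<in>J. \<phi> j v *\<^sub>R (mixed_val (map (\<lambda>X. X g0) xs @ P 0 j # at0 As)
        - c 0 j *\<^sub>R mixed_val (map (\<lambda>X. X g0) xs @ unit_ball_body # at0 As)))
      + (\<Sum>i<length As. \<Sum>j\<in>J. \<phi> j v *\<^sub>R (mixed_val (at0 (xs @ [A]) @ (at0 As)[i := P (Suc i) j])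
        - c (Suc i) j *\<^sub>R mixed_val (at0 (xs @ [A]) @ (at0 As)[i := unit_ball_body]))))) (at g0)"
    by (rule has_derivative_add)
  then show ?case
    unfolding length_Cons sum.lessThan_Suc_shift by (simp add: at0_def)
qed

lemma derivative_families:
  fixes A :: "'w \<Rightarrow> 'a::euclidean_space body"
  assumes \<Omega>: "open \<Omega>" and A: "smooth_family \<Omega> A" and g0: "g0 \<in> \<Omega>"
  obtains \<Omega>' c and P :: "'w \<Rightarrow> 'a body" where "open \<Omega>'" "g0 \<in> \<Omega>'" "\<Omega>' \<subseteq> \<Omega>" "smooth_family \<Omega>' P"
    "\<And>g x. g \<in> \<Omega>' \<Longrightarrow> norm x = 1 \<Longrightarrow> supp_fun (P g) x = frechet_derivative (family_fun A) (at (g, x)) (v, 0) + c"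
proof -
  let ?F = "\<lambda>z. frechet_derivative (family_fun A) (at z) (v, 0)"
  have H: "smooth_on (\<Omega> \<times> (- {0})) (family_fun A)" using A by (simp add: smooth_family_def)
  have F: "smooth_on (\<Omega> \<times> (- {0})) ?F" by (rule smooth_on_frechet_derivative[OF H])
  have hom: "?F (g, t *\<^sub>R x) = t * ?F (g, x)" if "g \<in> \<Omega>" "x \<noteq> 0" "t > 0" for g x t
    by (rule parameter_derivative_homogeneous[OF H _ that]) (simp add: supp_fun_scaleR)
  obtain \<Omega>' c and P :: "'w \<Rightarrow> 'a body" where *: "open \<Omega>'" "g0 \<in> \<Omega>'" "\<Omega>' \<subseteq> \<Omega>" "smooth_family \<Omega>' P"
    "\<And>g x. g \<in> \<Omega>' \<Longrightarrow> x \<noteq> 0 \<Longrightarrow> supp_fun (P g) x = ?F (g, x) + c * norm x"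
    by (rule homogeneous_plus_norm_support[OF \<Omega> F hom g0]) blast+
  have "supp_fun (P g) x = ?F (g, x) + c" if "g \<in> \<Omega>'" "norm x = 1" for g x
  proof -
    have "x \<noteq> 0" using that(2) by auto
    from *(5)[OF that(1) this] show ?thesis using that(2) by simp
  qed
  then show ?thesis by (rule that[OF *(1-4)])
qed

theorem C_k_on_mixed_val:
  fixes As :: "('w \<Rightarrow> 'a::euclidean_space body) list"
  assumes "open \<Omega>" "\<And>A. A \<in> set As \<Longrightarrow> smooth_family \<Omega> A" "length As \<le> DIM('a)"
  shows "C_k_on k \<Omega> (\<lambda>g. mixed_val (map (\<lambda>A. A g) As))"
  using assms
proof (induction k arbitrary: \<Omega> As)
  case 0
  have "isCont (\<lambda>g. mixed_val (map (\<lambda>A. A g) As)) g" if "g \<in> \<Omega>" for g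
    by (rule isCont_mixed_val) (use isCont_smooth_family 0 that in blast)+
  then show ?case by (simp add: continuous_at_imp_continuous_on)
next
  case (Suc k)
  let ?m = "length As"
  show ?case
  proof (rule C_k_on_local)
    fix g0 assume g0: "g0 \<in> \<Omega>"
    define ok where "ok i j \<Omega>' c P \<longleftrightarrow> open \<Omega>' \<and> g0 \<in> \<Omega>' \<and> \<Omega>' \<subseteq> \<Omega> \<and> smooth_family \<Omega>' P \<and>
      (\<forall>g x. g \<in> \<Omega>' \<longrightarrow> norm x = 1 \<longrightarrow> supp_fun (P g) x = frechet_derivative (family_fun (As ! i)) (at (g, x)) (e j, 0) + c)"
      for i j \<Omega>' c and P :: "'w \<Rightarrow> 'a body"
    have "\<exists>t. ok i j (fst t) (fst (snd t)) (snd (snd t))" if "i < ?m" for i j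
    proof -
      have Ai: "smooth_family \<Omega> (As ! i)" using that by (intro Suc.prems(2)) simp
      obtain \<Omega>' c and P :: "'w \<Rightarrow> 'a body" where "open \<Omega>'" "g0 \<in> \<Omega>'" "\<Omega>' \<subseteq> \<Omega>" "smooth_family \<Omega>' P"
        "\<And>g x. g \<in> \<Omega>' \<Longrightarrow> norm x = 1 \<Longrightarrow>
          supp_fun (P g) x = frechet_derivative (family_fun (As ! i)) (at (g, x)) (e j, 0) + c"
        by (rule derivative_families[OF Suc.prems(1) Ai g0, of "e j"]) blast+
      then have "ok i j \<Omega>' c P" by (simp add: ok_def)
      then show ?thesis by (intro exI[of _ "(\<Omega>', c, P)"]) simp
    qed
    then have "\<forall>ij. fst ij < ?m \<longrightarrow> (\<exists>t. ok (fst ij) (snd ij) (fst t) (fst (snd t)) (snd (snd t)))" by simp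
    then have "\<forall>ij. \<exists>t. fst ij < ?m \<longrightarrow> ok (fst ij) (snd ij) (fst t) (fst (snd t)) (snd (snd t))" by blast
    from choice[OF this] obtain t where t: "\<And>i j. i < ?m \<Longrightarrow> ok i j (fst (t (i, j))) (fst (snd (t (i, j)))) (snd (snd (t (i, j))))"
      by fastforce
    define X where "X i j = fst (t (i, j))" for i j
    define c where "c i j = fst (snd (t (i, j)))" for i j
    define P where "P i j = snd (snd (t (i, j)))" for i j
    have X: "open (X i j)" "g0 \<in> X i j" "X i j \<subseteq> \<Omega>" and PX: "smooth_family (X i j) (P i j)"
      and P: "\<And>g x. g \<in> X i j \<Longrightarrow> norm x = 1 \<Longrightarrow>
        supp_fun (P i j g) x = frechet_derivative (family_fun (As ! i)) (at (g, x)) (e j, 0) + c i j"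
      if "i < ?m" for i j
      using t[OF that, of j] unfolding ok_def X_def c_def P_def by blast+
    define N where "N = \<Omega> \<inter> (\<Inter>i\<in>{..<?m}. \<Inter>j\<in>J. X i j)"
    have N: "open N" unfolding N_def using X(1) Suc.prems(1) finite_J by (intro open_Int open_INT) auto
    have g0N: "g0 \<in> N" using X(2) g0 by (auto simp: N_def)
    have NX: "N \<subseteq> X i j" if "i < ?m" "j \<in> J" for i j using that by (auto simp: N_def)
    have N\<Omega>: "N \<subseteq> \<Omega>" by (auto simp: N_def)
    have AN: "smooth_family N A" if "A \<in> set As" for A using Suc.prems(2)[OF that] N\<Omega> by (rule smooth_family_subset)
    let ?D = "\<lambda>g v. \<Sum>i<?m. \<Sum>j\<in>J. \<phi> j v *\<^sub>R (mixed_val (map (\<lambda>A. A g) (As[i := P i j]))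
        - c i j *\<^sub>R mixed_val (map (\<lambda>A. A g) (As[i := \<lambda>_. unit_ball_body])))"
    have "C_k_on (Suc k) N (\<lambda>g. mixed_val (map (\<lambda>A. A g) As))"
    proof (rule C_k_on_SucI[OF N, where f'="?D"])
      fix g assume g: "g \<in> N"
      have "((\<lambda>h. mixed_val (map (\<lambda>X. X h) ([] @ As)) - mixed_val (map (\<lambda>X. X h) [] @ map (\<lambda>X. X g) As)) has_derivative
        (\<lambda>v. \<Sum>i<?m. \<Sum>j\<in>J. \<phi> j v *\<^sub>R (mixed_val (map (\<lambda>X. X g) [] @ (map (\<lambda>X. X g) As)[i := P i j g])
        - c i j *\<^sub>R mixed_val (map (\<lambda>X. X g) [] @ (map (\<lambda>X. X g) As)[i := unit_ball_body])))) (at g)"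
      proof (rule mixed_val_list_has_derivative[OF N g])
        show "smooth_family N A" if "A \<in> set As" for A using AN that .
        show "supp_fun (P i j g) x = frechet_derivative (family_fun (As ! i)) (at (g, x)) (e j, 0) + c i j"
          if "i < ?m" "j \<in> J" "norm x = 1" for i j x
          using P[OF that(1) subsetD[OF NX[OF that(1,2)] g] that(3)] .
      qed (use Suc.prems(3) in simp_all)
      then have "((\<lambda>h. (mixed_val (map (\<lambda>X. X h) As) - mixed_val (map (\<lambda>X. X g) As)) + mixed_val (map (\<lambda>X. X g) As))
          has_derivative (\<lambda>v. ?D g v + 0)) (at g)"
        by (intro has_derivative_add has_derivative_const) (simp add: map_update)
      then show "((\<lambda>g. mixed_val (map (\<lambda>A. A g) As)) has_derivative ?D g) (at g)" by simp
    next
      fix v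
      have IH: "C_k_on k N (\<lambda>g. mixed_val (map (\<lambda>A. A g) (As[i := B])))" if B: "smooth_family N B" for i B
      proof (rule Suc.IH[OF N])
        show "smooth_family N A" if "A \<in> set (As[i := B])" for A
          using that set_update_subset_insert[of As i B] AN B by blast
      qed (use Suc.prems(3) in simp)
      have ball: "smooth_family N (\<lambda>_. unit_ball_body :: 'a body)"
        by (rule smooth_family_const[OF smooth_on_supp_fun_unit_ball N])
      have diff: "C_k_on k N (\<lambda>g. f g - s *\<^sub>R h g)" if "C_k_on k N f" "C_k_on k N h" for s and f h :: "'w \<Rightarrow> 'a val"
        using C_k_on_add[OF that(1) C_k_on_linear[OF bounded_linear_scaleR_right that(2) N, of "- s"] N] by simp
      show "C_k_on k N (\<lambda>g. ?D g v)"
      proof (rule C_k_on_sum[OF _ N], rule C_k_on_sum[OF _ N], rule C_k_on_linear[OF bounded_linear_scaleR_right _ N], rule diff)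
        fix i j assume "i \<in> {..<?m}" "j \<in> J"
        then have ij: "i < ?m" "j \<in> J" by auto
        show "C_k_on k N (\<lambda>g. mixed_val (map (\<lambda>A. A g) (As[i := P i j])))"
          by (rule IH[OF smooth_family_subset[OF PX[OF ij(1)] NX[OF ij]]])
        show "C_k_on k N (\<lambda>g. mixed_val (map (\<lambda>A. A g) (As[i := \<lambda>_. unit_ball_body])))" by (rule IH[OF ball])
      qed
    qed
    then show "\<exists>T. open T \<and> g0 \<in> T \<and> C_k_on (Suc k) T (\<lambda>g. mixed_val (map (\<lambda>A. A g) As))" using N g0N by blast
  qed
qed

end

section \<open>Smoothness of the valuations\<close>

subsection \<open>The general linear group\<close>

lemma linear_blinfun: "linear (blinfun_apply g)"
  by (simp add: blinfun.bounded_linear_right bounded_linear.linear)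

definition unit_blinfun :: "'a::euclidean_space \<times> 'a \<Rightarrow> 'a \<Rightarrow>\<^sub>L 'a" where
  "unit_blinfun = (\<lambda>(b, c). Blinfun (\<lambda>x. (x \<bullet> b) *\<^sub>R c))"

lemma unit_blinfun_apply: "blinfun_apply (unit_blinfun (b, c)) x = (x \<bullet> b) *\<^sub>R c"
  unfolding unit_blinfun_def prod.case
  by (subst bounded_linear_Blinfun_apply) (auto intro!: bounded_linear_intros)

lemma finite_coordinates_blinfun:
  "finite_coordinates (Basis \<times> Basis) (unit_blinfun :: 'a::euclidean_space \<times> 'a \<Rightarrow> _) (\<lambda>(b, c) g. blinfun_apply g b \<bullet> c)"
proof (rule finite_coordinates.intro)
  fix j :: "'a \<times> 'a"
  show "bounded_linear ((\<lambda>(b, c) g. blinfun_apply g b \<bullet> c) j)"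
    by (cases j) (auto intro!: bounded_linear_inner_left_comp blinfun.bounded_linear_left)
next
  fix g :: "'a \<Rightarrow>\<^sub>L 'a"
  show "(\<Sum>j\<in>Basis \<times> Basis. (\<lambda>(b, c) g. blinfun_apply g b \<bullet> c) j g *\<^sub>R unit_blinfun j) = g"
  proof (rule blinfun_eqI)
    fix x
    have "blinfun_apply (\<Sum>j\<in>Basis \<times> Basis. (\<lambda>(b, c) g. blinfun_apply g b \<bullet> c) j g *\<^sub>R unit_blinfun j) x
      = (\<Sum>b\<in>Basis. \<Sum>c\<in>Basis. (blinfun_apply g b \<bullet> c) *\<^sub>R (x \<bullet> b) *\<^sub>R c)"
      unfolding sum.cartesian_product' by (simp add: blinfun.sum_left blinfun.scaleR_left unit_blinfun_apply)
    also have "\<dots> = (\<Sum>b\<in>Basis. (x \<bullet> b) *\<^sub>R (\<Sum>c\<in>Basis. (blinfun_apply g b \<bullet> c) *\<^sub>R c))"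
      by (simp add: scaleR_sum_right mult.commute)
    also have "\<dots> = (\<Sum>b\<in>Basis. (x \<bullet> b) *\<^sub>R blinfun_apply g b)" by (simp add: euclidean_representation)
    also have "\<dots> = blinfun_apply g x" by (rule linear_sum_Basis[OF linear_blinfun, symmetric])
    finally show "blinfun_apply (\<Sum>j\<in>Basis \<times> Basis. (\<lambda>(b, c) g. blinfun_apply g b \<bullet> c) j g *\<^sub>R unit_blinfun j) x
      = blinfun_apply g x" .
  qed
qed simp

lemma open_GL: "open (GL :: ('a::euclidean_space \<Rightarrow>\<^sub>L 'a) set)"
  unfolding open_subopen[of GL]
proof
  fix g0 :: "'a \<Rightarrow>\<^sub>L 'a" assume g0: "g0 \<in> GL"
  have "isCont (\<lambda>g. blinfun_apply g b) g0" for b :: 'a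
    by (rule bounded_linear.isCont[OF blinfun.bounded_linear_left]) simp
  moreover have "inj (blinfun_apply g0)" using g0 by (simp add: GL_def bij_def)
  ultimately have "\<forall>\<^sub>F g in nhds g0. inj (blinfun_apply g)"
    by (intro eventually_inj_linear_family[of UNIV]) (auto simp: linear_blinfun)
  then obtain T where T: "open T" "g0 \<in> T" "\<And>g. g \<in> T \<Longrightarrow> inj (blinfun_apply g)"
    unfolding eventually_nhds by blast
  have "T \<subseteq> GL"
    using T(3) linear_injective_imp_surjective[OF linear_blinfun] by (auto simp: GL_def bij_def)
  then show "\<exists>T. open T \<and> g0 \<in> T \<and> T \<subseteq> GL" using T by blast
qed

lemma inv_blinfun_apply:
  assumes "g \<in> GL"
  shows "blinfun_apply (Blinfun (inv (blinfun_apply g))) = inv (blinfun_apply g)"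
proof (rule bounded_linear_Blinfun_apply)
  have "linear (inv (blinfun_apply g))"
    by (rule inj_linear_imp_inv_linear[OF linear_blinfun]) (use assms in \<open>simp add: GL_def bij_def\<close>)
  then show "bounded_linear (inv (blinfun_apply g))" by (simp add: linear_conv_bounded_linear)
qed

lemma image_body_inv:
  assumes "g \<in> GL"
  shows "image_body g (image_body (Blinfun (inv (blinfun_apply g))) K) = K"
  using assms by (simp add: body_set_inject[symmetric] image_body.rep_eq inv_blinfun_apply image_comp
      GL_def bij_is_surj surj_f_inv_f o_def)

lemma image_body_plus: "image_body g (K + L) = image_body g K + image_body g L"
proof (rule body_eqI)
  fix x
  have "x \<in> body_set (image_body g (K + L)) \<longleftrightarrow> (\<exists>a\<in>body_set K. \<exists>b\<in>body_set L. x = blinfun_apply g (a + b))"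
    by (simp add: image_body.rep_eq image_iff Bex_def mem_body_plus) blast
  also have "\<dots> \<longleftrightarrow> x \<in> body_set (image_body g K + image_body g L)"
    by (simp add: mem_body_plus image_body.rep_eq blinfun.add_right)
  finally show "x \<in> body_set (image_body g (K + L)) \<longleftrightarrow> x \<in> body_set (image_body g K + image_body g L)" .
qed

lemma supp_fun_image_body:
  "supp_fun (image_body g A) x = supp_fun A (\<Sum>b\<in>Basis. (blinfun_apply g b \<bullet> x) *\<^sub>R b)"
proof -
  define y where "y = (\<Sum>b\<in>Basis. (blinfun_apply g b \<bullet> x) *\<^sub>R b)"
  have adj: "blinfun_apply g a \<bullet> x = a \<bullet> y" for a
  proof -
    have "blinfun_apply g a \<bullet> x = (\<Sum>b\<in>Basis. (a \<bullet> b) *\<^sub>R blinfun_apply g b) \<bullet> x"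
      by (simp only: linear_sum_Basis[OF linear_blinfun, symmetric])
    then show ?thesis by (simp add: y_def inner_sum_left inner_sum_right mult.commute)
  qed
  have "supp_fun (image_body g A) x = supp_fun A y"
  proof (rule antisym; rule supp_fun_le)
    fix z assume "z \<in> body_set (image_body g A)"
    then obtain a where a: "a \<in> body_set A" "z = blinfun_apply g a" by (auto simp: image_body.rep_eq)
    show "z \<bullet> x \<le> supp_fun A y" unfolding a(2) adj by (rule supp_fun_ge[OF a(1)])
  next
    fix a assume "a \<in> body_set A"
    then have "blinfun_apply g a \<in> body_set (image_body g A)" by (simp add: image_body.rep_eq)
    then show "a \<bullet> y \<le> supp_fun (image_body g A) x" unfolding adj[symmetric] by (rule supp_fun_ge)
  qed
  then show ?thesis by (simp only: y_def)
qed

lemma smooth_family_image_body: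
  fixes A :: "'a::euclidean_space body"
  assumes A: "smooth_on (- {0}) (supp_fun A)"
  shows "smooth_family GL (\<lambda>g. image_body g A)"
  unfolding smooth_family_def supp_fun_image_body
proof (rule smooth_on_compose[OF _ A open_family_domain[OF open_GL]])
  show "smooth_on (GL \<times> - {0}) (\<lambda>z :: ('a \<Rightarrow>\<^sub>L 'a) \<times> 'a. \<Sum>b\<in>Basis. (blinfun_apply (fst z) b \<bullet> snd z) *\<^sub>R b)"
    by (intro smooth_on_sum smooth_on_scaleR smooth_on_inner smooth_on_const open_family_domain open_GL
        smooth_on_bounded_linear bounded_linear_compose[OF blinfun.bounded_linear_left] bounded_linear_fst bounded_linear_snd)
  have "(\<Sum>b\<in>Basis. (blinfun_apply g b \<bullet> x) *\<^sub>R b) \<noteq> 0" if g: "g \<in> GL" and x: "x \<noteq> 0" for g and x :: 'a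
  proof
    assume "(\<Sum>b\<in>Basis. (blinfun_apply g b \<bullet> x) *\<^sub>R b) = 0"
    then have "supp_fun (image_body g K) x = 0" for K
      using supp_fun_scaleR[of 0 K x] by (simp add: supp_fun_image_body)
    from this[of "image_body (Blinfun (inv (blinfun_apply g))) unit_ball_body"] have "norm x = 0"
      using image_body_inv[OF g, of unit_ball_body] by (simp add: supp_fun_unit_ball)
    then show False using x by simp
  qed
  then show "(\<lambda>z. \<Sum>b\<in>Basis. (blinfun_apply (fst z) b \<bullet> snd z) *\<^sub>R b) ` (GL \<times> - {0}) \<subseteq> - {0 :: 'a}"
    by (intro image_subsetI) (simp add: mem_Times_iff)
qed

lemma smooth_on_mixed_val_image:
  fixes A :: "'a::euclidean_space body"
  assumes "smooth_on (- {0}) (supp_fun A)" "i \<le> DIM('a)"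
  shows "smooth_on GL (\<lambda>g. mixed_val (replicate i (image_body g A)))"
  unfolding smooth_on_def
proof
  fix k
  have "C_k_on k GL (\<lambda>g. mixed_val (map (\<lambda>A. A g) (replicate i (\<lambda>g. image_body g A))))"
    by (rule finite_coordinates.C_k_on_mixed_val[OF finite_coordinates_blinfun open_GL])
       (use assms smooth_family_image_body[OF assms(1)] in \<open>auto split: if_splits\<close>)
  then show "C_k_on k GL (\<lambda>g. mixed_val (replicate i (image_body g A)))" by simp
qed

subsection \<open>Volume under linear maps\<close>

definition vol_factor :: "('a::euclidean_space \<Rightarrow>\<^sub>L 'a) \<Rightarrow> real" where
  "vol_factor g = \<bar>det (matrix (coords \<circ> blinfun_apply g \<circ> of_coords))\<bar>"

lemma vol_image_body: "vol (image_body g K) = vol_factor g * vol K"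
proof -
  have vol: "vol K = measure lebesgue (coords ` body_set K)" for K :: "'a body"
    by (simp add: vol_def measure_coords_image)
  have lin: "linear (coords \<circ> blinfun_apply g \<circ> of_coords)"
    by (intro linear_compose linear_coords linear_of_coords linear_blinfun)
  have "compact (coords ` body_set K)"
    by (intro compact_continuous_image linear_continuous_on) (simp_all add: linear_conv_bounded_linear[symmetric] linear_coords)
  then have "measure lebesgue ((coords \<circ> blinfun_apply g \<circ> of_coords) ` coords ` body_set K) = vol_factor g * vol K"
    unfolding vol vol_factor_def by (intro measure_linear_image lin lmeasurable_compact)
  moreover have "(coords \<circ> blinfun_apply g \<circ> of_coords) ` coords ` body_set K = coords ` body_set (image_body g K)"
    by (simp add: image_comp o_def image_body.rep_eq)
  ultimately show ?thesis using vol by metis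
qed

lemma vol_unit_ball_pos: "0 < vol (unit_ball_body :: 'a::euclidean_space body)"
  using content_cball_pos[of 1 "0 :: 'a"] by (simp add: vol_def)

lemma vol_factor_pos: "0 < vol_factor g" if "g \<in> GL"
proof -
  have "vol_factor g * vol (image_body (Blinfun (inv (blinfun_apply g))) unit_ball_body) = vol (unit_ball_body :: 'a body)"
    using vol_image_body image_body_inv[OF that] by metis
  then have "vol_factor g \<noteq> 0" using vol_unit_ball_pos[where 'a='a] by auto
  then show ?thesis by (simp add: vol_factor_def)
qed

lemma bounded_linear_val_at_0: "bounded_linear (\<lambda>\<phi> :: 'a::euclidean_space val. Re (val_at \<phi> 0))"
proof (rule bounded_linear_intro[where K=1])
  show "norm (Re (val_at \<phi> 0)) \<le> norm \<phi> * 1" for \<phi> :: "'a val"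
    using cmod_le_norm_val[of 0 \<phi>] abs_Re_le_cmod[of "val_at \<phi> 0"] by (simp add: unit_bodies_def)
qed simp_all

lemma smooth_on_inverse_vol_factor: "smooth_on GL (\<lambda>g :: 'a::euclidean_space \<Rightarrow>\<^sub>L 'a. inverse (vol_factor g))"
proof -
  let ?B = "unit_ball_body :: 'a body"
  let ?f = "\<lambda>g. (1 / vol ?B) *\<^sub>R Re (val_at (mixed_val (replicate DIM('a) (image_body g ?B))) 0)"
  have "?f g = vol_factor g" for g
    using vol_unit_ball_pos[where 'a='a] by (simp add: val_at_mixed_val vol_image_body)
  then have eq: "?f = vol_factor" by (simp add: fun_eq_iff)
  have "smooth_on GL ?f"
    by (intro smooth_on_scaleR smooth_on_const open_GL smooth_on_linear[OF bounded_linear_val_at_0]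
        smooth_on_mixed_val_image smooth_on_supp_fun_unit_ball) simp
  then have "smooth_on GL (vol_factor :: ('a \<Rightarrow>\<^sub>L 'a) \<Rightarrow> real)" unfolding eq .
  then have "smooth_on GL (\<lambda>g :: 'a \<Rightarrow>\<^sub>L 'a. vol_factor g powr - 1)"
    by (rule smooth_on_compose[OF _ smooth_on_powr open_GL]) (auto simp: vol_factor_pos)
  then show ?thesis
    by (rule smooth_on_cong[OF open_GL, rotated]) (simp add: powr_minus abs_of_pos[OF vol_factor_pos])
qed

subsection \<open>Smooth valuations\<close>

lemma act_mu:
  fixes A :: "'a::euclidean_space body"
  assumes g: "g \<in> GL"
  shows "act g (mu A) = inverse (vol_factor g) *\<^sub>R
    (\<Sum>i\<le>DIM('a). real (DIM('a) choose i) *\<^sub>R mixed_val (replicate i (image_body g A)))"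
proof (rule val_eqI)
  fix K :: "'a body"
  let ?K = "image_body (Blinfun (inv (blinfun_apply g))) K"
  have "vol_factor g * vol (?K + A) = vol (K + image_body g A)"
    using vol_image_body[of g "?K + A"] by (simp add: image_body_plus image_body_inv[OF g])
  also have "\<dots> = (\<Sum>i\<le>DIM('a). real (DIM('a) choose i) * mixed_volume (replicate (DIM('a) - i) K @ replicate i (image_body g A)))"
    using mixed_volume_binomial[of "DIM('a)" K "image_body g A" "[]"] by simp
  finally have "vol (?K + A) = inverse (vol_factor g) *
      (\<Sum>i\<le>DIM('a). real (DIM('a) choose i) * mixed_volume (replicate (DIM('a) - i) K @ replicate i (image_body g A)))"
    using vol_factor_pos[OF g] by (simp add: field_simps)
  then show "val_at (act g (mu A)) K = val_at (inverse (vol_factor g) *\<^sub>R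
    (\<Sum>i\<le>DIM('a). real (DIM('a) choose i) *\<^sub>R mixed_val (replicate i (image_body g A)))) K"
    by (simp add: act.rep_eq val_at_mu val_at_sum val_at_mixed_val)
qed

theorem mu_smooth:
  fixes A :: "'a::euclidean_space body"
  assumes "A \<in> smooth_bodies"
  shows "mu A \<in> smooth_vals"
proof -
  have "smooth_on GL (\<lambda>g. inverse (vol_factor g) *\<^sub>R
    (\<Sum>i\<le>DIM('a). real (DIM('a) choose i) *\<^sub>R mixed_val (replicate i (image_body g A))))"
    by (intro smooth_on_scaleR smooth_on_inverse_vol_factor smooth_on_sum smooth_on_const open_GL
        smooth_on_mixed_val_image smooth_on_supp_fun assms) simp
  then show ?thesis
    unfolding smooth_vals_def by (auto intro: smooth_on_cong[OF open_GL act_mu[symmetric]])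
qed

lemma smooth_vals_0: "0 \<in> smooth_vals"
proof -
  have "act g 0 = (0 :: 'a val)" for g by (rule val_eqI) (simp add: act.rep_eq)
  then show ?thesis by (simp add: smooth_vals_def)
qed

lemma smooth_vals_add: "\<phi> \<in> smooth_vals \<Longrightarrow> \<psi> \<in> smooth_vals \<Longrightarrow> \<phi> + \<psi> \<in> smooth_vals"
proof -
  assume "\<phi> \<in> smooth_vals" "\<psi> \<in> smooth_vals"
  moreover have "act g (\<phi> + \<psi>) = act g \<phi> + act g \<psi>" for g by (rule val_eqI) (simp add: act.rep_eq)
  ultimately show ?thesis by (simp add: smooth_vals_def smooth_on_add open_GL)
qed

lemma smooth_vals_scaleR: "\<phi> \<in> smooth_vals \<Longrightarrow> r *\<^sub>R \<phi> \<in> smooth_vals"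
proof -
  assume "\<phi> \<in> smooth_vals"
  moreover have "act g (r *\<^sub>R \<phi>) = r *\<^sub>R act g \<phi>" for g by (rule val_eqI) (simp add: act.rep_eq)
  ultimately show ?thesis by (simp add: smooth_vals_def smooth_on_scaleR open_GL)
qed

lemma smooth_vals_combination:
  assumes "\<And>w X. (w, X) \<in> set ws \<Longrightarrow> X \<in> smooth_bodies"
  shows "(\<Sum>(w, X)\<leftarrow>ws. w *\<^sub>R mu X) \<in> smooth_vals"
  using assms
proof (induction ws)
  case (Cons x ws)
  obtain w X where x: "x = (w, X)" by (cases x)
  have "X \<in> smooth_bodies" by (rule Cons.prems[of w]) (simp add: x)
  moreover have "(\<Sum>(w, X)\<leftarrow>ws. w *\<^sub>R mu X) \<in> smooth_vals" by (rule Cons.IH) (erule Cons.prems[OF list.set_intros(2)])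
  ultimately show ?case by (simp add: x smooth_vals_add smooth_vals_scaleR mu_smooth)
qed (simp add: smooth_vals_0)

section \<open>The convolution of mixed volume valuations\<close>

context
  fixes conv :: "'a::euclidean_space val \<Rightarrow> 'a val \<Rightarrow> 'a val"
  assumes conv: "is_convolution conv"
begin

lemma conv_add_left: "\<phi> \<in> smooth_vals \<Longrightarrow> \<phi>' \<in> smooth_vals \<Longrightarrow> \<psi> \<in> smooth_vals \<Longrightarrow> conv (\<phi> + \<phi>') \<psi> = conv \<phi> \<psi> + conv \<phi>' \<psi>"
  and conv_add_right: "\<phi> \<in> smooth_vals \<Longrightarrow> \<phi>' \<in> smooth_vals \<Longrightarrow> \<psi> \<in> smooth_vals \<Longrightarrow> conv \<psi> (\<phi> + \<phi>') = conv \<psi> \<phi> + conv \<psi> \<phi>'"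
  and conv_scaleR_left: "\<phi> \<in> smooth_vals \<Longrightarrow> \<psi> \<in> smooth_vals \<Longrightarrow> conv (r *\<^sub>R \<phi>) \<psi> = r *\<^sub>R conv \<phi> \<psi>"
  and conv_scaleR_right: "\<phi> \<in> smooth_vals \<Longrightarrow> \<psi> \<in> smooth_vals \<Longrightarrow> conv \<phi> (r *\<^sub>R \<psi>) = r *\<^sub>R conv \<phi> \<psi>"
  and conv_mu: "A \<in> smooth_bodies \<Longrightarrow> B \<in> smooth_bodies \<Longrightarrow> conv (mu A) (mu B) = mu (A + B)"
  using conv by (simp_all add: is_convolution_def scaleR_val_def)

lemma conv_0_left: "\<psi> \<in> smooth_vals \<Longrightarrow> conv 0 \<psi> = 0"
  using conv_scaleR_left[OF smooth_vals_0, of \<psi> 0] by simp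

lemma conv_0_right: "\<phi> \<in> smooth_vals \<Longrightarrow> conv \<phi> 0 = 0"
  using conv_scaleR_right[OF _ smooth_vals_0, of \<phi> 0] by simp

lemma conv_combination_left:
  assumes "\<And>w X. (w, X) \<in> set ws \<Longrightarrow> X \<in> smooth_bodies" "\<psi> \<in> smooth_vals"
  shows "conv (\<Sum>(w, X)\<leftarrow>ws. w *\<^sub>R mu X) \<psi> = (\<Sum>(w, X)\<leftarrow>ws. w *\<^sub>R conv (mu X) \<psi>)"
  using assms(1)
proof (induction ws)
  case (Cons x ws)
  obtain w X where x: "x = (w, X)" by (cases x)
  have "X \<in> smooth_bodies" by (rule Cons.prems[of w]) (simp add: x)
  moreover have "(\<Sum>(w, X)\<leftarrow>ws. w *\<^sub>R mu X) \<in> smooth_vals" by (rule smooth_vals_combination) (erule Cons.prems[OF list.set_intros(2)])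
  moreover have "conv (\<Sum>(w, X)\<leftarrow>ws. w *\<^sub>R mu X) \<psi> = (\<Sum>(w, X)\<leftarrow>ws. w *\<^sub>R conv (mu X) \<psi>)"
    by (rule Cons.IH) (erule Cons.prems[OF list.set_intros(2)])
  ultimately show ?case
    by (simp add: x conv_add_left conv_scaleR_left smooth_vals_scaleR mu_smooth assms(2))
qed (simp add: conv_0_left assms(2))

lemma conv_combination_right:
  assumes "\<And>w X. (w, X) \<in> set ws \<Longrightarrow> X \<in> smooth_bodies" "\<phi> \<in> smooth_vals"
  shows "conv \<phi> (\<Sum>(w, X)\<leftarrow>ws. w *\<^sub>R mu X) = (\<Sum>(w, X)\<leftarrow>ws. w *\<^sub>R conv \<phi> (mu X))"
  using assms(1)
proof (induction ws)
  case (Cons x ws)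
  obtain w X where x: "x = (w, X)" by (cases x)
  have "X \<in> smooth_bodies" by (rule Cons.prems[of w]) (simp add: x)
  moreover have "(\<Sum>(w, X)\<leftarrow>ws. w *\<^sub>R mu X) \<in> smooth_vals" by (rule smooth_vals_combination) (erule Cons.prems[OF list.set_intros(2)])
  moreover have "conv \<phi> (\<Sum>(w, X)\<leftarrow>ws. w *\<^sub>R mu X) = (\<Sum>(w, X)\<leftarrow>ws. w *\<^sub>R conv \<phi> (mu X))"
    by (rule Cons.IH) (erule Cons.prems[OF list.set_intros(2)])
  ultimately show ?case
    by (simp add: x conv_add_right conv_scaleR_right smooth_vals_scaleR mu_smooth assms(2))
qed (simp add: conv_0_right assms(2))

end

lemma mixed_val_eq_combination:
  assumes len: "length As \<le> DIM('a)"
    and ws: "\<And>K. (\<Sum>(w, X)\<leftarrow>ws. w * mixed_volume (replicate DIM('a) (K + X)))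
      = mixed_volume (replicate (DIM('a) - length As) K @ (As :: 'a::euclidean_space body list))"
  shows "mixed_val As = (\<Sum>(w, X)\<leftarrow>ws. w *\<^sub>R mu X)"
proof (rule val_eqI)
  fix K
  have "complex_of_real (\<Sum>(w, X)\<leftarrow>ws. w * vol (K + X)) = val_at (\<Sum>(w, X)\<leftarrow>ws. w *\<^sub>R mu X) K"
    by (induction ws) (auto simp: val_at_mu)
  then show "val_at (mixed_val As) K = val_at (\<Sum>(w, X)\<leftarrow>ws. w *\<^sub>R mu X) K"
    using ws[of K] len by (simp add: val_at_mixed_val)
qed

lemma convolution_coefficient:
  assumes "n \<le> k + l" "k \<le> n" "l \<le> n"
  shows "fact l * fact k / (fact (k + l - n) * fact n) = inverse (real ((k + l) choose k)) * real ((k + l) choose n)"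
  using assms by (simp add: binomial_fact field_simps)

theorem corollary1p3:
  fixes conv :: "'a::euclidean_space val \<Rightarrow> 'a val \<Rightarrow> 'a val"
    and As Bs :: "'a body list" and n k l :: nat
  assumes "is_convolution conv"
    and "n = DIM('a)" and "k \<le> n" and "l \<le> n" and "k + l \<ge> n"
    and "length As = n - k" and "set As \<subseteq> smooth_bodies"
    and "length Bs = n - l" and "set Bs \<subseteq> smooth_bodies"
  shows "conv (mixed_val As) (mixed_val Bs) =
    (inverse (real ((k + l) choose k)) * real ((k + l) choose n)) *\<^sub>R mixed_val (As @ Bs)"
proof -
  have lenA: "length As \<le> DIM('a)" "DIM('a) - length As = k" and lenB: "length Bs \<le> DIM('a)" "DIM('a) - length Bs = l"
    and lenAB: "length (As @ Bs) \<le> DIM('a)" "DIM('a) - length (As @ Bs) = k + l - n"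
    using assms by auto
  obtain ws where ws: "\<And>w X. (w, X) \<in> set ws \<Longrightarrow> X \<in> smooth_bodies"
    "\<And>p Cs K. length Cs + p = DIM('a) \<Longrightarrow> length As \<le> p \<Longrightarrow>
      (\<Sum>(w, X)\<leftarrow>ws. w * mixed_volume (replicate p (K + X) @ Cs))
      = fact p * fact (DIM('a) - length As) / (fact (p - length As) * fact DIM('a))
        * mixed_volume (replicate (p - length As) K @ As @ Cs)"
    by (rule mixed_volume_combination[OF unit_ball_smooth smooth_bodies_plus smooth_bodies_scale assms(7) lenA(1)]) blast+
  obtain zs where zs: "\<And>w X. (w, X) \<in> set zs \<Longrightarrow> X \<in> smooth_bodies"
    "\<And>p Cs K. length Cs + p = DIM('a) \<Longrightarrow> length Bs \<le> p \<Longrightarrow>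
      (\<Sum>(w, X)\<leftarrow>zs. w * mixed_volume (replicate p (K + X) @ Cs))
      = fact p * fact (DIM('a) - length Bs) / (fact (p - length Bs) * fact DIM('a))
        * mixed_volume (replicate (p - length Bs) K @ Bs @ Cs)"
    by (rule mixed_volume_combination[OF unit_ball_smooth smooth_bodies_plus smooth_bodies_scale assms(9) lenB(1)]) blast+
  have A: "mixed_val As = (\<Sum>(w, X)\<leftarrow>ws. w *\<^sub>R mu X)"
    by (rule mixed_val_eq_combination[OF lenA(1)]) (use ws(2)[of "[]" "DIM('a)"] lenA in simp)
  have B: "mixed_val Bs = (\<Sum>(w, X)\<leftarrow>zs. w *\<^sub>R mu X)"
    by (rule mixed_val_eq_combination[OF lenB(1)]) (use zs(2)[of "[]" "DIM('a)"] lenB in simp)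
  have Bs: "mixed_val Bs \<in> smooth_vals" unfolding B by (rule smooth_vals_combination) (rule zs(1))
  have "conv (mixed_val As) (mixed_val Bs) = (\<Sum>(w, X)\<leftarrow>ws. w *\<^sub>R conv (mu X) (mixed_val Bs))"
    unfolding A by (rule conv_combination_left[OF assms(1) ws(1) Bs])
  also have "\<dots> = (inverse (real ((k + l) choose k)) * real ((k + l) choose n)) *\<^sub>R mixed_val (As @ Bs)"
  proof (rule val_eqI)
    fix K
    have val: "val_at (conv (mu X) (mixed_val Bs)) K = complex_of_real (mixed_volume (replicate l (K + X) @ Bs))"
      if X: "X \<in> smooth_bodies" for X
    proof -
      have "conv (mu X) (mixed_val Bs) = (\<Sum>(w, Y)\<leftarrow>zs. w *\<^sub>R conv (mu X) (mu Y))"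
        unfolding B by (rule conv_combination_right[OF assms(1) zs(1) mu_smooth[OF X]])
      also have "\<dots> = (\<Sum>(w, Y)\<leftarrow>zs. w *\<^sub>R mu (X + Y))"
        using zs(1) conv_mu[OF assms(1) X] by (intro arg_cong[of _ _ sum_list] map_cong refl) auto
      also have "val_at \<dots> K = val_at (mixed_val Bs) (K + X)"
        unfolding B by (induction zs) (auto simp: val_at_mu add.assoc)
      finally show ?thesis using lenB by (simp add: val_at_mixed_val)
    qed
    have "val_at (\<Sum>(w, X)\<leftarrow>ws. w *\<^sub>R conv (mu X) (mixed_val Bs)) K
      = (\<Sum>(w, X)\<leftarrow>ws. complex_of_real (w * mixed_volume (replicate l (K + X) @ Bs)))"
      unfolding val_at_sum_list using ws(1) val by (intro arg_cong[of _ _ sum_list] map_cong refl) auto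
    also have "\<dots> = complex_of_real (\<Sum>(w, X)\<leftarrow>ws. w * mixed_volume (replicate l (K + X) @ Bs))"
      by (induction ws) auto
    also have "(\<Sum>(w, X)\<leftarrow>ws. w * mixed_volume (replicate l (K + X) @ Bs))
      = fact l * fact k / (fact (k + l - n) * fact n) * mixed_volume (replicate (k + l - n) K @ As @ Bs)"
    proof -
      have "length Bs + l = DIM('a)" "length As \<le> l" "l - length As = k + l - n" using assms by auto
      from ws(2)[OF this(1,2), of K] this(3) show ?thesis using lenA(2) assms(2) by simp
    qed
    also have "complex_of_real \<dots> = val_at ((inverse (real ((k + l) choose k)) * real ((k + l) choose n)) *\<^sub>R mixed_val (As @ Bs)) K"
      using val_at_mixed_val[OF lenAB(1), of K] lenAB(2) convolution_coefficient[OF assms(5,3,4)] by simp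
    finally show "val_at (\<Sum>(w, X)\<leftarrow>ws. w *\<^sub>R conv (mu X) (mixed_val Bs)) K
      = val_at ((inverse (real ((k + l) choose k)) * real ((k + l) choose n)) *\<^sub>R mixed_val (As @ Bs)) K" .
  qed
  finally show ?thesis .
qed

end
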